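(* Let $2<p<3$. Let $V,\rho\in C(\mathbb{R}^3,\mathbb{R})$ satisfy $\inf_{\mathbb{R}^3}V>0$, $\lim_{|x|\to\infty}V(x)=V_\infty>0$, $\inf_{\mathbb{R}^3}\rho>0$ and $\lim_{|x|\to\infty}\rho(x)=\rho_\infty>0$. Suppose in addition that there exist constants $\lambda_0,k_0>0$ such that $$V_\infty^{3-p}\rho_\infty^{p-2}>\frac{2^{\frac{6-p}{2}}}{p}(p-2)^{p-2}(3-p)^{3-p}\bigl(1+\Lambda(\lambda_0,k_0)\bigr)$$ and $$\frac12\int_{\mathbb{R}^3}V(x)(u_0^2+v_0^2)\,dx+\frac14\int_{\mathbb{R}^3}\rho(x)\phi_{\rho,(u_0,v_0)}(u_0^2+v_0^2)\,dx<\frac12\int_{\mathbb{R}^3}\lambda_0(u_0^2+v_0^2)\,dx+\frac{k_0}{4}\int_{\mathbb{R}^3}\phi_{k_0,(u_0,v_0)}(u_0^2+v_0^2)\,dx,$$ where $(u_0,v_0)\in\mathbf{H}_r\setminus\{(0,0)\}$ is a minimizer of the minimization problem defining $\Lambda(\lambda_0,k_0)$. Then for every $\beta$ with $$\Lambda(\lambda_0,k_0)<\beta<\frac{p}{2^{\frac{6-p}{2}}}\left(\frac{V_\infty}{3-p}\right)^{3-p}\left(\frac{\rho_\infty}{p-2}\right)^{p-2}-1,$$ system $(HF_\beta)$ admits a vectorial ground state solution $(u_\beta^{(1)},v_\beta^{(1)})\in\mathbf{H}$ satisfying $J_\beta(u_\beta^{(1)},v_\beta^{(1)})=\inf_{(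u,v)\in\mathbf{H}}J_\beta(u,v)<0$.
   Context: $\mathbf{H}:=H^1(\mathbb{R}^3)\times H^1(\mathbb{R}^3)$ (real-valued functions) and $\mathbf{H}_r:=H^1_{rad}(\mathbb{R}^3)\times H^1_{rad}(\mathbb{R}^3)$ is its subspace of radial pairs. For $\rho$ a positive bounded continuous function (or positive constant), $\phi_{\rho,(u,v)}(x):=\int_{\mathbb{R}^3}\frac{\rho(y)(u^2(y)+v^2(y))}{|x-y|}\,dy$. System $(HF_\beta)$, $\beta\in\mathbb{R}$, is $$\begin{cases}-\Delta u+V(x)u+\rho(x)\phi_{\rho,(u,v)}u=|u|^{p-2}u+\beta|v|^{\frac p2}|u|^{\frac p2-2}u&\text{in }\mathbb{R}^3,\\-\Delta v+V(x)v+\rho(x)\phi_{\rho,(u,v)}v=|v|^{p-2}v+\beta|u|^{\frac p2}|v|^{\frac p2-2}v&\text{in }\mathbb{R}^3.\end{cases}$$ Its solutions are the critical points in $\mathbf{H}$ of the $C^1$ functional $$J_\beta(u,v)=\tfrac12\|(u,v)\|^2+\tfrac14\int_{\mathbb{R}^3}\rho(x)\phi_{\rho,(u,v)}(u^2+v^2)\,dx-\tfrac1p\int_{\mathbb{R}^3}\left(|u|^p+|v|^p+2\beta|u|^{\frac p2}|v|^{\frac p2}\right)dx,$$ with $\|(u,v)\|^2=\int_{\mathbb{R}^3}(|\nabla u|^2+|\nabla v|^2+V(x)u^2+V(x)v^2)\,dx$. A pair $(u,v)$ is nontrivial if $u\ne0$ or $v\ne0$, and vectorial if both $u\neq 0$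 and $v\ne0$. A ground state solution is a nontrivial solution whose energy $J_\beta$ is least among all nontrivial solutions. For constants $\theta,k>0$, $$\Lambda(\theta,k):=\inf_{(u,v)}\frac{\frac12\|(u,v)\|_\theta^2+\frac k4\int_{\mathbb{R}^3}\phi_{k,(u,v)}(u^2+v^2)\,dx-\frac1p\int_{\mathbb{R}^3}(|u|^p+|v|^p)\,dx}{\frac2p\int_{\mathbb{R}^3}|u|^{p/2}|v|^{p/2}\,dx},$$ the infimum being over $(u,v)\in\mathbf{H}_r\setminus\{(0,0)\}$ with nonzero denominator, where $\|(u,v)\|_\theta^2=\int_{\mathbb{R}^3}(|\nabla u|^2+\theta u^2+|\nabla v|^2+\theta v^2)\,dx$ and $\phi_{k,(u,v)}$ is $\phi_{\rho,(u,v)}$ with $\rho\equiv k$. *)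

theory Defs
  imports "HOL-Analysis.Analysis"
begin

text \<open>
  Elements of the Lebesgue and Sobolev spaces are Borel measurable representatives, identified
  when they agree almost everywhere: every notion below depends only on the class of the
  representative, and \<open>u = 0\<close> in the function space means \<open>u = 0\<close> almost everywhere.
\<close>

section \<open>The Sobolev space of order one\<close>

primrec C_diff :: "nat \<Rightarrow> (real^3 \<Rightarrow> real) \<Rightarrow> bool" where
  "C_diff 0 f \<longleftrightarrow> continuous_on UNIV f"
| "C_diff (Suc n) f \<longleftrightarrow> f differentiable_on UNIV \<and>
     (\<forall>i. C_diff n (\<lambda>x. frechet_derivative f (at x) (axis i 1)))"

definition test_function :: "(real^3 \<Rightarrow> real) \<Rightarrow> bool" where
  "test_function f \<longleftrightarrow> (\<forall>n. C_diff n f) \<and> compact (closure {x. f x \<noteq> 0})"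

definition square_integrable :: "(real^3 \<Rightarrow> 'b::euclidean_space) \<Rightarrow> bool" where
  "square_integrable f \<longleftrightarrow>
     f \<in> borel_measurable lborel \<and> integrable lborel (\<lambda>x. (norm (f x))\<^sup>2)"

definition has_weak_gradient :: "(real^3 \<Rightarrow> real) \<Rightarrow> (real^3 \<Rightarrow> real^3) \<Rightarrow> bool" where
  "has_weak_gradient u g \<longleftrightarrow> (\<forall>f i. test_function f \<longrightarrow>
     (\<integral>x. u x * frechet_derivative f (at x) (axis i 1) \<partial>lborel)
       = - (\<integral>x. g x $ i * f x \<partial>lborel))"

definition H1 :: "(real^3 \<Rightarrow> real) set" where
  "H1 = {u. square_integrable u \<and> (\<exists>g. square_integrable g \<and> has_weak_gradient u g)}"

text \<open>For \<open>u \<in> H1\<close> the weak gradient is unique up to null sets.\<close>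

definition weak_grad :: "(real^3 \<Rightarrow> real) \<Rightarrow> real^3 \<Rightarrow> real^3" where
  "weak_grad u = (SOME g. square_integrable g \<and> has_weak_gradient u g)"

definition ae_zero :: "(real^3 \<Rightarrow> real) \<Rightarrow> bool" where
  "ae_zero u \<longleftrightarrow> (AE x in lborel. u x = 0)"

definition radial :: "(real^3 \<Rightarrow> real) \<Rightarrow> bool" where
  "radial u \<longleftrightarrow> (\<exists>f :: real \<Rightarrow> real. AE x in lborel. u x = f (norm x))"

definition H1_pairs :: "((real^3 \<Rightarrow> real) \<times> (real^3 \<Rightarrow> real)) set" where
  "H1_pairs = H1 \<times> H1"

definition H1_rad_pairs :: "((real^3 \<Rightarrow> real) \<times> (real^3 \<Rightarrow> real)) set" where
  "H1_rad_pairs = {u \<in> H1. radial u} \<times> {v \<in> H1. radial v}"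

text \<open>
  The square of the norm with potential \<open>V\<close>. The constant potential \<open>V = 1\<close> gives the
  standard norm of the product space.
\<close>

definition pair_norm_sq ::
  "(real^3 \<Rightarrow> real) \<Rightarrow> (real^3 \<Rightarrow> real) \<Rightarrow> (real^3 \<Rightarrow> real) \<Rightarrow> real" where
  "pair_norm_sq V u v =
     (\<integral>x. (norm (weak_grad u x))\<^sup>2 + (norm (weak_grad v x))\<^sup>2
            + V x * (u x)\<^sup>2 + V x * (v x)\<^sup>2 \<partial>lborel)"

definition H_norm :: "(real^3 \<Rightarrow> real) \<Rightarrow> (real^3 \<Rightarrow> real) \<Rightarrow> real" where
  "H_norm u v = sqrt (pair_norm_sq (\<lambda>_. 1) u v)"

section \<open>The Hartree-Fock system and its energy functional\<close>

definition phi ::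
  "(real^3 \<Rightarrow> real) \<Rightarrow> (real^3 \<Rightarrow> real) \<Rightarrow> (real^3 \<Rightarrow> real) \<Rightarrow> real^3 \<Rightarrow> real" where
  "phi \<rho> u v x = (\<integral>y. \<rho> y * ((u y)\<^sup>2 + (v y)\<^sup>2) / norm (x - y) \<partial>lborel)"

definition J ::
  "(real^3 \<Rightarrow> real) \<Rightarrow> (real^3 \<Rightarrow> real) \<Rightarrow> real \<Rightarrow> real
     \<Rightarrow> (real^3 \<Rightarrow> real) \<Rightarrow> (real^3 \<Rightarrow> real) \<Rightarrow> real" where
  "J V \<rho> p \<beta> u v =
     1/2 * pair_norm_sq V u v
     + 1/4 * (\<integral>x. \<rho> x * phi \<rho> u v x * ((u x)\<^sup>2 + (v x)\<^sup>2) \<partial>lborel)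
     - 1/p * (\<integral>x. \<bar>u x\<bar> powr p + \<bar>v x\<bar> powr p
                    + 2 * \<beta> * \<bar>u x\<bar> powr (p/2) * \<bar>v x\<bar> powr (p/2) \<partial>lborel)"

text \<open>Critical points on the product space: the Frechet derivative exists and vanishes.\<close>

definition critical_point ::
  "((real^3 \<Rightarrow> real) \<Rightarrow> (real^3 \<Rightarrow> real) \<Rightarrow> real)
     \<Rightarrow> (real^3 \<Rightarrow> real) \<Rightarrow> (real^3 \<Rightarrow> real) \<Rightarrow> bool" where
  "critical_point F u v \<longleftrightarrow> (u, v) \<in> H1_pairs \<and>
     (\<forall>\<epsilon>>0. \<exists>\<delta>>0. \<forall>(h, k)\<in>H1_pairs. H_norm h k < \<delta> \<longrightarrow>
        \<bar>F (\<lambda>x. u x + h x) (\<lambda>x. v x + k x) - F u v\<bar> \<le> \<epsilon> * H_norm h k)"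

text \<open>
  Solutions of the system
  \<open>- \<Delta>u + V u + \<rho> \<phi> u = |u|^(p-2) u + \<beta> |v|^(p/2) |u|^(p/2-2) u\<close>,
  \<open>- \<Delta>v + V v + \<rho> \<phi> v = |v|^(p-2) v + \<beta> |u|^(p/2) |v|^(p/2-2) v\<close>,
  where \<open>\<phi> = phi \<rho> u v\<close>, are by definition the critical points of its energy functional \<open>J\<close>.
\<close>

definition HF_solution ::
  "(real^3 \<Rightarrow> real) \<Rightarrow> (real^3 \<Rightarrow> real) \<Rightarrow> real \<Rightarrow> real
     \<Rightarrow> (real^3 \<Rightarrow> real) \<Rightarrow> (real^3 \<Rightarrow> real) \<Rightarrow> bool" where
  "HF_solution V \<rho> p \<beta> u v \<longleftrightarrow> critical_point (J V \<rho> p \<beta>) u v"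

definition nontrivial :: "(real^3 \<Rightarrow> real) \<Rightarrow> (real^3 \<Rightarrow> real) \<Rightarrow> bool" where
  "nontrivial u v \<longleftrightarrow> \<not> ae_zero u \<or> \<not> ae_zero v"

definition vectorial :: "(real^3 \<Rightarrow> real) \<Rightarrow> (real^3 \<Rightarrow> real) \<Rightarrow> bool" where
  "vectorial u v \<longleftrightarrow> \<not> ae_zero u \<and> \<not> ae_zero v"

definition ground_state ::
  "(real^3 \<Rightarrow> real) \<Rightarrow> (real^3 \<Rightarrow> real) \<Rightarrow> real \<Rightarrow> real
     \<Rightarrow> (real^3 \<Rightarrow> real) \<Rightarrow> (real^3 \<Rightarrow> real) \<Rightarrow> bool" where
  "ground_state V \<rho> p \<beta> u v \<longleftrightarrow>
     HF_solution V \<rho> p \<beta> u v \<and> nontrivial u v \<and>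
     (\<forall>w z. HF_solution V \<rho> p \<beta> w z \<and> nontrivial w z
        \<longrightarrow> J V \<rho> p \<beta> u v \<le> J V \<rho> p \<beta> w z)"

section \<open>The threshold\<close>

definition Lambda_dom :: "real \<Rightarrow> ((real^3 \<Rightarrow> real) \<times> (real^3 \<Rightarrow> real)) set" where
  "Lambda_dom p = {(u, v) \<in> H1_rad_pairs. nontrivial u v \<and>
     2/p * (\<integral>x. \<bar>u x\<bar> powr (p/2) * \<bar>v x\<bar> powr (p/2) \<partial>lborel) \<noteq> 0}"

definition Lambda_quotient ::
  "real \<Rightarrow> real \<Rightarrow> real \<Rightarrow> (real^3 \<Rightarrow> real) \<times> (real^3 \<Rightarrow> real) \<Rightarrow> real" where
  "Lambda_quotient p \<theta> k = (\<lambda>(u, v).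
     (1/2 * pair_norm_sq (\<lambda>_. \<theta>) u v
      + k/4 * (\<integral>x. phi (\<lambda>_. k) u v x * ((u x)\<^sup>2 + (v x)\<^sup>2) \<partial>lborel)
      - 1/p * (\<integral>x. \<bar>u x\<bar> powr p + \<bar>v x\<bar> powr p \<partial>lborel))
     / (2/p * (\<integral>x. \<bar>u x\<bar> powr (p/2) * \<bar>v x\<bar> powr (p/2) \<partial>lborel)))"

text \<open>
  The infimum is taken in the extended reals, so that it is meaningful without knowing beforehand
  that the quotient is bounded below.
\<close>

definition Lambda :: "real \<Rightarrow> real \<Rightarrow> real \<Rightarrow> ereal" where
  "Lambda p \<theta> k = (INF w\<in>Lambda_dom p. ereal (Lambda_quotient p \<theta> k w))"

definition Lambda_minimizer ::
  "real \<Rightarrow> real \<Rightarrow> real \<Rightarrow> (real^3 \<Rightarrow> real) \<Rightarrow> (real^3 \<Rightarrow> real) \<Rightarrow> bool" where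
  "Lambda_minimizer p \<theta> k u v \<longleftrightarrow>
     is_arg_min (Lambda_quotient p \<theta> k) (\<lambda>w. w \<in> Lambda_dom p) (u, v)"

end

theory Submission
  imports Defs "HOL-Complex_Analysis.Great_Picard"
begin

text \<open>The solution is a global minimizer of \<open>J\<close>, and the upper bound for \<open>\<beta>\<close> is what makes \<open>J\<close> coercive.
By Lions' inequality (\<open>lions_inequality\<close>), a quarter of the gradient integral together with the
Coulomb part of \<open>J\<close> bounds \<open>2 powr (-3/2)\<close> times the integral of \<open>\<rho> (\<bar>u\<bar>\<^sup>3 + \<bar>v\<bar>\<^sup>3)\<close>. The exponent \<open>p\<close> lies between
\<open>2\<close> and \<open>3\<close>, so the nonlinearity can be compared pointwise with this cubic term and
\<open>V (u\<^sup>2 + v\<^sup>2) / 4\<close>, half of the potential part; the weighted inequality of arithmetic and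
geometric means (\<open>powr_interpolation\<close>) produces exactly the constant in the upper bound. The bound
for \<open>\<beta>\<close> is strict at infinity, so the nonlinearity is absorbed outside a ball, and inside the ball up to a constant (\<open>domination\<close>). Thus \<open>J\<close>
is bounded below, minimizing sequences are bounded, and mass that escapes to infinity cannot lower
the energy.

A minimizer exists (\<open>minimizer_exists\<close>) because \<open>J\<close> is lower semicontinuous along a minimizing sequence
that converges almost everywhere. The functional is split into the part \<open>kinetic\<close>, namely gradient plus
Coulomb energy minus the cubic term, and an integral whose integrand is bounded below by an integrable
function and is treated by Fatou's lemma. For \<open>kinetic\<close>, the energy of the sequence is at least that of the
limit plus that of the difference, up to errors that vanish, and the energy of the difference is nonnegative,
again by Lions' inequality. The convergence comes from a weighted form of Rellich's theorem
(\<open>rellich\<close>) and from Mazur's convex combinations (\<open>weak_gradient_limit\<close>).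

The infimum is negative: the minimizer \<open>(u0, v0)\<close> of the quotient has \<open>J\<close> negative for the constants
\<open>lam0\<close>, \<open>k0\<close> as soon as \<open>\<beta>\<close> exceeds \<open>Lambda\<close>, and the comparison hypothesis transfers this to \<open>V\<close>, \<open>\<rho>\<close>.
Moreover \<open>Lambda\<close> is nonnegative (\<open>Lambda_minimizer_props\<close>), so \<open>\<beta>\<close> is positive. Then a minimizer with
one vanishing component could be improved by rotating the pair \<open>(u, 0)\<close> slightly: this preserves the
quadratic and the Coulomb terms, while the coupling, of order \<open>p/2 < 2\<close>, gains more than the other
powers lose (\<open>second_component_nonzero\<close>). Finally a minimizer is a critical point in the sense of Frechet
because the second difference of \<open>J\<close> is bounded by the square of the increment
(\<open>minimizer_critical\<close>).

Both Lions' inequality and Rellich's theorem rest on one fact: a function with square integrable weak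
gradient is the Newtonian field of its gradient (\<open>eq_newton_field_AE\<close>). It is obtained by inserting
the regularized and cut off kernel \<open>1 / norm (y - x)\<close> as a test function in the definition of the weak
gradient. The Laplacian of the regularized kernel is an explicit approximate identity, which also
serves as the mollifier in the compactness proof.\<close>

section \<open>Smooth functions and test functions\<close>

abbreviation pderiv :: "3 \<Rightarrow> (real^3 \<Rightarrow> real) \<Rightarrow> real^3 \<Rightarrow> real" where
  "pderiv i f x \<equiv> frechet_derivative f (at x) (axis i 1)"

definition smooth :: "(real^3 \<Rightarrow> real) \<Rightarrow> bool" where
  "smooth f \<longleftrightarrow> (\<forall>n. C_diff n f)"

lemma pderiv_eq: "(f has_derivative f') (at x) \<Longrightarrow> pderiv i f x = f' (axis i 1)"
  by (metis frechet_derivative_at)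

lemma C_diff_SucD: "C_diff (Suc n) f \<Longrightarrow> C_diff n f"
proof (induction n arbitrary: f)
  case 0
  then show ?case by (auto intro: differentiable_imp_continuous_on)
next
  case (Suc n)
  from Suc.prems have "f differentiable_on UNIV" "\<And>i. C_diff (Suc n) (pderiv i f)" by auto
  with Suc.IH show ?case by simp
qed

lemma C_diff_const: "C_diff n (\<lambda>x. c)"
  by (induction n arbitrary: c) (auto intro: continuous_intros)

lemma C_diff_add: "C_diff n f \<Longrightarrow> C_diff n g \<Longrightarrow> C_diff n (\<lambda>x. f x + g x)"
proof (induction n arbitrary: f g)
  case 0
  then show ?case by (auto intro: continuous_intros)
next
  case (Suc n)
  have d: "f differentiable (at x)" "g differentiable (at x)" for x
    using Suc.prems by (auto simp: differentiable_on_def)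
  have "pderiv i (\<lambda>x. f x + g x) = (\<lambda>x. pderiv i f x + pderiv i g x)" for i
    using d by (auto intro!: ext pderiv_eq has_derivative_add simp: frechet_derivative_works[symmetric])
  then show ?case using Suc d by (auto simp: differentiable_on_def)
qed

lemma C_diff_mult: "C_diff n f \<Longrightarrow> C_diff n g \<Longrightarrow> C_diff n (\<lambda>x. f x * g x)"
proof (induction n arbitrary: f g)
  case 0
  then show ?case by (auto intro: continuous_intros)
next
  case (Suc n)
  have d: "f differentiable (at x)" "g differentiable (at x)" for x
    using Suc.prems by (auto simp: differentiable_on_def)
  have "pderiv i (\<lambda>x. f x * g x) = (\<lambda>x. f x * pderiv i g x + pderiv i f x * g x)" for i
  proof
    fix x
    have "((\<lambda>x. f x * g x) has_derivative
        (\<lambda>h. f x * frechet_derivative g (at x) h + frechet_derivative f (at x) h * g x)) (at x)"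
      using d by (intro has_derivative_mult) (auto simp: frechet_derivative_works[symmetric])
    from pderiv_eq[OF this] show "pderiv i (\<lambda>x. f x * g x) x = f x * pderiv i g x + pderiv i f x * g x" .
  qed
  moreover have "C_diff n (\<lambda>x. f x * pderiv i g x)" "C_diff n (\<lambda>x. pderiv i f x * g x)" for i
    using Suc C_diff_SucD by auto
  ultimately show ?case using d by (auto simp: differentiable_on_def intro!: C_diff_add)
qed

lemma smooth_const: "smooth (\<lambda>x. c)" by (simp add: smooth_def C_diff_const)
lemma smooth_add: "smooth f \<Longrightarrow> smooth g \<Longrightarrow> smooth (\<lambda>x. f x + g x)"
  by (simp add: smooth_def C_diff_add)
lemma smooth_mult: "smooth f \<Longrightarrow> smooth g \<Longrightarrow> smooth (\<lambda>x. f x * g x)"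
  by (simp add: smooth_def C_diff_mult)

lemma smooth_sum: "(\<And>i. i \<in> A \<Longrightarrow> smooth (f i)) \<Longrightarrow> smooth (\<lambda>x. \<Sum>i\<in>A. f i x)"
  by (induction A rule: infinite_finite_induct) (auto intro: smooth_const smooth_add)

lemma smooth_prod: "(\<And>i. i \<in> A \<Longrightarrow> smooth (f i)) \<Longrightarrow> smooth (\<lambda>x. \<Prod>i\<in>A. f i x)"
  by (induction A rule: infinite_finite_induct) (auto intro: smooth_const smooth_mult)

lemma smooth_component: "smooth (\<lambda>x. x $ j)"
  unfolding smooth_def
proof
  fix n
  have hd: "((\<lambda>x::real^3. x $ j) has_derivative (\<lambda>h. h $ j)) (at x)" for x
    by (rule bounded_linear_imp_has_derivative[OF bounded_linear_vec_nth])
  then have pd: "pderiv i (\<lambda>x. x $ j) = (\<lambda>x. axis i 1 $ j)" for i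
    by (auto intro!: ext pderiv_eq)
  have df: "(\<lambda>x::real^3. x $ j) differentiable_on UNIV"
    using hd by (auto simp: differentiable_on_def differentiable_def)
  show "C_diff n (\<lambda>x. x $ j)"
    by (cases n) (auto simp: pd C_diff_const df intro: differentiable_imp_continuous_on)
qed

text \<open>The functions \<open>D k\<close> are the successive derivatives of a function of one real variable,
  required only at the values that the inner function takes.\<close>

lemma smooth_compose:
  fixes D :: "nat \<Rightarrow> real \<Rightarrow> real"
  assumes q: "smooth q"
    and D: "\<And>k x. (D k has_real_derivative D (Suc k) (q x)) (at (q x))"
  shows "smooth (\<lambda>x. D k (q x))"
  unfolding smooth_def
proof
  fix n
  show "C_diff n (\<lambda>x. D k (q x))"
  proof (induction n arbitrary: k)
    case 0
    have "C_diff 0 q" using q by (simp add: smooth_def)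
    then have "isCont q x" for x by (auto simp: continuous_on_eq_continuous_at)
    then have "isCont (\<lambda>x. D k (q x)) x" for x
      using DERIV_isCont[OF D] by (rule isCont_o2)
    then show ?case by (auto simp: continuous_on_eq_continuous_at)
  next
    case (Suc n)
    have q1: "C_diff (Suc n) q" using q by (simp only: smooth_def)
    then have d: "q differentiable (at x)" for x by (auto simp: differentiable_on_def)
    have hd: "((\<lambda>x. D k (q x)) has_derivative
        (\<lambda>h. D (Suc k) (q x) * frechet_derivative q (at x) h)) (at x)" for x
      using d[of x] D[of k x] unfolding frechet_derivative_works has_field_derivative_def
      by (rule has_derivative_compose)
    have "pderiv i (\<lambda>x. D k (q x)) = (\<lambda>x. D (Suc k) (q x) * pderiv i q x)" for i
      by (rule ext, rule pderiv_eq[OF hd])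
    moreover have "C_diff n (\<lambda>x. D (Suc k) (q x) * pderiv i q x)" for i
      using q1 by (intro C_diff_mult Suc.IH) simp
    ultimately show ?case using hd by (auto simp: differentiable_on_def differentiable_def)
  qed
qed

text \<open>The flat function, all of whose derivatives vanish at the origin from the right.\<close>

definition flat :: "real \<Rightarrow> real" where
  "flat t = (if 0 < t then exp (- 1 / t) else 0)"

definition flat_deriv :: "nat \<Rightarrow> real \<Rightarrow> real" where
  "flat_deriv k t = (if 0 < t then
     poly (((\<lambda>P. [:0,0,1:] * (P - Polynomial.pderiv P)) ^^ k) 1) (1/t) * exp (- 1 / t) else 0)"

text \<open>With \<open>s = 1 / t\<close>, this gives the limits at the origin of all derivatives of \<open>exp (- (1 / t))\<close>.\<close>

lemma poly_times_exp_neg_tendsto_0: "((\<lambda>s. poly P s * exp (- s)) \<longlongrightarrow> 0) at_top" for P :: "real poly"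
proof -
  have "((\<lambda>s. \<Sum>i\<le>degree P. coeff P i * (s ^ i / exp s)) \<longlongrightarrow> (\<Sum>i\<le>degree P. coeff P i * 0)) at_top"
    by (intro tendsto_sum tendsto_mult tendsto_const tendsto_power_div_exp_0)
  then show ?thesis
    by (simp add: poly_altdef sum_distrib_right sum_divide_distrib exp_minus field_simps)
qed

lemma flat_deriv_has_derivative:
  "(flat_deriv k has_real_derivative flat_deriv (Suc k) t) (at t)"
proof -
  define P where "P = ((\<lambda>P::real poly. [:0,0,1:] * (P - Polynomial.pderiv P)) ^^ k) 1"
  have fk: "flat_deriv k = (\<lambda>t. if 0 < t then poly P (1/t) * exp (- 1 / t) else 0)"
    by (auto simp: flat_deriv_def P_def)
  have fSk: "flat_deriv (Suc k) t =
     (if 0 < t then (1/t)^2 * (poly P (1/t) - poly (Polynomial.pderiv P) (1/t)) * exp (- 1 / t) else 0)"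
    by (auto simp: flat_deriv_def P_def power2_eq_square)
  consider "t > 0" | "t < 0" | "t = 0" by linarith
  then show ?thesis
  proof cases
    case 1
    have "((\<lambda>t. poly P (1/t) * exp (- 1 / t)) has_real_derivative flat_deriv (Suc k) t) (at t)"
      using 1 by (auto intro!: derivative_eq_intros DERIV_chain2[OF poly_DERIV] simp: fSk field_simps power2_eq_square)
    then show ?thesis
      by (rule has_field_derivative_transform_within_open[of _ _ _ "{0<..}"]) (use 1 in \<open>auto simp: fk\<close>)
  next
    case 2
    have "((\<lambda>t. 0) has_real_derivative flat_deriv (Suc k) t) (at t)"
      using 2 by (simp add: fSk)
    then show ?thesis
      by (rule has_field_derivative_transform_within_open[of _ _ _ "{..<0}"]) (use 2 in \<open>auto simp: fk\<close>)
  next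
    case 3
    have r: "((\<lambda>h. flat_deriv k h / h) \<longlongrightarrow> 0) (at_right 0)"
    proof -
      have "((\<lambda>s. poly ([:0,1:] * P) s * exp (- s)) \<longlongrightarrow> 0) at_top"
        by (rule poly_times_exp_neg_tendsto_0)
      then have "((\<lambda>h. poly ([:0,1:] * P) (inverse h) * exp (- inverse h)) \<longlongrightarrow> 0) (at_right 0)"
        by (rule filterlim_compose[OF _ filterlim_inverse_at_top_right])
      then show ?thesis
        by (rule Lim_transform_eventually)
           (auto simp: fk field_simps eventually_at_right_less intro!: eventually_at_rightI[of 0 1])
    qed
    have l: "((\<lambda>h. flat_deriv k h / h) \<longlongrightarrow> 0) (at_left 0)"
      by (rule Lim_transform_eventually[OF tendsto_const])
         (auto simp: fk intro!: eventually_at_leftI[of "-1" 0])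
    from r l have "((\<lambda>h. flat_deriv k h / h) \<longlongrightarrow> 0) (at 0)"
      by (simp add: filterlim_split_at)
    moreover have "flat_deriv k 0 = 0" "flat_deriv (Suc k) 0 = 0" by (auto simp: flat_deriv_def)
    ultimately show ?thesis using 3 by (simp add: DERIV_def)
  qed
qed

lemma flat_deriv_0: "flat_deriv 0 = flat"
  by (auto simp: flat_deriv_def flat_def)

lemma smooth_flat: "smooth q \<Longrightarrow> smooth (\<lambda>x. flat (q x))"
  using smooth_compose[of q flat_deriv 0, OF _ flat_deriv_has_derivative] by (simp add: flat_deriv_0)

lemma flat_props: "0 \<le> flat t" "flat t \<le> 1" "t \<le> 0 \<Longrightarrow> flat t = 0" "t > 0 \<Longrightarrow> flat t > 0"
  by (auto simp: flat_def)

lemma test_functionI: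
  assumes "smooth f" "bounded {x. f x \<noteq> 0}"
  shows "test_function f"
  using assms by (simp add: test_function_def smooth_def)

lemma test_function_smooth: "test_function f \<Longrightarrow> smooth f"
  by (simp add: test_function_def smooth_def)

lemma test_function_bounded_support: "test_function f \<Longrightarrow> bounded {x. f x \<noteq> 0}"
  using bounded_closure_image compact_imp_bounded by (auto simp: test_function_def intro: bounded_subset closure_subset)

lemma smooth_pderiv: "smooth f \<Longrightarrow> smooth (pderiv i f)"
  unfolding smooth_def by (metis C_diff.simps(2))

lemma smooth_has_derivative:
  assumes "smooth f" shows "(f has_derivative frechet_derivative f (at x)) (at x)"
proof -
  have "C_diff 1 f" using assms by (simp only: smooth_def)
  then show ?thesis by (auto simp: differentiable_on_def frechet_derivative_works)
qed

lemma smooth_continuous: "smooth f \<Longrightarrow> continuous_on UNIV f"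
  unfolding smooth_def by (metis C_diff.simps(1))

lemma test_function_pderiv:
  assumes f: "test_function f" shows "test_function (pderiv i f)"
proof (rule test_functionI)
  show "smooth (pderiv i f)" by (intro smooth_pderiv test_function_smooth f)
  have "pderiv i f x = 0" if "x \<notin> closure {x. f x \<noteq> 0}" for x
  proof -
    have "((\<lambda>x. 0::real) has_derivative (\<lambda>h. 0)) (at x)" by simp
    then have "(f has_derivative (\<lambda>h. 0)) (at x)"
      by (rule has_derivative_transform_within_open[of _ _ _ _ "- closure {x. f x \<noteq> 0}"])
         (use that closure_subset[of "{x. f x \<noteq> 0}"] in auto)
    then show ?thesis using pderiv_eq[of f "\<lambda>h. 0"] by simp
  qed
  then have "{x. pderiv i f x \<noteq> 0} \<subseteq> closure {x. f x \<noteq> 0}" by blast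
  then show "bounded {x. pderiv i f x \<noteq> 0}"
    using bounded_closure[OF test_function_bounded_support[OF f]] by (rule bounded_subset[rotated])
qed

lemma test_function_bounded:
  assumes "test_function f" obtains B where "B > 0" "\<And>x. \<bar>f x\<bar> \<le> B"
proof -
  have "compact (closure {x. f x \<noteq> 0})" using assms by (simp add: test_function_def)
  then have "compact (f ` closure {x. f x \<noteq> 0})"
    using smooth_continuous[OF test_function_smooth[OF assms]]
    by (intro compact_continuous_image) (auto intro: continuous_on_subset)
  from compact_imp_bounded[OF this] obtain B where B: "B > 0" "\<And>x. x \<in> closure {x. f x \<noteq> 0} \<Longrightarrow> norm (f x) \<le> B"
    unfolding bounded_pos by auto
  have "\<bar>f x\<bar> \<le> B" for x
    using B(1) B(2)[of x] closure_subset[of "{x. f x \<noteq> 0}"] by (cases "f x = 0") auto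
  with B(1) that show ?thesis by blast
qed

lemma test_function_lipschitz:
  assumes f: "test_function f" obtains B where "B > 0" "\<And>x y. \<bar>f x - f y\<bar> \<le> B * norm (x - y)"
proof -
  have "\<exists>B>0. \<forall>x. \<bar>pderiv i f x\<bar> \<le> B" for i
    using test_function_bounded[OF test_function_pderiv[OF f, of i]] by metis
  then obtain B where B: "\<And>i. B i > 0" "\<And>i x. \<bar>pderiv i f x\<bar> \<le> B i" by metis
  have on: "onorm (frechet_derivative f (at x)) \<le> (\<Sum>i\<in>UNIV. B i)" for x
  proof (rule onorm_le)
    fix h :: "real^3"
    have lin: "linear (frechet_derivative f (at x))"
      using smooth_has_derivative[OF test_function_smooth[OF f]] has_derivative_linear by blast
    have "h = (\<Sum>i\<in>UNIV. h $ i *\<^sub>R axis i 1)"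
      by (simp add: vec_eq_iff axis_def sum.delta' if_distrib cong: if_cong)
    then have "frechet_derivative f (at x) h = (\<Sum>i\<in>UNIV. h $ i * pderiv i f x)"
      using linear_sum[OF lin, of "\<lambda>i. h $ i *\<^sub>R axis i 1" UNIV] linear_cmul[OF lin] by simp
    also have "norm \<dots> \<le> (\<Sum>i\<in>UNIV. norm h * B i)"
      by (rule order_trans[OF norm_sum sum_mono])
         (auto simp: abs_mult intro!: mult_mono B component_le_norm_cart)
    finally show "norm (frechet_derivative f (at x) h) \<le> (\<Sum>i\<in>UNIV. B i) * norm h"
      by (simp add: sum_distrib_left mult.commute)
  qed
  have "\<bar>f x - f y\<bar> \<le> (\<Sum>i\<in>UNIV. B i) * norm (x - y)" for x y
    using differentiable_bound[OF convex_UNIV, of f "\<lambda>x. frechet_derivative f (at x)" "\<Sum>i\<in>UNIV. B i" x y] on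
      smooth_has_derivative[OF test_function_smooth[OF f]] by auto
  moreover have "(\<Sum>i\<in>UNIV. B i) > 0" using B(1) by (intro sum_pos) auto
  ultimately show ?thesis using that by blast
qed

lemma test_function_measurable [measurable]: "test_function f \<Longrightarrow> f \<in> borel_measurable borel"
  by (intro borel_measurable_continuous_onI smooth_continuous test_function_smooth)

lemma test_function_square_integrable:
  assumes f: "test_function f" shows "integrable lborel f" "integrable lborel (\<lambda>x. (f x)^2)"
proof -
  obtain B where B: "B > 0" "\<And>x. \<bar>f x\<bar> \<le> B" using test_function_bounded[OF f] by metis
  obtain r where r: "\<And>x. f x \<noteq> 0 \<Longrightarrow> norm x \<le> r"
    using test_function_bounded_support[OF f] unfolding bounded_iff by auto
  have ib: "integrable lborel (\<lambda>x. c * indicator (cball (0::real^3) r) x)" for c :: real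
    using emeasure_bounded_finite[OF bounded_cball, of "0::real^3" r]
    by (intro integrable_mult_right integrable_real_indicator) auto
  note [measurable] = test_function_measurable[OF f]
  show "integrable lborel f"
    by (rule Bochner_Integration.integrable_bound[OF ib[of B]])
       (use B r in \<open>auto intro!: AE_I2 simp: indicator_def\<close>)
  show "integrable lborel (\<lambda>x. (f x)^2)"
    by (rule Bochner_Integration.integrable_bound[OF ib[of "B^2"]])
       (use B r in \<open>auto intro!: AE_I2 simp: indicator_def simp flip: abs_le_square_iff\<close>)
qed

text \<open>Bumps that increase to the indicator of an open box.\<close>

definition box_bump :: "real^3 \<Rightarrow> real^3 \<Rightarrow> nat \<Rightarrow> real^3 \<Rightarrow> real" where
  "box_bump a b n x = (\<Prod>i\<in>UNIV. flat (real n * (x $ i - a $ i)) * flat (real n * (b $ i - x $ i)))"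

lemma box_bump_bounds: "0 \<le> box_bump a b n x" "box_bump a b n x \<le> 1"
  unfolding box_bump_def
  by (auto intro!: prod_nonneg prod_le_1 mult_nonneg_nonneg mult_le_one simp: flat_props)

lemma box_bump_zero: "x \<notin> box a b \<Longrightarrow> box_bump a b n x = 0"
  unfolding box_bump_def mem_box_cart
  by (auto simp: prod_zero_iff not_less intro!: flat_props mult_nonneg_nonpos)

lemma test_function_box_bump: "test_function (box_bump a b n)"
proof (rule test_functionI)
  show "smooth (box_bump a b n)"
    unfolding box_bump_def[abs_def] diff_conv_add_uminus
    using smooth_mult[OF smooth_const[of "-1"] smooth_component]
    by (intro smooth_prod smooth_mult smooth_flat smooth_add smooth_const smooth_component) simp
  show "bounded {x. box_bump a b n x \<noteq> 0}"
    using box_bump_zero by (blast intro: bounded_subset[OF bounded_box])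
qed

lemma flat_scaled_tendsto: "t > 0 \<Longrightarrow> (\<lambda>n. flat (real n * t)) \<longlonglongrightarrow> 1"
proof -
  assume t: "t > 0"
  have "(\<lambda>n. exp (- 1 / (real n * t))) \<longlonglongrightarrow> exp (- 0)"
  proof (intro tendsto_exp)
    have "(\<lambda>n. (- 1 / t) * (1 / real n)) \<longlonglongrightarrow> (- 1 / t) * 0"
      by (intro tendsto_intros lim_const_over_n)
    then show "(\<lambda>n. - 1 / (real n * t)) \<longlonglongrightarrow> - 0" by (simp add: field_simps)
  qed
  moreover have "\<forall>\<^sub>F n in sequentially. exp (- 1 / (real n * t)) = flat (real n * t)"
    using eventually_gt_at_top[of 0] by eventually_elim (use t in \<open>auto simp: flat_def\<close>)
  ultimately show ?thesis by (auto intro: Lim_transform_eventually)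
qed

lemma box_bump_tendsto: "(\<lambda>n. box_bump a b n x) \<longlonglongrightarrow> indicator (box a b) x"
proof (cases "x \<in> box a b")
  case True
  then have "(\<lambda>n. box_bump a b n x) \<longlonglongrightarrow> (\<Prod>i\<in>(UNIV::3 set). 1 * 1)"
    unfolding box_bump_def by (intro tendsto_intros flat_scaled_tendsto) (auto simp: mem_box_cart)
  then show ?thesis using True by simp
qed (simp add: box_bump_zero)

text \<open>The fundamental lemma of the calculus of variations.\<close>

lemma AE_zero_if_zero_against_test_functions:
  fixes w :: "real^3 \<Rightarrow> real"
  assumes m[measurable]: "w \<in> borel_measurable borel"
    and loc: "\<And>a b. integrable lborel (\<lambda>x. indicator (box a b) x * w x)"
    and zero: "\<And>f. test_function f \<Longrightarrow> (LBINT x. w x * f x) = 0"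
  shows "AE x in lborel. w x = 0"
proof -
  have box0: "(LBINT x. indicator (box a b) x * w x) = 0" for a b
  proof -
    note [measurable] = test_function_measurable[OF test_function_box_bump]
    have "(\<lambda>n. \<integral>x. w x * box_bump a b n x \<partial>lborel) \<longlonglongrightarrow> (LBINT x. indicator (box a b) x * w x)"
    proof (rule integral_dominated_convergence[where w="\<lambda>x. \<bar>indicator (box a b) x * w x\<bar>"])
      show "AE x in lborel. norm (w x * box_bump a b i x) \<le> \<bar>indicator (box a b) x * w x\<bar>" for i
        by (intro AE_I2) (auto simp: indicator_def abs_mult box_bump_bounds box_bump_zero mult_left_le)
      show "AE x in lborel. (\<lambda>n. w x * box_bump a b n x) \<longlonglongrightarrow> indicator (box a b) x * w x"
        using tendsto_mult[OF tendsto_const box_bump_tendsto] by (intro AE_I2) (simp add: mult.commute)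
    qed (use loc in auto)
    then show ?thesis by (simp add: zero test_function_box_bump LIMSEQ_const_iff)
  qed
  define P where "P = density lborel (\<lambda>x. ennreal (w x))"
  define N where "N = density lborel (\<lambda>x. ennreal (- w x))"
  have PN: "emeasure P (box a b) = emeasure N (box a b)" "emeasure P (box a b) < \<infinity>" for a b
  proof -
    let ?v = "\<lambda>x. indicator (box a b) x * w x"
    have e: "ennreal (?v x) = ennreal (w x) * indicator (box a b) x"
         "ennreal (- ?v x) = ennreal (- w x) * indicator (box a b) x" for x
      by (auto simp: indicator_def)
    note r = real_lebesgue_integral_def[OF loc[of a b], unfolded box0 e]
    have fin: "(\<integral>\<^sup>+x. ennreal (w x) * indicator (box a b) x \<partial>lborel) < \<infinity>"
       "(\<integral>\<^sup>+x. ennreal (- w x) * indicator (box a b) x \<partial>lborel) < \<infinity>"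
      using loc[of a b] unfolding real_integrable_def e by (auto simp: top.not_eq_extremum)
    show "emeasure P (box a b) < \<infinity>" using fin by (simp add: P_def emeasure_density)
    show "emeasure P (box a b) = emeasure N (box a b)" using fin r
      by (simp add: P_def N_def emeasure_density)
         (metis enn2real_positive_iff ennreal_enn2real infinity_ennreal_def)
  qed
  have "P = N"
  proof (rule measure_eqI_generator_eq)
    let ?E = "range (\<lambda>(a, b). box a b::(real^3) set)"
    show "Int_stable ?E" by (auto simp: Int_stable_def box_Int_box)
    show "?E \<subseteq> Pow UNIV" "sets P = sigma_sets UNIV ?E" "sets N = sigma_sets UNIV ?E"
      by (simp_all add: borel_eq_box P_def N_def)
    let ?A = "\<lambda>n::nat. box (- (real n *\<^sub>R One)) (real n *\<^sub>R One) :: (real^3) set"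
    show "range ?A \<subseteq> ?E" "(\<Union>i. ?A i) = UNIV" unfolding UN_box_eq_UNIV by auto
    show "emeasure P (?A i) \<noteq> \<infinity>" for i using PN(2) less_top by (metis infinity_ennreal_def less_irrefl)
    show "emeasure P X = emeasure N X" if "X \<in> ?E" for X using that PN by auto
  qed
  then have "AE x in lborel. ennreal (w x) = ennreal (- w x)"
    unfolding P_def N_def by (intro sigma_finite_measure.density_unique sigma_finite_lborel) auto
  then show ?thesis
  proof eventually_elim
    case (elim x)
    then show ?case by (cases "w x \<ge> 0") (auto simp: ennreal_neg ennreal_eq_0_iff ennreal_inj)
  qed
qed

section \<open>Radial integrals and convolution with power kernels\<close>

lemma nn_integral_shift:
  fixes F :: "real^3 \<Rightarrow> ennreal"
  assumes [measurable]: "F \<in> borel_measurable borel"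
  shows "(\<integral>\<^sup>+y. F (y - x) \<partial>lborel) = (\<integral>\<^sup>+y. F y \<partial>lborel)"
proof -
  have "(\<integral>\<^sup>+y. F y \<partial>lborel) = (\<integral>\<^sup>+y. F y \<partial>distr lborel borel ((+) (- x)))"
    by (simp add: lborel_distr_plus)
  also have "\<dots> = (\<integral>\<^sup>+y. F (y - x) \<partial>lborel)"
    by (subst nn_integral_distr) (auto simp: algebra_simps)
  finally show ?thesis ..
qed

lemma nn_integral_reflect:
  fixes F :: "real^3 \<Rightarrow> ennreal"
  assumes [measurable]: "F \<in> borel_measurable borel"
  shows "(\<integral>\<^sup>+y. F (x - y) \<partial>lborel) = (\<integral>\<^sup>+y. F y \<partial>lborel)"
  by (subst (2) lborel_affine[of "-1" x]) (auto simp: nn_integral_density nn_integral_distr)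

lemma nn_integral_radial:
  fixes F :: "real \<Rightarrow> ennreal"
  assumes [measurable]: "F \<in> borel_measurable borel"
  shows "(\<integral>\<^sup>+y. F (norm (y::real^3)) \<partial>lborel)
    = (\<integral>\<^sup>+r. ennreal (4 * pi * r^2) * indicator {0..} r * F r \<partial>lborel)"
proof -
  let ?M = "distr lborel borel (norm :: real^3 \<Rightarrow> real)"
  let ?N = "density lborel (\<lambda>r. ennreal (4 * pi * r^2) * indicator {0..} r)"
  have emM: "emeasure ?M {..r} = (if 0 \<le> r then ennreal (4/3 * pi * r^3) else 0)" for r
  proof -
    have "emeasure ?M {..r} = emeasure lborel (norm -` {..r} \<inter> space lborel :: (real^3) set)"
      by (subst emeasure_distr) auto
    also have "norm -` {..r} \<inter> space lborel = (cball 0 r :: (real^3) set)" by auto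
    finally show ?thesis by (auto simp: emeasure_cball unit_ball_vol_3)
  qed
  have emN: "emeasure ?N {..r} = (if 0 \<le> r then ennreal (4/3 * pi * r^3) else 0)" for r
  proof -
    have "emeasure ?N {..r} = (\<integral>\<^sup>+s. ennreal (4 * pi * s^2) * indicator {0..r} s \<partial>lborel)"
      by (subst emeasure_density) (auto intro!: nn_integral_cong simp: indicator_def)
    also have "\<dots> = (if 0 \<le> r then ennreal (4/3 * pi * r^3) else 0)"
    proof (cases "0 \<le> r")
      case True
      have "(\<integral>\<^sup>+s. ennreal (4 * pi * s^2) * indicator {0..r} s \<partial>lborel) = ennreal (4/3 * pi * r^3 - 4/3 * pi * 0^3)"
        by (rule nn_integral_FTC_Icc) (use True in \<open>auto intro!: derivative_eq_intros simp: has_real_derivative_iff_has_vector_derivative[symmetric]\<close>)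
      then show ?thesis using True by simp
    qed simp
    finally show ?thesis .
  qed
  have "?M = ?N"
  proof (rule measure_eqI_generator_eq)
    let ?E = "range (\<lambda>a::real. {..a})" and ?A = "\<lambda>n::nat. {..real n}"
    show "Int_stable ?E" by (auto simp: Int_stable_def)
    show "?E \<subseteq> Pow UNIV" "sets ?M = sigma_sets UNIV ?E" "sets ?N = sigma_sets UNIV ?E"
      by (simp_all add: borel_eq_atMost)
    show "range ?A \<subseteq> ?E" "(\<Union>i. ?A i) = UNIV" by (auto simp: real_arch_simple)
    show "emeasure ?M (?A i) \<noteq> \<infinity>" for i by (simp add: emM)
    show "emeasure ?M X = emeasure ?N X" if "X \<in> ?E" for X using that by (auto simp: emM emN)
  qed
  have "(\<integral>\<^sup>+y. F (norm (y::real^3)) \<partial>lborel) = (\<integral>\<^sup>+r. F r \<partial>?M)"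
    by (subst nn_integral_distr) auto
  also have "\<dots> = (\<integral>\<^sup>+r. ennreal (4 * pi * r^2) * indicator {0..} r * F r \<partial>lborel)"
    unfolding \<open>?M = ?N\<close> by (subst nn_integral_density) auto
  finally show ?thesis .
qed

lemma nn_integral_power_inside:
  assumes "a < 3" "0 \<le> R"
  shows "(\<integral>\<^sup>+y. ennreal (norm (y::real^3) powr (-a)) * indicator {0..R} (norm y) \<partial>lborel)
    = ennreal (4 * pi * R powr (3 - a) / (3 - a))"
proof -
  have "(\<integral>\<^sup>+y. ennreal (norm (y::real^3) powr (-a)) * indicator {0..R} (norm y) \<partial>lborel)
      = (\<integral>\<^sup>+r. ennreal (4 * pi * r^2) * indicator {0..} r * (ennreal (r powr (-a)) * indicator {0..R} r) \<partial>lborel)"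
    by (rule nn_integral_radial) measurable
  also have "\<dots> = (\<integral>\<^sup>+r. ennreal (4 * pi) * (ennreal (r powr (2 - a)) * indicator {0..R} r) \<partial>lborel)"
  proof (rule nn_integral_cong_AE, use AE_lborel_singleton[of 0] in eventually_elim)
    case (elim r)
    then show ?case
      by (auto simp: indicator_def ennreal_mult'[symmetric] powr_diff powr_minus field_simps)
  qed
  also have "\<dots> = ennreal (4 * pi) * ennreal (R powr (2 - a + 1) / (2 - a + 1))"
    using has_integral_powr_from_0[of "2 - a" R] assms
    by (subst nn_integral_cmult) (auto intro!: arg_cong2[where f="(*)"] nn_integral_has_integral_lebesgue')
  finally show ?thesis using assms by (simp add: ennreal_mult'[symmetric])
qed

lemma nn_integral_power_outside:
  assumes "a > 3" "0 < R"
  shows "(\<integral>\<^sup>+y. ennreal (norm (y::real^3) powr (-a)) * indicator {R..} (norm y) \<partial>lborel)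
    = ennreal (4 * pi * R powr (3 - a) / (a - 3))"
proof -
  have "(\<integral>\<^sup>+y. ennreal (norm (y::real^3) powr (-a)) * indicator {R..} (norm y) \<partial>lborel)
      = (\<integral>\<^sup>+r. ennreal (4 * pi * r^2) * indicator {0..} r * (ennreal (r powr (-a)) * indicator {R..} r) \<partial>lborel)"
    by (rule nn_integral_radial) measurable
  also have "\<dots> = (\<integral>\<^sup>+r. ennreal (4 * pi) * (ennreal (r powr (2 - a)) * indicator {R..} r) \<partial>lborel)"
    using assms
    by (intro nn_integral_cong)
       (auto simp: indicator_def ennreal_mult'[symmetric] powr_diff powr_minus field_simps)
  also have "\<dots> = ennreal (4 * pi) * ennreal (- (R powr (2 - a + 1)) / (2 - a + 1))"
    using has_integral_powr_to_inf[of "2 - a" R] assms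
    by (subst nn_integral_cmult) (auto intro!: arg_cong2[where f="(*)"] nn_integral_has_integral_lebesgue')
  also have "- (R powr (2 - a + 1)) / (2 - a + 1) = R powr (3 - a) / (a - 3)"
    using assms by (simp add: field_simps)
  finally show ?thesis using assms by (simp add: ennreal_mult'[symmetric])
qed

text \<open>The half space of points closer to \<open>0\<close> than to \<open>z\<close>, where \<open>norm (y - z)\<close> is at least
  both \<open>norm y\<close> and \<open>norm z / 2\<close>.\<close>

lemma nn_integral_two_powers_half:
  fixes z :: "real^3"
  assumes ab: "a < 3" "0 \<le> b" "a + b > 3" and z: "z \<noteq> 0"
  shows "(\<integral>\<^sup>+y. ennreal (norm y powr (-a) * norm (y - z) powr (-b)) * indicator {y. norm y \<le> norm (y - z)} y \<partial>lborel)
    \<le> ennreal (4 * pi * (norm z / 2) powr (3 - a - b) * (1 / (3 - a) + 1 / (a + b - 3)))"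
proof -
  define R where "R = norm z / 2"
  have R: "R > 0" using z by (simp add: R_def)
  have "(\<integral>\<^sup>+y. ennreal (norm y powr (-a) * norm (y - z) powr (-b)) * indicator {y. norm y \<le> norm (y - z)} y \<partial>lborel)
     \<le> (\<integral>\<^sup>+y. ennreal (R powr (-b)) * (ennreal (norm (y::real^3) powr (-a)) * indicator {0..R} (norm y))
           + ennreal (norm y powr (-(a+b))) * indicator {R..} (norm y) \<partial>lborel)"
  proof (rule nn_integral_mono)
    fix y :: "real^3"
    show "ennreal (norm y powr (-a) * norm (y - z) powr (-b)) * indicator {y. norm y \<le> norm (y - z)} y
       \<le> ennreal (R powr (-b)) * (ennreal (norm y powr (-a)) * indicator {0..R} (norm y))
           + ennreal (norm y powr (-(a+b))) * indicator {R..} (norm y)"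
    proof (cases "norm y \<le> norm (y - z)")
      case True
      have "norm z \<le> norm y + norm (y - z)"
        using norm_triangle_ineq4[of y "y - z"] by simp
      then have g: "norm (y - z) \<ge> R" using True by (simp add: R_def)
      show ?thesis
      proof (cases "norm y \<le> R")
        case le: True
        have "norm (y - z) powr (-b) \<le> R powr (-b)"
          using g R ab by (intro powr_mono2') auto
        then have "norm y powr (-a) * norm (y - z) powr (-b) \<le> R powr (-b) * norm y powr (-a)"
          by (metis mult.commute mult_left_mono powr_ge_zero)
        then show ?thesis using True le
          by (simp add: ennreal_mult'[symmetric] ennreal_leI add_increasing2)
      next
        case False
        have "norm (y - z) powr (-b) \<le> norm y powr (-b)"
          using True False R ab by (intro powr_mono2') auto
        then have "norm y powr (-a) * norm (y - z) powr (-b) \<le> norm y powr (-a) * norm y powr (-b)"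
          by (simp add: mult_left_mono)
        also have "\<dots> = norm y powr (-(a+b))" by (simp flip: powr_add)
        finally show ?thesis using True False by (simp add: ennreal_leI)
      qed
    qed simp
  qed
  also have "\<dots> = ennreal (R powr (-b)) * ennreal (4 * pi * R powr (3 - a) / (3 - a))
      + ennreal (4 * pi * R powr (3 - (a + b)) / (a + b - 3))"
    using ab R nn_integral_power_inside[of a R] nn_integral_power_outside[of "a+b" R]
    by (subst nn_integral_add) (simp_all add: nn_integral_cmult)
  also have "\<dots> = ennreal (R powr (-b) * (4 * pi * R powr (3 - a) / (3 - a)) + 4 * pi * R powr (3 - (a + b)) / (a + b - 3))"
    using ab by (simp add: ennreal_mult'[symmetric] ennreal_plus[symmetric] del: ennreal_plus)
  also have "R powr (-b) * (4 * pi * R powr (3 - a) / (3 - a)) = 4 * pi * R powr (3 - a - b) / (3 - a)"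
  proof -
    have "R powr (3 - a - b) = R powr (-b) * R powr (3 - a)" by (simp flip: powr_add)
    then show ?thesis by simp
  qed
  finally show ?thesis by (simp add: R_def algebra_simps diff_diff_eq)
qed

text \<open>The two half spaces of points closer to \<open>0\<close> and closer to \<open>z\<close> are exchanged by the reflection
  \<open>y \<mapsto> z - y\<close>.\<close>

lemma nn_integral_two_powers:
  fixes z :: "real^3"
  assumes ab: "0 \<le> a" "a < 3" "0 \<le> b" "b < 3" "a + b > 3" and z: "z \<noteq> 0"
  shows "(\<integral>\<^sup>+y. ennreal (norm y powr (-a) * norm (y - z) powr (-b)) \<partial>lborel)
    \<le> ennreal (4 * pi * (norm z / 2) powr (3 - a - b) * (1 / (3 - a) + 1 / (3 - b) + 2 / (a + b - 3)))"
proof -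
  let ?f = "\<lambda>y::real^3. ennreal (norm y powr (-a) * norm (y - z) powr (-b))"
  let ?g = "\<lambda>y::real^3. ennreal (norm y powr (-b) * norm (y - (-z)) powr (-a)) * indicator {y. norm y \<le> norm (y - (-z))} y"
  have "(\<integral>\<^sup>+y. ?f y \<partial>lborel)
     \<le> (\<integral>\<^sup>+y. ?f y * indicator {y. norm y \<le> norm (y - z)} y + ?g (y - z) \<partial>lborel)"
    by (intro nn_integral_mono) (auto simp: indicator_def mult.commute)
  also have "\<dots> = (\<integral>\<^sup>+y. ?f y * indicator {y. norm y \<le> norm (y - z)} y \<partial>lborel) + (\<integral>\<^sup>+y. ?g (y - z) \<partial>lborel)"
    by (rule nn_integral_add) measurable
  also have "(\<integral>\<^sup>+y. ?g (y - z) \<partial>lborel) = (\<integral>\<^sup>+y. ?g y \<partial>lborel)"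
    by (rule nn_integral_shift) measurable
  also have "(\<integral>\<^sup>+y. ?f y * indicator {y. norm y \<le> norm (y - z)} y \<partial>lborel) + (\<integral>\<^sup>+y. ?g y \<partial>lborel) \<le> ennreal (4 * pi * (norm z / 2) powr (3 - a - b) * (1 / (3 - a) + 1 / (a + b - 3)))
      + ennreal (4 * pi * (norm (-z) / 2) powr (3 - b - a) * (1 / (3 - b) + 1 / (b + a - 3)))"
    using ab z by (intro add_mono nn_integral_two_powers_half) auto
  also have "\<dots> = ennreal (4 * pi * (norm z / 2) powr (3 - a - b) * (1 / (3 - a) + 1 / (a + b - 3))
      + 4 * pi * (norm z / 2) powr (3 - a - b) * (1 / (3 - b) + 1 / (a + b - 3)))"
    using ab by (subst ennreal_plus) (auto simp: add.commute diff_diff_eq algebra_simps intro!: mult_nonneg_nonneg add_nonneg_nonneg)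
  finally show ?thesis by (simp add: algebra_simps add_divide_distrib)
qed

text \<open>The inequality of Cauchy and Schwarz for the measure with density \<open>k\<close>, in a form without finiteness
  assumptions.\<close>

lemma cauchy_schwarz_weighted:
  fixes k :: "'a \<Rightarrow> real"
  assumes [measurable]: "k \<in> borel_measurable M" "G \<in> borel_measurable M" and k: "\<And>x. 0 \<le> k x"
  shows "(\<integral>\<^sup>+x. ennreal (k x) * G x \<partial>M)^2 \<le> (\<integral>\<^sup>+x. ennreal (k x) \<partial>M) * (\<integral>\<^sup>+x. ennreal (k x) * (G x)^2 \<partial>M)"
proof -
  have e: "ennreal (k x) = ennreal (sqrt (k x)) * ennreal (sqrt (k x))" for x
    using k[of x] by (simp flip: ennreal_mult)
  have "(\<integral>\<^sup>+x. ennreal (k x) * G x \<partial>M)^2 = (\<integral>\<^sup>+x. ennreal (sqrt (k x)) * (ennreal (sqrt (k x)) * G x) \<partial>M)^2"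
    by (simp add: e mult.assoc)
  also have "\<dots> \<le> (\<integral>\<^sup>+x. (ennreal (sqrt (k x)))^2 \<partial>M) * (\<integral>\<^sup>+x. (ennreal (sqrt (k x)) * G x)^2 \<partial>M)"
    by (rule Cauchy_Schwarz_nn_integral) auto
  also have "(\<lambda>x. (ennreal (sqrt (k x)))^2) = (\<lambda>x. ennreal (k x))"
    by (simp add: power2_eq_square flip: e)
  also have "(\<lambda>x. (ennreal (sqrt (k x)) * G x)^2) = (\<lambda>x. ennreal (k x) * (G x)^2)"
    by (simp add: power2_eq_square e mult_ac)
  finally show ?thesis .
qed

text \<open>Convolution with an integrable kernel is bounded on \<open>L\<^sup>2\<close>: the weighted inequality of Cauchy and
  Schwarz is integrated over \<open>x\<close>.\<close>

lemma young_inequality: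
  fixes k :: "real^3 \<Rightarrow> real" and G :: "real^3 \<Rightarrow> ennreal"
  assumes [measurable]: "k \<in> borel_measurable borel" "G \<in> borel_measurable borel" and k: "\<And>x. 0 \<le> k x"
  shows "(\<integral>\<^sup>+x. (\<integral>\<^sup>+y. ennreal (k (y - x)) * G y \<partial>lborel)^2 \<partial>lborel)
    \<le> (\<integral>\<^sup>+z. ennreal (k z) \<partial>lborel)^2 * (\<integral>\<^sup>+y. (G y)^2 \<partial>lborel)"
proof -
  let ?K = "\<integral>\<^sup>+z. ennreal (k z) \<partial>lborel"
  have "(\<integral>\<^sup>+x. (\<integral>\<^sup>+y. ennreal (k (y - x)) * G y \<partial>lborel)^2 \<partial>lborel)
     \<le> (\<integral>\<^sup>+x. ?K * (\<integral>\<^sup>+y. ennreal (k (y - x)) * (G y)^2 \<partial>lborel) \<partial>lborel)"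
  proof (rule nn_integral_mono)
    fix x :: "real^3"
    have "(\<integral>\<^sup>+y. ennreal (k (y - x)) * G y \<partial>lborel)^2
       \<le> (\<integral>\<^sup>+y. ennreal (k (y - x)) \<partial>lborel) * (\<integral>\<^sup>+y. ennreal (k (y - x)) * (G y)^2 \<partial>lborel)"
      by (rule cauchy_schwarz_weighted) (auto simp: k)
    then show "(\<integral>\<^sup>+y. ennreal (k (y - x)) * G y \<partial>lborel)^2
       \<le> ?K * (\<integral>\<^sup>+y. ennreal (k (y - x)) * (G y)^2 \<partial>lborel)"
      by (simp add: nn_integral_shift[of "\<lambda>z. ennreal (k z)"])
  qed
  also have "\<dots> = ?K * (\<integral>\<^sup>+x. \<integral>\<^sup>+y. ennreal (k (y - x)) * (G y)^2 \<partial>lborel \<partial>lborel)"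
    by (rule nn_integral_cmult) measurable
  also have "(\<integral>\<^sup>+x. \<integral>\<^sup>+y. ennreal (k (y - x)) * (G y)^2 \<partial>lborel \<partial>lborel)
      = (\<integral>\<^sup>+y. \<integral>\<^sup>+x. ennreal (k (y - x)) * (G y)^2 \<partial>lborel \<partial>lborel)"
    by (rule lborel_pair.Fubini') measurable
  also have "\<dots> = (\<integral>\<^sup>+y. ?K * (G y)^2 \<partial>lborel)"
    by (intro nn_integral_cong)
       (simp add: nn_integral_multc nn_integral_reflect[of "\<lambda>z. ennreal (k z)"])
  also have "\<dots> = ?K * (\<integral>\<^sup>+y. (G y)^2 \<partial>lborel)"
    by (rule nn_integral_cmult) measurable
  finally show ?thesis by (simp add: power2_eq_square mult.assoc)
qed

section \<open>The representation of a Sobolev function by its gradient\<close>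

lemma integrable_shift:
  fixes F :: "real^3 \<Rightarrow> 'b::{banach, second_countable_topology}"
  assumes "integrable lborel F"
  shows "integrable lborel (\<lambda>y. F (y - x))" and "(LBINT y. F (y - x)) = (LBINT y. F y)"
proof -
  have d: "distr lborel borel ((+) (- x)) = (lborel :: (real^3) measure)" by (rule lborel_distr_plus)
  have m: "F \<in> borel_measurable borel" using assms by auto
  have "integrable (distr lborel borel ((+) (- x))) F" using assms by (simp add: d)
  then show "integrable lborel (\<lambda>y. F (y - x))"
    by (subst (asm) integrable_distr_eq) (auto simp: m algebra_simps)
  have "(\<integral>y. F y \<partial>distr lborel borel ((+) (- x))) = (LBINT y. F (y - x))"
    by (subst integral_distr) (auto simp: m algebra_simps)
  then show "(LBINT y. F (y - x)) = (LBINT y. F y)" by (simp add: d)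
qed

text \<open>So \<open>1 / (1 + (norm w)\<^sup>2)\<close> is square integrable. It majorizes the kernels whose cutoff is removed below,
  and it is the weight that measures local convergence.\<close>

lemma integrable_bracket: "integrable lborel (\<lambda>w::real^3. 1 / (1 + (norm w)^2)^2)"
proof (rule integrableI_bounded)
  have "(\<integral>\<^sup>+w. ennreal (norm (1 / (1 + (norm (w::real^3))^2)^2)) \<partial>lborel)
     \<le> (\<integral>\<^sup>+w. indicator (cball (0::real^3) 1) w
          + ennreal (norm w powr (-4)) * indicator {1..} (norm w) \<partial>lborel)"
  proof (rule nn_integral_mono)
    fix w :: "real^3"
    show "ennreal (norm (1 / (1 + (norm w)^2)^2)) \<le> indicator (cball 0 1) w
          + ennreal (norm w powr (-4)) * indicator {1..} (norm w)"
    proof (cases "norm w \<le> 1")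
      case True
      have "1 / (1 + (norm w)^2)^2 \<le> 1" by (simp add: divide_simps)
      then have "ennreal (norm (1 / (1 + (norm w)^2)^2)) \<le> 1" by simp
      then show ?thesis using True by (simp add: add_increasing2)
    next
      case False
      have "norm w ^ 4 \<le> (1 + (norm w)^2)^2"
        by (simp add: power2_eq_square algebra_simps flip: power_mult) (simp add: power4_eq_xxxx)
      then have "1 / (1 + (norm w)^2)^2 \<le> 1 / norm w ^ 4"
        using False by (intro frac_le) auto
      also have "1 / norm w ^ 4 = norm w powr (-4)"
        using False by (auto simp: powr_minus powr_numeral divide_simps)
      finally have "1 / (1 + (norm w)^2)^2 \<le> norm w powr (-4)" .
      then show ?thesis using False by (simp add: ennreal_leI)
    qed
  qed
  also have "\<dots> < \<infinity>"
    using nn_integral_power_outside[of 4 1]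
    by (subst nn_integral_add) (auto simp: emeasure_cball intro!: borel_measurable_indicator)
  finally show "(\<integral>\<^sup>+w. ennreal (norm (1 / (1 + (norm (w::real^3))^2)^2)) \<partial>lborel) < \<infinity>" .
qed measurable

lemma integrable_mult_L2:
  fixes f g :: "'a \<Rightarrow> real"
  assumes [measurable]: "f \<in> borel_measurable M" "g \<in> borel_measurable M"
    and "integrable M (\<lambda>x. (f x)^2)" "integrable M (\<lambda>x. (g x)^2)"
  shows "integrable M (\<lambda>x. f x * g x)"
proof (rule Bochner_Integration.integrable_bound)
  show "integrable M (\<lambda>x. (f x)^2 + (g x)^2)" using assms by auto
  have "\<bar>a * b\<bar> \<le> a^2 + b^2" for a b :: real
  proof -
    have "2 * (\<bar>a\<bar> * \<bar>b\<bar>) \<le> a^2 + b^2" "0 \<le> \<bar>a\<bar> * \<bar>b\<bar>"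
      using sum_squares_bound[of "\<bar>a\<bar>" "\<bar>b\<bar>"] by auto
    then show ?thesis unfolding abs_mult by linarith
  qed
  then show "AE x in M. norm (f x * g x) \<le> norm ((f x)^2 + (g x)^2)" by (intro AE_I2) simp
qed measurable

definition regdist :: "real \<Rightarrow> real^3 \<Rightarrow> real" where
  "regdist \<delta> w = sqrt ((norm w)^2 + \<delta>^2)"

text \<open>The Laplacian of \<open>1 / regdist \<delta>\<close> is \<open>- 4 * pi * eta \<delta>\<close>; the kernels \<open>eta \<delta>\<close> form an
  approximate identity as \<open>\<delta>\<close> tends to zero.\<close>

definition eta :: "real \<Rightarrow> real^3 \<Rightarrow> real" where
  "eta \<delta> w = 3 * \<delta>^2 / (4 * pi) / (regdist \<delta> w)^5"

lemma regdist_measurable [measurable]: "regdist \<delta> \<in> borel_measurable borel"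
  unfolding regdist_def[abs_def] by measurable
lemma eta_measurable [measurable]: "eta \<delta> \<in> borel_measurable borel"
  unfolding eta_def[abs_def] by measurable

lemma regdist_ge: "norm w \<le> regdist \<delta> w" "\<delta> \<le> regdist \<delta> w"
  by (auto simp: regdist_def real_le_rsqrt)
lemma regdist_pos: "\<delta> > 0 \<Longrightarrow> regdist \<delta> w > 0"
  using regdist_ge(2)[of \<delta> w] by linarith
lemma regdist_sq: "(regdist \<delta> w)^2 = (norm w)^2 + \<delta>^2"
  by (simp add: regdist_def)
lemma eta_nonneg: "\<delta> > 0 \<Longrightarrow> 0 \<le> eta \<delta> w"
  using regdist_pos[of \<delta> w] by (simp add: eta_def)

lemma nn_integral_eta:
  assumes d: "\<delta> > 0" shows "(\<integral>\<^sup>+w. ennreal (eta \<delta> w) \<partial>lborel) = 1"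
proof -
  let ?s = "\<lambda>r::real. sqrt (r^2 + \<delta>^2)"
  have sp: "?s r > 0" for r using d by (simp add: sum_power2_gt_zero_iff)
  have sq: "(?s r)^2 = r^2 + \<delta>^2" for r by simp
  have "(\<integral>\<^sup>+w. ennreal (eta \<delta> w) \<partial>lborel)
     = (\<integral>\<^sup>+r. ennreal (4 * pi * r^2) * indicator {0..} r * ennreal (3 * \<delta>^2 / (4 * pi) / (?s r)^5) \<partial>lborel)"
    unfolding eta_def regdist_def
    by (rule nn_integral_radial[of "\<lambda>r. ennreal (3 * \<delta>^2 / (4 * pi) / (?s r)^5)"]) measurable
  also have "\<dots> = (\<integral>\<^sup>+r. ennreal (3 * \<delta>^2 * r^2 / (?s r)^5) * indicator {0..} r \<partial>lborel)"
    using sp by (intro nn_integral_cong) (auto simp: indicator_def less_imp_le simp flip: ennreal_mult')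
  also have "\<dots> = ennreal (1 - 0^3 / (?s 0)^3)"
  proof (rule nn_integral_FTC_atLeast[where F="\<lambda>r. r^3 / (?s r)^3"])
    fix r :: real assume "0 \<le> r"
    have "((\<lambda>r. r^3 / (?s r)^3) has_real_derivative
        (3 * r^2 * (?s r)^3 - r^3 * (3 * (?s r)^2 * (r / ?s r))) / ((?s r)^3 * (?s r)^3)) (at r)"
      using sp[of r] by (auto intro!: derivative_eq_intros simp: sum_power2_gt_zero_iff not_sum_power2_lt_zero d divide_simps)
    moreover have "(3 * r^2 * (?s r)^3 - r^3 * (3 * (?s r)^2 * (r / ?s r))) / ((?s r)^3 * (?s r)^3)
       = 3 * \<delta>^2 * r^2 / (?s r)^5"
    proof -
      define t where "t = ?s r"
      have t: "t > 0" "\<delta>^2 = t^2 - r^2" using sp[of r] sq[of r] unfolding t_def by auto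
      have "3 * r^2 * t^3 - r^3 * (3 * t^2 * (r / t)) = t * (3 * \<delta>^2 * r^2)"
        using t(1) unfolding t(2) by (simp add: field_simps power2_eq_square power3_eq_cube)
      moreover have "t^3 * t^3 = t * t^5" by (simp flip: power_add power_Suc)
      ultimately show ?thesis using t(1) unfolding t_def[symmetric] by simp
    qed
    ultimately show "((\<lambda>r. r^3 / (?s r)^3) has_real_derivative 3 * \<delta>^2 * r^2 / (?s r)^5) (at r)" by simp
    show "0 \<le> 3 * \<delta>^2 * r^2 / (?s r)^5" using sp[of r] by simp
  next
    have "((\<lambda>r. (1 / sqrt (1 + \<delta>^2 * (inverse r)^2))^3) \<longlongrightarrow> (1 / sqrt (1 + \<delta>^2 * 0^2))^3) at_top"
      by (intro tendsto_intros tendsto_inverse_0_at_top[OF filterlim_ident]) auto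
    then have "((\<lambda>r. (1 / sqrt (1 + \<delta>^2 * (inverse r)^2))^3) \<longlongrightarrow> 1) at_top" by simp
    moreover have "\<forall>\<^sub>F r in at_top. (1 / sqrt (1 + \<delta>^2 * (inverse r)^2))^3 = r^3 / (?s r)^3"
    proof (use eventually_gt_at_top[of 0] in eventually_elim)
      case (elim r)
      have "r^2 + \<delta>^2 = r^2 * (1 + \<delta>^2 * (inverse r)^2)" using elim by (simp add: field_simps)
      then have "?s r = r * sqrt (1 + \<delta>^2 * (inverse r)^2)" using elim by (simp add: real_sqrt_mult)
      then show ?case using elim by (simp add: power_divide power_mult_distrib)
    qed
    ultimately show "((\<lambda>r. r^3 / (?s r)^3) \<longlongrightarrow> 1) at_top" by (rule Lim_transform_eventually)
  qed measurable
  finally show ?thesis using d by simp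
qed

text \<open>The finite first moment makes mollification converge at the rate \<open>\<delta>\<close> against Lipschitz functions.\<close>

lemma nn_integral_eta_moment:
  assumes d: "\<delta> > 0" shows "(\<integral>\<^sup>+w. ennreal (eta \<delta> w * norm w) \<partial>lborel) \<le> ennreal (4 * \<delta>)"
proof -
  have "(\<integral>\<^sup>+w. ennreal (eta \<delta> w * norm w) \<partial>lborel)
     \<le> (\<integral>\<^sup>+w. ennreal \<delta> * ennreal (eta \<delta> w)
          + ennreal (3 * \<delta>^2 / (4 * pi)) * (ennreal (norm w powr (-4)) * indicator {\<delta>..} (norm w)) \<partial>lborel)"
  proof (rule nn_integral_mono)
    fix w :: "real^3"
    show "ennreal (eta \<delta> w * norm w) \<le> ennreal \<delta> * ennreal (eta \<delta> w)
          + ennreal (3 * \<delta>^2 / (4 * pi)) * (ennreal (norm w powr (-4)) * indicator {\<delta>..} (norm w))"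
    proof (cases "norm w \<le> \<delta>")
      case True
      then have "eta \<delta> w * norm w \<le> \<delta> * eta \<delta> w"
        using eta_nonneg[OF d] by (metis mult.commute mult_left_mono)
      then show ?thesis using d eta_nonneg[OF d] by (simp add: add_increasing2 ennreal_leI flip: ennreal_mult)
    next
      case False
      have p: "norm w > 0" using False d by linarith
      have "eta \<delta> w \<le> 3 * \<delta>^2 / (4 * pi) / (norm w)^5"
        unfolding eta_def using regdist_ge(1)[of w \<delta>] p by (intro frac_le power_mono) auto
      then have "eta \<delta> w * norm w \<le> 3 * \<delta>^2 / (4 * pi) / (norm w)^5 * norm w"
        using p by (intro mult_right_mono) auto
      also have "\<dots> = 3 * \<delta>^2 / (4 * pi) * (norm w powr (-4))"
        using p by (simp add: powr_minus powr_numeral divide_simps) (simp add: numeral_eq_Suc)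
      finally show ?thesis using False by (simp add: ennreal_leI add_increasing flip: ennreal_mult')
    qed
  qed
  also have "\<dots> = ennreal \<delta> * 1 + ennreal (3 * \<delta>^2 / (4 * pi)) * ennreal (4 * pi * \<delta> powr (3 - 4) / (4 - 3))"
    using nn_integral_power_outside[of 4 \<delta>] d nn_integral_eta[OF d]
    by (subst nn_integral_add) (simp_all add: nn_integral_cmult)
  also have "\<dots> = ennreal (4 * \<delta>)"
    using d by (simp add: powr_minus field_simps power2_eq_square flip: ennreal_mult' ennreal_plus)
  finally show ?thesis .
qed

lemma eta_le: "\<delta> > 0 \<Longrightarrow> eta \<delta> w \<le> 1 / \<delta>^3"
proof -
  assume d: "\<delta> > 0"
  have "eta \<delta> w \<le> 3 * \<delta>^2 / (4 * pi) / \<delta>^5"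
    unfolding eta_def using regdist_ge(2)[of \<delta> w] d
    by (intro divide_left_mono power_mono mult_pos_pos zero_less_power) (auto intro: less_le_trans)
  also have "\<dots> = (3 / (4 * pi)) * (1 / \<delta>^3)" using d by (simp add: field_simps)
  also have "\<dots> \<le> 1 * (1 / \<delta>^3)" using d pi_gt3 by (intro mult_right_mono) auto
  finally show ?thesis by simp
qed

lemma integrable_eta: assumes d: "\<delta> > 0"
  shows "integrable lborel (eta \<delta>)" "integrable lborel (\<lambda>w. (eta \<delta> w)^2)" "(LBINT w. eta \<delta> w) = 1"
proof -
  show 1: "integrable lborel (eta \<delta>)"
    by (rule integrableI_bounded) (use nn_integral_eta[OF d] eta_nonneg[OF d] in auto)
  have "eta \<delta> w * eta \<delta> w \<le> 1 / \<delta>^3 * eta \<delta> w" for w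
    by (intro mult_right_mono eta_le eta_nonneg d)
  note le = this
  show "integrable lborel (\<lambda>w. (eta \<delta> w)^2)"
    by (rule Bochner_Integration.integrable_bound[OF integrable_mult_right[OF 1, of "1/\<delta>^3"]])
       (use le eta_nonneg[OF d] d in \<open>auto intro!: AE_I2 simp: power2_eq_square abs_mult\<close>)
  show "(LBINT w. eta \<delta> w) = 1"
    using nn_integral_eta[OF d] eta_nonneg[OF d] by (subst integral_eq_nn_integral) auto
qed

text \<open>The part of the Coulomb field \<open>1 / norm w ^ 2\<close> that the regularization removes.\<close>

definition field_defect :: "real \<Rightarrow> real^3 \<Rightarrow> real" where
  "field_defect \<delta> w = norm w powr (-2) - norm w / (regdist \<delta> w)^3"

lemma field_defect_measurable [measurable]: "field_defect \<delta> \<in> borel_measurable borel"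
  unfolding field_defect_def[abs_def] by measurable

text \<open>The two bounds are used inside and outside the ball of radius \<open>\<delta>\<close>; both are integrable there, which
  yields an integral of order \<open>\<delta>\<close>.\<close>

lemma field_defect_bounds:
  assumes d: "\<delta> > 0"
  shows "0 \<le> field_defect \<delta> w" "field_defect \<delta> w \<le> norm w powr (-2)"
    "field_defect \<delta> w \<le> 3/2 * \<delta>^2 * norm w powr (-4)"
proof -
  have "0 \<le> field_defect \<delta> w \<and> field_defect \<delta> w \<le> norm w powr (-2)
      \<and> field_defect \<delta> w \<le> 3/2 * \<delta>^2 * norm w powr (-4)"
  proof (cases "w = 0")
    case False
    define r where "r = norm w"
    define s where "s = regdist \<delta> w"
    have r: "r > 0" "r \<le> s" "s > 0" "s^2 = r^2 + \<delta>^2"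
      using False regdist_ge regdist_pos[OF d] regdist_sq by (auto simp: r_def s_def)
    have fd: "field_defect \<delta> w = 1 / r^2 - r / s^3"
      using r by (simp add: field_defect_def r_def s_def powr_minus powr_numeral divide_simps)
    have "r / s^3 = (r / s)^3 / r^2" using r(1,3) by (simp add: field_simps power2_eq_square power3_eq_cube)
    also have "\<dots> \<le> 1 / r^2" using r by (intro divide_right_mono power_le_one) auto
    finally have "r / s^3 \<le> 1 / r^2" .
    moreover
    have "1 / r^2 - r / s^3 \<le> 3/2 * \<delta>^2 / r^4"
    proof -
      have "1 - r / s \<le> (s^2 - r^2) / (2 * r^2)"
      proof -
        have "2 * r^2 * (s - r) \<le> s * (s^2 - r^2)"
        proof -
          have "2 * r^2 * (s - r) \<le> (s * (s + r)) * (s - r)"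
          proof (rule mult_right_mono)
            have "r * r \<le> s * s" "r * r \<le> s * r" using r by (auto intro: mult_mono)
            then show "2 * r^2 \<le> s * (s + r)" by (simp add: power2_eq_square distrib_left)
          qed (use r in auto)
          then show ?thesis by (simp add: algebra_simps power2_eq_square)
        qed
        then show ?thesis using r by (simp add: divide_simps algebra_simps)
      qed
      also have "\<dots> = \<delta>^2 / (2 * r^2)" using r by simp
      finally have a: "1 - r / s \<le> \<delta>^2 / (2 * r^2)" .
      have "1 - (r/s)^3 \<le> 3 * (1 - r / s)"
      proof -
        define q where "q = r / s"
        have q: "0 \<le> q" "q \<le> 1" using r by (auto simp: q_def)
        have "1 - q^3 = (1 - q) * (1 + q + q^2)" by (simp add: algebra_simps power2_eq_square power3_eq_cube)
        also have "\<dots> \<le> (1 - q) * 3" using q power_le_one[of q 2] by (intro mult_left_mono) auto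
        finally show ?thesis by (simp only: q_def mult.commute)
      qed
      then have b: "1 - (r/s)^3 \<le> 3 * \<delta>^2 / (2 * r^2)" using a by simp
      have "1 / r^2 - r / s^3 = (1 - (r/s)^3) / r^2"
        using r by (simp add: field_simps power2_eq_square power3_eq_cube)
      also have "\<dots> \<le> (3 * \<delta>^2 / (2 * r^2)) / r^2" using b by (intro divide_right_mono) auto
      finally show ?thesis by (simp add: field_simps flip: power_add)
    qed
    moreover have "norm w powr (-2) = 1 / r^2" "norm w powr (-4) = 1 / r^4"
      using r by (auto simp: r_def powr_minus powr_numeral divide_simps)
    ultimately show ?thesis unfolding fd using r by simp
  qed (simp add: field_defect_def)
  then show "0 \<le> field_defect \<delta> w" "field_defect \<delta> w \<le> norm w powr (-2)"
    "field_defect \<delta> w \<le> 3/2 * \<delta>^2 * norm w powr (-4)" by auto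
qed

lemma nn_integral_field_defect:
  assumes d: "\<delta> > 0"
  shows "(\<integral>\<^sup>+w. ennreal (field_defect \<delta> w) \<partial>lborel) \<le> ennreal (10 * pi * \<delta>)"
proof -
  have "(\<integral>\<^sup>+w. ennreal (field_defect \<delta> w) \<partial>lborel)
     \<le> (\<integral>\<^sup>+w. ennreal (norm (w::real^3) powr (-2)) * indicator {0..\<delta>} (norm w)
          + ennreal (3/2 * \<delta>^2) * (ennreal (norm w powr (-4)) * indicator {\<delta>..} (norm w)) \<partial>lborel)"
  proof (rule nn_integral_mono)
    fix w :: "real^3"
    show "ennreal (field_defect \<delta> w) \<le> ennreal (norm w powr (-2)) * indicator {0..\<delta>} (norm w)
          + ennreal (3/2 * \<delta>^2) * (ennreal (norm w powr (-4)) * indicator {\<delta>..} (norm w))"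
      using field_defect_bounds[OF d, of w]
      by (cases "norm w \<le> \<delta>") (auto simp: ennreal_leI add_increasing2 simp flip: ennreal_mult')
  qed
  also have "\<dots> = ennreal (4 * pi * \<delta> powr (3 - 2) / (3 - 2)) + ennreal (3/2 * \<delta>^2) * ennreal (4 * pi * \<delta> powr (3 - 4) / (4 - 3))"
    using nn_integral_power_inside[of 2 \<delta>] nn_integral_power_outside[of 4 \<delta>] d
    by (subst nn_integral_add) (simp_all add: nn_integral_cmult)
  also have "\<dots> = ennreal (10 * pi * \<delta>)"
    using d by (simp add: powr_minus field_simps power2_eq_square flip: ennreal_mult' ennreal_plus)
  finally show ?thesis .
qed

section \<open>Regularized kernels as test functions\<close>

lemma square_integrableD:
  assumes "square_integrable f"
  shows "f \<in> borel_measurable borel" "integrable lborel (\<lambda>x. (norm (f x))\<^sup>2)"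
  using assms by (auto simp: square_integrable_def)

lemma square_integrable_mult:
  fixes f g :: "real^3 \<Rightarrow> real"
  assumes "square_integrable f" "square_integrable g"
  shows "integrable lborel (\<lambda>x. f x * g x)"
  using assms by (intro integrable_mult_L2) (auto simp: square_integrable_def)

lemma square_integrable_bound:
  fixes f :: "real^3 \<Rightarrow> 'a::euclidean_space" and g :: "real^3 \<Rightarrow> 'b::euclidean_space"
  assumes g: "square_integrable g" and [measurable]: "f \<in> borel_measurable borel"
    and b: "\<And>x. norm (f x) \<le> norm (g x)"
  shows "square_integrable f"
  unfolding square_integrable_def
proof
  have [measurable]: "g \<in> borel_measurable borel" using g by (rule square_integrableD)
  show "integrable lborel (\<lambda>x. (norm (f x))\<^sup>2)"
    by (rule Bochner_Integration.integrable_bound[OF square_integrableD(2)[OF g]])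
       (use b in \<open>auto intro!: AE_I2 power_mono\<close>)
qed simp

lemma square_integrable_component:
  assumes "square_integrable (g :: real^3 \<Rightarrow> real^3)"
  shows "square_integrable (\<lambda>x. g x $ i)"
proof (rule square_integrable_bound[OF assms])
  have [measurable]: "g \<in> borel_measurable borel" using assms by (rule square_integrableD)
  show "(\<lambda>x. g x $ i) \<in> borel_measurable borel"
    by (rule borel_measurable_continuous_on[OF _ \<open>g \<in> borel_measurable borel\<close>, of "\<lambda>v. v $ i"])
       (intro continuous_intros)
qed (simp add: component_le_norm_cart)

lemma square_integrable_norm:
  "square_integrable g \<Longrightarrow> square_integrable (\<lambda>x. norm (g x))"
  by (auto simp: square_integrable_def intro: borel_measurable_norm)

lemma test_function_square_integrable':
  "test_function f \<Longrightarrow> square_integrable f"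
  using test_function_square_integrable test_function_measurable by (auto simp: square_integrable_def)

text \<open>The gradient of the test function is \<open>2 \<Phi>1 (y - x)\<close>, and the divergence of this field is the factor of
  \<open>u\<close> on the left. The identity is the sum of the definitions of the weak partial derivatives, with the
  components of the field as test functions.\<close>

lemma weak_gradient_radial_test:
  fixes u :: "real^3 \<Rightarrow> real" and g :: "real^3 \<Rightarrow> real^3" and \<Phi> \<Phi>1 \<Phi>2 :: "real \<Rightarrow> real"
  assumes u: "square_integrable u" and g: "square_integrable g" and wg: "has_weak_gradient u g"
    and test: "test_function (\<lambda>y. \<Phi> ((norm (y - x))^2))"
    and d1: "\<And>t. t \<ge> 0 \<Longrightarrow> (\<Phi> has_real_derivative \<Phi>1 t) (at t)"
    and d2: "\<And>t. t \<ge> 0 \<Longrightarrow> (\<Phi>1 has_real_derivative \<Phi>2 t) (at t)"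
  shows "(LBINT y. u y * (4 * \<Phi>2 ((norm (y - x))^2) * (norm (y - x))^2 + 6 * \<Phi>1 ((norm (y - x))^2)))
    = - (LBINT y. inner (g y) (y - x) * (2 * \<Phi>1 ((norm (y - x))^2)))"
proof -
  let ?q = "\<lambda>y. (norm (y - x))^2"
  let ?f = "\<lambda>y. \<Phi> (?q y)"
  let ?fi = "\<lambda>i y. 2 * \<Phi>1 (?q y) * (y $ i - x $ i)"
  have hq: "(?q has_derivative (\<lambda>h. 2 * inner (y - x) h)) (at y)" for y
    unfolding power2_norm_eq_inner by (auto intro!: derivative_eq_intros simp: inner_commute)
  have hf: "(?f has_derivative (\<lambda>h. \<Phi>1 (?q y) * (2 * inner (y - x) h))) (at y)" for y
    using has_derivative_compose[OF hq d1[of "?q y", unfolded has_field_derivative_def]] by simp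
  have p1: "pderiv i ?f = ?fi i" for i
    by (rule ext, subst pderiv_eq[OF hf]) (simp add: inner_axis)
  have h1: "((\<lambda>y. \<Phi>1 (?q y)) has_derivative (\<lambda>h. \<Phi>2 (?q y) * (2 * inner (y - x) h))) (at y)" for y
    using has_derivative_compose[OF hq d2[of "?q y", unfolded has_field_derivative_def]] by simp
  have hi: "((\<lambda>y. y $ i - x $ i) has_derivative (\<lambda>h. h $ i)) (at y)" for y i
    using has_derivative_diff[OF bounded_linear_imp_has_derivative[OF bounded_linear_vec_nth] has_derivative_const]
    by force
  have hfi: "(?fi i has_derivative (\<lambda>h. 2 * (\<Phi>1 (?q y) * h $ i + \<Phi>2 (?q y) * (2 * inner (y - x) h) * (y $ i - x $ i)))) (at y)" for i y
    using has_derivative_mult_right[OF has_derivative_mult[OF h1 hi], of 2] by (simp add: mult.assoc)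
  have p2: "pderiv i (?fi i) y = 2 * \<Phi>1 (?q y) + 4 * \<Phi>2 (?q y) * (y $ i - x $ i)^2" for i y
    by (subst pderiv_eq[OF hfi]) (simp add: inner_axis power2_eq_square algebra_simps)
  have t1: "test_function (?fi i)" for i using test_function_pderiv[OF test, of i] by (simp only: p1)
  have t2: "test_function (pderiv i (?fi i))" for i by (rule test_function_pderiv[OF t1])
  have qs: "?q y = (\<Sum>i\<in>UNIV. (y $ i - x $ i)^2)" for y
    unfolding power2_norm_eq_inner by (simp add: inner_vec_def power2_eq_square)
  have "(LBINT y. u y * (4 * \<Phi>2 (?q y) * ?q y + 6 * \<Phi>1 (?q y)))
     = (\<integral>y. (\<Sum>i\<in>UNIV. u y * pderiv i (?fi i) y) \<partial>lborel)"
  proof (rule Bochner_Integration.integral_cong[OF refl])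
    fix y
    have "(\<Sum>i\<in>UNIV. u y * pderiv i (?fi i) y)
      = (\<Sum>i\<in>(UNIV::3 set). u y * (2 * \<Phi>1 (?q y)) + u y * (4 * \<Phi>2 (?q y)) * (y $ i - x $ i)^2)"
      unfolding p2 by (simp add: algebra_simps)
    also have "\<dots> = u y * (6 * \<Phi>1 (?q y)) + u y * (4 * \<Phi>2 (?q y)) * ?q y"
      unfolding qs by (simp add: sum.distrib flip: sum_distrib_left)
    finally show "u y * (4 * \<Phi>2 (?q y) * ?q y + 6 * \<Phi>1 (?q y)) = (\<Sum>i\<in>UNIV. u y * pderiv i (?fi i) y)"
      by (simp add: algebra_simps)
  qed
  also have "\<dots> = (\<Sum>i\<in>UNIV. \<integral>y. u y * pderiv i (?fi i) y \<partial>lborel)"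
    by (intro Bochner_Integration.integral_sum square_integrable_mult u test_function_square_integrable' t2)
  also have "\<dots> = (\<Sum>i\<in>UNIV. - (LBINT y. g y $ i * ?fi i y))"
    using wg t1 unfolding has_weak_gradient_def by (intro sum.cong refl) blast
  also have "\<dots> = - (\<integral>y. (\<Sum>i\<in>UNIV. g y $ i * ?fi i y) \<partial>lborel)"
    using square_integrable_mult[OF square_integrable_component[OF g] test_function_square_integrable'[OF t1]]
    by (subst Bochner_Integration.integral_sum) (auto simp: sum_negf)
  also have "(\<lambda>y. \<Sum>i\<in>UNIV. g y $ i * ?fi i y) = (\<lambda>y. inner (g y) (y - x) * (2 * \<Phi>1 (?q y)))"
    
  proof
    fix y
    have "(\<Sum>i\<in>UNIV. g y $ i * ?fi i y) = (\<Sum>i\<in>UNIV. g y $ i * (y $ i - x $ i) * (2 * \<Phi>1 (?q y)))"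
      by (intro sum.cong refl) simp
    then show "(\<Sum>i\<in>UNIV. g y $ i * ?fi i y) = inner (g y) (y - x) * (2 * \<Phi>1 (?q y))"
      unfolding sum_distrib_right[symmetric] by (simp add: inner_vec_def)
  qed
  finally show ?thesis .
qed

text \<open>On \<open>t \<le> 1\<close> the derivative is continuous and vanishes for negative arguments.\<close>

lemma flat_deriv_bounded: obtains B where "B > 0" "\<And>t. t \<le> 1 \<Longrightarrow> \<bar>flat_deriv k t\<bar> \<le> B"
proof -
  have "compact (flat_deriv k ` {0..1})"
    using DERIV_isCont[OF flat_deriv_has_derivative]
    by (intro compact_continuous_image continuous_at_imp_continuous_on) auto
  from compact_imp_bounded[OF this] obtain B where B: "B > 0" "\<And>t. t \<in> {0..1} \<Longrightarrow> norm (flat_deriv k t) \<le> B"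
    unfolding bounded_pos by auto
  have "\<bar>flat_deriv k t\<bar> \<le> B" if "t \<le> 1" for t
    using B that by (cases "t \<ge> 0") (auto simp: flat_deriv_def)
  with B(1) that show ?thesis by blast
qed

text \<open>The Newtonian kernel, regularized at the origin and cut off at distance \<open>R\<close>, as a function
  of the squared distance, with its first two derivatives.\<close>

definition cutoff_kernel :: "real \<Rightarrow> real \<Rightarrow> real \<Rightarrow> real" where
  "cutoff_kernel \<delta> R t = exp 1 * (flat_deriv 0 (1 - t * inverse R^2) * inverse (sqrt (t + \<delta>^2)))"

definition cutoff_kernel1 :: "real \<Rightarrow> real \<Rightarrow> real \<Rightarrow> real" where
  "cutoff_kernel1 \<delta> R t = exp 1 * (- 1/2 * (flat_deriv 0 (1 - t * inverse R^2) * inverse (sqrt (t + \<delta>^2))^3)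
      - flat_deriv 1 (1 - t * inverse R^2) * inverse R^2 * inverse (sqrt (t + \<delta>^2)))"

definition cutoff_kernel2 :: "real \<Rightarrow> real \<Rightarrow> real \<Rightarrow> real" where
  "cutoff_kernel2 \<delta> R t = exp 1 * (3/4 * (flat_deriv 0 (1 - t * inverse R^2) * inverse (sqrt (t + \<delta>^2))^5)
      + flat_deriv 1 (1 - t * inverse R^2) * inverse R^2 * inverse (sqrt (t + \<delta>^2))^3
      + flat_deriv 2 (1 - t * inverse R^2) * inverse R^4 * inverse (sqrt (t + \<delta>^2)))"

lemma cutoff_kernel_derivs:
  assumes d: "\<delta> > 0" and t: "t \<ge> 0"
  shows "(cutoff_kernel \<delta> R has_real_derivative cutoff_kernel1 \<delta> R t) (at t)"
    "(cutoff_kernel1 \<delta> R has_real_derivative cutoff_kernel2 \<delta> R t) (at t)"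
proof -
  define i where "i = inverse (sqrt (t + \<delta>^2))"
  have p: "t + \<delta>^2 > 0" using t d by (simp add: add_nonneg_pos)
  have df: "((\<lambda>t. flat_deriv k (1 - t * inverse R^2)) has_real_derivative
      - flat_deriv (Suc k) (1 - t * inverse R^2) * inverse R^2) (at t)" for k
  proof -
    have "((\<lambda>t. 1 - t * inverse R^2) has_real_derivative 0 - 1 * inverse R^2) (at t)"
      by (intro DERIV_diff DERIV_const DERIV_cmult_right DERIV_ident)
    from DERIV_chain2[OF flat_deriv_has_derivative this] show ?thesis by simp
  qed
  have di: "((\<lambda>t. inverse (sqrt (t + \<delta>^2))) has_real_derivative - 1/2 * i^3) (at t)"
  proof -
    have "((\<lambda>t. sqrt (t + \<delta>^2)) has_real_derivative inverse (sqrt (t + \<delta>^2)) / 2 * (1 + 0)) (at t)"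
      by (rule DERIV_chain2[where f=sqrt and g="\<lambda>t. t + \<delta>^2", OF DERIV_real_sqrt[OF p]]) (intro DERIV_add DERIV_ident DERIV_const)
    from DERIV_inverse'[OF this] p show ?thesis by (simp add: i_def power3_eq_cube)
  qed
  have di3: "((\<lambda>t. inverse (sqrt (t + \<delta>^2))^3) has_real_derivative - 3/2 * i^5) (at t)"
    by (rule DERIV_cong[OF DERIV_power[OF di, of 3]]) (simp add: i_def numeral_eq_Suc mult_ac)
  have n: "Suc 1 = 2" "Suc 0 = 1" by auto
  have "(cutoff_kernel \<delta> R has_real_derivative exp 1 *
      (- flat_deriv (Suc 0) (1 - t * inverse R^2) * inverse R^2 * i + (- 1/2 * i^3) * flat_deriv 0 (1 - t * inverse R^2))) (at t)"
    unfolding cutoff_kernel_def[abs_def] i_def by (intro DERIV_cmult DERIV_mult df di[unfolded i_def])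
  then show "(cutoff_kernel \<delta> R has_real_derivative cutoff_kernel1 \<delta> R t) (at t)"
    by (rule DERIV_cong) (simp add: cutoff_kernel1_def i_def algebra_simps)
  have "(cutoff_kernel1 \<delta> R has_real_derivative exp 1 *
      (- 1/2 * (- flat_deriv (Suc 0) (1 - t * inverse R^2) * inverse R^2 * i^3 + (- 3/2 * i^5) * flat_deriv 0 (1 - t * inverse R^2))
       - (- flat_deriv (Suc 1) (1 - t * inverse R^2) * inverse R^2 * inverse R^2 * i
         + (- 1/2 * i^3) * (flat_deriv 1 (1 - t * inverse R^2) * inverse R^2)))) (at t)"
    unfolding cutoff_kernel1_def[abs_def] i_def
    by (intro DERIV_cmult DERIV_mult DERIV_diff DERIV_cmult_right df di[unfolded i_def] di3[unfolded i_def])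
  then show "(cutoff_kernel1 \<delta> R has_real_derivative cutoff_kernel2 \<delta> R t) (at t)"
    unfolding n
    by (rule DERIV_cong)
       (simp add: cutoff_kernel2_def i_def algebra_simps power2_eq_square power4_eq_xxxx)
qed

text \<open>The first expression is the Laplacian of the kernel and the second the length of its gradient. The
  bounds do not depend on the radius \<open>R\<close> of the cutoff and are square integrable in space, so they
  dominate the passage to the limit \<open>R \<rightarrow> \<infinity>\<close>.\<close>

lemma cutoff_kernel_bounds:
  assumes d: "0 < \<delta>" "\<delta> \<le> 1"
  obtains K where "K > 0"
    "\<And>R t. R \<ge> 1 \<Longrightarrow> t \<ge> 0 \<Longrightarrow> \<bar>4 * cutoff_kernel2 \<delta> R t * t + 6 * cutoff_kernel1 \<delta> R t\<bar> \<le> K / (1 + t)"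
    "\<And>R t. R \<ge> 1 \<Longrightarrow> t \<ge> 0 \<Longrightarrow> \<bar>2 * cutoff_kernel1 \<delta> R t\<bar> * sqrt t \<le> K / (1 + t)"
proof -
  obtain B0 B1 B2 where B': "B0 > 0" "B1 > 0" "B2 > 0" "\<And>t. t \<le> 1 \<Longrightarrow> \<bar>flat_deriv 0 t\<bar> \<le> B0"
    "\<And>t. t \<le> 1 \<Longrightarrow> \<bar>flat_deriv 1 t\<bar> \<le> B1" "\<And>t. t \<le> 1 \<Longrightarrow> \<bar>flat_deriv 2 t\<bar> \<le> B2"
    using flat_deriv_bounded[of 0] flat_deriv_bounded[of 1] flat_deriv_bounded[of 2] by metis
  define B where "B = B0 + B1 + B2"
  have B: "B > 0" "\<And>t. t \<le> 1 \<Longrightarrow> \<bar>flat_deriv 0 t\<bar> \<le> B" "\<And>t. t \<le> 1 \<Longrightarrow> \<bar>flat_deriv 1 t\<bar> \<le> B"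
    "\<And>t. t \<le> 1 \<Longrightarrow> \<bar>flat_deriv 2 t\<bar> \<le> B"
    using B'(1-3) B'(4-6)[THEN order_trans] unfolding B_def by auto
  define K where "K = exp 1 * B / \<delta>^3"
  have K: "K > 0" using B d by (simp add: K_def)
  have main: "\<bar>cutoff_kernel1 \<delta> R t\<bar> \<le> 5/2 * K / (1 + t) \<and> \<bar>cutoff_kernel1 \<delta> R t\<bar> * sqrt t \<le> 5/2 * K / (1 + t)
      \<and> \<bar>cutoff_kernel2 \<delta> R t\<bar> * t \<le> 5 * K / (1 + t)" if R: "R \<ge> 1" and t: "t \<ge> 0" for R t
  proof (cases "t \<ge> R^2")
    case True
    then have "1 - t * inverse R^2 \<le> 0" using R by (simp add: field_simps)
    then have "flat_deriv k (1 - t * inverse R^2) = 0" for k by (simp add: flat_deriv_def)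
    then show ?thesis using K t by (simp add: cutoff_kernel1_def cutoff_kernel2_def)
  next
    case False
    define i where "i = inverse (sqrt (t + \<delta>^2))"
    define l where "l = inverse R^2"
    define m where "m = inverse (\<delta>^2 * (1 + t))"
    have "1 - t * l \<le> 1" using t by (simp add: l_def)
    note F = B(2)[OF this] B(3)[OF this] B(4)[OF this]
    have p: "t + \<delta>^2 > 0" using t d by (simp add: add_nonneg_pos)
    have i2: "i^2 = inverse (t + \<delta>^2)" using p by (simp add: i_def power_inverse)
    have i0: "i > 0" using p by (simp add: i_def)
    have l0: "l > 0" using R by (simp add: l_def)
    have l2: "l * l = inverse R^4" by (simp add: l_def flip: power_add)
    have m0: "m > 0" using d t by (simp add: m_def)
    have d2: "\<delta>^2 \<le> 1" using d by (simp add: power_le_one)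
    have D: "0 < \<delta>^2 * (1 + t)" using d t by simp
    have d2t: "\<delta>^2 * t \<le> t" using d2 t by (simp add: mult_left_le_one_le)
    have "\<delta>^2 * (1 + t) \<le> t + \<delta>^2" using d2t by (simp add: algebra_simps)
    then have im: "i^2 \<le> m" unfolding m_def i2 using D by (rule le_imp_inverse_le)
    have "1 \<le> R^2" using R by simp
    then have "\<delta>^2 * (1 + t) \<le> 2 * R^2" using False d2t d2 by (simp add: distrib_left)
    then have "inverse (2 * R^2) \<le> m" unfolding m_def using D by (rule le_imp_inverse_le)
    then have lm: "l \<le> 2 * m" by (simp add: l_def power_inverse)
    have tl: "t * l \<le> 1" "0 \<le> t * l" using False R t by (simp_all add: l_def field_simps)
    have ti: "t * i^2 \<le> 1" "0 \<le> t * i^2" using p t by (simp_all add: i2 field_simps)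
    have sti: "sqrt t * i \<le> 1"
    proof -
      have "sqrt t \<le> sqrt (t + \<delta>^2)" by simp
      then show ?thesis using p by (simp add: i_def field_simps)
    qed
    have id: "i \<le> inverse \<delta>"
    proof -
      have "\<delta> \<le> sqrt (t + \<delta>^2)" using t by (intro real_le_rsqrt) simp
      then show ?thesis unfolding i_def using d(1) by (rule le_imp_inverse_le)
    qed
    have Bs: "\<bar>a\<bar> \<le> B \<Longrightarrow> 0 \<le> b \<Longrightarrow> b \<le> c \<Longrightarrow> \<bar>a * b\<bar> \<le> B * c" for a b c :: real
      using B(1) by (auto simp: abs_mult intro!: mult_mono)
    have mi: "x * i \<le> y * i" if "x \<le> y" for x y using that i0 by simp
    have tri3: "\<bar>e * (x + y + z)\<bar> \<le> e * (X + Y + Z)" if "\<bar>x\<bar> \<le> X" "\<bar>y\<bar> \<le> Y" "\<bar>z\<bar> \<le> Z" "0 \<le> e" for e x y z X Y Z :: real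
      using that by (auto simp: abs_mult intro!: mult_left_mono)
    have k1: "\<bar>cutoff_kernel1 \<delta> R t\<bar> \<le> exp 1 * (B * (1/2 * (m * i)) + B * (2 * m * i) + 0)"
    proof -
      have "cutoff_kernel1 \<delta> R t = exp 1 * (- (flat_deriv 0 (1 - t * l) * (1/2 * (i^2 * i)))
         + (- (flat_deriv 1 (1 - t * l) * (l * i))) + 0)"
        unfolding cutoff_kernel1_def i_def[symmetric] l_def[symmetric] by (simp add: power2_eq_square power3_eq_cube)
      moreover have "\<bar>flat_deriv 0 (1 - t * l) * (1/2 * (i^2 * i))\<bar> \<le> B * (1/2 * (m * i))"
        using i0 im by (intro Bs F mult_left_mono mi) auto
      moreover have "\<bar>flat_deriv 1 (1 - t * l) * (l * i)\<bar> \<le> B * (2 * m * i)"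
        using i0 lm l0 by (intro Bs F mi) auto
      ultimately show ?thesis using tri3 by (metis abs_minus_cancel abs_zero exp_ge_zero order_refl)
    qed
    have k2: "\<bar>cutoff_kernel2 \<delta> R t * t\<bar> \<le> exp 1 * (B * (3/4 * (1 * m * i)) + B * (1 * (2 * m) * i) + B * (1 * (2 * m) * i))"
    proof -
      have "cutoff_kernel2 \<delta> R t * t = exp 1 * (flat_deriv 0 (1 - t * l) * (3/4 * ((t * i^2) * i^2 * i))
         + flat_deriv 1 (1 - t * l) * ((t * i^2) * l * i)
         + flat_deriv 2 (1 - t * l) * ((t * l) * l * i))"
        unfolding cutoff_kernel2_def i_def[symmetric] l_def[symmetric] l2[symmetric]
        by (simp add: algebra_simps numeral_eq_Suc)
      moreover have "\<bar>flat_deriv 0 (1 - t * l) * (3/4 * ((t * i^2) * i^2 * i))\<bar> \<le> B * (3/4 * (1 * m * i))"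
        using i0 im ti m0 by (intro Bs F mult_left_mono mi mult_mono) auto
      moreover have "\<bar>flat_deriv 1 (1 - t * l) * ((t * i^2) * l * i)\<bar> \<le> B * (1 * (2 * m) * i)"
        using i0 lm ti l0 by (intro Bs F mi mult_mono) auto
      moreover have "\<bar>flat_deriv 2 (1 - t * l) * ((t * l) * l * i)\<bar> \<le> B * (1 * (2 * m) * i)"
        using i0 lm tl l0 by (intro Bs F mi mult_mono) auto
      ultimately show ?thesis by (simp only:) (rule tri3, auto)
    qed
    have mK: "exp 1 * B * (m * inverse \<delta>) = K / (1 + t)"
      using d t by (simp add: m_def K_def field_simps power2_eq_square power3_eq_cube)
    have mi': "exp 1 * B * (m * i) \<le> K / (1 + t)"
      unfolding mK[symmetric] using id m0 B(1) by (intro mult_left_mono) auto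
    have K1: "\<bar>cutoff_kernel1 \<delta> R t\<bar> \<le> 5/2 * (exp 1 * B * (m * i))" using k1 by (simp add: algebra_simps)
    have e: "5/2 * K / (1 + t) = 5/2 * (K / (1 + t))" "5 * K / (1 + t) = 5 * (K / (1 + t))" by simp_all
    have a: "\<bar>cutoff_kernel1 \<delta> R t\<bar> \<le> 5/2 * K / (1 + t)" unfolding e using K1 mi' by linarith
    have b: "\<bar>cutoff_kernel2 \<delta> R t\<bar> * t \<le> 5 * K / (1 + t)"
    proof -
      have "0 \<le> exp 1 * B * (m * i)" using m0 i0 B(1) by simp
      moreover have "\<bar>cutoff_kernel2 \<delta> R t\<bar> * t \<le> 19/4 * (exp 1 * B * (m * i))"
        using k2 t by (simp add: abs_mult algebra_simps)
      ultimately show ?thesis unfolding e using mi' by linarith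
    qed
    have "\<bar>cutoff_kernel1 \<delta> R t\<bar> * sqrt t \<le> 5/2 * (exp 1 * B * (m * i)) * sqrt t"
      using K1 t by (intro mult_right_mono) auto
    also have "\<dots> = 5/2 * (exp 1 * B) * m * (sqrt t * i)" by simp
    also have "\<dots> \<le> 5/2 * (exp 1 * B) * m * 1"
      using sti m0 B(1) by (intro mult_left_mono) auto
    also have "\<dots> \<le> 5/2 * (exp 1 * B * (m * inverse \<delta>))"
    proof -
      have "m * 1 \<le> m * inverse \<delta>" using d m0 by (intro mult_left_mono) (auto simp: one_le_inverse)
      then have "5/2 * (exp 1 * B) * (m * 1) \<le> 5/2 * (exp 1 * B) * (m * inverse \<delta>)"
        by (rule mult_left_mono) (use B(1) in simp)
      then show ?thesis by (simp only: mult.assoc)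
    qed
    finally have "\<bar>cutoff_kernel1 \<delta> R t\<bar> * sqrt t \<le> 5/2 * K / (1 + t)" unfolding e mK .
    with a b show ?thesis by blast
  qed
  show ?thesis
  proof
    show "35 * K > 0" using K by simp
    fix R t :: real assume R: "R \<ge> 1" and t: "t \<ge> 0"
    from main[OF this] have m: "\<bar>cutoff_kernel1 \<delta> R t\<bar> \<le> 5/2 * K / (1 + t)" "\<bar>cutoff_kernel1 \<delta> R t\<bar> * sqrt t \<le> 5/2 * K / (1 + t)"
      "\<bar>cutoff_kernel2 \<delta> R t\<bar> * t \<le> 5 * K / (1 + t)" by auto
    have "\<bar>4 * cutoff_kernel2 \<delta> R t * t + 6 * cutoff_kernel1 \<delta> R t\<bar>
       \<le> 4 * (\<bar>cutoff_kernel2 \<delta> R t\<bar> * t) + 6 * \<bar>cutoff_kernel1 \<delta> R t\<bar>"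
      using t by (intro order_trans[OF abs_triangle_ineq]) (simp add: abs_mult)
    also have "\<dots> \<le> 35 * K / (1 + t)"
    proof -
      have e: "5/2 * K / (1 + t) = 5/2 * (K / (1 + t))" "5 * K / (1 + t) = 5 * (K / (1 + t))"
        "35 * K / (1 + t) = 35 * (K / (1 + t))" by simp_all
      show ?thesis using m unfolding e by linarith
    qed
    finally show "\<bar>4 * cutoff_kernel2 \<delta> R t * t + 6 * cutoff_kernel1 \<delta> R t\<bar> \<le> 35 * K / (1 + t)" .
    have "\<bar>2 * cutoff_kernel1 \<delta> R t\<bar> * sqrt t = 2 * (\<bar>cutoff_kernel1 \<delta> R t\<bar> * sqrt t)" by (simp add: abs_mult)
    also have "\<dots> \<le> 2 * (5/2 * K / (1 + t))" using m by (intro mult_left_mono) auto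
    also have "\<dots> = 5 * K / (1 + t)" by (simp only: times_divide_eq_right)
    also have "\<dots> \<le> 35 * K / (1 + t)" using K t by (intro divide_right_mono) auto
    finally show "\<bar>2 * cutoff_kernel1 \<delta> R t\<bar> * sqrt t \<le> 35 * K / (1 + t)" .
  qed
qed

lemma test_function_cutoff_kernel:
  assumes d: "\<delta> > 0" and R: "R > 0"
  shows "test_function (\<lambda>y. cutoff_kernel \<delta> R ((norm (y - x))^2))"
proof (rule test_functionI)
  have q: "smooth (\<lambda>y. (norm (y - x))^2)"
  proof -
    have e: "(norm (y - x))^2 = (\<Sum>i\<in>UNIV. (y $ i + (- x $ i)) * (y $ i + (- x $ i)))" for y
      unfolding power2_norm_eq_inner by (simp add: inner_vec_def)
    show ?thesis unfolding e
      by (intro smooth_sum smooth_mult smooth_add smooth_component smooth_const)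
  qed
  define D where "D k t = (\<Prod>j<k. - (1/2) - real j) * (t + \<delta>^2) powr (- (1/2) - real k)" for k :: nat and t :: real
  have "smooth (\<lambda>y. D 0 ((norm (y - x))^2))"
  proof (rule smooth_compose[OF q])
    fix k y
    have "(norm (y - x))^2 + \<delta>^2 > 0" using d by (simp add: add_nonneg_pos)
    then show "(D k has_real_derivative D (Suc k) ((norm (y - x))^2)) (at ((norm (y - x))^2))"
      unfolding D_def by (auto intro!: derivative_eq_intros simp: algebra_simps)
  qed
  moreover have "D 0 t = inverse (sqrt (t + \<delta>^2))" if "t \<ge> 0" for t
    using that by (simp add: D_def powr_minus powr_half_sqrt)
  ultimately have k: "smooth (\<lambda>y. inverse (sqrt ((norm (y - x))^2 + \<delta>^2)))" by simp
  have "smooth (\<lambda>y. flat (1 + (- (inverse R^2)) * (norm (y - x))^2))"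
    by (intro smooth_flat smooth_add smooth_mult smooth_const q)
  then have c: "smooth (\<lambda>y. flat_deriv 0 (1 - (norm (y - x))^2 * inverse R^2))"
    by (simp add: flat_deriv_0 mult.commute)
  show "smooth (\<lambda>y. cutoff_kernel \<delta> R ((norm (y - x))^2))"
    unfolding cutoff_kernel_def by (intro smooth_mult k c smooth_const)
  have "y \<in> cball x R" if "cutoff_kernel \<delta> R ((norm (y - x))^2) \<noteq> 0" for y
  proof -
    have "1 - (norm (y - x))^2 * inverse R^2 > 0" using that by (auto simp: cutoff_kernel_def flat_deriv_def split: if_splits)
    then have "(norm (y - x))^2 < R^2" using R by (simp add: field_simps)
    then have "norm (y - x) \<le> R" using R power2_less_imp_less[of "norm (y - x)" R] by simp
    then show ?thesis by (simp add: dist_norm norm_minus_commute)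
  qed
  then show "bounded {y. cutoff_kernel \<delta> R ((norm (y - x))^2) \<noteq> 0}"
    by (blast intro: bounded_subset[OF bounded_cball])
qed

lemma abs_mult_le_weighted:
  fixes a b t :: real
  assumes t: "t > 0" shows "\<bar>a * b\<bar> \<le> t * a^2 + inverse t * b^2"
proof -
  have "2 * (t * \<bar>a\<bar>) * \<bar>b\<bar> \<le> (t * \<bar>a\<bar>)^2 + \<bar>b\<bar>^2" by (rule sum_squares_bound)
  moreover have "t * (t * a^2 + inverse t * b^2) = (t * \<bar>a\<bar>)^2 + \<bar>b\<bar>^2"
  proof -
    have "t * (inverse t * b^2) = b^2" using t by simp
    then show ?thesis by (simp add: distrib_left power_mult_distrib power2_eq_square[of t] mult.assoc)
  qed
  ultimately have "t * (2 * \<bar>a * b\<bar>) \<le> t * (t * a^2 + inverse t * b^2)"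
    by (simp add: abs_mult mult_ac)
  then have "2 * \<bar>a * b\<bar> \<le> t * a^2 + inverse t * b^2" using t by simp
  then show ?thesis using abs_ge_zero[of "a * b"] by linarith
qed

lemma square_integrable_bracket: "square_integrable (\<lambda>y. K / (1 + (norm (y - x :: real^3))^2))"
proof -
  have "integrable lborel (\<lambda>y. K^2 * (1 / (1 + (norm (y - x :: real^3))^2)^2))"
    by (intro integrable_mult_right integrable_shift(1)[OF integrable_bracket])
  then show ?thesis by (simp add: square_integrable_def power_divide)
qed

lemma flat_deriv_cutoff_tendsto:
  "(\<lambda>n. flat_deriv k (1 - t * inverse (real (Suc n))^2)) \<longlonglongrightarrow> flat_deriv k 1"
proof -
  have "(\<lambda>n. 1 - t * inverse (real (Suc n))^2) \<longlonglongrightarrow> 1 - t * 0^2"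
    by (intro tendsto_intros LIMSEQ_inverse_real_of_nat)
  then have "(\<lambda>n. 1 - t * inverse (real (Suc n))^2) \<longlonglongrightarrow> 1" by simp
  then show ?thesis
    by (rule isCont_tendsto_compose[OF DERIV_isCont[OF flat_deriv_has_derivative]])
qed

lemma cutoff_kernel_tendsto:
  "(\<lambda>n. cutoff_kernel1 \<delta> (real (Suc n)) t) \<longlonglongrightarrow> - 1/2 * inverse (sqrt (t + \<delta>^2))^3"
  "(\<lambda>n. cutoff_kernel2 \<delta> (real (Suc n)) t) \<longlonglongrightarrow> 3/4 * inverse (sqrt (t + \<delta>^2))^5"
proof -
  have e: "exp (1::real) * (inverse (exp 1) * X) = X" "exp (1::real) * (3 * (inverse (exp 1) * X)) = 3 * X" for X
    by (simp_all add: field_simps)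
  have "(\<lambda>n. cutoff_kernel1 \<delta> (real (Suc n)) t) \<longlonglongrightarrow>
    exp 1 * (- 1/2 * (flat_deriv 0 1 * inverse (sqrt (t + \<delta>^2))^3) - flat_deriv 1 1 * 0^2 * inverse (sqrt (t + \<delta>^2)))"
    unfolding cutoff_kernel1_def
    by (intro tendsto_mult tendsto_add tendsto_diff tendsto_power tendsto_const flat_deriv_cutoff_tendsto LIMSEQ_inverse_real_of_nat)
  then show "(\<lambda>n. cutoff_kernel1 \<delta> (real (Suc n)) t) \<longlonglongrightarrow> - 1/2 * inverse (sqrt (t + \<delta>^2))^3"
    by (simp add: flat_deriv_def exp_minus e)
  have "(\<lambda>n. cutoff_kernel2 \<delta> (real (Suc n)) t) \<longlonglongrightarrow>
    exp 1 * (3/4 * (flat_deriv 0 1 * inverse (sqrt (t + \<delta>^2))^5) + flat_deriv 1 1 * 0^2 * inverse (sqrt (t + \<delta>^2))^3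
      + flat_deriv 2 1 * 0^4 * inverse (sqrt (t + \<delta>^2)))"
    unfolding cutoff_kernel2_def
    by (intro tendsto_mult tendsto_add tendsto_diff tendsto_power tendsto_const flat_deriv_cutoff_tendsto LIMSEQ_inverse_real_of_nat)
  then show "(\<lambda>n. cutoff_kernel2 \<delta> (real (Suc n)) t) \<longlonglongrightarrow> 3/4 * inverse (sqrt (t + \<delta>^2))^5"
    by (simp add: flat_deriv_def exp_minus e)
qed

lemma flat_deriv_measurable [measurable]: "flat_deriv k \<in> borel_measurable borel"
  by (intro borel_measurable_continuous_onI continuous_at_imp_continuous_on ballI DERIV_isCont[OF flat_deriv_has_derivative])

definition mollify :: "real \<Rightarrow> (real^3 \<Rightarrow> real) \<Rightarrow> real^3 \<Rightarrow> real" where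
  "mollify \<delta> u x = (LBINT y. u y * eta \<delta> (y - x))"

text \<open>The weak gradient is tested against the cut off kernel, and the cutoff is removed by dominated
  convergence. The left hand side is the convolution with the Laplacian of the regularized kernel.\<close>

lemma regularized_representation:
  assumes d: "0 < \<delta>" "\<delta> \<le> 1" and u: "square_integrable u" and g: "square_integrable g" and wg: "has_weak_gradient u g"
  shows "mollify \<delta> u x = - (1 / (4 * pi)) * (LBINT y. inner (g y) (y - x) * inverse (regdist \<delta> (y - x))^3)"
proof -
  note [measurable] = square_integrableD(1)[OF u] square_integrableD(1)[OF g]
  define q where "q y = (norm (y - x))^2" for y
  have qm[measurable]: "q \<in> borel_measurable borel" unfolding q_def[abs_def] by measurable
  have [measurable]: "cutoff_kernel1 \<delta> R \<in> borel_measurable borel" "cutoff_kernel2 \<delta> R \<in> borel_measurable borel" for R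
    unfolding cutoff_kernel1_def[abs_def] cutoff_kernel2_def[abs_def] by measurable
  obtain K where K: "K > 0"
    "\<And>R t. R \<ge> 1 \<Longrightarrow> t \<ge> 0 \<Longrightarrow> \<bar>4 * cutoff_kernel2 \<delta> R t * t + 6 * cutoff_kernel1 \<delta> R t\<bar> \<le> K / (1 + t)"
    "\<And>R t. R \<ge> 1 \<Longrightarrow> t \<ge> 0 \<Longrightarrow> \<bar>2 * cutoff_kernel1 \<delta> R t\<bar> * sqrt t \<le> K / (1 + t)"
    using cutoff_kernel_bounds[OF d] by blast
  have q0: "q y \<ge> 0" for y by (simp add: q_def)
  let ?A = "\<lambda>n y. u y * (4 * cutoff_kernel2 \<delta> (real (Suc n)) (q y) * q y + 6 * cutoff_kernel1 \<delta> (real (Suc n)) (q y))"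
  let ?B = "\<lambda>n y. inner (g y) (y - x) * (2 * cutoff_kernel1 \<delta> (real (Suc n)) (q y))"
  have eq: "(LBINT y. ?A n y) = - (LBINT y. ?B n y)" for n
    unfolding q_def
    using d
    by (intro weak_gradient_radial_test[where \<Phi>="cutoff_kernel \<delta> (real (Suc n))"] u g wg
        test_function_cutoff_kernel cutoff_kernel_derivs) auto
  have ub: "integrable lborel (\<lambda>y. \<bar>u y\<bar> * (K / (1 + q y)))"
    using square_integrable_mult[OF square_integrable_norm[OF u] square_integrable_bracket[of K x]] by (simp add: q_def)
  have gb: "integrable lborel (\<lambda>y. norm (g y) * (K / (1 + q y)))"
    using square_integrable_mult[OF square_integrable_norm[OF g] square_integrable_bracket[of K x]] by (simp add: q_def)
  have rd: "sqrt (q y + \<delta>^2) = regdist \<delta> (y - x)" for y by (simp add: q_def regdist_def)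
  have A: "(\<lambda>n. \<integral>y. ?A n y \<partial>lborel) \<longlonglongrightarrow> (LBINT y. - (4 * pi) * (u y * eta \<delta> (y - x)))"
  proof (rule integral_dominated_convergence[OF _ _ ub])
    show "AE y in lborel. norm (?A n y) \<le> \<bar>u y\<bar> * (K / (1 + q y))" for n
      unfolding real_norm_def abs_mult[of "u _"] by (intro AE_I2 mult_left_mono K(2) q0) auto
    show "AE y in lborel. (\<lambda>n. ?A n y) \<longlonglongrightarrow> - (4 * pi) * (u y * eta \<delta> (y - x))"
    proof (rule AE_I2)
      fix y
      define i where "i = inverse (regdist \<delta> (y - x))"
      have s: "regdist \<delta> (y - x) > 0" using d by (simp add: regdist_pos)
      have "(\<lambda>n. ?A n y) \<longlonglongrightarrow> u y * (4 * (3/4 * i^5) * q y + 6 * (- 1/2 * i^3))"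
        unfolding i_def rd[symmetric] by (intro tendsto_mult tendsto_add tendsto_const cutoff_kernel_tendsto)
      also have "4 * (3/4 * i^5) * q y + 6 * (- 1/2 * i^3) = - (4 * pi) * eta \<delta> (y - x)"
      proof -
        have e: "eta \<delta> (y - x) = 3 * \<delta>^2 / (4 * pi) * i^5"
          by (simp add: eta_def i_def inverse_eq_divide power_one_over)
        have q: "q y = (regdist \<delta> (y - x))^2 - \<delta>^2" by (simp add: regdist_sq q_def)
        have i3: "i^3 = i^5 * (regdist \<delta> (y - x))^2"
        proof -
          have "i * regdist \<delta> (y - x) = 1" using s by (simp add: i_def)
          moreover have "i^5 * (regdist \<delta> (y - x))^2 = i^3 * (i * regdist \<delta> (y - x))^2"
            by (simp add: numeral_eq_Suc mult_ac)
          ultimately show ?thesis by simp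
        qed
        show ?thesis unfolding e i3 q by (simp add: algebra_simps)
      qed
      finally show "(\<lambda>n. ?A n y) \<longlonglongrightarrow> - (4 * pi) * (u y * eta \<delta> (y - x))" by (simp add: mult_ac)
    qed
  qed measurable
  have B: "(\<lambda>n. \<integral>y. ?B n y \<partial>lborel) \<longlonglongrightarrow> (LBINT y. - (inner (g y) (y - x) * inverse (regdist \<delta> (y - x))^3))"
  proof (rule integral_dominated_convergence[OF _ _ gb])
    show "AE y in lborel. norm (?B n y) \<le> norm (g y) * (K / (1 + q y))" for n
    proof (rule AE_I2)
      fix y
      have "norm (?B n y) \<le> (norm (g y) * norm (y - x)) * \<bar>2 * cutoff_kernel1 \<delta> (real (Suc n)) (q y)\<bar>"
        unfolding real_norm_def abs_mult[of "inner _ _"] by (intro mult_right_mono Cauchy_Schwarz_ineq2) auto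
      also have "\<dots> = norm (g y) * (\<bar>2 * cutoff_kernel1 \<delta> (real (Suc n)) (q y)\<bar> * sqrt (q y))"
        by (simp add: q_def)
      also have "\<dots> \<le> norm (g y) * (K / (1 + q y))"
        by (intro mult_left_mono K(3) q0) auto
      finally show "norm (?B n y) \<le> norm (g y) * (K / (1 + q y))" .
    qed
    show "AE y in lborel. (\<lambda>n. ?B n y) \<longlonglongrightarrow> - (inner (g y) (y - x) * inverse (regdist \<delta> (y - x))^3)"
    proof (rule AE_I2)
      fix y
      have "(\<lambda>n. ?B n y) \<longlonglongrightarrow> inner (g y) (y - x) * (2 * (- 1/2 * inverse (regdist \<delta> (y - x))^3))"
        unfolding rd[symmetric] by (intro tendsto_mult tendsto_const cutoff_kernel_tendsto)
      then show "(\<lambda>n. ?B n y) \<longlonglongrightarrow> - (inner (g y) (y - x) * inverse (regdist \<delta> (y - x))^3)" by simp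
    qed
  qed measurable
  have "(LBINT y. - (4 * pi) * (u y * eta \<delta> (y - x))) = - (LBINT y. - (inner (g y) (y - x) * inverse (regdist \<delta> (y - x))^3))"
    using LIMSEQ_unique[OF A tendsto_minus[OF B, unfolded eq[symmetric]]] by simp
  then have "(4 * pi) * mollify \<delta> u x = - (LBINT y. inner (g y) (y - x) * inverse (regdist \<delta> (y - x))^3)"
    by (simp add: mollify_def)
  then show ?thesis by (simp add: field_simps)
qed

lemma eta_even: "eta \<delta> (x - y) = eta \<delta> (y - x)"
  by (simp add: eta_def regdist_def norm_minus_commute)

lemma square_integrable_eta: "\<delta> > 0 \<Longrightarrow> square_integrable (\<lambda>y. eta \<delta> (y - x))"
  using integrable_shift(1)[OF integrable_eta(2), of \<delta> x] by (simp add: square_integrable_def)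

lemma nn_integral_eta_shift: "\<delta> > 0 \<Longrightarrow> (\<integral>\<^sup>+y. ennreal (eta \<delta> (y - x)) \<partial>lborel) = 1"
  using nn_integral_shift[of "\<lambda>w. ennreal (eta \<delta> w)" x] nn_integral_eta[of \<delta>] by simp

lemma mollify_measurable [measurable]:
  assumes [measurable]: "u \<in> borel_measurable borel" shows "mollify \<delta> u \<in> borel_measurable borel"
  unfolding mollify_def[abs_def] by measurable

text \<open>The bound is uniform in \<open>x\<close>, as needed to extract subsequences.\<close>

lemma mollify_bound:
  assumes d: "\<delta> > 0" and u: "square_integrable u"
  shows "\<bar>mollify \<delta> u x\<bar> \<le> (LBINT y. (u y)^2) + (LBINT w. (eta \<delta> w)^2)"
proof -
  have 1: "integrable lborel (\<lambda>y. u y * eta \<delta> (y - x))"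
    by (rule square_integrable_mult[OF u square_integrable_eta[OF d]])
  have u2: "integrable lborel (\<lambda>y. (u y)^2)" using square_integrableD(2)[OF u] by simp
  have e2: "integrable lborel (\<lambda>y. (eta \<delta> (y - x))^2)" by (rule integrable_shift(1)[OF integrable_eta(2)[OF d]])
  have b: "\<bar>a * b\<bar> \<le> a^2 + b^2" for a b :: real using abs_mult_le_weighted[of 1 a b] by simp
  have "\<bar>mollify \<delta> u x\<bar> \<le> (LBINT y. \<bar>u y * eta \<delta> (y - x)\<bar>)"
    unfolding mollify_def by (rule integral_abs_bound)
  also have "\<dots> \<le> (LBINT y. (u y)^2 + (eta \<delta> (y - x))^2)"
    by (intro integral_mono integrable_abs 1 Bochner_Integration.integrable_add u2 e2 b)
  also have "\<dots> = (LBINT y. (u y)^2) + (LBINT y. (eta \<delta> (y - x))^2)"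
    by (rule Bochner_Integration.integral_add[OF u2 e2])
  also have "(LBINT y. (eta \<delta> (y - x))^2) = (LBINT w. (eta \<delta> w)^2)"
    by (rule integrable_shift(2)[OF integrable_eta(2)[OF d]])
  finally show ?thesis .
qed

text \<open>Mollified functions converge weakly; against a Lipschitz test function this needs no more
  than the first moment of the kernel.\<close>

lemma mollify_tendsto_weakly:
  assumes u: "square_integrable u" and f: "test_function f"
  shows "(\<lambda>n. \<integral>x. mollify (inverse (real (Suc n))) u x * f x \<partial>lborel) \<longlonglongrightarrow> (LBINT x. u x * f x)"
proof -
  obtain L where L: "L > 0" "\<And>x y. \<bar>f x - f y\<bar> \<le> L * norm (x - y)" using test_function_lipschitz[OF f] by blast
  note [measurable] = square_integrableD(1)[OF u] test_function_measurable[OF f]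
  have u2: "integrable lborel (\<lambda>y. (u y)^2)" using square_integrableD(2)[OF u] by simp
  have f1: "integrable lborel f" and f2: "square_integrable f"
    using test_function_square_integrable[OF f] test_function_square_integrable'[OF f] by auto
  define C where "C = (LBINT y. (u y)^2) + 8 * L * (LBINT y. \<bar>f y\<bar>)"
  have main: "\<bar>(LBINT x. mollify \<delta> u x * f x) - (LBINT x. u x * f x)\<bar> \<le> sqrt \<delta> * C" if d: "\<delta> > 0" for \<delta>
  proof -
    (* The kernel is even, so mollification can be moved to the test function. *)
    define F where "F y = (LBINT x. f x * eta \<delta> (x - y))" for y
    have [measurable]: "F \<in> borel_measurable borel" unfolding F_def[abs_def] by measurable
    have fin: "(\<integral>\<^sup>+x. \<integral>\<^sup>+y. ennreal \<bar>u y * eta \<delta> (y - x) * f x\<bar> \<partial>lborel \<partial>lborel) < \<infinity>"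
    proof -
      define M where "M = (LBINT y. (u y)^2) + (LBINT w. (eta \<delta> w)^2)"
      have "(\<integral>\<^sup>+y. ennreal \<bar>u y * eta \<delta> (y - x)\<bar> \<partial>lborel) \<le> ennreal M" for x
      proof -
        have i: "integrable lborel (\<lambda>y. \<bar>u y\<bar> * eta \<delta> (y - x))" and su: "square_integrable (\<lambda>y. \<bar>u y\<bar>)"
          using square_integrable_mult[OF square_integrable_norm[OF u] square_integrable_eta[OF d]] square_integrable_norm[OF u] by auto
        have "(\<integral>\<^sup>+y. ennreal \<bar>u y * eta \<delta> (y - x)\<bar> \<partial>lborel) = (\<integral>\<^sup>+y. ennreal (\<bar>u y\<bar> * eta \<delta> (y - x)) \<partial>lborel)"
          using eta_nonneg[OF d] by (simp add: abs_mult)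
        also have "\<dots> = ennreal (mollify \<delta> (\<lambda>y. \<bar>u y\<bar>) x)"
          unfolding mollify_def using i eta_nonneg[OF d] by (intro nn_integral_eq_integral) auto
        also have "\<dots> \<le> ennreal M" using mollify_bound[OF d su, of x] by (intro ennreal_leI) (simp add: M_def)
        finally show ?thesis .
      qed
      then have "(\<integral>\<^sup>+x. (\<integral>\<^sup>+y. ennreal \<bar>u y * eta \<delta> (y - x)\<bar> \<partial>lborel) * ennreal \<bar>f x\<bar> \<partial>lborel) \<le> (\<integral>\<^sup>+x. ennreal M * ennreal \<bar>f x\<bar> \<partial>lborel)"
        by (intro nn_integral_mono mult_right_mono) auto
      also have "\<dots> < \<infinity>" using f1 by (simp add: nn_integral_cmult integrable_iff_bounded ennreal_mult_less_top)
      finally show ?thesis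
        by (simp add: abs_mult[of "_ * _" "f _"] ennreal_mult nn_integral_multc)
    qed
    have prod: "integrable (lborel \<Otimes>\<^sub>M lborel) (\<lambda>(x, y). u y * eta \<delta> (y - x) * f x)"
    proof (rule integrableI_bounded)
      have "(\<integral>\<^sup>+z. ennreal (norm (case z of (x, y) \<Rightarrow> u y * eta \<delta> (y - x) * f x)) \<partial>(lborel \<Otimes>\<^sub>M lborel))
        = (\<integral>\<^sup>+x. \<integral>\<^sup>+y. ennreal \<bar>u y * eta \<delta> (y - x) * f x\<bar> \<partial>lborel \<partial>lborel)"
        by (subst lborel.nn_integral_fst[symmetric]) auto
      with fin show "(\<integral>\<^sup>+z. ennreal (norm (case z of (x, y) \<Rightarrow> u y * eta \<delta> (y - x) * f x)) \<partial>(lborel \<Otimes>\<^sub>M lborel)) < \<infinity>" by simp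
    qed measurable
    have "(LBINT x. mollify \<delta> u x * f x) = (\<integral>x. \<integral>y. u y * eta \<delta> (y - x) * f x \<partial>lborel \<partial>lborel)"
      by (simp add: mollify_def)
    also have "\<dots> = (\<integral>y. \<integral>x. u y * eta \<delta> (y - x) * f x \<partial>lborel \<partial>lborel)"
      using lborel_pair.Fubini_integral[OF prod] by simp
    also have "\<dots> = (LBINT y. u y * F y)"
      by (simp add: F_def mult.assoc mult.commute[of "f _"] eta_even)
    finally have U: "(LBINT x. mollify \<delta> u x * f x) = (LBINT y. u y * F y)" .
    have ef: "integrable lborel (\<lambda>x. f x * eta \<delta> (x - y))" for y
      by (rule square_integrable_mult[OF f2 square_integrable_eta[OF d]])
    have ee: "integrable lborel (\<lambda>x. eta \<delta> (x - y))" "(LBINT x. eta \<delta> (x - y)) = 1" for y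
      using integrable_shift[OF integrable_eta(1)[OF d], of y] integrable_eta(3)[OF d] by auto
    have sup: "\<bar>F y - f y\<bar> \<le> 4 * L * \<delta>" for y
    proof -
      have "F y - f y = (LBINT x. f x * eta \<delta> (x - y)) - f y * (LBINT x. eta \<delta> (x - y))"
        by (simp add: F_def ee)
      also have "\<dots> = (LBINT x. f x * eta \<delta> (x - y) - f y * eta \<delta> (x - y))"
        using ef ee by simp
      finally have e: "F y - f y = (LBINT x. f x * eta \<delta> (x - y) - f y * eta \<delta> (x - y))" .
      have "ennreal \<bar>F y - f y\<bar> \<le> (\<integral>\<^sup>+x. ennreal (norm (f x * eta \<delta> (x - y) - f y * eta \<delta> (x - y))) \<partial>lborel)"
        unfolding e real_norm_def[symmetric] by (intro integral_norm_bound_ennreal Bochner_Integration.integrable_diff ef integrable_mult_right ee)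
      also have "\<dots> \<le> (\<integral>\<^sup>+x. ennreal L * ennreal (eta \<delta> (x - y) * norm (x - y)) \<partial>lborel)"
      proof (rule nn_integral_mono)
        fix x
        have "norm (f x * eta \<delta> (x - y) - f y * eta \<delta> (x - y)) = \<bar>f x - f y\<bar> * eta \<delta> (x - y)"
          using eta_nonneg[OF d, of "x - y"] by (simp add: abs_mult flip: left_diff_distrib)
        also have "\<dots> \<le> L * norm (x - y) * eta \<delta> (x - y)" using eta_nonneg[OF d] by (intro mult_right_mono L)
        finally show "ennreal (norm (f x * eta \<delta> (x - y) - f y * eta \<delta> (x - y))) \<le> ennreal L * ennreal (eta \<delta> (x - y) * norm (x - y))"
          using L(1) by (simp add: ennreal_leI mult_ac flip: ennreal_mult')
      qed
      also have "\<dots> = ennreal L * (\<integral>\<^sup>+w. ennreal (eta \<delta> w * norm w) \<partial>lborel)"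
        using nn_integral_shift[of "\<lambda>w. ennreal (eta \<delta> w * norm w)" y] by (simp add: nn_integral_cmult)
      also have "\<dots> \<le> ennreal L * ennreal (4 * \<delta>)" by (intro mult_left_mono nn_integral_eta_moment d) auto
      also have "\<dots> = ennreal (4 * L * \<delta>)" using L(1) by (simp add: mult_ac flip: ennreal_mult')
      finally show ?thesis using L(1) d by (simp add: ennreal_le_iff)
    qed
    have F1: "(\<integral>\<^sup>+y. ennreal \<bar>F y\<bar> \<partial>lborel) \<le> ennreal (LBINT y. \<bar>f y\<bar>)"
    proof -
      have "(\<integral>\<^sup>+y. ennreal \<bar>F y\<bar> \<partial>lborel) \<le> (\<integral>\<^sup>+y. \<integral>\<^sup>+x. ennreal (norm (f x * eta \<delta> (x - y))) \<partial>lborel \<partial>lborel)"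
        unfolding F_def real_norm_def[symmetric] by (intro nn_integral_mono integral_norm_bound_ennreal ef)
      also have "\<dots> = (\<integral>\<^sup>+x. \<integral>\<^sup>+y. ennreal (norm (f x * eta \<delta> (x - y))) \<partial>lborel \<partial>lborel)"
        by (rule lborel_pair.Fubini') measurable
      also have "\<dots> = (\<integral>\<^sup>+x. ennreal \<bar>f x\<bar> * 1 \<partial>lborel)"
        using eta_nonneg[OF d] nn_integral_eta_shift[OF d]
        by (intro nn_integral_cong) (simp add: abs_mult ennreal_mult nn_integral_cmult eta_even[of \<delta> x for x])
      also have "\<dots> = ennreal (LBINT y. \<bar>f y\<bar>)"
        using f1 by (simp add: nn_integral_eq_integral)
      finally show ?thesis .
    qed
    have Fi: "integrable lborel F"
      using le_less_trans[OF F1 ennreal_less_top] by (intro integrableI_bounded) auto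
    have F1': "(LBINT y. \<bar>F y\<bar>) \<le> (LBINT y. \<bar>f y\<bar>)"
      using F1 Fi by (subst (asm) nn_integral_eq_integral) (auto simp: ennreal_le_iff)
    have h2: "integrable lborel (\<lambda>y. (F y - f y)^2)" and h2b: "(LBINT y. (F y - f y)^2) \<le> 8 * L * \<delta> * (LBINT y. \<bar>f y\<bar>)"
    proof -
      have b: "(F y - f y)^2 \<le> 4 * L * \<delta> * (\<bar>F y\<bar> + \<bar>f y\<bar>)" for y
      proof -
        have "(F y - f y)^2 = \<bar>F y - f y\<bar> * \<bar>F y - f y\<bar>" by (simp add: power2_eq_square)
        also have "\<dots> \<le> (4 * L * \<delta>) * (\<bar>F y\<bar> + \<bar>f y\<bar>)" using L(1) d by (intro mult_mono sup) auto
        finally show ?thesis .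
      qed
      have i: "integrable lborel (\<lambda>y. 4 * L * \<delta> * (\<bar>F y\<bar> + \<bar>f y\<bar>))" using Fi f1 by auto
      show i2: "integrable lborel (\<lambda>y. (F y - f y)^2)"
        by (rule Bochner_Integration.integrable_bound[OF i]) (use b L(1) d in \<open>auto intro!: AE_I2 intro: order_trans\<close>)
      have "(LBINT y. (F y - f y)^2) \<le> (LBINT y. 4 * L * \<delta> * (\<bar>F y\<bar> + \<bar>f y\<bar>))"
        by (intro integral_mono i i2 b)
      also have "\<dots> = 4 * L * \<delta> * ((LBINT y. \<bar>F y\<bar>) + (LBINT y. \<bar>f y\<bar>))" using Fi f1 by simp
      also have "\<dots> \<le> 4 * L * \<delta> * ((LBINT y. \<bar>f y\<bar>) + (LBINT y. \<bar>f y\<bar>))"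
        using F1' L(1) d by (intro mult_left_mono) auto
      finally show "(LBINT y. (F y - f y)^2) \<le> 8 * L * \<delta> * (LBINT y. \<bar>f y\<bar>)" by (simp add: algebra_simps)
    qed
    have sq: "square_integrable (\<lambda>y. F y - f y)" using h2 by (simp add: square_integrable_def)
    have iuh: "integrable lborel (\<lambda>y. u y * (F y - f y))" by (rule square_integrable_mult[OF u sq])
    have iuf: "integrable lborel (\<lambda>y. u y * f y)" by (rule square_integrable_mult[OF u f2])
    have "(LBINT y. u y * F y) - (LBINT y. u y * f y) = (LBINT y. u y * (F y - f y))"
    proof -
      have "(LBINT y. u y * F y) = (LBINT y. u y * (F y - f y) + u y * f y)" by (simp add: algebra_simps)
      then show ?thesis using iuh iuf by simp
    qed
    also have "\<bar>\<dots>\<bar> \<le> (LBINT y. \<bar>u y * (F y - f y)\<bar>)" by (rule integral_abs_bound)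
    also have "\<dots> \<le> (LBINT y. sqrt \<delta> * (u y)^2 + inverse (sqrt \<delta>) * (F y - f y)^2)"
    proof (intro integral_mono integrable_abs iuh Bochner_Integration.integrable_add integrable_mult_right u2 h2)
      fix y
      show "\<bar>u y * (F y - f y)\<bar> \<le> sqrt \<delta> * (u y)^2 + inverse (sqrt \<delta>) * (F y - f y)^2"
        using d by (intro abs_mult_le_weighted) simp
    qed
    also have "\<dots> = sqrt \<delta> * (LBINT y. (u y)^2) + inverse (sqrt \<delta>) * (LBINT y. (F y - f y)^2)"
      using u2 h2 by simp
    also have "\<dots> \<le> sqrt \<delta> * (LBINT y. (u y)^2) + inverse (sqrt \<delta>) * (8 * L * \<delta> * (LBINT y. \<bar>f y\<bar>))"
      using h2b d by (intro add_left_mono mult_left_mono) auto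
    also have "\<dots> = sqrt \<delta> * C"
    proof -
      have "inverse (sqrt \<delta>) * \<delta> = sqrt \<delta>" using d by (simp add: field_simps)
      then have "inverse (sqrt \<delta>) * (8 * L * \<delta> * I) = sqrt \<delta> * (8 * L * I)" for I
        by (metis (no_types, opaque_lifting) mult.assoc mult.commute)
      then show ?thesis by (simp add: C_def distrib_left)
    qed
    finally show ?thesis by (simp add: U)
  qed
  have "(\<lambda>n. sqrt (inverse (real (Suc n))) * C) \<longlonglongrightarrow> sqrt 0 * C"
    by (intro tendsto_intros LIMSEQ_inverse_real_of_nat)
  then have z: "(\<lambda>n. sqrt (inverse (real (Suc n))) * C) \<longlonglongrightarrow> 0" by simp
  have "(\<lambda>n. (LBINT x. mollify (inverse (real (Suc n))) u x * f x) - (LBINT x. u x * f x)) \<longlonglongrightarrow> 0"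
    by (rule Lim_null_comparison[OF _ z]) (use main in \<open>auto intro!: always_eventually\<close>)
  then show ?thesis by (simp add: LIM_zero_iff)
qed

lemma ennreal_le_plus:
  "a \<le> b + c \<Longrightarrow> 0 \<le> b \<Longrightarrow> 0 \<le> c \<Longrightarrow> ennreal a \<le> ennreal b + ennreal c"
  using ennreal_leI[of a "b + c"] by simp

lemma power2_integral_nn:
  fixes f :: "'a \<Rightarrow> real"
  assumes "integrable M (\<lambda>x. (f x)^2)"
  shows "(\<integral>\<^sup>+x. (ennreal \<bar>f x\<bar>)^2 \<partial>M) = ennreal (\<integral>x. (f x)^2 \<partial>M)"
  using assms by (simp add: ennreal_power nn_integral_eq_integral)

lemma square_integrable_nn:
  fixes f :: "real^3 \<Rightarrow> 'a::euclidean_space"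
  shows "square_integrable f \<longleftrightarrow> f \<in> borel_measurable borel \<and> (\<integral>\<^sup>+x. (ennreal (norm (f x)))^2 \<partial>lborel) < \<infinity>"
  by (auto simp: square_integrable_def integrable_iff_bounded ennreal_power)

definition defect_potential :: "real \<Rightarrow> (real^3 \<Rightarrow> ennreal) \<Rightarrow> real^3 \<Rightarrow> ennreal" where
  "defect_potential \<delta> G x = (\<integral>\<^sup>+y. ennreal (field_defect \<delta> (y - x)) * G y \<partial>lborel)"

definition riesz :: "(real^3 \<Rightarrow> ennreal) \<Rightarrow> real^3 \<Rightarrow> ennreal" where
  "riesz G x = (\<integral>\<^sup>+y. ennreal (norm (y - x) powr (-2)) * G y \<partial>lborel)"

lemma riesz_measurable [measurable]:
  assumes [measurable]: "G \<in> borel_measurable borel"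
  shows "riesz G \<in> borel_measurable borel" "defect_potential \<delta> G \<in> borel_measurable borel"
  unfolding riesz_def[abs_def] defect_potential_def[abs_def] by measurable

lemma defect_potential_L2:
  assumes [measurable]: "G \<in> borel_measurable borel" and d: "\<delta> > 0"
  shows "(\<integral>\<^sup>+x. (defect_potential \<delta> G x)^2 \<partial>lborel) \<le> ennreal ((10 * pi * \<delta>)^2) * (\<integral>\<^sup>+y. (G y)^2 \<partial>lborel)"
proof -
  have "(\<integral>\<^sup>+x. (defect_potential \<delta> G x)^2 \<partial>lborel) \<le> (\<integral>\<^sup>+w. ennreal (field_defect \<delta> w) \<partial>lborel)^2 * (\<integral>\<^sup>+y. (G y)^2 \<partial>lborel)"
    unfolding defect_potential_def by (rule young_inequality) (auto intro: field_defect_bounds d)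
  also have "\<dots> \<le> ennreal (10 * pi * \<delta>)^2 * (\<integral>\<^sup>+y. (G y)^2 \<partial>lborel)"
    by (intro mult_right_mono power_mono nn_integral_field_defect d) auto
  finally show ?thesis using d by (simp add: ennreal_power)
qed

lemma power_decompose: "norm w powr (-2) = field_defect \<delta> w + norm w / (regdist \<delta> w)^3"
  by (simp add: field_defect_def)

text \<open>The kernel is at most \<open>field_defect 1\<close>, which is integrable and so preserves square integrability, plus a
  square integrable function, whose product with \<open>norm (g y)\<close> is integrable for every \<open>x\<close>.\<close>

lemma riesz_finite_AE:
  fixes g :: "real^3 \<Rightarrow> 'a::euclidean_space"
  assumes g: "square_integrable g"
  shows "AE x in lborel. riesz (\<lambda>y. ennreal (norm (g y))) x < \<infinity>"
proof -
  note [measurable] = square_integrableD(1)[OF g]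
  let ?G = "\<lambda>y. ennreal (norm (g y))"
  have "(\<integral>\<^sup>+x. (defect_potential 1 ?G x)^2 \<partial>lborel) \<le> ennreal ((10 * pi * 1)^2) * (\<integral>\<^sup>+y. (?G y)^2 \<partial>lborel)"
    by (rule defect_potential_L2) auto
  also have "\<dots> < \<infinity>" using g by (simp add: square_integrable_nn ennreal_mult_less_top)
  finally have "AE x in lborel. (defect_potential 1 ?G x)^2 \<noteq> \<infinity>" by (intro nn_integral_PInf_AE) auto
  then show ?thesis
  proof eventually_elim
    case (elim x)
    have "integrable lborel (\<lambda>y. 1 / (1 + (norm (y - x))^2) * norm (g y))"
      by (rule square_integrable_mult[OF square_integrable_bracket square_integrable_norm[OF g]])
    then have f: "(\<integral>\<^sup>+y. ennreal (1 / (1 + (norm (y - x))^2)) * ?G y \<partial>lborel) < \<infinity>"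
      by (simp add: integrable_iff_bounded abs_mult flip: ennreal_mult)
    have "riesz ?G x \<le> (\<integral>\<^sup>+y. ennreal (field_defect 1 (y - x)) * ?G y + ennreal (1 / (1 + (norm (y - x))^2)) * ?G y \<partial>lborel)"
      unfolding riesz_def
    proof (rule nn_integral_mono)
      fix y
      define w where "w = y - x"
      have s: "regdist 1 w > 0" "(regdist 1 w)^2 = (norm w)^2 + 1" by (simp_all add: regdist_pos regdist_sq)
      have "norm w / (regdist 1 w)^3 \<le> regdist 1 w / (regdist 1 w)^3"
        using s regdist_ge(1)[of w 1] by (intro divide_right_mono) auto
      also have "\<dots> = 1 / (regdist 1 w)^2" using s(1) by (simp add: power2_eq_square power3_eq_cube)
      finally have "norm w powr (-2) \<le> field_defect 1 w + 1 / (1 + (norm w)^2)"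
        unfolding power_decompose[of w 1] s(2) by (simp add: add.commute)
      then have "ennreal (norm w powr (-2)) \<le> ennreal (field_defect 1 w) + ennreal (1 / (1 + (norm w)^2))"
        by (rule ennreal_le_plus) (auto intro: field_defect_bounds)
      from mult_right_mono[OF this, of "?G y"]
      show "ennreal (norm (y - x) powr (-2)) * ?G y \<le> ennreal (field_defect 1 (y - x)) * ?G y + ennreal (1 / (1 + (norm (y - x))^2)) * ?G y"
        by (simp add: w_def distrib_right)
    qed
    also have "\<dots> = defect_potential 1 ?G x + (\<integral>\<^sup>+y. ennreal (1 / (1 + (norm (y - x))^2)) * ?G y \<partial>lborel)"
      unfolding defect_potential_def by (rule nn_integral_add) measurable
    also have "\<dots> < \<infinity>"
    proof -
      have "defect_potential 1 ?G x \<noteq> top"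
      proof
        assume "defect_potential 1 ?G x = top"
        with elim show False by (simp add: power2_eq_square)
      qed
      then show ?thesis using f by (simp add: less_top)
    qed
    finally show ?case .
  qed
qed

text \<open>A Sobolev function is the Newtonian field of its gradient.  Both sides are compared through
  the mollified function, to which the regularized formula applies.\<close>

context
  fixes u :: "real^3 \<Rightarrow> real" and g :: "real^3 \<Rightarrow> real^3"
  assumes u: "square_integrable u" and g: "square_integrable g" and wg: "has_weak_gradient u g"
begin

definition newton_field :: "real^3 \<Rightarrow> real" where
  "newton_field x = - (1 / (4 * pi)) * (LBINT y. inner (g y) (y - x) * inverse (norm (y - x))^3)"

lemma newton_field_integrable:
  assumes fin: "riesz (\<lambda>y. ennreal (norm (g y))) x < \<infinity>"
  shows "integrable lborel (\<lambda>y. inner (g y) (y - x) * inverse (norm (y - x))^3)"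
    and "\<bar>inner (g y) (y - x) * inverse (norm (y - x))^3\<bar> \<le> norm (y - x) powr (-2) * norm (g y)"
proof -
  note [measurable] = square_integrableD(1)[OF g]
  show b: "\<bar>inner (g y) (y - x) * inverse (norm (y - x))^3\<bar> \<le> norm (y - x) powr (-2) * norm (g y)" for y
  proof (cases "y = x")
    case False
    have "\<bar>inner (g y) (y - x) * inverse (norm (y - x))^3\<bar> \<le> (norm (g y) * norm (y - x)) * inverse (norm (y - x))^3"
      unfolding abs_mult using Cauchy_Schwarz_ineq2[of "g y" "y - x"] by (intro mult_mono) auto
    also have "\<dots> = norm (y - x) powr (-2) * norm (g y)"
      using False by (simp add: powr_minus powr_numeral field_simps power2_eq_square power3_eq_cube)
    finally show ?thesis .
  qed simp
  show "integrable lborel (\<lambda>y. inner (g y) (y - x) * inverse (norm (y - x))^3)"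
  proof (rule integrableI_bounded)
    have "(\<integral>\<^sup>+y. ennreal (norm (inner (g y) (y - x) * inverse (norm (y - x))^3)) \<partial>lborel)
       \<le> riesz (\<lambda>y. ennreal (norm (g y))) x"
      unfolding riesz_def using b by (intro nn_integral_mono) (auto intro!: ennreal_leI simp flip: ennreal_mult)
    with fin show "(\<integral>\<^sup>+y. ennreal (norm (inner (g y) (y - x) * inverse (norm (y - x))^3)) \<partial>lborel) < \<infinity>" by simp
  qed measurable
qed

lemma newton_field_bound:
  assumes fin: "riesz (\<lambda>y. ennreal (norm (g y))) x < \<infinity>"
  shows "ennreal \<bar>newton_field x\<bar> \<le> ennreal (1 / (4 * pi)) * riesz (\<lambda>y. ennreal (norm (g y))) x"
proof -
  have "ennreal \<bar>LBINT y. inner (g y) (y - x) * inverse (norm (y - x))^3\<bar>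
    \<le> (\<integral>\<^sup>+y. ennreal (norm (inner (g y) (y - x) * inverse (norm (y - x))^3)) \<partial>lborel)"
    unfolding real_norm_def[symmetric] by (rule integral_norm_bound_ennreal[OF newton_field_integrable(1)[OF fin]])
  also have "\<dots> \<le> riesz (\<lambda>y. ennreal (norm (g y))) x"
    unfolding riesz_def using newton_field_integrable(2)[OF fin]
    by (intro nn_integral_mono) (auto intro!: ennreal_leI simp flip: ennreal_mult)
  finally have "ennreal (1 / (4 * pi)) * ennreal \<bar>LBINT y. inner (g y) (y - x) * inverse (norm (y - x))^3\<bar>
    \<le> ennreal (1 / (4 * pi)) * riesz (\<lambda>y. ennreal (norm (g y))) x" by (intro mult_left_mono) auto
  then show ?thesis by (simp add: newton_field_def abs_mult flip: ennreal_mult)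
qed

lemma mollify_newton_field:
  assumes d: "0 < \<delta>" "\<delta> \<le> 1" and fin: "riesz (\<lambda>y. ennreal (norm (g y))) x < \<infinity>"
  shows "ennreal \<bar>newton_field x - mollify \<delta> u x\<bar> \<le> ennreal (1 / (4 * pi)) * defect_potential \<delta> (\<lambda>y. ennreal (norm (g y))) x"
proof -
  note [measurable] = square_integrableD(1)[OF g]
  let ?a = "\<lambda>y. inner (g y) (y - x) * inverse (norm (y - x))^3"
  let ?b = "\<lambda>y. inner (g y) (y - x) * inverse (regdist \<delta> (y - x))^3"
  have ia: "integrable lborel ?a" by (rule newton_field_integrable[OF fin])
  have ib: "integrable lborel ?b"
  proof (rule Bochner_Integration.integrable_bound[OF integrable_abs[OF ia]])
    have "\<bar>?b y\<bar> \<le> \<bar>?a y\<bar>" for y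
    proof (cases "y = x")
      case False
      have "inverse (regdist \<delta> (y - x)) \<le> inverse (norm (y - x))"
        using False regdist_ge(1)[of "y - x" \<delta>] by (intro le_imp_inverse_le) auto
      then have "inverse (regdist \<delta> (y - x))^3 \<le> inverse (norm (y - x))^3"
        using regdist_pos[OF d(1), of "y - x"] by (intro power_mono) auto
      then show ?thesis using regdist_pos[OF d(1), of "y - x"] by (auto simp: abs_mult intro!: mult_left_mono)
    qed simp
    then show "AE y in lborel. norm (?b y) \<le> norm \<bar>?a y\<bar>" by (intro AE_I2) simp
  qed measurable
  have pw: "\<bar>?a y - ?b y\<bar> \<le> field_defect \<delta> (y - x) * norm (g y)" for y
  proof (cases "y = x")
    case False
    define w where "w = y - x"
    have w: "norm w > 0" using False by (simp add: w_def)
    have fd: "field_defect \<delta> w = norm w * (inverse (norm w)^3 - inverse (regdist \<delta> w)^3)"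
      using w by (simp add: field_defect_def powr_minus powr_numeral field_simps power2_eq_square power3_eq_cube)
    then have p: "inverse (norm w)^3 - inverse (regdist \<delta> w)^3 \<ge> 0"
      using field_defect_bounds(1)[OF d(1), of w] w by (simp add: zero_le_mult_iff)
    have "\<bar>?a y - ?b y\<bar> = \<bar>inner (g y) w\<bar> * (inverse (norm w)^3 - inverse (regdist \<delta> w)^3)"
      using p by (simp add: w_def abs_mult flip: right_diff_distrib)
    also have "\<dots> \<le> (norm (g y) * norm w) * (inverse (norm w)^3 - inverse (regdist \<delta> w)^3)"
      using p by (intro mult_right_mono Cauchy_Schwarz_ineq2)
    finally show ?thesis by (simp add: fd w_def[symmetric] mult_ac)
  qed (simp add: field_defect_def)
  have "newton_field x - mollify \<delta> u x = - (1 / (4 * pi)) * (LBINT y. ?a y - ?b y)"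
    unfolding regularized_representation[OF d u g wg] newton_field_def Bochner_Integration.integral_diff[OF ia ib]
    by (simp only: right_diff_distrib)
  then have e: "\<bar>newton_field x - mollify \<delta> u x\<bar> = (1 / (4 * pi)) * \<bar>LBINT y. ?a y - ?b y\<bar>"
    by (simp add: abs_mult)
  have "ennreal \<bar>LBINT y. ?a y - ?b y\<bar> \<le> (\<integral>\<^sup>+y. ennreal (norm (?a y - ?b y)) \<partial>lborel)"
    unfolding real_norm_def[symmetric] by (intro integral_norm_bound_ennreal Bochner_Integration.integrable_diff ia ib)
  also have "\<dots> \<le> defect_potential \<delta> (\<lambda>y. ennreal (norm (g y))) x"
    unfolding defect_potential_def using pw field_defect_bounds(1)[OF d(1)]
    by (intro nn_integral_mono) (auto intro!: ennreal_leI simp flip: ennreal_mult)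
  finally show ?thesis unfolding e by (subst ennreal_mult) (auto intro: mult_left_mono)
qed

lemma newton_field_measurable [measurable]: "newton_field \<in> borel_measurable borel"
proof -
  note [measurable] = square_integrableD(1)[OF g]
  show ?thesis unfolding newton_field_def[abs_def] by measurable
qed

text \<open>Both functions are integrals of the gradient against a kernel; the difference of the kernels is bounded
  by \<open>field_defect\<close>, whose integral is of order \<open>\<delta>\<close>.\<close>

lemma newton_field_minus_mollify:
  assumes d: "0 < \<delta>" "\<delta> \<le> 1"
  shows "square_integrable (\<lambda>x. newton_field x - mollify \<delta> u x)"
    and "(LBINT x. (newton_field x - mollify \<delta> u x)^2) \<le> 25/4 * \<delta>^2 * (LBINT y. (norm (g y))^2)"
proof -
  note [measurable] = square_integrableD(1)[OF g] square_integrableD(1)[OF u]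
  let ?G = "\<lambda>y. ennreal (norm (g y))"
  have "(\<integral>\<^sup>+x. (ennreal (norm (newton_field x - mollify \<delta> u x)))^2 \<partial>lborel)
     \<le> (\<integral>\<^sup>+x. (ennreal (1 / (4 * pi)) * defect_potential \<delta> ?G x)^2 \<partial>lborel)"
  proof (rule nn_integral_mono_AE, use riesz_finite_AE[OF g] in eventually_elim)
    case (elim x)
    then show ?case using mollify_newton_field[OF d] by (intro power_mono) auto
  qed
  also have "\<dots> = ennreal ((1 / (4 * pi))^2) * (\<integral>\<^sup>+x. (defect_potential \<delta> ?G x)^2 \<partial>lborel)"
    by (simp add: power_mult_distrib ennreal_power nn_integral_cmult)
  also have "\<dots> \<le> ennreal ((1 / (4 * pi))^2) * (ennreal ((10 * pi * \<delta>)^2) * (\<integral>\<^sup>+y. (?G y)^2 \<partial>lborel))"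
    by (intro mult_left_mono defect_potential_L2 d) auto
  also have "(\<integral>\<^sup>+y. (?G y)^2 \<partial>lborel) = ennreal (LBINT y. (norm (g y))^2)"
    using power2_integral_nn[OF square_integrableD(2)[OF g]] by simp
  also have "ennreal ((1 / (4 * pi))^2) * (ennreal ((10 * pi * \<delta>)^2) * ennreal (LBINT y. (norm (g y))^2))
      = ennreal (25/4 * \<delta>^2 * (LBINT y. (norm (g y))^2))"
    by (simp add: power_mult_distrib power_divide flip: ennreal_mult)
  finally have b: "(\<integral>\<^sup>+x. (ennreal (norm (newton_field x - mollify \<delta> u x)))^2 \<partial>lborel)
     \<le> ennreal (25/4 * \<delta>^2 * (LBINT y. (norm (g y))^2))" .
  show s: "square_integrable (\<lambda>x. newton_field x - mollify \<delta> u x)"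
    unfolding square_integrable_nn using le_less_trans[OF b ennreal_less_top] by simp
  have "(\<integral>\<^sup>+x. (ennreal \<bar>newton_field x - mollify \<delta> u x\<bar>)^2 \<partial>lborel) = ennreal (LBINT x. (newton_field x - mollify \<delta> u x)^2)"
    using square_integrableD(2)[OF s] by (intro power2_integral_nn) simp
  with b show "(LBINT x. (newton_field x - mollify \<delta> u x)^2) \<le> 25/4 * \<delta>^2 * (LBINT y. (norm (g y))^2)"
    by (simp add: ennreal_le_iff)
qed

text \<open>The mollified functions converge to the field in \<open>L\<^sup>2\<close> and weakly to \<open>u\<close>.\<close>

lemma eq_newton_field_AE: "AE x in lborel. u x = newton_field x"
proof -
  note [measurable] = square_integrableD(1)[OF g] square_integrableD(1)[OF u]
  have mi: "integrable lborel (\<lambda>x. mollify \<delta> u x * h x)" if "\<delta> > 0" "integrable lborel h" for \<delta> h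
  proof (rule Bochner_Integration.integrable_bound)
    let ?M = "(LBINT y. (u y)^2) + (LBINT w. (eta \<delta> w)^2)"
    show "integrable lborel (\<lambda>x. ?M * \<bar>h x\<bar>)" using that by auto
    show "AE x in lborel. norm (mollify \<delta> u x * h x) \<le> norm (?M * \<bar>h x\<bar>)"
    proof (rule AE_I2)
      fix x
      have "\<bar>mollify \<delta> u x\<bar> \<le> \<bar>?M\<bar>" using mollify_bound[OF that(1) u, of x] by linarith
      then show "norm (mollify \<delta> u x * h x) \<le> norm (?M * \<bar>h x\<bar>)"
        by (simp add: abs_mult mult_right_mono)
    qed
  qed (use that in measurable)
  have ni: "integrable lborel (\<lambda>x. newton_field x * h x)" if h: "square_integrable h" "integrable lborel h" for h
  proof -
    have "integrable lborel (\<lambda>x. (newton_field x - mollify 1 u x) * h x + mollify 1 u x * h x)"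
      by (intro Bochner_Integration.integrable_add square_integrable_mult newton_field_minus_mollify h mi) auto
    then show ?thesis by (simp add: algebra_simps)
  qed
  have "AE x in lborel. newton_field x - u x = 0"
  proof (rule AE_zero_if_zero_against_test_functions)
    fix a b :: "real^3"
    have "square_integrable (indicator (box a b) :: real^3 \<Rightarrow> real)" "integrable lborel (indicator (box a b) :: real^3 \<Rightarrow> real)"
    proof -
      show i: "integrable lborel (indicator (box a b) :: real^3 \<Rightarrow> real)"
        by (intro integrable_real_indicator) (auto simp: emeasure_lborel_box_eq)
      have "(\<lambda>x. (norm (indicator (box a b) x :: real))^2) = indicator (box a b)" by (auto simp: indicator_def)
      with i show "square_integrable (indicator (box a b) :: real^3 \<Rightarrow> real)" by (simp add: square_integrable_def)
    qed
    note ind = this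
    have "integrable lborel (\<lambda>x. newton_field x * indicator (box a b) x - u x * indicator (box a b) x)"
      by (intro Bochner_Integration.integrable_diff ni square_integrable_mult u ind)
    then show "integrable lborel (\<lambda>x. indicator (box a b) x * (newton_field x - u x))" by (simp add: algebra_simps)
  next
    fix f assume f: "test_function f"
    have f1: "integrable lborel f" and f2: "square_integrable f"
      using test_function_square_integrable[OF f] test_function_square_integrable'[OF f] by auto
    let ?I = "\<lambda>n. \<integral>x. mollify (inverse (real (Suc n))) u x * f x \<partial>lborel"
    let ?G = "LBINT y. (norm (g y))^2"
    let ?F = "LBINT y. (f y)^2"
    have lim1: "?I \<longlonglongrightarrow> (LBINT x. u x * f x)" by (rule mollify_tendsto_weakly[OF u f])
    have bd: "\<bar>(LBINT x. newton_field x * f x) - (LBINT x. mollify \<delta> u x * f x)\<bar> \<le> \<delta> * (25/4 * ?G + ?F)"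
      if d: "0 < \<delta>" "\<delta> \<le> 1" for \<delta>
    proof -
      note D = newton_field_minus_mollify[OF d]
      have D2: "integrable lborel (\<lambda>x. (newton_field x - mollify \<delta> u x)^2)" using square_integrableD(2)[OF D(1)] by simp
      have F2: "integrable lborel (\<lambda>x. (f x)^2)" using square_integrableD(2)[OF f2] by simp
      have i: "integrable lborel (\<lambda>x. (newton_field x - mollify \<delta> u x) * f x)" by (rule square_integrable_mult[OF D(1) f2])
      have "(LBINT x. newton_field x * f x) - (LBINT x. mollify \<delta> u x * f x) = (LBINT x. (newton_field x - mollify \<delta> u x) * f x)"
        unfolding left_diff_distrib using Bochner_Integration.integral_diff[OF ni[OF f2 f1] mi[OF d(1) f1]] by simp
      also have "\<bar>\<dots>\<bar> \<le> (LBINT x. \<bar>(newton_field x - mollify \<delta> u x) * f x\<bar>)" by (rule integral_abs_bound)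
      also have "\<dots> \<le> (LBINT x. inverse \<delta> * (newton_field x - mollify \<delta> u x)^2 + \<delta> * (f x)^2)"
      proof (intro integral_mono integrable_abs i Bochner_Integration.integrable_add integrable_mult_right D2 F2)
        fix x
        show "\<bar>(newton_field x - mollify \<delta> u x) * f x\<bar> \<le> inverse \<delta> * (newton_field x - mollify \<delta> u x)^2 + \<delta> * (f x)^2"
          using abs_mult_le_weighted[of "inverse \<delta>"] d by simp
      qed
      also have "\<dots> = inverse \<delta> * (LBINT x. (newton_field x - mollify \<delta> u x)^2) + \<delta> * ?F"
        using D2 F2 by simp
      also have "\<dots> \<le> inverse \<delta> * (25/4 * \<delta>^2 * ?G) + \<delta> * ?F"
        using D(2) d by (intro add_right_mono mult_left_mono) auto
      also have "\<dots> = \<delta> * (25/4 * ?G + ?F)" using d by (simp add: field_simps power2_eq_square)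
      finally show ?thesis .
    qed
    have z: "(\<lambda>n. inverse (real (Suc n)) * (25/4 * ?G + ?F)) \<longlonglongrightarrow> 0"
      by (rule tendsto_mult_left_zero[OF LIMSEQ_inverse_real_of_nat])
    have "(\<lambda>n. (LBINT x. newton_field x * f x) - ?I n) \<longlonglongrightarrow> 0"
      by (rule Lim_null_comparison[OF _ z]) (use bd in \<open>auto intro!: always_eventually simp: inverse_le_1_iff\<close>)
    moreover have "(\<lambda>n. (LBINT x. newton_field x * f x) - ?I n) \<longlonglongrightarrow> (LBINT x. newton_field x * f x) - (LBINT x. u x * f x)"
      by (intro tendsto_intros lim1)
    ultimately have "(LBINT x. newton_field x * f x) - (LBINT x. u x * f x) = 0"
      by (rule LIMSEQ_unique[rotated])
    then show "(LBINT x. (newton_field x - u x) * f x) = 0"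
      using ni[OF f2 f1] square_integrable_mult[OF u f2] by (simp add: left_diff_distrib)
  qed measurable
  then show ?thesis by eventually_elim simp
qed

theorem sobolev_pointwise_bound:
  "AE x in lborel. ennreal \<bar>u x\<bar> \<le> ennreal (1 / (4 * pi)) * riesz (\<lambda>y. ennreal (norm (g y))) x"
  using eq_newton_field_AE riesz_finite_AE[OF g]
  by eventually_elim (use newton_field_bound in auto)

text \<open>A rate that depends on the gradient only: mollification is uniformly close to the identity on bounded
  sets of the Sobolev space.\<close>

theorem mollify_L2_distance:
  assumes d: "0 < \<delta>" "\<delta> \<le> 1"
  shows "square_integrable (\<lambda>x. u x - mollify \<delta> u x)"
    and "(LBINT x. (u x - mollify \<delta> u x)^2) \<le> 25/4 * \<delta>^2 * (LBINT y. (norm (g y))^2)"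
proof -
  note [measurable] = square_integrableD(1)[OF g] square_integrableD(1)[OF u]
  have e: "AE x in lborel. (newton_field x - mollify \<delta> u x)^2 = (u x - mollify \<delta> u x)^2"
    using eq_newton_field_AE by eventually_elim simp
  have i: "integrable lborel (\<lambda>x. (newton_field x - mollify \<delta> u x)^2)"
    using square_integrableD(2)[OF newton_field_minus_mollify(1)[OF d]] by simp
  from i e have "integrable lborel (\<lambda>x. (u x - mollify \<delta> u x)^2)"
    by (subst (asm) integrable_cong_AE) auto
  then show "square_integrable (\<lambda>x. u x - mollify \<delta> u x)" by (simp add: square_integrable_def)
  show "(LBINT x. (u x - mollify \<delta> u x)^2) \<le> 25/4 * \<delta>^2 * (LBINT y. (norm (g y))^2)"
    using newton_field_minus_mollify(2)[OF d] e by (subst (asm) integral_cong_AE) auto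
qed

end

section \<open>Sobolev functions with a chosen gradient\<close>

text \<open>Weak gradients are unique up to null sets only. Carrying a gradient along with the function keeps
  algebraic operations free of choices.\<close>

definition sobolev :: "(real^3 \<Rightarrow> real) \<Rightarrow> (real^3 \<Rightarrow> real^3) \<Rightarrow> bool" where
  "sobolev u g \<longleftrightarrow> square_integrable u \<and> square_integrable g \<and> has_weak_gradient u g"

lemma sobolevD:
  assumes "sobolev u g"
  shows "square_integrable u" "square_integrable g" "has_weak_gradient u g"
    "u \<in> borel_measurable borel" "g \<in> borel_measurable borel"
    "integrable lborel (\<lambda>x. (u x)^2)" "integrable lborel (\<lambda>x. (norm (g x))^2)"
  using assms square_integrableD[of u] square_integrableD[of g] by (auto simp: sobolev_def)

lemma square_integrable_scaleR: "square_integrable f \<Longrightarrow> square_integrable (\<lambda>x. c *\<^sub>R f x)"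
  unfolding square_integrable_def by (auto simp: power_mult_distrib)

lemma square_integrable_add:
  assumes f: "square_integrable f" and g: "square_integrable g"
  shows "square_integrable (\<lambda>x. f x + g x)"
proof -
  note [measurable] = square_integrableD(1)[OF f] square_integrableD(1)[OF g]
  have "integrable lborel (\<lambda>x. (norm (f x + g x))^2)"
  proof (rule Bochner_Integration.integrable_bound)
    show "integrable lborel (\<lambda>x. 2 * (norm (f x))^2 + 2 * (norm (g x))^2)"
      using square_integrableD(2)[OF f] square_integrableD(2)[OF g] by auto
    have "(norm (f x + g x))^2 \<le> 2 * (norm (f x))^2 + 2 * (norm (g x))^2" for x
    proof -
      have "(norm (f x + g x))^2 \<le> (norm (f x) + norm (g x))^2"
        by (intro power_mono norm_triangle_ineq) auto
      also have "\<dots> \<le> 2 * (norm (f x))^2 + 2 * (norm (g x))^2"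
        using sum_squares_bound[of "norm (f x)" "norm (g x)"] by (simp add: power2_sum)
      finally show ?thesis .
    qed
    then show "AE x in lborel. norm ((norm (f x + g x))^2) \<le> norm (2 * (norm (f x))^2 + 2 * (norm (g x))^2)"
      by (intro AE_I2) auto
  qed measurable
  then show ?thesis by (simp add: square_integrable_def)
qed

lemma sobolev_scale:
  assumes "sobolev u g" shows "sobolev (\<lambda>x. c * u x) (\<lambda>x. c *\<^sub>R g x)"
proof -
  have "square_integrable (\<lambda>x. c * u x)" using square_integrable_scaleR[OF sobolevD(1)[OF assms], of c] by simp
  moreover have "square_integrable (\<lambda>x. c *\<^sub>R g x)" by (rule square_integrable_scaleR[OF sobolevD(2)[OF assms]])
  moreover have "has_weak_gradient (\<lambda>x. c * u x) (\<lambda>x. c *\<^sub>R g x)"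
    using sobolevD(3)[OF assms] unfolding has_weak_gradient_def by (simp add: mult.assoc)
  ultimately show ?thesis by (simp add: sobolev_def)
qed

lemma sobolev_add:
  assumes a: "sobolev u g" and b: "sobolev v h" shows "sobolev (\<lambda>x. u x + v x) (\<lambda>x. g x + h x)"
proof -
  have "has_weak_gradient (\<lambda>x. u x + v x) (\<lambda>x. g x + h x)"
    unfolding has_weak_gradient_def
  proof (intro allI impI)
    fix f i assume f: "test_function f"
    have i: "integrable lborel (\<lambda>x. w x * pderiv i f x)" if "square_integrable w" for w
      by (rule square_integrable_mult[OF that test_function_square_integrable'[OF test_function_pderiv[OF f]]])
    have j: "integrable lborel (\<lambda>x. w x $ i * f x)" if "square_integrable w" for w :: "real^3 \<Rightarrow> real^3"
      by (rule square_integrable_mult[OF square_integrable_component[OF that] test_function_square_integrable'[OF f]])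
    show "(LBINT x. (u x + v x) * pderiv i f x) = - (LBINT x. (g x + h x) $ i * f x)"
      using sobolevD(3)[OF a] sobolevD(3)[OF b] f i[OF sobolevD(1)[OF a]] i[OF sobolevD(1)[OF b]]
        j[OF sobolevD(2)[OF a]] j[OF sobolevD(2)[OF b]]
      unfolding has_weak_gradient_def by (simp add: distrib_right)
  qed
  then show ?thesis using a b by (auto simp: sobolev_def intro: square_integrable_add)
qed

lemma sobolev_diff:
  assumes a: "sobolev u g" and b: "sobolev v h" shows "sobolev (\<lambda>x. u x - v x) (\<lambda>x. g x - h x)"
  using sobolev_add[OF a sobolev_scale[OF b, of "-1"]] by simp

lemma AE_vec_eqI: "(\<And>i. AE x in M. f x $ i = g x $ i) \<Longrightarrow> AE x in M. f x = (g x :: real^3)"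
  unfolding vec_eq_iff using AE_finite_allI[of UNIV "\<lambda>i x. f x $ i = g x $ i" M] by simp

lemma sobolev_gradient_unique:
  assumes a: "sobolev u g" and b: "sobolev u h" shows "AE x in lborel. g x = h x"
proof (rule AE_vec_eqI)
  fix i
  have s: "square_integrable (\<lambda>x. g x $ i)" "square_integrable (\<lambda>x. h x $ i)"
    by (intro square_integrable_component sobolevD(2)[OF a] sobolevD(2)[OF b])+
  note [measurable] = square_integrableD(1)[OF s(1)] square_integrableD(1)[OF s(2)]
  have ind: "square_integrable (indicator (box a b) :: real^3 \<Rightarrow> real)" for a b
  proof -
    have i: "integrable lborel (indicator (box a b) :: real^3 \<Rightarrow> real)"
      by (intro integrable_real_indicator) (auto simp: emeasure_lborel_box_eq)
    have "(\<lambda>x. (norm (indicator (box a b) x :: real))^2) = indicator (box a b)" by (auto simp: indicator_def)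
    with i show "square_integrable (indicator (box a b) :: real^3 \<Rightarrow> real)" by (simp add: square_integrable_def)
  qed
  have "AE x in lborel. g x $ i - h x $ i = 0"
  proof (rule AE_zero_if_zero_against_test_functions)
    fix a b :: "real^3"
    have "integrable lborel (\<lambda>x. indicator (box a b) x * (g x $ i) - indicator (box a b) x * (h x $ i))"
      by (intro Bochner_Integration.integrable_diff square_integrable_mult s ind)
    then show "integrable lborel (\<lambda>x. indicator (box a b) x * (g x $ i - h x $ i))"
      by (simp add: algebra_simps)
  next
    fix f assume f: "test_function f"
    have "(LBINT x. g x $ i * f x) = (LBINT x. h x $ i * f x)"
      using sobolevD(3)[OF a, unfolded has_weak_gradient_def, rule_format, OF f, of i]
        sobolevD(3)[OF b, unfolded has_weak_gradient_def, rule_format, OF f, of i] by simp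
    then show "(LBINT x. (g x $ i - h x $ i) * f x) = 0"
      using square_integrable_mult[OF s(1) test_function_square_integrable'[OF f]]
        square_integrable_mult[OF s(2) test_function_square_integrable'[OF f]]
      by (simp add: left_diff_distrib)
  qed measurable
  then show "AE x in lborel. g x $ i = h x $ i" by eventually_elim simp
qed

lemma sobolev_cong_AE:
  assumes a: "sobolev u g" and [measurable]: "v \<in> borel_measurable borel" and e: "AE x in lborel. u x = v x"
  shows "sobolev v g"
proof -
  note [measurable] = sobolevD(4)[OF a]
  have "AE x in lborel. (u x)^2 = (v x)^2" using e by eventually_elim simp
  then have "integrable lborel (\<lambda>x. (v x)^2)"
    using sobolevD(6)[OF a] by (subst (asm) integrable_cong_AE) auto
  moreover have "has_weak_gradient v g"
    unfolding has_weak_gradient_def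
  proof (intro allI impI)
    fix f i assume f: "test_function f"
    note [measurable] = test_function_measurable[OF test_function_pderiv[OF f, of i]]
    have "AE x in lborel. u x * pderiv i f x = v x * pderiv i f x" using e by eventually_elim simp
    then have "(LBINT x. u x * pderiv i f x) = (LBINT x. v x * pderiv i f x)"
      by (intro integral_cong_AE) auto
    then show "(LBINT x. v x * pderiv i f x) = - (LBINT x. g x $ i * f x)"
      using sobolevD(3)[OF a, unfolded has_weak_gradient_def, rule_format, OF f, of i] by simp
  qed
  ultimately show ?thesis using sobolevD(2)[OF a] by (simp add: sobolev_def square_integrable_def)
qed

lemma sobolev_weak_grad: "u \<in> H1 \<Longrightarrow> sobolev u (weak_grad u)"
proof -
  assume "u \<in> H1"
  then have u: "square_integrable u" and ex: "\<exists>g. square_integrable g \<and> has_weak_gradient u g"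
    by (simp_all add: H1_def)
  from someI_ex[OF ex] u show ?thesis unfolding weak_grad_def sobolev_def by blast
qed

lemma sobolev_H1: "sobolev u g \<Longrightarrow> u \<in> H1"
  by (auto simp: sobolev_def H1_def)

lemma weak_grad_eq_AE:
  assumes "sobolev u g" shows "AE x in lborel. weak_grad u x = g x"
  by (rule sobolev_gradient_unique[OF sobolev_weak_grad[OF sobolev_H1[OF assms]] assms])

section \<open>The Coulomb energy: Lions' and Hardy's inequalities\<close>

definition newton :: "(real^3 \<Rightarrow> ennreal) \<Rightarrow> real^3 \<Rightarrow> ennreal" where
  "newton F x = (\<integral>\<^sup>+y. ennreal (norm (y - x) powr (-1)) * F y \<partial>lborel)"

definition coulomb :: "(real^3 \<Rightarrow> ennreal) \<Rightarrow> (real^3 \<Rightarrow> ennreal) \<Rightarrow> ennreal" where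
  "coulomb F H = (\<integral>\<^sup>+x. F x * newton H x \<partial>lborel)"

lemma newton_measurable [measurable]:
  assumes [measurable]: "F \<in> borel_measurable borel" shows "newton F \<in> borel_measurable borel"
  unfolding newton_def[abs_def] by measurable

lemma riesz_adjoint:
  assumes [measurable]: "F \<in> borel_measurable borel" "G \<in> borel_measurable borel"
  shows "(\<integral>\<^sup>+x. F x * riesz G x \<partial>lborel) = (\<integral>\<^sup>+y. G y * riesz F y \<partial>lborel)"
proof -
  have "(\<integral>\<^sup>+x. F x * riesz G x \<partial>lborel) = (\<integral>\<^sup>+x. \<integral>\<^sup>+y. F x * (ennreal (norm (y - x) powr (-2)) * G y) \<partial>lborel \<partial>lborel)"
    unfolding riesz_def by (simp add: nn_integral_cmult)
  also have "\<dots> = (\<integral>\<^sup>+y. \<integral>\<^sup>+x. F x * (ennreal (norm (y - x) powr (-2)) * G y) \<partial>lborel \<partial>lborel)"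
    by (rule lborel_pair.Fubini') measurable
  also have "\<dots> = (\<integral>\<^sup>+y. \<integral>\<^sup>+x. G y * (ennreal (norm (x - y) powr (-2)) * F x) \<partial>lborel \<partial>lborel)"
    by (simp add: mult_ac norm_minus_commute)
  also have "\<dots> = (\<integral>\<^sup>+y. G y * riesz F y \<partial>lborel)"
    unfolding riesz_def by (simp add: nn_integral_cmult)
  finally show ?thesis .
qed

lemma two_powers_shifted:
  fixes x z :: "real^3"
  assumes ab: "0 \<le> a" "a < 3" "0 \<le> b" "b < 3" "a + b > 3" and z: "z \<noteq> x"
  shows "(\<integral>\<^sup>+y. ennreal (norm (y - x) powr (-a) * norm (y - z) powr (-b)) \<partial>lborel)
    \<le> ennreal (4 * pi * (norm (z - x) / 2) powr (3 - a - b) * (1 / (3 - a) + 1 / (3 - b) + 2 / (a + b - 3)))"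
proof -
  have "(\<integral>\<^sup>+y. ennreal (norm (y - x) powr (-a) * norm (y - z) powr (-b)) \<partial>lborel)
    = (\<integral>\<^sup>+y. ennreal (norm (y - x) powr (-a) * norm ((y - x) - (z - x)) powr (-b)) \<partial>lborel)" by simp
  also have "\<dots> = (\<integral>\<^sup>+w. ennreal (norm w powr (-a) * norm (w - (z - x)) powr (-b)) \<partial>lborel)"
    by (rule nn_integral_shift[of "\<lambda>w. ennreal (norm w powr (-a) * norm (w - (z - x)) powr (-b))"]) measurable
  also have "\<dots> \<le> ennreal (4 * pi * (norm (z - x) / 2) powr (3 - a - b) * (1 / (3 - a) + 1 / (3 - b) + 2 / (a + b - 3)))"
    using z by (intro nn_integral_two_powers ab) auto
  finally show ?thesis .
qed

text \<open>Composing two Riesz kernels of order one gives a multiple of the Newtonian kernel, so the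
  \<open>L\<^sup>2\<close> norm of the field of a charge is controlled by its Coulomb energy.\<close>

lemma riesz_energy:
  assumes [measurable]: "F \<in> borel_measurable borel"
  shows "(\<integral>\<^sup>+y. (riesz F y)^2 \<partial>lborel) \<le> ennreal (32 * pi) * coulomb F F"
proof -
  let ?k = "\<lambda>y x. ennreal (norm (x - y) powr (-2))"
  have "(\<integral>\<^sup>+y. (riesz F y)^2 \<partial>lborel) = (\<integral>\<^sup>+y. \<integral>\<^sup>+x. F x * (?k y x * riesz F y) \<partial>lborel \<partial>lborel)"
    by (subst (2) riesz_def[abs_def], subst riesz_def[abs_def])
       (auto simp: power2_eq_square mult_ac simp flip: nn_integral_multc riesz_def intro!: nn_integral_cong)
  also have "\<dots> = (\<integral>\<^sup>+x. \<integral>\<^sup>+y. F x * (?k y x * riesz F y) \<partial>lborel \<partial>lborel)"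
    by (rule lborel_pair.Fubini') measurable
  also have "\<dots> = (\<integral>\<^sup>+x. F x * (\<integral>\<^sup>+y. ?k y x * riesz F y \<partial>lborel) \<partial>lborel)"
    by (simp add: nn_integral_cmult)
  also have "\<dots> \<le> (\<integral>\<^sup>+x. F x * (ennreal (32 * pi) * newton F x) \<partial>lborel)"
  proof (intro nn_integral_mono mult_left_mono)
    fix x
    have "(\<integral>\<^sup>+y. ?k y x * riesz F y \<partial>lborel) = (\<integral>\<^sup>+y. \<integral>\<^sup>+z. ennreal (norm (y - x) powr (-2) * norm (y - z) powr (-2)) * F z \<partial>lborel \<partial>lborel)"
      unfolding riesz_def by (simp add: nn_integral_cmult[symmetric] ennreal_mult mult.assoc norm_minus_commute)
    also have "\<dots> = (\<integral>\<^sup>+z. \<integral>\<^sup>+y. ennreal (norm (y - x) powr (-2) * norm (y - z) powr (-2)) * F z \<partial>lborel \<partial>lborel)"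
      by (rule lborel_pair.Fubini') measurable
    also have "\<dots> \<le> (\<integral>\<^sup>+z. ennreal (32 * pi) * (ennreal (norm (z - x) powr (-1)) * F z) \<partial>lborel)"
    proof (rule nn_integral_mono_AE, use AE_lborel_singleton[of x] in eventually_elim)
      case (elim z)
      have "(\<integral>\<^sup>+y. ennreal (norm (y - x) powr (-2) * norm (y - z) powr (-2)) \<partial>lborel) \<le>
        ennreal (4 * pi * (norm (z - x) / 2) powr (3 - 2 - 2) * (1 / (3 - 2) + 1 / (3 - 2) + 2 / (2 + 2 - 3)))"
        using elim by (intro two_powers_shifted) auto
      also have "4 * pi * (norm (z - x) / 2) powr (3 - 2 - 2) * (1 / (3 - 2) + 1 / (3 - 2) + 2 / (2 + 2 - 3)) = 32 * pi * norm (z - x) powr (-1)"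
        using elim by (simp add: powr_minus field_simps)
      finally have "(\<integral>\<^sup>+y. ennreal (norm (y - x) powr (-2) * norm (y - z) powr (-2)) \<partial>lborel) * F z \<le> ennreal (32 * pi * norm (z - x) powr (-1)) * F z"
        by (rule mult_right_mono) simp
      also have "(\<integral>\<^sup>+y. ennreal (norm (y - x) powr (-2) * norm (y - z) powr (-2)) \<partial>lborel) * F z
          = (\<integral>\<^sup>+y. ennreal (norm (y - x) powr (-2) * norm (y - z) powr (-2)) * F z \<partial>lborel)"
        by (rule nn_integral_multc[symmetric]) measurable
      also have "ennreal (32 * pi * norm (z - x) powr (-1)) = ennreal (32 * pi) * ennreal (norm (z - x) powr (-1))"
        by (rule ennreal_mult') simp
      finally show ?case by (simp only: mult.assoc)
    qed
    also have "\<dots> = ennreal (32 * pi) * newton F x"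
      unfolding newton_def by (rule nn_integral_cmult) measurable
    finally show "(\<integral>\<^sup>+y. ?k y x * riesz F y \<partial>lborel) \<le> ennreal (32 * pi) * newton F x" .
  qed simp
  also have "\<dots> = ennreal (32 * pi) * coulomb F F"
    unfolding coulomb_def by (subst nn_integral_cmult[symmetric]) (auto simp: mult_ac)
  finally show ?thesis .
qed

lemma ennreal_young:
  assumes "a \<ge> 0" "c > 0"
  shows "ennreal (c * a) * R \<le> ennreal (1/4 * a^2) + ennreal (c^2) * R^2"
proof (cases R)
  case (real r)
  have "c * a * r \<le> 1/4 * a^2 + c^2 * r^2"
    using sum_squares_bound[of "a/2" "c * r"] by (simp add: power_divide power_mult_distrib mult_ac)
  then show ?thesis using real assms
    by (simp add: ennreal_power ennreal_leI flip: ennreal_mult ennreal_plus)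
next
  case top
  then show ?thesis using assms by (simp add: ennreal_mult_top power2_eq_square)
qed

text \<open>Lions' inequality: \<open>u\<close> is bounded by the field of its gradient, and the field of the charge
  \<open>F\<close> by the Coulomb energy.\<close>

lemma lions_inequality:
  assumes u: "sobolev u g" and v: "sobolev v h" and [measurable]: "F \<in> borel_measurable borel"
  shows "ennreal (1 / (2 * sqrt 2)) * (\<integral>\<^sup>+x. F x * ennreal (\<bar>u x\<bar> + \<bar>v x\<bar>) \<partial>lborel)
    \<le> ennreal (1/4 * ((LBINT x. (norm (g x))^2) + (LBINT x. (norm (h x))^2))) + ennreal (1/4) * coulomb F F"
proof -
  note [measurable] = sobolevD(4,5)[OF u] sobolevD(4,5)[OF v]
  let ?b = "1 / (2 * sqrt 2) :: real"
  define c where "c = ?b / (4 * pi)"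
  have c: "c > 0" by (simp add: c_def)
  have c2: "2 * (c^2) * (32 * pi) \<le> 1/4"
  proof -
    have "2 * (c^2) * (32 * pi) = 1 / (2 * pi)"
      by (simp add: c_def power_divide power_mult_distrib field_simps) (simp add: power2_eq_square)
    also have "\<dots> \<le> 1/4" using pi_gt3 by (simp add: field_simps)
    finally show ?thesis .
  qed
  have one: "ennreal ?b * (\<integral>\<^sup>+x. F x * ennreal \<bar>u x\<bar> \<partial>lborel)
     \<le> ennreal (1/4 * (LBINT x. (norm (g x))^2)) + ennreal (c^2) * (\<integral>\<^sup>+y. (riesz F y)^2 \<partial>lborel)"
    if u: "sobolev u g" for u g
  proof -
    note [measurable] = sobolevD(4,5)[OF u]
    let ?G = "\<lambda>y. ennreal (norm (g y))"
    have "(\<integral>\<^sup>+x. F x * ennreal \<bar>u x\<bar> \<partial>lborel) \<le> (\<integral>\<^sup>+x. ennreal (1 / (4 * pi)) * (F x * riesz ?G x) \<partial>lborel)"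
      using sobolev_pointwise_bound[OF sobolevD(1-3)[OF u]]
      by (intro nn_integral_mono_AE, eventually_elim) (metis mult.left_commute mult_left_mono zero_le)
    also have "\<dots> = ennreal (1 / (4 * pi)) * (\<integral>\<^sup>+y. ?G y * riesz F y \<partial>lborel)"
      by (subst nn_integral_cmult) (auto simp: riesz_adjoint)
    finally have "ennreal ?b * (\<integral>\<^sup>+x. F x * ennreal \<bar>u x\<bar> \<partial>lborel) \<le> ennreal ?b * (ennreal (1 / (4 * pi)) * (\<integral>\<^sup>+y. ?G y * riesz F y \<partial>lborel))"
      by (rule mult_left_mono) simp
    also have "\<dots> = (\<integral>\<^sup>+y. ennreal (c * norm (g y)) * riesz F y \<partial>lborel)"
      using c by (simp add: c_def nn_integral_cmult[symmetric] mult.assoc[symmetric] ennreal_mult'[symmetric])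
    also have "\<dots> \<le> (\<integral>\<^sup>+y. ennreal (1/4 * (norm (g y))^2) + ennreal (c^2) * (riesz F y)^2 \<partial>lborel)"
      by (intro nn_integral_mono ennreal_young c) simp
    also have "\<dots> = (\<integral>\<^sup>+y. ennreal (1/4 * (norm (g y))^2) \<partial>lborel) + ennreal (c^2) * (\<integral>\<^sup>+y. (riesz F y)^2 \<partial>lborel)"
      by (subst nn_integral_add) (auto simp: nn_integral_cmult)
    also have "(\<integral>\<^sup>+y. ennreal (1/4 * (norm (g y))^2) \<partial>lborel) = ennreal (1/4 * (LBINT x. (norm (g x))^2))"
      using sobolevD(7)[OF u] by (subst nn_integral_eq_integral) auto
    finally show ?thesis .
  qed
  have "ennreal ?b * (\<integral>\<^sup>+x. F x * ennreal (\<bar>u x\<bar> + \<bar>v x\<bar>) \<partial>lborel)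
     = ennreal ?b * (\<integral>\<^sup>+x. F x * ennreal \<bar>u x\<bar> \<partial>lborel) + ennreal ?b * (\<integral>\<^sup>+x. F x * ennreal \<bar>v x\<bar> \<partial>lborel)"
    by (simp add: distrib_left nn_integral_add)
  also have "\<dots> \<le> (ennreal (1/4 * (LBINT x. (norm (g x))^2)) + ennreal (c^2) * (\<integral>\<^sup>+y. (riesz F y)^2 \<partial>lborel))
      + (ennreal (1/4 * (LBINT x. (norm (h x))^2)) + ennreal (c^2) * (\<integral>\<^sup>+y. (riesz F y)^2 \<partial>lborel))"
    by (intro add_mono one u v)
  also have "\<dots> = ennreal (1/4 * ((LBINT x. (norm (g x))^2) + (LBINT x. (norm (h x))^2))) + ennreal (2 * c^2) * (\<integral>\<^sup>+y. (riesz F y)^2 \<partial>lborel)"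
  proof -
    have "ennreal (2 * c^2) = ennreal (c^2) + ennreal (c^2)" by (simp flip: ennreal_plus)
    moreover have "ennreal (1/4 * ((LBINT x. (norm (g x))^2) + (LBINT x. (norm (h x))^2)))
       = ennreal (1/4 * (LBINT x. (norm (g x))^2)) + ennreal (1/4 * (LBINT x. (norm (h x))^2))"
      unfolding distrib_left by (rule ennreal_plus) auto
    ultimately show ?thesis by (simp only: distrib_right add_ac)
  qed
  also have "ennreal (2 * c^2) * (\<integral>\<^sup>+y. (riesz F y)^2 \<partial>lborel) \<le> ennreal (1/4) * coulomb F F"
  proof -
    have "ennreal (2 * c^2) * (\<integral>\<^sup>+y. (riesz F y)^2 \<partial>lborel) \<le> ennreal (2 * c^2) * (ennreal (32 * pi) * coulomb F F)"
      by (intro mult_left_mono riesz_energy) auto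
    also have "\<dots> = ennreal (2 * c^2 * (32 * pi)) * coulomb F F"
    proof -
      have "ennreal (2 * c^2 * (32 * pi)) = ennreal (2 * c^2) * ennreal (32 * pi)" by (rule ennreal_mult') simp
      then show ?thesis by (simp only: mult.assoc)
    qed
    also have "\<dots> \<le> ennreal (1/4) * coulomb F F" by (intro mult_right_mono ennreal_leI c2) auto
    finally show ?thesis .
  qed
  finally show ?thesis by simp
qed

text \<open>Hardy's inequality, by Schur's test for the kernel \<open>|y - x| powr (-1) |z - y| powr (-2)\<close> with
  weight \<open>|z - x| powr (3/2)\<close>.\<close>

lemma hardy_inequality:
  obtains C where "C > 0"
    "\<And>u g x. sobolev u g \<Longrightarrow> (\<integral>\<^sup>+y. ennreal (norm (y - x) powr (-2) * (u y)^2) \<partial>lborel) \<le> ennreal (C * (LBINT y. (norm (g y))^2))"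
proof -
  (* With the exponents 3/2 and 5/2 both convolutions converge at the two singularities and at infinity,
     and the weight cancels after the second integration. *)
  define C1 where "C1 = 4 * pi * (1/2) powr (-1/2) * (1 / (3 - 3/2) + 1 / (3 - 2) + 2 / (3/2 + 2 - 3))"
  define C2 where "C2 = 4 * pi * (1/2) powr (-3/2) * (1 / (3 - 5/2) + 1 / (3 - 2) + 2 / (5/2 + 2 - 3))"
  have C: "C1 > 0" "C2 > 0" by (auto simp: C1_def C2_def intro!: mult_pos_pos)
  define C where "C = (1 / (4 * pi))^2 * C1 * C2"
  show ?thesis
  proof
    show "C > 0" using C by (simp add: C_def)
    fix u g and x :: "real^3" assume u: "sobolev u g"
    note [measurable] = sobolevD(4,5)[OF u]
    let ?G = "\<lambda>z. ennreal (norm (g z))"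
    let ?W = "\<lambda>z. ennreal (norm (z - x) powr (3/2)) * (?G z)^2"
    have k1: "(\<integral>\<^sup>+z. ennreal (norm (z - x) powr (-3/2) * norm (z - y) powr (-2)) \<partial>lborel) \<le> ennreal (C1 * norm (y - x) powr (-1/2))" if "y \<noteq> x" for y
      using two_powers_shifted[of "3/2" 2 y x] that
      by (simp add: C1_def powr_divide field_simps)
    have k2: "(\<integral>\<^sup>+y. ennreal (norm (y - x) powr (-5/2) * norm (y - z) powr (-2)) \<partial>lborel) \<le> ennreal (C2 * norm (z - x) powr (-3/2))" if "z \<noteq> x" for z
      using two_powers_shifted[of "5/2" 2 z x] that
      by (simp add: C2_def powr_divide field_simps)
    have R: "(riesz ?G y)^2 \<le> ennreal (C1 * norm (y - x) powr (-1/2)) * (\<integral>\<^sup>+z. ennreal (norm (z - y) powr (-2)) * ?W z \<partial>lborel)" if y: "y \<noteq> x" for y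
    proof -
      let ?k = "\<lambda>z. norm (z - x) powr (-3/2) * norm (z - y) powr (-2)"
      have "riesz ?G y = (\<integral>\<^sup>+z. ennreal (?k z) * (ennreal (norm (z - x) powr (3/2)) * ?G z) \<partial>lborel)"
        unfolding riesz_def
      proof (rule nn_integral_cong_AE, use AE_lborel_singleton[of x] in eventually_elim)
        case (elim z)
        then have "norm (z - x) powr (-3/2) * norm (z - x) powr (3/2) = 1" by (simp flip: powr_add)
        then have "norm (z - y) powr (-2) = ?k z * norm (z - x) powr (3/2)" by (simp add: mult_ac)
        then have "ennreal (norm (z - y) powr (-2)) = ennreal (?k z * norm (z - x) powr (3/2))" by (rule arg_cong)
        also have "\<dots> = ennreal (?k z) * ennreal (norm (z - x) powr (3/2))" by (rule ennreal_mult) auto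
        finally show ?case by (simp only: mult.assoc)
      qed
      then have "(riesz ?G y)^2 \<le> (\<integral>\<^sup>+z. ennreal (?k z) \<partial>lborel) * (\<integral>\<^sup>+z. ennreal (?k z) * (ennreal (norm (z - x) powr (3/2)) * ?G z)^2 \<partial>lborel)"
        using cauchy_schwarz_weighted[of ?k lborel "\<lambda>z. ennreal (norm (z - x) powr (3/2)) * ?G z"] by simp
      also have "(\<integral>\<^sup>+z. ennreal (?k z) * (ennreal (norm (z - x) powr (3/2)) * ?G z)^2 \<partial>lborel) = (\<integral>\<^sup>+z. ennreal (norm (z - y) powr (-2)) * ?W z \<partial>lborel)"
      proof (rule nn_integral_cong_AE, use AE_lborel_singleton[of x] in eventually_elim)
        case (elim z)
        then have "norm (z - x) powr (-3/2) * norm (z - x) powr (3/2) = 1" by (simp flip: powr_add)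
        then have "?k z * (norm (z - x) powr (3/2))^2 = norm (z - y) powr (-2) * norm (z - x) powr (3/2)"
          by (simp add: power2_eq_square mult_ac)
        then have "ennreal (?k z) * (ennreal (norm (z - x) powr (3/2)))^2 = ennreal (norm (z - y) powr (-2)) * ennreal (norm (z - x) powr (3/2))"
          by (simp add: ennreal_power flip: ennreal_mult)
        then show ?case by (simp only: power_mult_distrib mult.assoc[symmetric])
      qed
      also have "(\<integral>\<^sup>+z. ennreal (?k z) \<partial>lborel) * (\<integral>\<^sup>+z. ennreal (norm (z - y) powr (-2)) * ?W z \<partial>lborel)
         \<le> ennreal (C1 * norm (y - x) powr (-1/2)) * (\<integral>\<^sup>+z. ennreal (norm (z - y) powr (-2)) * ?W z \<partial>lborel)"
        by (intro mult_right_mono k1 y) auto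
      finally show ?thesis .
    qed
    have "(\<integral>\<^sup>+y. ennreal (norm (y - x) powr (-2) * (u y)^2) \<partial>lborel)
       \<le> (\<integral>\<^sup>+y. ennreal ((1 / (4 * pi))^2 * C1) * (\<integral>\<^sup>+z. ennreal (norm (y - x) powr (-5/2) * norm (y - z) powr (-2)) * ?W z \<partial>lborel) \<partial>lborel)"
    proof (rule nn_integral_mono_AE, use sobolev_pointwise_bound[OF sobolevD(1-3)[OF u]] AE_lborel_singleton[of x] in eventually_elim)
      case (elim y)
      have "ennreal ((u y)^2) = (ennreal \<bar>u y\<bar>)^2" by (simp add: ennreal_power)
      also have "\<dots> \<le> (ennreal (1 / (4 * pi)) * riesz ?G y)^2" by (intro power_mono elim) auto
      also have "\<dots> = ennreal ((1 / (4 * pi))^2) * (riesz ?G y)^2" by (simp add: power_mult_distrib ennreal_power)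
      also have "\<dots> \<le> ennreal ((1 / (4 * pi))^2) * (ennreal (C1 * norm (y - x) powr (-1/2)) * (\<integral>\<^sup>+z. ennreal (norm (z - y) powr (-2)) * ?W z \<partial>lborel))"
        by (intro mult_left_mono R elim) auto
      finally have "ennreal (norm (y - x) powr (-2)) * ennreal ((u y)^2) \<le> ennreal (norm (y - x) powr (-2)) *
         (ennreal ((1 / (4 * pi))^2) * (ennreal (C1 * norm (y - x) powr (-1/2)) * (\<integral>\<^sup>+z. ennreal (norm (z - y) powr (-2)) * ?W z \<partial>lborel)))"
        by (rule mult_left_mono) simp
      also have "\<dots> = ennreal ((1 / (4 * pi))^2 * C1) * (ennreal (norm (y - x) powr (-2) * norm (y - x) powr (-1/2)) * (\<integral>\<^sup>+z. ennreal (norm (z - y) powr (-2)) * ?W z \<partial>lborel))"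
        using C by (simp add: ennreal_mult mult_ac)
      also have "norm (y - x) powr (-2) * norm (y - x) powr (-1/2) = norm (y - x) powr (-5/2)" by (simp flip: powr_add)
      also have "ennreal (norm (y - x) powr (-5/2)) * (\<integral>\<^sup>+z. ennreal (norm (z - y) powr (-2)) * ?W z \<partial>lborel)
        = (\<integral>\<^sup>+z. ennreal (norm (y - x) powr (-5/2) * norm (y - z) powr (-2)) * ?W z \<partial>lborel)"
        by (subst nn_integral_cmult[symmetric]) (auto simp: ennreal_mult mult.assoc norm_minus_commute)
      finally show ?case by (simp add: ennreal_mult)
    qed
    also have "\<dots> = ennreal ((1 / (4 * pi))^2 * C1) * (\<integral>\<^sup>+y. \<integral>\<^sup>+z. ennreal (norm (y - x) powr (-5/2) * norm (y - z) powr (-2)) * ?W z \<partial>lborel \<partial>lborel)"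
      by (rule nn_integral_cmult) measurable
    also have "(\<integral>\<^sup>+y. \<integral>\<^sup>+z. ennreal (norm (y - x) powr (-5/2) * norm (y - z) powr (-2)) * ?W z \<partial>lborel \<partial>lborel)
      = (\<integral>\<^sup>+z. \<integral>\<^sup>+y. ennreal (norm (y - x) powr (-5/2) * norm (y - z) powr (-2)) * ?W z \<partial>lborel \<partial>lborel)"
      by (rule lborel_pair.Fubini') measurable
    also have "\<dots> \<le> (\<integral>\<^sup>+z. ennreal C2 * (?G z)^2 \<partial>lborel)"
    proof (rule nn_integral_mono_AE, use AE_lborel_singleton[of x] in eventually_elim)
      case (elim z)
      have "(\<integral>\<^sup>+y. ennreal (norm (y - x) powr (-5/2) * norm (y - z) powr (-2)) * ?W z \<partial>lborel)
        = (\<integral>\<^sup>+y. ennreal (norm (y - x) powr (-5/2) * norm (y - z) powr (-2)) \<partial>lborel) * ?W z"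
        by (rule nn_integral_multc) measurable
      also have "\<dots> \<le> ennreal (C2 * norm (z - x) powr (-3/2)) * ?W z" by (intro mult_right_mono k2 elim) auto
      also have "\<dots> = ennreal (C2 * (norm (z - x) powr (-3/2) * norm (z - x) powr (3/2))) * (?G z)^2"
        using C by (simp add: ennreal_mult mult.assoc)
      also have "norm (z - x) powr (-3/2) * norm (z - x) powr (3/2) = 1" using elim by (simp flip: powr_add)
      finally show ?case by simp
    qed
    also have "(\<integral>\<^sup>+z. ennreal C2 * (?G z)^2 \<partial>lborel) = ennreal C2 * ennreal (LBINT y. (norm (g y))^2)"
      using power2_integral_nn[OF sobolevD(7)[OF u]] by (simp add: nn_integral_cmult)
    finally show "(\<integral>\<^sup>+y. ennreal (norm (y - x) powr (-2) * (u y)^2) \<partial>lborel) \<le> ennreal (C * (LBINT y. (norm (g y))^2))"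
      using C by (simp add: C_def mult_left_mono flip: ennreal_mult mult.assoc)
  qed
qed

definition nsq :: "(real^3 \<Rightarrow> real) \<Rightarrow> (real^3 \<Rightarrow> real^3) \<Rightarrow> real" where
  "nsq u g = (LBINT y. (u y)^2) + (LBINT y. (norm (g y))^2)"

lemma nsq_nonneg: "0 \<le> nsq u g" by (simp add: nsq_def)

lemma nsq_scale: "nsq (\<lambda>x. c * u x) (\<lambda>x. c *\<^sub>R g x) = c^2 * nsq u g"
  by (simp add: nsq_def power_mult_distrib distrib_left)

text \<open>By Hardy's inequality, since the kernel \<open>norm (y - x) powr (-1)\<close> is at most \<open>1\<close> plus its square.\<close>

lemma newton_bound:
  obtains K where "K > 0"
    "\<And>u g x. sobolev u g \<Longrightarrow> newton (\<lambda>y. ennreal ((u y)^2)) x \<le> ennreal (K * nsq u g)"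
proof -
  obtain C where C: "C > 0"
    "\<And>u g x. sobolev u g \<Longrightarrow> (\<integral>\<^sup>+y. ennreal (norm (y - x) powr (-2) * (u y)^2) \<partial>lborel) \<le> ennreal (C * (LBINT y. (norm (g y))^2))"
    using hardy_inequality by blast
  show ?thesis
  proof
    show "C + 1 > 0" using C by simp
    fix u g and x :: "real^3" assume u: "sobolev u g"
    note [measurable] = sobolevD(4,5)[OF u]
    have "newton (\<lambda>y. ennreal ((u y)^2)) x \<le> (\<integral>\<^sup>+y. ennreal ((u y)^2) + ennreal (norm (y - x) powr (-2) * (u y)^2) \<partial>lborel)"
      unfolding newton_def
    proof (rule nn_integral_mono)
      fix y
      have "t powr (-1) \<le> 1 + t powr (-2)" if "t \<ge> 0" for t :: real
      proof (cases "t \<ge> 1")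
        case True
        then have "t powr (-1) \<le> 1" using ge_one_powr_ge_zero[of t 1] by (simp add: powr_minus inverse_le_1_iff)
        then show ?thesis by (simp add: add_increasing2)
      next
        case False
        then show ?thesis
        proof (cases "t = 0")
          case False
          have "1 / t \<le> 1 / t^2" using False \<open>\<not> t \<ge> 1\<close> that by (intro divide_left_mono) (auto simp: power2_eq_square mult_left_le)
          then have "t powr (-1) \<le> t powr (-2)" using False that by (simp add: powr_minus powr_numeral inverse_eq_divide)
          then show ?thesis by simp
        qed simp
      qed
      from mult_right_mono[OF this[of "norm (y - x)"], of "(u y)^2"]
      show "ennreal (norm (y - x) powr (-1)) * ennreal ((u y)^2) \<le> ennreal ((u y)^2) + ennreal (norm (y - x) powr (-2) * (u y)^2)"
        by (subst ennreal_mult[symmetric]) (auto intro!: ennreal_le_plus simp: distrib_right)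
    qed
    also have "\<dots> = (\<integral>\<^sup>+y. ennreal ((u y)^2) \<partial>lborel) + (\<integral>\<^sup>+y. ennreal (norm (y - x) powr (-2) * (u y)^2) \<partial>lborel)"
      by (rule nn_integral_add) measurable
    also have "\<dots> \<le> ennreal (LBINT y. (u y)^2) + ennreal (C * (LBINT y. (norm (g y))^2))"
      using sobolevD(6)[OF u] by (intro add_mono C u) (simp add: nn_integral_eq_integral)
    also have "\<dots> = ennreal ((LBINT y. (u y)^2) + C * (LBINT y. (norm (g y))^2))"
      using C by (intro ennreal_plus[symmetric]) auto
    also have "\<dots> \<le> ennreal ((C + 1) * nsq u g)"
      using C by (intro ennreal_leI) (simp add: nsq_def algebra_simps)
    finally show "newton (\<lambda>y. ennreal ((u y)^2)) x \<le> ennreal ((C + 1) * nsq u g)" .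
  qed
qed

lemma sobolev_zero: "sobolev (\<lambda>x. 0) (\<lambda>x. 0)"
proof -
  have "has_weak_gradient (\<lambda>x. 0) (\<lambda>x. 0)" by (simp add: has_weak_gradient_def)
  then show ?thesis by (simp add: sobolev_def square_integrable_def)
qed

text \<open>Lions' inequality for the charge \<open>u\<^sup>2\<close> embeds the Sobolev space into \<open>L\<^sup>3\<close>.\<close>

lemma L3_bound:
  obtains K where "K > 0"
    "\<And>u g t. sobolev u g \<Longrightarrow> t > 0 \<Longrightarrow> nsq u g \<le> t^2 \<Longrightarrow> integrable lborel (\<lambda>x. \<bar>u x\<bar>^3)"
    "\<And>u g t. sobolev u g \<Longrightarrow> t > 0 \<Longrightarrow> nsq u g \<le> t^2 \<Longrightarrow> (LBINT x. \<bar>u x\<bar>^3) \<le> K * t^3"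
proof -
  obtain C where C: "C > 0" "\<And>u g x. sobolev u g \<Longrightarrow> newton (\<lambda>y. ennreal ((u y)^2)) x \<le> ennreal (C * nsq u g)"
    using newton_bound by blast
  define K where "K = 2 * sqrt 2 * ((1 + C) / 4)"
  have K: "K > 0" using C by (simp add: K_def)
  have one: "(\<integral>\<^sup>+x. ennreal (\<bar>u x\<bar>^3) \<partial>lborel) \<le> ennreal K" if u: "sobolev u g" and n: "nsq u g \<le> 1" for u g
  proof -
    note [measurable] = sobolevD(4,5)[OF u]
    let ?F = "\<lambda>y. ennreal ((u y)^2)"
    have "0 \<le> (LBINT y. (u y)^2)" "0 \<le> (LBINT y. (norm (g y))^2)" by simp_all
    then have b: "(LBINT y. (u y)^2) \<le> 1" "(LBINT y. (norm (g y))^2) \<le> 1"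
      using n[unfolded nsq_def] by linarith+
    have "coulomb ?F ?F \<le> (\<integral>\<^sup>+x. ?F x * ennreal C \<partial>lborel)"
      unfolding coulomb_def
    proof (intro nn_integral_mono mult_left_mono)
      fix x
      have "newton ?F x \<le> ennreal (C * nsq u g)" by (rule C(2)[OF u])
      also have "\<dots> \<le> ennreal C" using n C(1) by (intro ennreal_leI) (simp add: mult_left_le)
      finally show "newton ?F x \<le> ennreal C" .
    qed simp
    also have "\<dots> = ennreal (LBINT y. (u y)^2) * ennreal C"
      using sobolevD(6)[OF u] by (simp add: nn_integral_multc nn_integral_eq_integral)
    also have "\<dots> \<le> ennreal 1 * ennreal C" by (intro mult_right_mono ennreal_leI b) auto
    finally have co: "coulomb ?F ?F \<le> ennreal C" by simp
    have "ennreal (1 / (2 * sqrt 2)) * (\<integral>\<^sup>+x. ?F x * ennreal \<bar>u x\<bar> \<partial>lborel)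
       \<le> ennreal (1/4 * (LBINT x. (norm (g x))^2)) + ennreal (1/4) * coulomb ?F ?F"
      using lions_inequality[OF u sobolev_zero, of ?F] by simp
    also have "\<dots> \<le> ennreal (1/4) + ennreal (1/4) * ennreal C"
      using b co by (intro add_mono mult_left_mono ennreal_leI) auto
    also have "\<dots> = ennreal ((1 + C) / 4)"
    proof -
      have "ennreal (1/4) * ennreal C = ennreal (C/4)" using C by (subst ennreal_mult[symmetric]) auto
      moreover have "ennreal (1/4) + ennreal (C/4) = ennreal (1/4 + C/4)" using C by (intro ennreal_plus[symmetric]) auto
      ultimately show ?thesis by (simp only: add_divide_distrib)
    qed
    finally have "ennreal (2 * sqrt 2) * (ennreal (1 / (2 * sqrt 2)) * (\<integral>\<^sup>+x. ?F x * ennreal \<bar>u x\<bar> \<partial>lborel))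
      \<le> ennreal (2 * sqrt 2) * ennreal ((1 + C) / 4)" by (rule mult_left_mono) simp
    moreover have "ennreal (2 * sqrt 2) * (ennreal (1 / (2 * sqrt 2)) * X) = X" for X
    proof -
      have "ennreal (2 * sqrt 2) * ennreal (1 / (2 * sqrt 2)) = ennreal (2 * sqrt 2 * (1 / (2 * sqrt 2)))"
        by (rule ennreal_mult'[symmetric]) simp
      also have "2 * sqrt 2 * (1 / (2 * sqrt 2)) = (1::real)" by simp
      finally have "ennreal (2 * sqrt 2) * ennreal (1 / (2 * sqrt 2)) = 1" by (simp only: ennreal_1)
      then show ?thesis by (simp only: mult.assoc[symmetric] mult_1)
    qed
    moreover have "ennreal (2 * sqrt 2) * ennreal ((1 + C) / 4) = ennreal K"
      unfolding K_def by (rule ennreal_mult'[symmetric]) simp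
    moreover have "?F x * ennreal \<bar>u x\<bar> = ennreal (\<bar>u x\<bar>^3)" for x
      by (subst ennreal_mult[symmetric]) (auto simp: power3_eq_cube power2_eq_square abs_mult_self_eq)
    ultimately show ?thesis by (simp only:)
  qed
  (* Both sides are homogeneous of degree three, so the bound for the unit ball scales. *)
  have all: "(\<integral>\<^sup>+x. ennreal (\<bar>u x\<bar>^3) \<partial>lborel) \<le> ennreal (K * t^3)" if u: "sobolev u g" and t: "t > 0" and n: "nsq u g \<le> t^2" for u g t
  proof -
    note [measurable] = sobolevD(4,5)[OF u]
    have "nsq (\<lambda>x. inverse t * u x) (\<lambda>x. inverse t *\<^sub>R g x) \<le> 1"
      unfolding nsq_scale using n t by (simp add: power_inverse field_simps)
    from one[OF sobolev_scale[OF u] this]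
    have "ennreal (t^3) * (\<integral>\<^sup>+x. ennreal (\<bar>inverse t * u x\<bar>^3) \<partial>lborel) \<le> ennreal (t^3) * ennreal K"
      by (rule mult_left_mono) simp
    also have "ennreal (t^3) * ennreal K = ennreal (K * t^3)" using t K by (simp add: mult.commute flip: ennreal_mult)
    also have "ennreal (t^3) * (\<integral>\<^sup>+x. ennreal (\<bar>inverse t * u x\<bar>^3) \<partial>lborel) = (\<integral>\<^sup>+x. ennreal (\<bar>u x\<bar>^3) \<partial>lborel)"
      using t by (subst nn_integral_cmult[symmetric])
        (auto simp: ennreal_mult[symmetric] abs_mult power_mult_distrib power_inverse intro!: nn_integral_cong)
    finally show ?thesis .
  qed
  show ?thesis
  proof (rule that[OF K])
    fix u g t assume u: "sobolev u g" and t: "(t::real) > 0" and n: "nsq u g \<le> t^2"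
    note [measurable] = sobolevD(4,5)[OF u]
    show i: "integrable lborel (\<lambda>x. \<bar>u x\<bar>^3)"
      by (rule integrableI_bounded) (use le_less_trans[OF all[OF u t n] ennreal_less_top] in auto)
    show "(LBINT x. \<bar>u x\<bar>^3) \<le> K * t^3"
      using all[OF u t n] K t by (subst (asm) nn_integral_eq_integral[OF i]) (auto simp: ennreal_le_iff)
  qed
qed

section \<open>Compactness\<close>

lemma tendsto_le_liminf: "f \<longlonglongrightarrow> l \<Longrightarrow> l \<le> liminf f" for l :: ennreal
  using lim_imp_Liminf[of sequentially f l] by simp

lemma ennreal_le_suminf: "f k \<le> (\<Sum>k. f k)" for f :: "nat \<Rightarrow> ennreal"
  using sum_le_suminf[OF summableI, of "{k}" f] by simp

text \<open>Completeness of \<open>L\<^sup>2\<close>: a subsequence with summable differences converges almost everywhere, and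
  Fatou's lemma identifies the limit in the mean.\<close>

lemma complete_L2:
  fixes f :: "nat \<Rightarrow> 'a \<Rightarrow> 'b::euclidean_space"
  assumes [measurable]: "\<And>n. f n \<in> borel_measurable M"
    and cauchy: "\<And>e. e > 0 \<Longrightarrow> \<exists>N. \<forall>m\<ge>N. \<forall>n\<ge>N. (\<integral>\<^sup>+x. ennreal ((norm (f m x - f n x))^2) \<partial>M) \<le> ennreal e"
  obtains r F where "strict_mono (r::nat \<Rightarrow> nat)" "F \<in> borel_measurable M" "AE x in M. (\<lambda>n. f (r n) x) \<longlonglongrightarrow> F x"
    "\<And>e. e > 0 \<Longrightarrow> \<exists>N. \<forall>n\<ge>N. (\<integral>\<^sup>+x. ennreal ((norm (f n x - F x))^2) \<partial>M) \<le> ennreal e"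
proof -
  have "\<exists>N. \<forall>k. \<forall>m\<ge>N k. \<forall>n\<ge>N k. (\<integral>\<^sup>+x. ennreal ((norm (f m x - f n x))^2) \<partial>M) \<le> ennreal ((1/4)^k)"
    using cauchy by (intro choice allI) auto
  then obtain N where N: "\<And>k m n. m \<ge> N k \<Longrightarrow> n \<ge> N k \<Longrightarrow> (\<integral>\<^sup>+x. ennreal ((norm (f m x - f n x))^2) \<partial>M) \<le> ennreal ((1/4)^k)"
    by blast
  define r where "r = rec_nat (N 0) (\<lambda>k rk. max (Suc rk) (N (Suc k)))"
  have rS: "r (Suc k) = max (Suc (r k)) (N (Suc k))" and r0: "r 0 = N 0" for k by (auto simp: r_def)
  have r: "strict_mono r" unfolding strict_mono_Suc_iff by (simp add: rS less_max_iff_disj)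
  have rN: "r k \<ge> N k" for k by (cases k) (auto simp: rS r0)
  define D where "D k x = norm (f (r (Suc k)) x - f (r k) x)" for k x
  have [measurable]: "D k \<in> borel_measurable M" for k unfolding D_def[abs_def] by measurable
  have "(\<integral>\<^sup>+x. (\<Sum>k. ennreal (2^k * (D k x)^2)) \<partial>M) = (\<Sum>k. \<integral>\<^sup>+x. ennreal (2^k * (D k x)^2) \<partial>M)"
    by (rule nn_integral_suminf) measurable
  also have "\<dots> \<le> (\<Sum>k. ennreal ((1/2)^k))"
  proof (rule suminf_le)
    fix k
    have "(\<integral>\<^sup>+x. ennreal (2^k * (D k x)^2) \<partial>M) = ennreal (2^k) * (\<integral>\<^sup>+x. ennreal ((D k x)^2) \<partial>M)"
      by (subst nn_integral_cmult[symmetric]) (auto simp: ennreal_mult)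
    also have "\<dots> \<le> ennreal (2^k) * ennreal ((1/4)^k)"
      unfolding D_def using rN[of k] rN[of "Suc k"] rS[of k] by (intro mult_left_mono N) (auto intro: order_trans)
    also have "\<dots> = ennreal ((1/2)^k)" by (subst ennreal_mult[symmetric]) (auto simp: power_mult_distrib[symmetric])
    finally show "(\<integral>\<^sup>+x. ennreal (2^k * (D k x)^2) \<partial>M) \<le> ennreal ((1/2)^k)" .
  qed auto
  also have "\<dots> < \<infinity>" by (subst suminf_ennreal2) (auto intro: summable_geometric)
  finally have "AE x in M. (\<Sum>k. ennreal (2^k * (D k x)^2)) \<noteq> \<infinity>" by (intro nn_integral_PInf_AE) auto
  then have conv: "AE x in M. convergent (\<lambda>n. f (r n) x)"
  proof eventually_elim
    case (elim x)
    define C where "C = enn2real (\<Sum>k. ennreal (2^k * (D k x)^2))"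
    have b: "2^k * (D k x)^2 \<le> C" for k
    proof -
      have "ennreal (2^k * (D k x)^2) \<le> (\<Sum>k. ennreal (2^k * (D k x)^2))"
        by (rule ennreal_le_suminf)
      also have "\<dots> = ennreal C"
        unfolding C_def by (rule ennreal_enn2real[symmetric]) (use elim in \<open>simp only: less_top infinity_ennreal_def\<close>)
      finally show ?thesis by (simp add: C_def ennreal_le_iff)
    qed
    have C0: "C \<ge> 0" by (simp add: C_def)
    have Dk: "D k x \<le> sqrt C * (sqrt (1/2))^k" for k
    proof -
      have "(D k x)^2 \<le> C * (1/2)^k" using b[of k] by (simp add: power_divide field_simps)
      then have "D k x \<le> sqrt (C * (1/2)^k)" by (rule real_le_rsqrt)
      then show ?thesis by (simp add: real_sqrt_mult real_sqrt_power)
    qed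
    have "summable (\<lambda>k. sqrt C * (sqrt (1/2))^k)"
      by (intro summable_mult summable_geometric) (auto simp: real_sqrt_lt_1_iff)
    then have "summable (\<lambda>k. f (r (Suc k)) x - f (r k) x)"
      by (rule summable_comparison_test') (use Dk in \<open>auto simp: D_def\<close>)
    then have "convergent (\<lambda>n. \<Sum>k<n. f (r (Suc k)) x - f (r k) x)" by (simp add: summable_iff_convergent)
    then have "convergent (\<lambda>n. f (r n) x - f (r 0) x)" using sum_lessThan_telescope[of "\<lambda>k. f (r k) x"] by simp
    then obtain l where "(\<lambda>n. f (r n) x - f (r 0) x) \<longlonglongrightarrow> l" by (auto simp: convergent_def)
    from tendsto_add[OF this tendsto_const[of "f (r 0) x"]] show ?case by (auto simp: convergent_def)
  qed
  define F where "F x = lim (\<lambda>n. f (r n) x)" for x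
  have [measurable]: "F \<in> borel_measurable M" unfolding F_def[abs_def] by measurable
  have lim: "AE x in M. (\<lambda>n. f (r n) x) \<longlonglongrightarrow> F x"
    using conv by eventually_elim (simp add: F_def convergent_LIMSEQ_iff)
  show ?thesis
  proof (rule that[OF r _ lim])
    fix e :: real assume "e > 0"
    then obtain N' where N': "\<And>m n. m \<ge> N' \<Longrightarrow> n \<ge> N' \<Longrightarrow> (\<integral>\<^sup>+x. ennreal ((norm (f m x - f n x))^2) \<partial>M) \<le> ennreal e"
      using cauchy by blast
    have "(\<integral>\<^sup>+x. ennreal ((norm (f n x - F x))^2) \<partial>M) \<le> ennreal e" if n: "n \<ge> N'" for n
    proof -
      have "(\<integral>\<^sup>+x. ennreal ((norm (f n x - F x))^2) \<partial>M) \<le> (\<integral>\<^sup>+x. liminf (\<lambda>k. ennreal ((norm (f n x - f (r k) x))^2)) \<partial>M)"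
      proof (rule nn_integral_mono_AE, use lim in eventually_elim)
        case (elim x)
        then have "(\<lambda>k. ennreal ((norm (f n x - f (r k) x))^2)) \<longlonglongrightarrow> ennreal ((norm (f n x - F x))^2)"
          by (intro tendsto_ennrealI tendsto_intros)
        then show ?case by (rule tendsto_le_liminf)
      qed
      also have "\<dots> \<le> liminf (\<lambda>k. \<integral>\<^sup>+x. ennreal ((norm (f n x - f (r k) x))^2) \<partial>M)"
        by (rule nn_integral_liminf) measurable
      also have "\<dots> \<le> liminf (\<lambda>k. ennreal e)"
      proof (rule Liminf_mono)
        have "\<forall>\<^sub>F k in sequentially. r k \<ge> N'" using filterlim_subseq[OF r] by (simp add: filterlim_at_top)
        then show "\<forall>\<^sub>F k in sequentially. (\<integral>\<^sup>+x. ennreal ((norm (f n x - f (r k) x))^2) \<partial>M) \<le> ennreal e"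
          by eventually_elim (use N' n in auto)
      qed
      finally show ?thesis by (simp add: Liminf_const)
    qed
    then show "\<exists>N. \<forall>n\<ge>N. (\<integral>\<^sup>+x. ennreal ((norm (f n x - F x))^2) \<partial>M) \<le> ennreal e" by blast
  qed measurable
qed

lemma regdist_lipschitz: "\<bar>regdist \<delta> w - regdist \<delta> w'\<bar> \<le> norm (w - w')"
proof -
  have e: "regdist \<delta> w = norm (w, \<delta>)" for w by (simp add: regdist_def norm_prod_def)
  have "\<bar>norm (w, \<delta>) - norm (w', \<delta>)\<bar> \<le> norm ((w, \<delta>) - (w', \<delta>))" by (rule norm_triangle_ineq3)
  then show ?thesis by (simp add: e norm_prod_def)
qed

lemma eta_lipschitz:
  assumes d: "\<delta> > 0" obtains L where "L > 0" "\<And>w w'. \<bar>eta \<delta> w - eta \<delta> w'\<bar> \<le> L * norm (w - w')"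
proof
  show "3 * \<delta>^2 / (4 * pi) * (5 / \<delta>^6) > 0" using d by simp
  fix w w' :: "real^3"
  define i where "i w = inverse (regdist \<delta> w)" for w
  have s: "regdist \<delta> w > 0" for w using d by (simp add: regdist_pos)
  have i: "0 < i w" "\<delta> * i w \<le> 1" for w
    using s regdist_ge(2)[of \<delta> w] by (auto simp: i_def field_simps)
  have ij: "\<bar>i w - i w'\<bar> \<le> norm (w - w') / \<delta>^2"
  proof -
    have "i w - i w' = (regdist \<delta> w' - regdist \<delta> w) * (i w * i w')"
      using s[of w] s[of w'] by (simp add: i_def field_simps)
    also have "\<bar>\<dots>\<bar> = \<bar>regdist \<delta> w' - regdist \<delta> w\<bar> * (i w * i w')"
      using i(1)[of w] i(1)[of w'] by (simp add: abs_mult)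
    also have "\<dots> \<le> norm (w - w') * (1 / \<delta> * (1 / \<delta>))"
      using i(1)[of w] i(1)[of w'] i(2)[of w] i(2)[of w'] d regdist_lipschitz[of \<delta> w' w]
      by (intro mult_mono) (auto simp: norm_minus_commute field_simps)
    finally show ?thesis by (simp add: power2_eq_square)
  qed
  have "\<bar>(\<delta> * i w)^5 - (\<delta> * i w')^5\<bar> \<le> 5 * \<bar>\<delta> * i w - \<delta> * i w'\<bar>"
    using norm_power_diff[of "\<delta> * i w" "\<delta> * i w'" 5] i d by (simp add: abs_mult less_imp_le)
  also have "\<dots> = 5 * \<delta> * \<bar>i w - i w'\<bar>" using d by (simp add: abs_mult flip: right_diff_distrib)
  also have "\<dots> \<le> 5 * \<delta> * (norm (w - w') / \<delta>^2)" using ij d by (intro mult_left_mono) auto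
  finally have "\<delta>^5 * \<bar>i w^5 - i w'^5\<bar> \<le> 5 * \<delta> * (norm (w - w') / \<delta>^2)"
    using d by (simp add: power_mult_distrib abs_mult flip: right_diff_distrib)
  then have h: "\<bar>i w^5 - i w'^5\<bar> \<le> 5 * \<delta> * (norm (w - w') / \<delta>^2) / \<delta>^5"
    using d by (simp add: pos_le_divide_eq mult.commute)
  have e: "eta \<delta> w = 3 * \<delta>^2 / (4 * pi) * i w^5" for w
    by (simp add: eta_def i_def inverse_eq_divide power_one_over)
  have "\<bar>eta \<delta> w - eta \<delta> w'\<bar> = 3 * \<delta>^2 / (4 * pi) * \<bar>i w^5 - i w'^5\<bar>"
    unfolding e right_diff_distrib[symmetric] abs_mult by simp
  also have "\<dots> \<le> 3 * \<delta>^2 / (4 * pi) * (5 * \<delta> * (norm (w - w') / \<delta>^2) / \<delta>^5)"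
    by (rule mult_left_mono[OF h]) simp
  also have "5 * \<delta> * (norm (w - w') / \<delta>^2) / \<delta>^5 = 5 / \<delta>^6 * norm (w - w')"
    using d by (simp add: field_simps) (simp add: numeral_eq_Suc)
  finally show "\<bar>eta \<delta> w - eta \<delta> w'\<bar> \<le> 3 * \<delta>^2 / (4 * pi) * (5 / \<delta>^6) * norm (w - w')" by (simp only: mult.assoc)
qed

text \<open>A uniform modulus of continuity on bounded sets of \<open>L\<^sup>2\<close>, so that the theorem of Arzela and Ascoli
  applies to the mollified sequence.\<close>

lemma mollify_equicontinuous:
  assumes d: "\<delta> > 0" and M: "M \<ge> 0" and e: "e > 0"
  obtains s where "s > 0"
    "\<And>u x x'. square_integrable u \<Longrightarrow> (LBINT y. (u y)^2) \<le> M \<Longrightarrow> norm (x - x') < s \<Longrightarrow> \<bar>mollify \<delta> u x - mollify \<delta> u x'\<bar> < e"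
proof -
  obtain L where L: "L > 0" "\<And>w w'. \<bar>eta \<delta> w - eta \<delta> w'\<bar> \<le> L * norm (w - w')" using eta_lipschitz[OF d] by blast
  define t where "t = e / (2 * (M + 1))"
  have t: "t > 0" using M e by (simp add: t_def)
  show ?thesis
  proof
    show "t * e / (4 * L) > 0" using t e L by simp
    fix u and x x' :: "real^3"
    assume u: "square_integrable u" and uM: "(LBINT y. (u y)^2) \<le> M" and xx: "norm (x - x') < t * e / (4 * L)"
    note [measurable] = square_integrableD(1)[OF u]
    have u2: "integrable lborel (\<lambda>y. (u y)^2)" using square_integrableD(2)[OF u] by simp
    let ?d = "\<lambda>y. eta \<delta> (y - x) - eta \<delta> (y - x')"
    have e1: "integrable lborel (\<lambda>y. eta \<delta> (y - x))" "(LBINT y. eta \<delta> (y - x)) = 1" for x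
      using integrable_shift[OF integrable_eta(1)[OF d], of x] integrable_eta(3)[OF d] by auto
    have ib: "integrable lborel (\<lambda>y. L * norm (x - x') * (eta \<delta> (y - x) + eta \<delta> (y - x')))"
      by (intro integrable_mult_right Bochner_Integration.integrable_add e1)
    have pb: "(?d y)^2 \<le> L * norm (x - x') * (eta \<delta> (y - x) + eta \<delta> (y - x'))" for y
    proof -
      have "\<bar>?d y\<bar> \<le> L * norm (x - x')" using L(2)[of "y - x" "y - x'"] by (simp add: norm_minus_commute)
      moreover have "\<bar>?d y\<bar> \<le> eta \<delta> (y - x) + eta \<delta> (y - x')"
        using eta_nonneg[OF d, of "y - x"] eta_nonneg[OF d, of "y - x'"] by linarith
      ultimately have "\<bar>?d y\<bar> * \<bar>?d y\<bar> \<le> L * norm (x - x') * (eta \<delta> (y - x) + eta \<delta> (y - x'))"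
        using L(1) by (intro mult_mono) auto
      then show ?thesis by (simp add: power2_eq_square)
    qed
    have i2: "integrable lborel (\<lambda>y. (?d y)^2)"
      by (rule Bochner_Integration.integrable_bound[OF ib]) (use pb in \<open>auto intro!: AE_I2 intro: order_trans[OF _ abs_ge_self]\<close>)
    have "(LBINT y. (?d y)^2) \<le> (LBINT y. L * norm (x - x') * (eta \<delta> (y - x) + eta \<delta> (y - x')))"
      by (intro integral_mono i2 ib pb)
    also have "\<dots> = 2 * L * norm (x - x')" using e1 by simp
    finally have d2: "(LBINT y. (?d y)^2) \<le> 2 * L * norm (x - x')" .
    have sq: "square_integrable ?d" using i2 by (simp add: square_integrable_def)
    have "mollify \<delta> u x - mollify \<delta> u x' = (LBINT y. u y * ?d y)"
      unfolding mollify_def right_diff_distrib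
      by (rule Bochner_Integration.integral_diff[symmetric]) (intro square_integrable_mult u square_integrable_eta d)+
    also have "\<bar>\<dots>\<bar> \<le> (LBINT y. \<bar>u y * ?d y\<bar>)" by (rule integral_abs_bound)
    also have "\<dots> \<le> (LBINT y. t * (u y)^2 + inverse t * (?d y)^2)"
      by (intro integral_mono integrable_abs square_integrable_mult u sq Bochner_Integration.integrable_add
          integrable_mult_right u2 i2 abs_mult_le_weighted t)
    also have "\<dots> = t * (LBINT y. (u y)^2) + inverse t * (LBINT y. (?d y)^2)" using u2 i2 by simp
    also have "\<dots> \<le> t * M + inverse t * (2 * L * norm (x - x'))"
      using uM d2 t by (intro add_mono mult_left_mono) auto
    also have "\<dots> < e"
    proof -
      have "t * M < e / 2" using M e by (simp add: t_def field_simps)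
      moreover have "inverse t * (2 * L * norm (x - x')) < e / 2"
        using xx t L(1) by (simp add: field_simps)
      ultimately show ?thesis by linarith
    qed
    finally show "\<bar>mollify \<delta> u x - mollify \<delta> u x'\<bar> < e" .
  qed
qed

text \<open>The square of the weight is integrable and bounded below by a positive constant on bounded sets.
  Convergence of \<open>weight\<^sup>2 * (u n - u)\<^sup>2\<close> in mean therefore replaces convergence on every bounded set.\<close>

definition weight :: "real^3 \<Rightarrow> real" where "weight x = 1 / (1 + (norm x)^2)"

lemma weight_props: "0 < weight x" "weight x \<le> 1" "weight \<in> borel_measurable borel" "integrable lborel (\<lambda>x. (weight x)^2)"
proof -
  show "0 < weight x" "weight x \<le> 1" by (auto simp: weight_def add_pos_nonneg divide_le_eq_1)
  show "weight \<in> borel_measurable borel" unfolding weight_def[abs_def] by measurable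
  show "integrable lborel (\<lambda>x. (weight x)^2)" using integrable_bracket by (simp add: weight_def[abs_def] power_divide)
qed

lemma square_sum3: "(a + b + c)^2 \<le> 3 * (a^2 + b^2 + c^2)" for a b c :: real
  using sum_squares_bound[of a b] sum_squares_bound[of b c] sum_squares_bound[of a c]
  by (simp add: power2_eq_square algebra_simps)

lemma square_sum4: "(a + (b - c) - d)^2 \<le> 3 * (a^2 + 2 * (b^2 + c^2) + d^2)" for a b c d :: real
proof -
  have "(b - c)^2 \<le> 2 * (b^2 + c^2)" using sum_squares_bound[of b "- c"] by (simp add: power2_diff)
  then show ?thesis using square_sum3[of a "b - c" "- d"] by simp
qed

text \<open>Rellich's theorem on the whole space, with a weight in place of bounded domains. Mollification
  changes the members of the sequence little, uniformly in the index, and the mollified functions form an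
  equicontinuous family.\<close>

lemma rellich:
  fixes u :: "nat \<Rightarrow> real^3 \<Rightarrow> real"
  assumes sob: "\<And>n. sobolev (u n) (g n)" and bound: "\<And>n. nsq (u n) (g n) \<le> M"
  obtains r w where "strict_mono (r::nat \<Rightarrow> nat)" "square_integrable w"
    "(LBINT x. (w x)^2) \<le> M"
    "AE x in lborel. (\<lambda>n. u (r n) x) \<longlonglongrightarrow> w x"
    "(\<lambda>n. \<integral>x. (weight x)^2 * (u (r n) x - w x)^2 \<partial>lborel) \<longlonglongrightarrow> 0"
proof -
  note [measurable] = sobolevD(4,5)[OF sob] weight_props(3)
  have nn: "0 \<le> (LBINT y. (u n y)^2)" "0 \<le> (LBINT y. (norm (g n y))^2)" for n by simp_all
  have uM: "(LBINT y. (u n y)^2) \<le> M" and gM: "(LBINT y. (norm (g n y))^2) \<le> M" for n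
    using bound[of n] nn[of n] unfolding nsq_def by linarith+
  have M0: "M \<ge> 0" using nn(1)[of 0] uM[of 0] by linarith
  define \<delta> where "\<delta> m = inverse (real (Suc m))" for m
  have \<delta>: "\<delta> m > 0" "\<delta> m \<le> 1" for m by (auto simp: \<delta>_def inverse_le_1_iff)
  define B where "B m = M + (LBINT w. (eta (\<delta> m) w)^2) + 1" for m
  have B0: "B m > 0" for m
  proof -
    have "0 \<le> (LBINT w. (eta (\<delta> m) w)^2)" by simp
    then show ?thesis using M0 unfolding B_def by linarith
  qed
  have molB: "\<bar>mollify (\<delta> m) (u n) x\<bar> \<le> B m" for m n x
    using mollify_bound[OF \<delta>(1) sobolevD(1)[OF sob], of m n x] uM[of n] by (simp add: B_def)
  (* For all mollification parameters at once, a diagonal subsequence converges at the points of a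
     countable dense set; equicontinuity extends the convergence to all points. *)
  obtain D :: "(real^3) set" where D: "countable D" "\<And>X. open X \<Longrightarrow> X \<noteq> {} \<Longrightarrow> \<exists>d\<in>D. d \<in> X"
    using countable_dense_exists by blast
  obtain r0 where r0: "strict_mono (r0::nat\<Rightarrow>nat)"
    "\<And>p. p \<in> D \<times> (UNIV::nat set) \<Longrightarrow> \<exists>l. (\<lambda>n. (case p of (x, m) \<Rightarrow> mollify (\<delta> m) (u (r0 n)) x / B m)) \<longlonglongrightarrow> l"
  proof (rule function_convergent_subsequence[of "D \<times> (UNIV::nat set)" "\<lambda>n p. case p of (x, m) \<Rightarrow> mollify (\<delta> m) (u n) x / B m" 1])
    show "countable (D \<times> (UNIV::nat set))" using D by auto
    show "norm (case p of (x, m) \<Rightarrow> mollify (\<delta> m) (u n) x / B m) \<le> 1" for n p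
      using molB B0 by (auto split: prod.split simp: abs_of_pos divide_le_eq_1_pos)
  qed blast
  define U where "U n = u (r0 n)" for n
  have Dconv: "convergent (\<lambda>n. mollify (\<delta> m) (U n) x)" if "x \<in> D" for x m
  proof -
    from r0(2)[of "(x, m)"] that obtain l where "(\<lambda>n. mollify (\<delta> m) (U n) x / B m) \<longlonglongrightarrow> l" by (auto simp: U_def)
    from tendsto_mult[OF this tendsto_const[of "B m"]] show ?thesis
      using B0[of m] by (auto simp: convergent_def)
  qed
  have conv: "convergent (\<lambda>n. mollify (\<delta> m) (U n) x)" for x m
  proof -
    have "Cauchy (\<lambda>n. mollify (\<delta> m) (U n) x)"
    proof (rule metric_CauchyI)
      fix e :: real assume e: "e > 0"
      obtain s where s: "s > 0"
        "\<And>u x x'. square_integrable u \<Longrightarrow> (LBINT y. (u y)^2) \<le> M \<Longrightarrow> norm (x - x') < s \<Longrightarrow> \<bar>mollify (\<delta> m) u x - mollify (\<delta> m) u x'\<bar> < e/3"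
        using mollify_equicontinuous[OF \<delta>(1) M0, of "e/3" m] e by auto
      obtain x' where x': "x' \<in> D" "norm (x - x') < s" using D(2)[of "ball x s"] s by (auto simp: dist_norm)
      have "Cauchy (\<lambda>n. mollify (\<delta> m) (U n) x')" using Dconv[OF x'(1)] by (rule convergent_Cauchy)
      then obtain N where N: "\<And>k n. k \<ge> N \<Longrightarrow> n \<ge> N \<Longrightarrow> dist (mollify (\<delta> m) (U k) x') (mollify (\<delta> m) (U n) x') < e/3"
        unfolding Cauchy_def using e by (metis zero_less_divide_iff zero_less_numeral)
      show "\<exists>N. \<forall>k\<ge>N. \<forall>n\<ge>N. dist (mollify (\<delta> m) (U k) x) (mollify (\<delta> m) (U n) x) < e"
      proof (intro exI allI impI)
        fix k n assume kn: "k \<ge> N" "n \<ge> N"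
        have "\<bar>mollify (\<delta> m) (U j) x - mollify (\<delta> m) (U j) x'\<bar> < e/3" for j
          unfolding U_def by (intro s sobolevD(1)[OF sob] uM x')
        from this[of k] this[of n] N[OF kn] show "dist (mollify (\<delta> m) (U k) x) (mollify (\<delta> m) (U n) x) < e"
          unfolding dist_real_def by linarith
      qed
    qed
    then show ?thesis by (simp add: Cauchy_convergent_iff)
  qed
  define Uinf where "Uinf m x = lim (\<lambda>n. mollify (\<delta> m) (U n) x)" for m x
  have Ulim: "(\<lambda>n. mollify (\<delta> m) (U n) x) \<longlonglongrightarrow> Uinf m x" for m x
    using conv by (simp add: Uinf_def convergent_LIMSEQ_iff)
  have [measurable]: "U n \<in> borel_measurable borel" for n unfolding U_def by measurable
  have [measurable]: "Uinf m \<in> borel_measurable borel" for m unfolding Uinf_def[abs_def] by measurable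
  have UB: "\<bar>Uinf m x\<bar> \<le> B m" for m x
    using tendsto_rabs[OF Ulim[of m x]] by (rule LIMSEQ_le_const2) (use molB in \<open>auto simp: U_def\<close>)
  have wB: "integrable lborel (\<lambda>x. (weight x)^2 * (4 * (B m)^2))" for m
    by (intro integrable_mult_left weight_props)
  have diffB: "(a - b)^2 \<le> (4 * (B m)^2)" if "\<bar>a\<bar> \<le> B m" "\<bar>b\<bar> \<le> B m" for a b m
  proof -
    have "\<bar>a - b\<bar> \<le> \<bar>2 * B m\<bar>" using that B0[of m] by linarith
    then have "(a - b)^2 \<le> (2 * B m)^2" by (simp only: abs_le_square_iff)
    then show ?thesis by (simp add: power_mult_distrib)
  qed
  have molU: "\<bar>mollify (\<delta> m) (U n) x\<bar> \<le> B m" for m n x unfolding U_def by (rule molB)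
  have iD: "integrable lborel (\<lambda>x. (weight x)^2 * (mollify (\<delta> m) (U n) x - Uinf m x)^2)" for m n
    by (rule Bochner_Integration.integrable_bound[OF wB[of m]])
       (auto intro!: AE_I2 mult_left_mono diffB molU UB simp: abs_mult)
  have DCT: "(\<lambda>n. \<integral>x. (weight x)^2 * (mollify (\<delta> m) (U n) x - Uinf m x)^2 \<partial>lborel) \<longlonglongrightarrow> 0" for m
  proof -
    have "(\<lambda>n. \<integral>x. (weight x)^2 * (mollify (\<delta> m) (U n) x - Uinf m x)^2 \<partial>lborel) \<longlonglongrightarrow> (\<integral>x. (weight x)^2 * 0 \<partial>(lborel::(real^3) measure))"
    proof (rule integral_dominated_convergence[OF _ _ wB[of m]])
      show "AE x in lborel. (\<lambda>n. (weight x)^2 * (mollify (\<delta> m) (U n) x - Uinf m x)^2) \<longlonglongrightarrow> (weight x)^2 * 0"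
      proof (intro AE_I2 tendsto_mult tendsto_const)
        fix x
        have "(\<lambda>n. (mollify (\<delta> m) (U n) x - Uinf m x)^2) \<longlonglongrightarrow> (Uinf m x - Uinf m x)^2"
          by (intro tendsto_intros Ulim)
        then show "(\<lambda>n. (mollify (\<delta> m) (U n) x - Uinf m x)^2) \<longlonglongrightarrow> 0" by simp
      qed
      show "AE x in lborel. norm ((weight x)^2 * (mollify (\<delta> m) (U n) x - Uinf m x)^2) \<le> (weight x)^2 * (4 * (B m)^2)" for n
        by (auto intro!: AE_I2 mult_left_mono diffB molU UB simp: abs_mult)
    qed measurable
    then show ?thesis by simp
  qed
  have mo: "square_integrable (\<lambda>x. U n x - mollify (\<delta> m) (U n) x)"
    "(LBINT x. (U n x - mollify (\<delta> m) (U n) x)^2) \<le> 25/4 * (\<delta> m)^2 * M" for n m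
  proof -
    note S = sobolevD(1-3)[OF sob[of "r0 n"]]
    show "square_integrable (\<lambda>x. U n x - mollify (\<delta> m) (U n) x)"
      unfolding U_def by (rule mollify_L2_distance(1)[OF S \<delta>])
    have "(LBINT x. (U n x - mollify (\<delta> m) (U n) x)^2) \<le> 25/4 * (\<delta> m)^2 * (LBINT y. (norm (g (r0 n) y))^2)"
      unfolding U_def by (rule mollify_L2_distance(2)[OF S \<delta>])
    also have "\<dots> \<le> 25/4 * (\<delta> m)^2 * M" using gM by (intro mult_left_mono) auto
    finally show "(LBINT x. (U n x - mollify (\<delta> m) (U n) x)^2) \<le> 25/4 * (\<delta> m)^2 * M" .
  qed
  have mo2: "integrable lborel (\<lambda>x. (U n x - mollify (\<delta> m) (U n) x)^2)" for n m
    using square_integrableD(2)[OF mo(1)] by simp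
  (* The distance to the mollified functions is small uniformly in the index, and for a fixed parameter
     the mollified functions converge in weighted mean. *)
  have cauchy: "\<exists>N. \<forall>k\<ge>N. \<forall>n\<ge>N. (\<integral>\<^sup>+x. ennreal ((norm (weight x * U k x - weight x * U n x))^2) \<partial>lborel) \<le> ennreal e" if e: "e > 0" for e
  proof -
    have "(\<lambda>m. 25/4 * (\<delta> m)^2 * M) \<longlonglongrightarrow> 25/4 * 0^2 * M"
      unfolding \<delta>_def by (intro tendsto_intros LIMSEQ_inverse_real_of_nat)
    then have "\<forall>\<^sub>F m in sequentially. 25/4 * (\<delta> m)^2 * M < e / 24"
      by (rule order_tendstoD(2)) (use e in simp)
    then obtain m where m: "25/4 * (\<delta> m)^2 * M < e / 24" by (auto simp: eventually_sequentially)
    have "\<forall>\<^sub>F n in sequentially. (LBINT x. (weight x)^2 * (mollify (\<delta> m) (U n) x - Uinf m x)^2) < e / 24"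
      by (rule order_tendstoD(2)[OF DCT]) (use e in simp)
    then obtain N where N: "\<And>n. n \<ge> N \<Longrightarrow> (LBINT x. (weight x)^2 * (mollify (\<delta> m) (U n) x - Uinf m x)^2) < e / 24"
      by (auto simp: eventually_sequentially)
    have gen: "A \<le> X \<Longrightarrow> B' \<le> X \<Longrightarrow> X < e / 24 \<Longrightarrow> C < e / 24 \<Longrightarrow> D' < e / 24 \<Longrightarrow> 3 * (A + B') + 6 * (C + D') \<le> e"
      for A B' C D' X :: real using e by argo
    show ?thesis
    proof (intro exI allI impI)
      fix k n assume kn: "k \<ge> N" "n \<ge> N"
      let ?a = "\<lambda>j x. (U j x - mollify (\<delta> m) (U j) x)^2"
      let ?b = "\<lambda>j x. (weight x)^2 * (mollify (\<delta> m) (U j) x - Uinf m x)^2"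
      have pw: "(norm (weight x * U k x - weight x * U n x))^2 \<le> 3 * (?a k x + ?a n x) + 6 * (?b k x + ?b n x)" for x
      proof -
        let ?w = "weight x" and ?p = "\<lambda>j. U j x - mollify (\<delta> m) (U j) x" and ?q = "\<lambda>j. mollify (\<delta> m) (U j) x - Uinf m x"
        have w1: "?w^2 \<le> 1" using weight_props(1,2)[of x] by (simp add: power_le_one)
        have "U k x - U n x = ?p k + (?q k - ?q n) - ?p n" by simp
        then have "(U k x - U n x)^2 \<le> 3 * ((?p k)^2 + 2 * ((?q k)^2 + (?q n)^2) + (?p n)^2)"
          using square_sum4[of "?p k" "?q k" "?q n" "?p n"] by (simp only:)
        then have "?w^2 * (U k x - U n x)^2 \<le> ?w^2 * (3 * ((?p k)^2 + 2 * ((?q k)^2 + (?q n)^2) + (?p n)^2))"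
          by (rule mult_left_mono) simp
        also have "\<dots> = 3 * (?w^2 * (?p k)^2 + ?w^2 * (?p n)^2) + 6 * (?b k x + ?b n x)" by (simp add: algebra_simps)
        also have "\<dots> \<le> 3 * (?a k x + ?a n x) + 6 * (?b k x + ?b n x)"
          using w1 mult_right_mono[OF w1, of "(?p k)^2"] mult_right_mono[OF w1, of "(?p n)^2"] by simp
        also have "?w^2 * (U k x - U n x)^2 = (norm (weight x * U k x - weight x * U n x))^2"
          by (simp add: power_mult_distrib flip: right_diff_distrib)
        finally show ?thesis .
      qed
      have "(\<integral>\<^sup>+x. ennreal ((norm (weight x * U k x - weight x * U n x))^2) \<partial>lborel) \<le> (\<integral>\<^sup>+x. ennreal (3 * (?a k x + ?a n x) + 6 * (?b k x + ?b n x)) \<partial>lborel)"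
        by (intro nn_integral_mono ennreal_leI pw)
      also have "\<dots> = ennreal (LBINT x. 3 * (?a k x + ?a n x) + 6 * (?b k x + ?b n x))"
        using mo2 iD by (intro nn_integral_eq_integral) auto
      also have "(LBINT x. 3 * (?a k x + ?a n x) + 6 * (?b k x + ?b n x))
         = 3 * ((LBINT x. ?a k x) + (LBINT x. ?a n x)) + 6 * ((LBINT x. ?b k x) + (LBINT x. ?b n x))"
        using mo2 iD by simp
      also have "ennreal \<dots> \<le> ennreal e"
      proof (rule ennreal_leI)
        show "3 * ((LBINT x. ?a k x) + (LBINT x. ?a n x)) + 6 * ((LBINT x. ?b k x) + (LBINT x. ?b n x)) \<le> e"
          by (rule gen[OF mo(2) mo(2) m N[OF kn(1)] N[OF kn(2)]])
      qed
      finally show "(\<integral>\<^sup>+x. ennreal ((norm (weight x * U k x - weight x * U n x))^2) \<partial>lborel) \<le> ennreal e" .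
    qed
  qed
  obtain r1 F where r1: "strict_mono (r1::nat \<Rightarrow> nat)" and F[measurable]: "F \<in> borel_measurable lborel"
    and FAE: "AE x in lborel. (\<lambda>n. weight x * U (r1 n) x) \<longlonglongrightarrow> F x"
    and FL: "\<And>e. e > 0 \<Longrightarrow> \<exists>N. \<forall>n\<ge>N. (\<integral>\<^sup>+x. ennreal ((norm (weight x * U n x - F x))^2) \<partial>lborel) \<le> ennreal e"
    using complete_L2[of "\<lambda>n x. weight x * U n x" lborel] cauchy by (auto simp: measurable_lborel1)
  define w where "w x = F x / weight x" for x
  have [measurable]: "w \<in> borel_measurable borel" unfolding w_def[abs_def] using F by measurable
  have Fw: "F x = weight x * w x" for x using weight_props(1)[of x] by (simp add: w_def)
  have wAE: "AE x in lborel. (\<lambda>n. U (r1 n) x) \<longlonglongrightarrow> w x"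
    using FAE
  proof eventually_elim
    case (elim x)
    from tendsto_divide[OF this tendsto_const[of "weight x"]] show ?case
      using weight_props(1)[of x] by (simp add: w_def)
  qed
  have "(\<integral>\<^sup>+x. ennreal ((w x)^2) \<partial>lborel) \<le> (\<integral>\<^sup>+x. liminf (\<lambda>n. ennreal ((U (r1 n) x)^2)) \<partial>lborel)"
  proof (rule nn_integral_mono_AE, use wAE in eventually_elim)
    case (elim x)
    then have "(\<lambda>n. ennreal ((U (r1 n) x)^2)) \<longlonglongrightarrow> ennreal ((w x)^2)" by (intro tendsto_ennrealI tendsto_intros)
    then show ?case by (rule tendsto_le_liminf)
  qed
  also have "\<dots> \<le> liminf (\<lambda>n. \<integral>\<^sup>+x. ennreal ((U (r1 n) x)^2) \<partial>lborel)" by (rule nn_integral_liminf) measurable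
  also have "\<dots> \<le> liminf (\<lambda>n::nat. ennreal M)"
  proof (rule Liminf_mono, rule always_eventually, rule allI)
    fix n
    have "(\<integral>\<^sup>+x. ennreal ((U (r1 n) x)^2) \<partial>lborel) = ennreal (LBINT x. (U (r1 n) x)^2)"
      unfolding U_def using sobolevD(6)[OF sob] by (intro nn_integral_eq_integral) auto
    also have "\<dots> \<le> ennreal M" unfolding U_def by (intro ennreal_leI uM)
    finally show "(\<integral>\<^sup>+x. ennreal ((U (r1 n) x)^2) \<partial>lborel) \<le> ennreal M" .
  qed
  finally have wM: "(\<integral>\<^sup>+x. ennreal ((w x)^2) \<partial>lborel) \<le> ennreal M" by (simp add: Liminf_const)
  have w2: "integrable lborel (\<lambda>x. (w x)^2)"
    by (rule integrableI_bounded) (use le_less_trans[OF wM ennreal_less_top] in auto)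
  have wsq: "square_integrable w" using w2 by (simp add: square_integrable_def)
  have wM': "(LBINT x. (w x)^2) \<le> M" using wM w2 M0 by (simp add: nn_integral_eq_integral ennreal_le_iff)
  have lim: "(\<lambda>n. \<integral>x. (weight x)^2 * (U n x - w x)^2 \<partial>lborel) \<longlonglongrightarrow> 0"
  proof (rule LIMSEQ_I)
    fix e :: real assume e: "e > 0"
    then obtain N where N: "\<And>n. n \<ge> N \<Longrightarrow> (\<integral>\<^sup>+x. ennreal ((norm (weight x * U n x - F x))^2) \<partial>lborel) \<le> ennreal (e/2)"
      using FL[of "e/2"] by auto
    have "(LBINT x. (weight x)^2 * (U n x - w x)^2) \<le> e/2" if "n \<ge> N" for n
    proof -
      have eq: "(norm (weight x * U n x - F x))^2 = (weight x)^2 * (U n x - w x)^2" for x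
        by (simp add: Fw power_mult_distrib flip: right_diff_distrib)
      have i: "integrable lborel (\<lambda>x. (weight x)^2 * (U n x - w x)^2)"
        by (rule integrableI_bounded) (use le_less_trans[OF N[OF that, unfolded eq] ennreal_less_top] in \<open>auto simp: abs_mult\<close>)
      show ?thesis using N[OF that, unfolded eq] e
        by (subst (asm) nn_integral_eq_integral[OF i]) (auto simp: ennreal_le_iff)
    qed
    moreover have "0 \<le> (LBINT x. (weight x)^2 * (U n x - w x)^2)" for n by simp
    ultimately show "\<exists>N. \<forall>n\<ge>N. norm ((LBINT x. (weight x)^2 * (U n x - w x)^2) - 0) < e"
      using e by (intro exI[of _ N]) (smt (verit) real_norm_def field_sum_of_halves)
  qed
  show ?thesis
  proof (rule that[of "r0 \<circ> r1" w])
    show "strict_mono (r0 \<circ> r1)" by (rule strict_mono_o[OF r0(1) r1])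
    show "AE x in lborel. (\<lambda>n. u ((r0 \<circ> r1) n) x) \<longlonglongrightarrow> w x" using wAE by (simp add: U_def)
    show "(\<lambda>n. \<integral>x. (weight x)^2 * (u ((r0 \<circ> r1) n) x - w x)^2 \<partial>lborel) \<longlonglongrightarrow> 0"
      using LIMSEQ_subseq_LIMSEQ[OF lim r1] by (simp add: U_def o_def)
  qed (rule wsq, rule wM')
qed

section \<open>Weak limits of gradients\<close>

lemma integral_inner_weighted:
  fixes f h :: "real^3 \<Rightarrow> 'a::euclidean_space"
  assumes f: "square_integrable f" and h: "square_integrable h"
  shows "integrable lborel (\<lambda>x. inner (f x) (h x))"
    "s > 0 \<Longrightarrow> \<bar>LBINT x. inner (f x) (h x)\<bar> \<le> s * (LBINT x. (norm (f x))^2) + inverse s * (LBINT x. (norm (h x))^2)"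
proof -
  note [measurable] = square_integrableD(1)[OF f] square_integrableD(1)[OF h]
  have i: "integrable lborel (\<lambda>x. norm (f x) * norm (h x))"
    by (intro square_integrable_mult square_integrable_norm f h)
  show ii: "integrable lborel (\<lambda>x. inner (f x) (h x))"
    by (rule Bochner_Integration.integrable_bound[OF i]) (auto intro!: AE_I2 Cauchy_Schwarz_ineq2)
  assume s: "s > 0"
  have "\<bar>LBINT x. inner (f x) (h x)\<bar> \<le> (LBINT x. \<bar>inner (f x) (h x)\<bar>)" by (rule integral_abs_bound)
  also have "\<dots> \<le> (LBINT x. s * (norm (f x))^2 + inverse s * (norm (h x))^2)"
  proof (intro integral_mono integrable_abs ii Bochner_Integration.integrable_add integrable_mult_right square_integrableD(2) f h)
    fix x
    have "\<bar>inner (f x) (h x)\<bar> \<le> \<bar>norm (f x) * norm (h x)\<bar>" using Cauchy_Schwarz_ineq2[of "f x" "h x"] by simp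
    also have "\<dots> \<le> s * (norm (f x))^2 + inverse s * (norm (h x))^2" by (rule abs_mult_le_weighted[OF s])
    finally show "\<bar>inner (f x) (h x)\<bar> \<le> s * (norm (f x))^2 + inverse s * (norm (h x))^2" .
  qed
  also have "\<dots> = s * (LBINT x. (norm (f x))^2) + inverse s * (LBINT x. (norm (h x))^2)"
    using square_integrableD(2)[OF f] square_integrableD(2)[OF h] by simp
  finally show "\<bar>LBINT x. inner (f x) (h x)\<bar> \<le> s * (LBINT x. (norm (f x))^2) + inverse s * (LBINT x. (norm (h x))^2)" .
qed

lemma square_integrable_diff:
  assumes f: "square_integrable f" and g: "square_integrable g" shows "square_integrable (\<lambda>x. f x - g x)"
  using square_integrable_add[OF f square_integrable_scaleR[OF g, of "-1"]] by simp

lemma integral_norm_diff: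
  fixes f h :: "real^3 \<Rightarrow> 'a::euclidean_space"
  assumes f: "square_integrable f" and h: "square_integrable h"
  shows "(LBINT x. (norm (f x + t *\<^sub>R h x))^2) = (LBINT x. (norm (f x))^2)
    + 2 * t * (LBINT x. inner (f x) (h x)) + t^2 * (LBINT x. (norm (h x))^2)"
proof -
  have "(norm (f x + t *\<^sub>R h x))^2 = (norm (f x))^2 + 2 * t * inner (f x) (h x) + t^2 * (norm (h x))^2" for x
    unfolding power2_norm_eq_inner by (simp add: inner_add_left inner_add_right inner_commute power2_eq_square algebra_simps)
  then show ?thesis
    using square_integrableD(2)[OF f] square_integrableD(2)[OF h] integral_inner_weighted(1)[OF f h] by simp
qed

lemma integral_norm_convex:
  fixes f h :: "real^3 \<Rightarrow> 'a::euclidean_space"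
  assumes f: "square_integrable f" and h: "square_integrable h" and t: "0 \<le> t" "t \<le> 1"
    and b: "(LBINT x. (norm (f x))^2) \<le> M" "(LBINT x. (norm (h x))^2) \<le> M"
  shows "(LBINT x. (norm ((1 - t) *\<^sub>R f x + t *\<^sub>R h x))^2) \<le> M"
proof -
  have pw: "(norm ((1 - t) *\<^sub>R f x + t *\<^sub>R h x))^2 \<le> (1 - t) * (norm (f x))^2 + t * (norm (h x))^2" for x
  proof -
    have "(1 - t) * (norm (f x))^2 + t * (norm (h x))^2 - (norm ((1 - t) *\<^sub>R f x + t *\<^sub>R h x))^2
       = (1 - t) * t * (norm (f x - h x))^2"
      unfolding power2_norm_eq_inner
      by (simp add: inner_add_left inner_add_right inner_diff_left inner_diff_right inner_commute power2_eq_square algebra_simps)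
    also have "\<dots> \<ge> 0" using t by simp
    finally show ?thesis by simp
  qed
  have "(LBINT x. (norm ((1 - t) *\<^sub>R f x + t *\<^sub>R h x))^2) \<le> (LBINT x. (1 - t) * (norm (f x))^2 + t * (norm (h x))^2)"
    by (intro integral_mono square_integrableD(2) square_integrable_add square_integrable_scaleR f h
        Bochner_Integration.integrable_add integrable_mult_right pw)
  also have "\<dots> = (1 - t) * (LBINT x. (norm (f x))^2) + t * (LBINT x. (norm (h x))^2)"
    using square_integrableD(2)[OF f] square_integrableD(2)[OF h] by simp
  also have "\<dots> \<le> (1 - t) * M + t * M" using b t by (intro add_mono mult_left_mono) auto
  finally show ?thesis by (simp add: algebra_simps)
qed

text \<open>Convex combinations of the tails of a sequence of functions with their gradients.\<close>

inductive_set tail_hull :: "(nat \<Rightarrow> real^3 \<Rightarrow> real) \<Rightarrow> (nat \<Rightarrow> real^3 \<Rightarrow> real^3) \<Rightarrow> nat \<Rightarrow> ((real^3 \<Rightarrow> real) \<times> (real^3 \<Rightarrow> real^3)) set"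
  for u g N where
  base: "k \<ge> N \<Longrightarrow> (u k, g k) \<in> tail_hull u g N"
| comb: "(a, b) \<in> tail_hull u g N \<Longrightarrow> (a', b') \<in> tail_hull u g N \<Longrightarrow> 0 \<le> t \<Longrightarrow> t \<le> 1 \<Longrightarrow>
    (\<lambda>x. (1 - t) * a x + t * a' x, \<lambda>x. (1 - t) *\<^sub>R b x + t *\<^sub>R b' x) \<in> tail_hull u g N"

lemma tail_hull_mono: "(a, b) \<in> tail_hull u g N \<Longrightarrow> N' \<le> N \<Longrightarrow> (a, b) \<in> tail_hull u g N'"
  by (induction rule: tail_hull.induct) (auto intro: tail_hull.intros)

lemma tail_hull_sobolev:
  assumes "\<And>n. sobolev (u n) (g n)" "(a, b) \<in> tail_hull u g N" shows "sobolev a b"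
  using assms(2) by (induction rule: tail_hull.induct) (auto intro: assms(1) sobolev_add sobolev_scale)

text \<open>A bound for the norm of the gradients survives convex combinations, and so does the convergence in
  weighted mean in \<open>tail_hull_weighted_bound\<close>.\<close>

lemma tail_hull_gradient_bound:
  assumes s: "\<And>n. sobolev (u n) (g n)" and b: "\<And>n. (LBINT x. (norm (g n x))^2) \<le> M" and h: "(a, b) \<in> tail_hull u g N"
  shows "(LBINT x. (norm (b x))^2) \<le> M"
  using h
proof (induction rule: tail_hull.induct)
  case (comb a b a' b' t)
  then show ?case by (intro integral_norm_convex sobolevD(2) tail_hull_sobolev[OF s]) auto
qed (rule b)

lemma square_integrable_weight: "square_integrable w \<Longrightarrow> square_integrable (\<lambda>x. weight x * w x)"
proof (rule square_integrable_bound)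
  assume "square_integrable w"
  then have [measurable]: "w \<in> borel_measurable borel" by (rule square_integrableD)
  note [measurable] = weight_props(3)
  show "(\<lambda>x. weight x * w x) \<in> borel_measurable borel" by measurable
  show "norm (weight x * w x) \<le> norm (w x)" for x
    using weight_props(1,2)[of x] by (simp add: abs_mult mult_left_le_one_le)
qed

lemma tail_hull_weighted_bound:
  assumes s: "\<And>n. sobolev (u n) (g n)" and w: "square_integrable w"
    and b: "\<And>n. n \<ge> N \<Longrightarrow> (LBINT x. (weight x)^2 * (u n x - w x)^2) \<le> D" and h: "(a, b) \<in> tail_hull u g N"
  shows "(LBINT x. (weight x)^2 * (a x - w x)^2) \<le> D"
  using h
proof (induction rule: tail_hull.induct)
  case (comb a b a' b' t)
  have e: "(weight x)^2 * (c x - w x)^2 = (norm (weight x * (c x - w x)))^2" for c x by (simp add: power_mult_distrib)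
  have q: "square_integrable (\<lambda>x. weight x * (c x - w x))" if "(c, d) \<in> tail_hull u g N" for c d
    by (intro square_integrable_weight square_integrable_diff w sobolevD(1)[OF tail_hull_sobolev[OF s that]])
  have "(LBINT x. (norm ((1 - t) *\<^sub>R (weight x * (a x - w x)) + t *\<^sub>R (weight x * (a' x - w x))))^2) \<le> D"
    using comb by (intro integral_norm_convex q) (auto simp: e)
  moreover have "(1 - t) *\<^sub>R (weight x * (a x - w x)) + t *\<^sub>R (weight x * (a' x - w x)) = weight x * ((1 - t) * a x + t * a' x - w x)" for x
    by (simp add: algebra_simps)
  ultimately show ?case unfolding e[where c = "\<lambda>x. (1 - t) * a x + t * a' x"] by (simp only:)
qed (rule b)

text \<open>Mazur's argument without weak topology: nearly norm minimal convex combinations of the tails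
  converge strongly, and minimality makes the limit nearly orthogonal to the remainders.\<close>

lemma weak_gradient_limit:
  fixes u :: "nat \<Rightarrow> real^3 \<Rightarrow> real" and g :: "nat \<Rightarrow> real^3 \<Rightarrow> real^3"
  assumes sob: "\<And>n. sobolev (u n) (g n)" and gM: "\<And>n. (LBINT x. (norm (g n x))^2) \<le> M"
    and w: "square_integrable w"
    and lim: "(\<lambda>n. \<integral>x. (weight x)^2 * (u n x - w x)^2 \<partial>lborel) \<longlonglongrightarrow> 0"
  obtains G where "sobolev w G"
    "\<And>e. e > 0 \<Longrightarrow> \<exists>N. \<forall>n\<ge>N. (LBINT x. inner (G x) (g n x - G x)) \<ge> - e"
proof -
  have M0: "M \<ge> 0" using order_trans[OF _ gM[of 0]] by simp
  let ?H = "tail_hull u g"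
  define I where "I b = (LBINT x. (norm (b x))^2)" for b :: "real^3 \<Rightarrow> real^3"
  have I0: "0 \<le> I b" for b by (simp add: I_def)
  define m where "m N = Inf ((\<lambda>(a, b). I b) ` ?H N)" for N
  have ne: "?H N \<noteq> {}" for N using tail_hull.base[of N N u g] by auto
  have bb: "bdd_below ((\<lambda>(a, b). I b) ` ?H N)" for N by (rule bdd_belowI[of _ 0]) (auto simp: I0)
  have m_le: "m N \<le> I b" if "(a, b) \<in> ?H N" for a b N
    unfolding m_def by (rule cInf_lower[OF _ bb]) (use that in force)
  have mM: "m N \<le> M" for N using m_le[OF tail_hull.base[of N N u g]] gM[of N] by (simp add: I_def)
  have m_mono: "m N \<le> m K" if "N \<le> K" for N K
    unfolding m_def using that ne by (intro cInf_superset_mono bb) (auto intro: tail_hull_mono)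
  have "\<forall>N. \<exists>c. c \<in> ?H N \<and> I (snd c) < m N + inverse (real (Suc N))"
  proof
    fix N
    have "Inf ((\<lambda>(a, b). I b) ` ?H N) < m N + inverse (real (Suc N))" unfolding m_def[symmetric] by simp
    then have "\<exists>y\<in>(\<lambda>(a, b). I b) ` ?H N. y < m N + inverse (real (Suc N))"
      by (intro cInf_lessD) (use ne in simp)
    then show "\<exists>c. c \<in> ?H N \<and> I (snd c) < m N + inverse (real (Suc N))" by fastforce
  qed
  then obtain c where c: "\<And>N. c N \<in> ?H N" "\<And>N. I (snd (c N)) < m N + inverse (real (Suc N))" by metis
  define a where "a N = fst (c N)" for N
  define b where "b N = snd (c N)" for N
  have ab: "(a N, b N) \<in> ?H N" and bm: "I (b N) < m N + inverse (real (Suc N))" for N using c by (auto simp: a_def b_def)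
  have sab: "sobolev (a N) (b N)" for N by (rule tail_hull_sobolev[OF sob ab])
  note [measurable] = sobolevD(4,5)[OF sob] sobolevD(4,5)[OF sab] square_integrableD(1)[OF w] weight_props(3)
  have bM: "I (b N) \<le> M" for N unfolding I_def by (rule tail_hull_gradient_bound[OF sob gM ab])
  have sd: "square_integrable (\<lambda>x. b N x - b K x)" for N K by (intro square_integrable_diff sobolevD(2)[OF sab])
  (* The midpoint of two elements of the hull has norm at least m N, so the parallelogram identity turns
     near minimality into a Cauchy estimate. *)
  have dist: "I (\<lambda>x. b K x - b N x) \<le> 2 * (m K - m N) + 4 * inverse (real (Suc N))" if NK: "N \<le> K" for N K
  proof -
    have "(\<lambda>x. (1 - 1/2) * a N x + 1/2 * a K x, \<lambda>x. (1 - 1/2) *\<^sub>R b N x + (1/2::real) *\<^sub>R b K x) \<in> ?H N"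
      by (rule tail_hull.comb[OF ab tail_hull_mono[OF ab NK]]) auto
    then have mid: "m N \<le> I (\<lambda>x. (1 - 1/2) *\<^sub>R b N x + (1/2::real) *\<^sub>R b K x)" by (rule m_le)
    have "(norm (b K x - b N x))^2 = 2 * (norm (b N x))^2 + 2 * (norm (b K x))^2 - 4 * (norm ((1 - 1/2) *\<^sub>R b N x + (1/2::real) *\<^sub>R b K x))^2" for x
      unfolding power2_norm_eq_inner by (simp add: inner_add_left inner_add_right inner_diff_left inner_diff_right inner_commute algebra_simps)
    moreover have "integrable lborel (\<lambda>x. (norm ((1 - 1/2) *\<^sub>R b N x + (1/2::real) *\<^sub>R b K x))^2)"
      by (intro square_integrableD(2) square_integrable_add square_integrable_scaleR sobolevD(2)[OF sab])
    ultimately have "I (\<lambda>x. b K x - b N x) = 2 * I (b N) + 2 * I (b K) - 4 * I (\<lambda>x. (1 - 1/2) *\<^sub>R b N x + (1/2::real) *\<^sub>R b K x)"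
      unfolding I_def using sobolevD(7)[OF sab] by simp
    also have "\<dots> \<le> 2 * (m N + inverse (real (Suc N))) + 2 * (m K + inverse (real (Suc K))) - 4 * m N"
      using bm[of N] bm[of K] mid by argo
    finally have "I (\<lambda>x. b K x - b N x) \<le> 2 * (m N + inverse (real (Suc N))) + 2 * (m K + inverse (real (Suc K))) - 4 * m N" .
    moreover have "inverse (real (Suc K)) \<le> inverse (real (Suc N))" using NK by (intro le_imp_inverse_le) auto
    ultimately show ?thesis by argo
  qed
  obtain L where "m \<longlonglongrightarrow> L" by (rule incseq_convergent[of m M]) (use m_mono mM in \<open>auto simp: incseq_def\<close>)
  then have mC: "Cauchy m" by (rule LIMSEQ_imp_Cauchy)
  have inv: "\<exists>N. \<forall>n\<ge>N. inverse (real (Suc n)) < e" if "e > 0" for e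
    using LIMSEQ_D[OF LIMSEQ_inverse_real_of_nat that] by simp
  have cauchy: "\<exists>N. \<forall>k\<ge>N. \<forall>n\<ge>N. (\<integral>\<^sup>+x. ennreal ((norm (b k x - b n x))^2) \<partial>lborel) \<le> ennreal e" if e: "e > 0" for e
  proof -
    obtain N1 where N1: "\<And>k n. k \<ge> N1 \<Longrightarrow> n \<ge> N1 \<Longrightarrow> dist (m k) (m n) < e / 4"
      using mC e unfolding Cauchy_def by (metis zero_less_divide_iff zero_less_numeral)
    obtain N2 where N2: "\<And>n. n \<ge> N2 \<Longrightarrow> inverse (real (Suc n)) < e / 8" using inv[of "e/8"] e by auto
    have le: "I (\<lambda>x. b k x - b n x) \<le> e" if "n \<ge> max N1 N2" "k \<ge> n" for k n
    proof -
      have "m k - m n < e / 4" using le_less_trans[OF abs_ge_self N1[of k n, unfolded dist_real_def]] that by simp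
      moreover have "inverse (real (Suc n)) < e / 8" using N2[of n] that by simp
      ultimately show ?thesis using dist[OF that(2)] by argo
    qed
    have sym: "I (\<lambda>x. b k x - b n x) = I (\<lambda>x. b n x - b k x)" for k n by (simp add: I_def norm_minus_commute)
    have "I (\<lambda>x. b k x - b n x) \<le> e" if "n \<ge> max N1 N2" "k \<ge> max N1 N2" for k n
      using le[of n k] le[of k n] that sym[of k n] by (cases "k \<ge> n") auto
    moreover have "(\<integral>\<^sup>+x. ennreal ((norm (b k x - b n x))^2) \<partial>lborel) = ennreal (I (\<lambda>x. b k x - b n x))" for k n
      unfolding I_def by (rule nn_integral_eq_integral[OF square_integrableD(2)[OF sd]]) simp
    ultimately show ?thesis by (intro exI[of _ "max N1 N2"]) (auto intro: ennreal_leI)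
  qed
  obtain G where G: "G \<in> borel_measurable lborel"
    and GL: "\<And>e. e > 0 \<Longrightarrow> \<exists>N. \<forall>n\<ge>N. (\<integral>\<^sup>+x. ennreal ((norm (b n x - G x))^2) \<partial>lborel) \<le> ennreal e"
  proof (rule complete_L2[of b lborel, OF _ cauchy])
    fix r :: "nat \<Rightarrow> nat" and F
    assume "F \<in> borel_measurable lborel"
      "\<And>e. e > 0 \<Longrightarrow> \<exists>N. \<forall>n\<ge>N. (\<integral>\<^sup>+x. ennreal ((norm (b n x - F x))^2) \<partial>lborel) \<le> ennreal e"
    then show thesis by (rule that)
  qed simp_all
  have [measurable]: "G \<in> borel_measurable borel" using G by simp
  obtain N0 where N0: "(\<integral>\<^sup>+x. ennreal ((norm (b N0 x - G x))^2) \<partial>lborel) \<le> ennreal 1" using GL[of 1] by auto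
  have sbG: "square_integrable (\<lambda>x. b N0 x - G x)"
    unfolding square_integrable_nn using le_less_trans[OF N0 ennreal_less_top] by (simp add: ennreal_power)
  have sG: "square_integrable G"
    using square_integrable_diff[OF sobolevD(2)[OF sab[of N0]] sbG] by simp
  have sdG: "square_integrable (\<lambda>x. b N x - G x)" for N by (intro square_integrable_diff sobolevD(2)[OF sab] sG)
  have Glim: "(\<lambda>N. I (\<lambda>x. b N x - G x)) \<longlonglongrightarrow> 0"
  proof (rule LIMSEQ_I)
    fix e :: real assume e: "e > 0"
    then obtain N where N: "\<And>n. n \<ge> N \<Longrightarrow> (\<integral>\<^sup>+x. ennreal ((norm (b n x - G x))^2) \<partial>lborel) \<le> ennreal (e/2)" using GL[of "e/2"] by auto
    have "I (\<lambda>x. b n x - G x) \<le> e/2" if "n \<ge> N" for n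
      using N[OF that] e unfolding I_def
      by (subst (asm) nn_integral_eq_integral[OF square_integrableD(2)[OF sdG]]) (auto simp: ennreal_le_iff)
    then show "\<exists>N. \<forall>n\<ge>N. norm (I (\<lambda>x. b n x - G x) - 0) < e"
      using e I0 by (intro exI[of _ N]) (smt (verit) real_norm_def field_sum_of_halves)
  qed
  have swd: "square_integrable (\<lambda>x. weight x * (a N x - w x))" for N
    by (intro square_integrable_weight square_integrable_diff w sobolevD(1)[OF sab])
  have alim: "(\<lambda>N. \<integral>x. (norm (weight x * (a N x - w x)))^2 \<partial>lborel) \<longlonglongrightarrow> 0"
  proof (rule LIMSEQ_I)
    fix e :: real assume e: "e > 0"
    obtain N where N: "\<And>n. n \<ge> N \<Longrightarrow> (LBINT x. (weight x)^2 * (u n x - w x)^2) < e/2"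
      using order_tendstoD(2)[OF lim, of "e/2"] e by (auto simp: eventually_sequentially)
    have "(LBINT x. (weight x)^2 * (a n x - w x)^2) \<le> e/2" if "n \<ge> N" for n
      by (rule tail_hull_weighted_bound[OF sob w _ ab]) (use N that in \<open>auto intro!: less_imp_le\<close>)
    moreover have "0 \<le> (LBINT x. (weight x)^2 * (a n x - w x)^2)" for n by simp
    ultimately show "\<exists>N. \<forall>n\<ge>N. norm ((LBINT x. (norm (weight x * (a n x - w x)))^2) - 0) < e"
      using e unfolding power_mult_distrib real_norm_def abs_mult power2_abs
      by (intro exI[of _ N]) (smt (verit) field_sum_of_halves)
  qed
  have L2conv: "(\<lambda>N. \<integral>x. inner (p N x) (q x) \<partial>lborel) \<longlonglongrightarrow> 0"
    if p: "\<And>N. square_integrable (p N)" and q: "square_integrable q" and z: "(\<lambda>N. \<integral>x. (norm (p N x))^2 \<partial>lborel) \<longlonglongrightarrow> 0"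
    for p :: "nat \<Rightarrow> real^3 \<Rightarrow> 'c::euclidean_space" and q
  proof (rule LIMSEQ_I)
    fix e :: real assume e: "e > 0"
    let ?Q = "LBINT x. (norm (q x))^2"
    have Q: "?Q \<ge> 0" by simp
    define s where "s = e / (2 * (?Q + 1))"
    have "0 < e / (2 * (A + 1)) \<and> e / (2 * (A + 1)) * A < e/2" if "A \<ge> 0" for A :: real using e that by (auto simp: field_simps)
    from this[OF Q] have s: "s > 0" "s * ?Q < e/2" unfolding s_def by auto
    obtain N where N: "\<And>n. n \<ge> N \<Longrightarrow> (LBINT x. (norm (p n x))^2) < s * (e/2)"
      using order_tendstoD(2)[OF z, of "s * (e/2)"] s e by (auto simp: eventually_sequentially)
    have "\<bar>LBINT x. inner (p n x) (q x)\<bar> < e" if "n \<ge> N" for n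
    proof -
      have "\<bar>LBINT x. inner (p n x) (q x)\<bar> \<le> inverse s * (LBINT x. (norm (p n x))^2) + inverse (inverse s) * ?Q"
        using s by (intro integral_inner_weighted(2) p q) simp
      also have "inverse s * (LBINT x. (norm (p n x))^2) < inverse s * (s * (e/2))"
        using N[OF that] s by (intro mult_strict_left_mono) auto
      also have "inverse s * (s * (e/2)) = e/2" using s(1) by simp
      finally show ?thesis using s by simp
    qed
    then show "\<exists>N. \<forall>n\<ge>N. norm ((LBINT x. inner (p n x) (q x)) - 0) < e" by auto
  qed
  have wg: "has_weak_gradient w G"
    unfolding has_weak_gradient_def
  proof (intro allI impI)
    fix f i assume f: "test_function f"
    have tf: "test_function (pderiv i f)" by (rule test_function_pderiv[OF f])
    have tq: "square_integrable (\<lambda>x. pderiv i f x / weight x)"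
    proof (rule test_function_square_integrable', rule test_functionI)
      have e: "pderiv i f x / weight x = pderiv i f x * (1 + (\<Sum>j\<in>UNIV. x $ j * x $ j))" for x
        unfolding weight_def power2_norm_eq_inner by (simp add: inner_vec_def)
      show "smooth (\<lambda>x. pderiv i f x / weight x)" unfolding e
        by (intro smooth_mult smooth_add smooth_sum smooth_const smooth_component test_function_smooth[OF tf])
      show "bounded {x. pderiv i f x / weight x \<noteq> 0}"
        by (rule bounded_subset[OF test_function_bounded_support[OF tf]]) auto
    qed
    have iw: "integrable lborel (\<lambda>x. v x * pderiv i f x)" if "square_integrable v" for v
      by (rule square_integrable_mult[OF that test_function_square_integrable'[OF tf]])
    have iG: "integrable lborel (\<lambda>x. v x $ i * f x)" if "square_integrable v" for v :: "real^3 \<Rightarrow> real^3"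
      by (rule square_integrable_mult[OF square_integrable_component[OF that] test_function_square_integrable'[OF f]])
    have "(\<lambda>N. \<integral>x. inner (weight x * (a N x - w x)) (pderiv i f x / weight x) \<partial>lborel) \<longlonglongrightarrow> 0"
      by (rule L2conv[OF swd tq alim])
    moreover have "inner (weight x * (a N x - w x)) (pderiv i f x / weight x) = a N x * pderiv i f x - w x * pderiv i f x" for x N
      using weight_props(1)[of x] by (simp add: field_simps)
    ultimately have 1: "(\<lambda>N. (LBINT x. a N x * pderiv i f x) - (LBINT x. w x * pderiv i f x)) \<longlonglongrightarrow> 0"
      using iw[OF sobolevD(1)[OF sab]] iw[OF w] by simp
    have sax: "square_integrable (\<lambda>x. axis i (f x) :: real^3)"
    proof (rule square_integrable_bound[OF test_function_square_integrable'[OF f]])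
      have ax: "(\<lambda>x. axis i (f x) :: real^3) = (\<lambda>x. f x *\<^sub>R (axis i 1 :: real^3))" by (auto simp: vec_eq_iff axis_def)
      have "continuous_on UNIV (\<lambda>x. axis i (f x) :: real^3)" unfolding ax
        by (intro continuous_intros smooth_continuous[OF test_function_smooth[OF f]])
      then show "(\<lambda>x. axis i (f x) :: real^3) \<in> borel_measurable borel" by (rule borel_measurable_continuous_onI)
    qed (simp add: norm_eq_sqrt_inner inner_axis_axis)
    have "(\<lambda>N. \<integral>x. inner (b N x - G x) (axis i (f x)) \<partial>lborel) \<longlonglongrightarrow> 0"
      by (rule L2conv[OF sdG sax]) (use Glim in \<open>simp add: I_def\<close>)
    moreover have "inner (b N x - G x) (axis i (f x)) = b N x $ i * f x - G x $ i * f x" for x N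
      by (simp add: inner_axis left_diff_distrib)
    ultimately have 2: "(\<lambda>N. (LBINT x. b N x $ i * f x) - (LBINT x. G x $ i * f x)) \<longlonglongrightarrow> 0"
      using iG[OF sobolevD(2)[OF sab]] iG[OF sG] by simp
    have "(LBINT x. a N x * pderiv i f x) = - (LBINT x. b N x $ i * f x)" for N
      using sobolevD(3)[OF sab, unfolded has_weak_gradient_def, rule_format, OF f] .
    with tendsto_add[OF 1 2] have "(\<lambda>N. - (LBINT x. w x * pderiv i f x) - (LBINT x. G x $ i * f x)) \<longlonglongrightarrow> 0" by simp
    then have "- (LBINT x. w x * pderiv i f x) - (LBINT x. G x $ i * f x) = 0" by (simp add: LIMSEQ_const_iff)
    then show "(LBINT x. w x * pderiv i f x) = - (LBINT x. G x $ i * f x)" by simp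
  qed
  have res: "sobolev w G" using w sG wg by (simp add: sobolev_def)
  show ?thesis
  proof (rule that[OF res])
    fix e :: real assume e: "e > 0"
    define t where "t = min 1 (e / (8 * (M + 1)))"
    have t: "0 < t" "t \<le> 1" "2 * t * M \<le> e / 4"
    proof -
      show "0 < t" "t \<le> 1" using e M0 by (auto simp: t_def)
      have "2 * t * M \<le> 2 * (e / (8 * (M + 1))) * M" using M0 by (intro mult_right_mono mult_left_mono) (auto simp: t_def)
      also have "\<dots> \<le> e / 4" using M0 e by (simp add: field_simps)
      finally show "2 * t * M \<le> e / 4" .
    qed
    define s where "s = e / (4 * (4 * M + I G + 1))"
    have s: "s > 0" "s * (4 * M) + s * I G \<le> e / 4"
    proof -
      have p: "4 * M + I G + 1 > 0" using M0 I0[of G] by linarith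
      show "s > 0" using e p by (simp add: s_def)
      have "s * (4 * M + I G) \<le> s * (4 * M + I G + 1)" using \<open>s > 0\<close> by (intro mult_left_mono) auto
      also have "\<dots> = e / 4"
      proof -
        have "e / (4 * A) * A = e / 4" if "A > 0" for A :: real using that by simp
        from this[OF p] show ?thesis unfolding s_def .
      qed
      finally show "s * (4 * M) + s * I G \<le> e / 4" by (simp add: distrib_left)
    qed
    obtain N1 where N1: "\<And>n. n \<ge> N1 \<Longrightarrow> I (\<lambda>x. b n x - G x) < s * e / 8"
      using order_tendstoD(2)[OF Glim, of "s * e / 8"] s e by (auto simp: eventually_sequentially)
    obtain N2 where N2: "\<And>n. n \<ge> N2 \<Longrightarrow> inverse (real (Suc n)) < t * e / 2" using inv[of "t * e / 2"] e t by auto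
    define N where "N = max N1 N2"
    show "\<exists>N. \<forall>n\<ge>N. (LBINT x. inner (G x) (g n x - G x)) \<ge> - e"
    proof (intro exI[of _ N] allI impI)
      fix n assume n: "n \<ge> N"
      let ?d = "\<lambda>x. g n x - b N x"
      have sdn: "square_integrable ?d" by (intro square_integrable_diff sobolevD(2)[OF sob] sobolevD(2)[OF sab])
      have d4: "I ?d \<le> 4 * M"
      proof -
        have sb: "square_integrable (\<lambda>x. - b N x)" using square_integrable_scaleR[OF sobolevD(2)[OF sab[of N]], of "-1"] by simp
        have "I (\<lambda>x. (1 - 1/2) *\<^sub>R g n x + (1/2::real) *\<^sub>R (- b N x)) \<le> M"
          unfolding I_def by (rule integral_norm_convex[OF sobolevD(2)[OF sob] sb]) (use gM[of n] bM[of N] in \<open>auto simp: I_def\<close>)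
        moreover have "(1 - 1/2) *\<^sub>R g n x + (1/2::real) *\<^sub>R (- b N x) = (1/2) *\<^sub>R ?d x" for x by (simp add: scaleR_diff_right)
        ultimately show ?thesis by (simp add: I_def power_mult_distrib power_divide)
      qed
      (* A step of length t from the near minimizer towards the n-th term cannot bring the norm below m N;
         dividing by t bounds the inner product from below. *)
      have "(\<lambda>x. (1 - t) * a N x + t * u n x, \<lambda>x. (1 - t) *\<^sub>R b N x + t *\<^sub>R g n x) \<in> ?H N"
        using t n by (intro tail_hull.comb ab tail_hull.base) auto
      then have "m N \<le> I (\<lambda>x. (1 - t) *\<^sub>R b N x + t *\<^sub>R g n x)" by (rule m_le)
      also have "(\<lambda>x. (1 - t) *\<^sub>R b N x + t *\<^sub>R g n x) = (\<lambda>x. b N x + t *\<^sub>R ?d x)" by (simp add: algebra_simps)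
      also have "I (\<lambda>x. b N x + t *\<^sub>R ?d x) = I (b N) + 2 * t * (LBINT x. inner (b N x) (?d x)) + t^2 * I ?d"
        unfolding I_def by (rule integral_norm_diff[OF sobolevD(2)[OF sab] sdn])
      finally have "m N \<le> I (b N) + 2 * t * (LBINT x. inner (b N x) (?d x)) + t^2 * I ?d" .
      moreover have "t^2 * I ?d \<le> t^2 * (4 * M)" using d4 by (intro mult_left_mono) auto
      moreover have "I (b N) < m N + t * e / 2" using bm[of N] N2[of N] by (simp add: N_def)
      ultimately have "- (t * e / 2) - t^2 * (4 * M) \<le> 2 * t * (LBINT x. inner (b N x) (?d x))" by linarith
      then have "t * (- (e / 4) - 2 * t * M) \<le> t * (LBINT x. inner (b N x) (?d x))"
        by (simp add: algebra_simps power2_eq_square)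
      then have A: "- (e / 4) - 2 * t * M \<le> (LBINT x. inner (b N x) (?d x))" using t(1) by simp
      have I1: "I (\<lambda>x. b N x - G x) < s * e / 8" by (rule N1) (simp add: N_def)
      have B: "\<bar>LBINT x. inner (?d x) (b N x - G x)\<bar> \<le> s * I ?d + inverse s * I (\<lambda>x. b N x - G x)"
        unfolding I_def by (rule integral_inner_weighted(2)[OF sdn sdG s(1)])
      have C: "\<bar>LBINT x. inner (G x) (b N x - G x)\<bar> \<le> s * I G + inverse s * I (\<lambda>x. b N x - G x)"
        unfolding I_def by (rule integral_inner_weighted(2)[OF sG sdG s(1)])
      have S: "inverse s * I (\<lambda>x. b N x - G x) \<le> e / 8"
        using I1 s(1) by (simp add: field_simps)
      have D: "s * I ?d \<le> s * (4 * M)" using d4 s(1) by (intro mult_left_mono) auto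
      have ex: "inner (G x) (g n x - G x) = inner (b N x) (?d x) - inner (?d x) (b N x - G x) + inner (G x) (b N x - G x)" for x
        by (simp add: inner_diff_left inner_diff_right inner_commute algebra_simps)
      have "(LBINT x. inner (G x) (g n x - G x)) = (LBINT x. inner (b N x) (?d x)) - (LBINT x. inner (?d x) (b N x - G x)) + (LBINT x. inner (G x) (b N x - G x))"
        unfolding ex using integral_inner_weighted(1)[OF sobolevD(2)[OF sab[of N]] sdn] integral_inner_weighted(1)[OF sdn sdG[of N]] integral_inner_weighted(1)[OF sG sdG[of N]]
        by simp
      then show "(LBINT x. inner (G x) (g n x - G x)) \<ge> - e" using A B C S D s(2) t(3) by linarith
    qed
  qed
qed

section \<open>Products against a locally vanishing sequence\<close>

text \<open>The part of a function above a multiple of the squared weight. As \<open>k\<close> grows it becomes small in every Lebesgue space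
  to which \<open>u\<close> belongs, while below the threshold products with \<open>w\<close> are controlled by the weighted norm
  of \<open>w\<close>.\<close>

definition weight_excess :: "nat \<Rightarrow> (real^3 \<Rightarrow> real) \<Rightarrow> real^3 \<Rightarrow> real" where
  "weight_excess k u x = max 0 (\<bar>u x\<bar> - real k * (weight x)^2)"

lemma weight_excess_bounds:
  "0 \<le> weight_excess k u x" "weight_excess k u x \<le> \<bar>u x\<bar>" "\<bar>u x\<bar> \<le> real k * (weight x)^2 + weight_excess k u x"
  by (auto simp: weight_excess_def)

lemma weight_excess_tendsto: "(\<lambda>k. weight_excess k u x) \<longlonglongrightarrow> 0"
proof (rule tendsto_eventually)
  have w: "(weight x)^2 > 0" using weight_props(1)[of x] by simp
  obtain N where N: "\<bar>u x\<bar> < real N * (weight x)^2" using reals_Archimedean3[OF w] by blast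
  show "\<forall>\<^sub>F k in sequentially. weight_excess k u x = 0"
    using eventually_ge_at_top[of N]
  proof eventually_elim
    case (elim k)
    then have "real N * (weight x)^2 \<le> real k * (weight x)^2" by (intro mult_right_mono) auto
    then show ?case using N by (simp add: weight_excess_def)
  qed
qed

lemma weight_excess_integral_tendsto:
  assumes [measurable]: "u \<in> borel_measurable borel" and i: "integrable lborel (\<lambda>x. \<bar>u x\<bar>^j)" and j: "j > 0"
  shows "integrable lborel (\<lambda>x. (weight_excess k u x)^j)" "(\<lambda>k. \<integral>x. (weight_excess k u x)^j \<partial>lborel) \<longlonglongrightarrow> 0"
proof -
  note [measurable] = weight_props(3)
  have [measurable]: "weight_excess k u \<in> borel_measurable borel" for k unfolding weight_excess_def[abs_def] by measurable
  have b: "norm ((weight_excess k u x)^j) \<le> \<bar>u x\<bar>^j" for k x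
    using weight_excess_bounds(1,2)[of k u x] by (simp add: power_mono)
  show "integrable lborel (\<lambda>x. (weight_excess k u x)^j)"
    by (rule Bochner_Integration.integrable_bound[OF i]) (use b in auto)
  have "(\<lambda>k. \<integral>x. (weight_excess k u x)^j \<partial>lborel) \<longlonglongrightarrow> (\<integral>x. 0 \<partial>(lborel :: (real^3) measure))"
  proof (rule integral_dominated_convergence[OF _ _ i])
    show "AE x in lborel. (\<lambda>k. (weight_excess k u x)^j) \<longlonglongrightarrow> 0"
      using tendsto_power[OF weight_excess_tendsto, of u _ j] j by (intro AE_I2) (simp add: zero_power)
  qed (use b in auto)
  then show "(\<lambda>k. \<integral>x. (weight_excess k u x)^j \<partial>lborel) \<longlonglongrightarrow> 0" by simp
qed

text \<open>A sequence that vanishes locally and is bounded in \<open>L\<^sup>2\<close> has vanishing overlap with each fixed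
  function. The function is split at \<open>k * weight\<^sup>2\<close>: the excess is small against the bound, and the rest
  is small against the weighted norm.\<close>

lemma product_tendsto_0:
  fixes w :: "nat \<Rightarrow> real^3 \<Rightarrow> real"
  assumes u: "square_integrable u" and w: "\<And>n. square_integrable (w n)" and M: "\<And>n. (LBINT x. (w n x)^2) \<le> M"
    and lim: "(\<lambda>n. \<integral>x. (weight x)^2 * (w n x)^2 \<partial>lborel) \<longlonglongrightarrow> 0"
  shows "(\<lambda>n. \<integral>x. \<bar>u x * w n x\<bar> \<partial>lborel) \<longlonglongrightarrow> 0"
proof (rule LIMSEQ_I)
  fix e :: real assume e: "e > 0"
  note [measurable] = square_integrableD(1)[OF u] square_integrableD(1)[OF w] weight_props(3)
  have [measurable]: "weight_excess k u \<in> borel_measurable borel" for k unfolding weight_excess_def[abs_def] by measurable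
  have M0: "M \<ge> 0" using order_trans[OF _ M[of 0]] by simp
  have u2: "integrable lborel (\<lambda>x. \<bar>u x\<bar>^2)" using square_integrableD(2)[OF u] by simp
  note ex = weight_excess_integral_tendsto[OF _ u2, simplified]
  define s where "s = e / (4 * (M + 1))"
  have s: "s > 0" "s * M \<le> e / 4" using e M0 by (auto simp: s_def field_simps)
  have "\<forall>\<^sub>F k in sequentially. (LBINT x. (weight_excess k u x)^2) < s * (e / 4)"
    by (rule order_tendstoD(2)[OF ex(2)]) (use s e in auto)
  then obtain k where k: "(LBINT x. (weight_excess k u x)^2) < s * (e / 4)" by (auto simp: eventually_sequentially)
  define W where "W = (LBINT x. (weight x)^2)"
  have W0: "W \<ge> 0" by (simp add: W_def)
  define t where "t = e / (4 * (real k + 1) * (W + 1))"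
  have t: "t > 0" "real k * (t * W) \<le> e / 4"
  proof -
    show "t > 0" using e W0 by (simp add: t_def)
    have "real k * (t * W) \<le> (real k + 1) * (t * (W + 1))" using \<open>t > 0\<close> W0 by (intro mult_mono) auto
    also have "\<dots> = e / 4"
    proof -
      have "A * (e / (4 * A * B) * B) = e / 4" if "A > 0" "B > 0" for A B :: real using that by simp
      from this[of "real k + 1" "W + 1"] W0 show ?thesis unfolding t_def by simp
    qed
    finally show "real k * (t * W) \<le> e / 4" .
  qed
  have "\<forall>\<^sub>F n in sequentially. (LBINT x. (weight x)^2 * (w n x)^2) < t * (e / (4 * (real k + 1)))"
    by (rule order_tendstoD(2)[OF lim]) (use t e in auto)
  then obtain N where N: "\<And>n. n \<ge> N \<Longrightarrow> (LBINT x. (weight x)^2 * (w n x)^2) < t * (e / (4 * (real k + 1)))" by (auto simp: eventually_sequentially)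
  show "\<exists>N. \<forall>n\<ge>N. norm ((LBINT x. \<bar>u x * w n x\<bar>) - 0) < e"
  proof (intro exI[of _ N] allI impI)
    fix n assume n: "n \<ge> N"
    have ww: "integrable lborel (\<lambda>x. (weight x)^2 * (w n x)^2)"
      using square_integrableD(2)[OF square_integrable_weight[OF w[of n]]] by (simp add: power_mult_distrib)
    have w2: "integrable lborel (\<lambda>x. (w n x)^2)" using square_integrableD(2)[OF w[of n]] by simp
    have pw: "\<bar>u x * w n x\<bar> \<le> real k * (t * (weight x)^2 + inverse t * ((weight x)^2 * (w n x)^2)) + (inverse s * (weight_excess k u x)^2 + s * (w n x)^2)" for x
    proof -
      have "\<bar>u x * w n x\<bar> \<le> (real k * (weight x)^2 + weight_excess k u x) * \<bar>w n x\<bar>"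
        unfolding abs_mult by (intro mult_right_mono weight_excess_bounds) auto
      also have "\<dots> = real k * (weight x * (weight x * \<bar>w n x\<bar>)) + weight_excess k u x * \<bar>w n x\<bar>"
        by (simp add: algebra_simps power2_eq_square)
      also have "\<dots> \<le> real k * (t * (weight x)^2 + inverse t * (weight x * \<bar>w n x\<bar>)^2) + (inverse s * (weight_excess k u x)^2 + s * \<bar>w n x\<bar>^2)"
        using abs_mult_le_weighted[OF t(1), of "weight x" "weight x * \<bar>w n x\<bar>"]
          abs_mult_le_weighted[of "inverse s" "weight_excess k u x" "\<bar>w n x\<bar>"] s(1)
        by (intro add_mono mult_left_mono) auto
      finally show ?thesis by (simp add: power_mult_distrib)
    qed
    have "(LBINT x. \<bar>u x * w n x\<bar>) \<le> (LBINT x. real k * (t * (weight x)^2 + inverse t * ((weight x)^2 * (w n x)^2)) + (inverse s * (weight_excess k u x)^2 + s * (w n x)^2))"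
      by (intro integral_mono integrable_abs square_integrable_mult u w Bochner_Integration.integrable_add integrable_mult_right
          weight_props(4) ww w2 ex(1) pw) measurable
    also have "\<dots> = real k * (t * W) + real k * (inverse t * (LBINT x. (weight x)^2 * (w n x)^2))
       + (inverse s * (LBINT x. (weight_excess k u x)^2) + s * (LBINT x. (w n x)^2))"
      using weight_props(4) ww w2 ex(1) by (simp add: W_def distrib_left)
    also have "\<dots> < e"
    proof -
      have "inverse t * (LBINT x. (weight x)^2 * (w n x)^2) \<le> e / (4 * (real k + 1))"
        using N[OF n] t(1) by (simp add: field_simps)
      then have "real k * (inverse t * (LBINT x. (weight x)^2 * (w n x)^2)) \<le> real k * (e / (4 * (real k + 1)))"
        by (intro mult_left_mono) auto
      also have "\<dots> \<le> e / 4" using e by (simp add: field_simps)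
      finally have a: "real k * (inverse t * (LBINT x. (weight x)^2 * (w n x)^2)) \<le> e / 4" .
      have b: "inverse s * (LBINT x. (weight_excess k u x)^2) < e / 4" using k s(1) by (simp add: field_simps)
      have c: "s * (LBINT x. (w n x)^2) \<le> e / 4" using M[of n] s by (meson mult_left_mono less_imp_le order_trans)
      from a b c t(2) show ?thesis by argo
    qed
    finally show "norm ((LBINT x. \<bar>u x * w n x\<bar>) - 0) < e" by simp
  qed
qed

text \<open>The case distinction is which of the two functions dominates; the parameter \<open>s\<close> moves weight from one
  to the other.\<close>

lemma cubic_young:
  fixes a b s :: real assumes "0 \<le> a" "0 \<le> b" "0 < s"
  shows "a * b^2 \<le> inverse s^2 * a^3 + s * b^3" "a^2 * b \<le> s * a^3 + inverse s * (a * b^2)"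
proof -
  show "a * b^2 \<le> inverse s^2 * a^3 + s * b^3"
  proof (cases "b \<le> inverse s * a")
    case True
    have "a * b^2 \<le> a * (inverse s * a)^2" using True assms by (intro mult_left_mono power_mono) auto
    also have "\<dots> = inverse s^2 * a^3" by (simp add: power_mult_distrib power2_eq_square power3_eq_cube)
    also have "\<dots> \<le> inverse s^2 * a^3 + s * b^3" using assms by simp
    finally show ?thesis .
  next
    case False
    then have "a \<le> s * b" using assms by (simp add: field_simps)
    then have "a * b^2 \<le> s * b * b^2" by (rule mult_right_mono) simp
    also have "\<dots> = s * b^3" by (simp add: power2_eq_square power3_eq_cube)
    also have "\<dots> \<le> inverse s^2 * a^3 + s * b^3" using assms by simp
    finally show ?thesis .
  qed
  show "a^2 * b \<le> s * a^3 + inverse s * (a * b^2)"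
  proof (cases "b \<le> s * a")
    case True
    have "a^2 * b \<le> a^2 * (s * a)" using True by (rule mult_left_mono) simp
    also have "\<dots> = s * a^3" by (simp add: power2_eq_square power3_eq_cube)
    also have "\<dots> \<le> s * a^3 + inverse s * (a * b^2)" using assms by simp
    finally show ?thesis .
  next
    case False
    then have "a \<le> inverse s * b" using assms by (simp add: field_simps)
    then have "a * (a * b) \<le> inverse s * b * (a * b)" using assms by (intro mult_right_mono) auto
    also have "\<dots> = inverse s * (a * b^2)" by (simp add: power2_eq_square)
    also have "\<dots> \<le> s * a^3 + inverse s * (a * b^2)" using assms by simp
    finally show ?thesis by (simp add: power2_eq_square)
  qed
qed

lemma cubic_product_integrable:
  fixes u w :: "real^3 \<Rightarrow> real"
  assumes [measurable]: "u \<in> borel_measurable borel" "w \<in> borel_measurable borel"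
    and u3: "integrable lborel (\<lambda>x. \<bar>u x\<bar>^3)" and w3: "integrable lborel (\<lambda>x. \<bar>w x\<bar>^3)"
  shows "integrable lborel (\<lambda>x. \<bar>u x\<bar> * (w x)^2)"
proof (rule Bochner_Integration.integrable_bound[OF Bochner_Integration.integrable_add[OF u3 w3]])
  show "AE x in lborel. norm (\<bar>u x\<bar> * (w x)^2) \<le> norm (\<bar>u x\<bar>^3 + \<bar>w x\<bar>^3)"
    using cubic_young(1)[of "\<bar>u x\<bar>" "\<bar>w x\<bar>" 1 for x] by (intro AE_I2) simp
qed measurable

text \<open>The analogue of \<open>product_tendsto_0\<close> for the mixed terms in the expansion of the cubic term. The
  second limit follows from the first, since \<open>u\<^sup>2 \<bar>w\<bar>\<close> interpolates between \<open>\<bar>u\<bar>\<^sup>3\<close> and \<open>\<bar>u\<bar> w\<^sup>2\<close>.\<close>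

lemma cubic_product_tendsto_0:
  fixes w :: "nat \<Rightarrow> real^3 \<Rightarrow> real"
  assumes u[measurable]: "u \<in> borel_measurable borel" and u3: "integrable lborel (\<lambda>x. \<bar>u x\<bar>^3)"
    and w: "\<And>n. square_integrable (w n)" and w3: "\<And>n. integrable lborel (\<lambda>x. \<bar>w n x\<bar>^3)"
    and M: "\<And>n. (LBINT x. \<bar>w n x\<bar>^3) \<le> M"
    and lim: "(\<lambda>n. \<integral>x. (weight x)^2 * (w n x)^2 \<partial>lborel) \<longlonglongrightarrow> 0"
  shows "(\<lambda>n. \<integral>x. \<bar>u x\<bar> * (w n x)^2 \<partial>lborel) \<longlonglongrightarrow> 0"
    and "(\<lambda>n. \<integral>x. (u x)^2 * \<bar>w n x\<bar> \<partial>lborel) \<longlonglongrightarrow> 0"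
    and "\<And>n. integrable lborel (\<lambda>x. (u x)^2 * \<bar>w n x\<bar>)"
proof -
  note [measurable] = square_integrableD(1)[OF w] weight_props(3)
  have [measurable]: "weight_excess k u \<in> borel_measurable borel" for k unfolding weight_excess_def[abs_def] by measurable
  have M0: "M \<ge> 0" using order_trans[OF _ M[of 0]] by simp
  note ex = weight_excess_integral_tendsto[OF u u3, simplified]
  have iuw: "integrable lborel (\<lambda>x. \<bar>u x\<bar> * (w n x)^2)" for n
    by (rule cubic_product_integrable[OF _ _ u3 w3]) measurable
  show iuw': "integrable lborel (\<lambda>x. (u x)^2 * \<bar>w n x\<bar>)" for n
    using cubic_product_integrable[OF _ _ w3[of n] u3] by (simp add: mult.commute)
  show L: "(\<lambda>n. \<integral>x. \<bar>u x\<bar> * (w n x)^2 \<partial>lborel) \<longlonglongrightarrow> 0"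
  proof (rule LIMSEQ_I)
    fix e :: real assume e: "e > 0"
    define s where "s = e / (4 * (M + 1))"
    have s: "s > 0" "s * M \<le> e / 4" using e M0 by (auto simp: s_def field_simps)
    have "\<forall>\<^sub>F k in sequentially. (LBINT x. (weight_excess k u x)^3) < s^2 * (e / 4)"
      by (rule order_tendstoD(2)[OF ex(2)]) (use s e in auto)
    then obtain k where k: "(LBINT x. (weight_excess k u x)^3) < s^2 * (e / 4)" by (auto simp: eventually_sequentially)
    have "\<forall>\<^sub>F n in sequentially. (LBINT x. (weight x)^2 * (w n x)^2) < e / (4 * (real k + 1))"
      by (rule order_tendstoD(2)[OF lim]) (use e in auto)
    then obtain N where N: "\<And>n. n \<ge> N \<Longrightarrow> (LBINT x. (weight x)^2 * (w n x)^2) < e / (4 * (real k + 1))" by (auto simp: eventually_sequentially)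
    show "\<exists>N. \<forall>n\<ge>N. norm ((LBINT x. \<bar>u x\<bar> * (w n x)^2) - 0) < e"
    proof (intro exI[of _ N] allI impI)
      fix n assume n: "n \<ge> N"
      have ww: "integrable lborel (\<lambda>x. (weight x)^2 * (w n x)^2)"
        using square_integrableD(2)[OF square_integrable_weight[OF w[of n]]] by (simp add: power_mult_distrib)
      have pw: "\<bar>u x\<bar> * (w n x)^2 \<le> real k * ((weight x)^2 * (w n x)^2) + (inverse s^2 * (weight_excess k u x)^3 + s * \<bar>w n x\<bar>^3)" for x
      proof -
        have "\<bar>u x\<bar> * (w n x)^2 \<le> (real k * (weight x)^2 + weight_excess k u x) * (w n x)^2"
          by (intro mult_right_mono weight_excess_bounds) auto
        also have "\<dots> = real k * ((weight x)^2 * (w n x)^2) + weight_excess k u x * \<bar>w n x\<bar>^2" by (simp add: algebra_simps)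
        also have "\<dots> \<le> real k * ((weight x)^2 * (w n x)^2) + (inverse s^2 * (weight_excess k u x)^3 + s * \<bar>w n x\<bar>^3)"
          by (intro add_left_mono cubic_young(1) weight_excess_bounds s) auto
        finally show ?thesis .
      qed
      have "(LBINT x. \<bar>u x\<bar> * (w n x)^2) \<le> (LBINT x. real k * ((weight x)^2 * (w n x)^2) + (inverse s^2 * (weight_excess k u x)^3 + s * \<bar>w n x\<bar>^3))"
        by (intro integral_mono iuw Bochner_Integration.integrable_add integrable_mult_right ww w3 ex(1) pw)
      also have "\<dots> = real k * (LBINT x. (weight x)^2 * (w n x)^2)
         + (inverse s^2 * (LBINT x. (weight_excess k u x)^3) + s * (LBINT x. \<bar>w n x\<bar>^3))"
        using ww w3 ex(1) by simp
      also have "\<dots> < e"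
      proof -
        have "real k * (LBINT x. (weight x)^2 * (w n x)^2) \<le> real k * (e / (4 * (real k + 1)))"
          using N[OF n] by (intro mult_left_mono) auto
        also have "\<dots> \<le> e / 4" using e by (simp add: field_simps)
        finally have a: "real k * (LBINT x. (weight x)^2 * (w n x)^2) \<le> e / 4" .
        have "inverse s^2 * (LBINT x. (weight_excess k u x)^3) < inverse s^2 * (s^2 * (e / 4))"
          using k s(1) by (intro mult_strict_left_mono) auto
        also have "\<dots> = e / 4" using s(1) by (simp add: power_inverse)
        finally have b: "inverse s^2 * (LBINT x. (weight_excess k u x)^3) < e / 4" .
        have c: "s * (LBINT x. \<bar>w n x\<bar>^3) \<le> e / 4" using M[of n] s by (meson mult_left_mono less_imp_le order_trans)
        from a b c e show ?thesis by argo
      qed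
      finally show "norm ((LBINT x. \<bar>u x\<bar> * (w n x)^2) - 0) < e" by simp
    qed
  qed
  show "(\<lambda>n. \<integral>x. (u x)^2 * \<bar>w n x\<bar> \<partial>lborel) \<longlonglongrightarrow> 0"
  proof (rule LIMSEQ_I)
    fix e :: real assume e: "e > 0"
    define U where "U = (LBINT x. \<bar>u x\<bar>^3)"
    have U0: "U \<ge> 0" by (simp add: U_def)
    define s where "s = e / (2 * (U + 1))"
    have s: "s > 0" "s * U \<le> e / 2" using e U0 by (auto simp: s_def field_simps)
    have "\<forall>\<^sub>F n in sequentially. (LBINT x. \<bar>u x\<bar> * (w n x)^2) < s * (e / 2)"
      by (rule order_tendstoD(2)[OF L]) (use e s in auto)
    then obtain N where N: "\<And>n. n \<ge> N \<Longrightarrow> (LBINT x. \<bar>u x\<bar> * (w n x)^2) < s * (e / 2)" by (auto simp: eventually_sequentially)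
    show "\<exists>N. \<forall>n\<ge>N. norm ((LBINT x. (u x)^2 * \<bar>w n x\<bar>) - 0) < e"
    proof (intro exI[of _ N] allI impI)
      fix n assume n: "n \<ge> N"
      have pw: "(u x)^2 * \<bar>w n x\<bar> \<le> s * \<bar>u x\<bar>^3 + inverse s * (\<bar>u x\<bar> * (w n x)^2)" for x
        using cubic_young(2)[of "\<bar>u x\<bar>" "\<bar>w n x\<bar>" s] s by simp
      have "(LBINT x. (u x)^2 * \<bar>w n x\<bar>) \<le> (LBINT x. s * \<bar>u x\<bar>^3 + inverse s * (\<bar>u x\<bar> * (w n x)^2))"
        by (intro integral_mono iuw' Bochner_Integration.integrable_add integrable_mult_right iuw u3 pw)
      also have "\<dots> = s * U + inverse s * (LBINT x. \<bar>u x\<bar> * (w n x)^2)" using u3 iuw by (simp add: U_def)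
      also have "inverse s * (LBINT x. \<bar>u x\<bar> * (w n x)^2) < inverse s * (s * (e / 2))"
        using N[OF n] s(1) by (intro mult_strict_left_mono) auto
      also have "inverse s * (s * (e / 2)) = e / 2" using s(1) by simp
      finally have "(LBINT x. (u x)^2 * \<bar>w n x\<bar>) < e" using s by simp
      moreover have "0 \<le> (LBINT x. (u x)^2 * \<bar>w n x\<bar>)" by simp
      ultimately show "norm ((LBINT x. (u x)^2 * \<bar>w n x\<bar>) - 0) < e" by simp
    qed
  qed
qed

section \<open>Charges with bounded potential\<close>

text \<open>The Coulomb potential of a charge is bounded, so all interactions of charges are finite and can be
  treated as real numbers. By \<open>newton_bound\<close> the squares of Sobolev functions are charges.\<close>

definition charge :: "real \<Rightarrow> (real^3 \<Rightarrow> real) \<Rightarrow> bool" where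
  "charge K F \<longleftrightarrow> integrable lborel F \<and> F \<in> borel_measurable borel \<and> (\<forall>x. 0 \<le> F x) \<and> 0 \<le> K \<and>
     (\<forall>x. newton (\<lambda>y. ennreal (F y)) x \<le> ennreal K)"

definition interaction :: "(real^3 \<Rightarrow> real) \<Rightarrow> (real^3 \<Rightarrow> real) \<Rightarrow> real" where
  "interaction F H = enn2real (coulomb (\<lambda>x. ennreal (F x)) (\<lambda>x. ennreal (H x)))"

lemma newton_mono: "(\<And>y. F y \<le> H y) \<Longrightarrow> newton F x \<le> newton H x"
  unfolding newton_def by (intro nn_integral_mono mult_left_mono) auto

lemma newton_add:
  assumes [measurable]: "F \<in> borel_measurable borel" "H \<in> borel_measurable borel"
  shows "newton (\<lambda>y. F y + H y) x = newton F x + newton H x"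
  unfolding newton_def by (simp add: distrib_left nn_integral_add)

lemma newton_cmult:
  assumes [measurable]: "F \<in> borel_measurable borel"
  shows "newton (\<lambda>y. c * F y) x = c * newton F x"
  unfolding newton_def by (simp add: mult.left_commute nn_integral_cmult)

lemma coulomb_commute:
  assumes [measurable]: "F \<in> borel_measurable borel" "H \<in> borel_measurable borel"
  shows "coulomb F H = coulomb H F"
proof -
  have "coulomb F H = (\<integral>\<^sup>+x. \<integral>\<^sup>+y. F x * (ennreal (norm (y - x) powr (-1)) * H y) \<partial>lborel \<partial>lborel)"
    unfolding coulomb_def newton_def by (simp add: nn_integral_cmult)
  also have "\<dots> = (\<integral>\<^sup>+y. \<integral>\<^sup>+x. F x * (ennreal (norm (y - x) powr (-1)) * H y) \<partial>lborel \<partial>lborel)"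
    by (rule lborel_pair.Fubini') measurable
  also have "\<dots> = (\<integral>\<^sup>+y. \<integral>\<^sup>+x. H y * (ennreal (norm (x - y) powr (-1)) * F x) \<partial>lborel \<partial>lborel)"
    by (simp add: mult_ac norm_minus_commute)
  also have "\<dots> = coulomb H F" unfolding coulomb_def newton_def by (simp add: nn_integral_cmult)
  finally show ?thesis .
qed

lemma chargeD:
  assumes "charge K F"
  shows "integrable lborel F" "F \<in> borel_measurable borel" "0 \<le> F x" "0 \<le> K" "newton (\<lambda>y. ennreal (F y)) x \<le> ennreal K"
  using assms by (auto simp: charge_def)

lemma charge_mono:
  assumes F: "charge K F" and [measurable]: "H \<in> borel_measurable borel" and b: "\<And>x. 0 \<le> H x" "\<And>x. H x \<le> F x"
  shows "charge K H"
proof -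
  have "integrable lborel H"
    by (rule Bochner_Integration.integrable_bound[OF chargeD(1)[OF F]]) (use b in \<open>auto intro!: AE_I2 intro: order_trans[OF _ abs_ge_self]\<close>)
  moreover have "newton (\<lambda>y. ennreal (H y)) x \<le> ennreal K" for x
    by (rule order_trans[OF newton_mono chargeD(5)[OF F]]) (rule ennreal_leI[OF b(2)])
  ultimately show ?thesis using b(1) chargeD(4)[OF F] by (simp add: charge_def)
qed

lemma charge_add:
  assumes F: "charge K F" and H: "charge L H" shows "charge (K + L) (\<lambda>x. F x + H x)"
proof -
  note [measurable] = chargeD(2)[OF F] chargeD(2)[OF H]
  have "newton (\<lambda>y. ennreal (F y + H y)) x \<le> ennreal (K + L)" for x
  proof -
    have "newton (\<lambda>y. ennreal (F y + H y)) x = newton (\<lambda>y. ennreal (F y)) x + newton (\<lambda>y. ennreal (H y)) x"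
      using chargeD(3)[OF F] chargeD(3)[OF H] by (subst newton_add[symmetric]) auto
    also have "\<dots> \<le> ennreal K + ennreal L" by (intro add_mono chargeD(5) F H)
    finally show ?thesis using chargeD(4)[OF F] chargeD(4)[OF H] by simp
  qed
  then show ?thesis using chargeD[OF F] chargeD[OF H] by (simp add: charge_def)
qed

lemma charge_cmult:
  assumes F: "charge K F" and c: "0 \<le> c" shows "charge (c * K) (\<lambda>x. c * F x)"
proof -
  note [measurable] = chargeD(2)[OF F]
  have "newton (\<lambda>y. ennreal (c * F y)) x \<le> ennreal (c * K)" for x
  proof -
    have "newton (\<lambda>y. ennreal (c * F y)) x = ennreal c * newton (\<lambda>y. ennreal (F y)) x"
      using c chargeD(3)[OF F] by (subst newton_cmult[symmetric]) (auto simp: ennreal_mult)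
    also have "\<dots> \<le> ennreal c * ennreal K" by (intro mult_left_mono chargeD(5) F) simp
    finally show ?thesis using c chargeD(4)[OF F] by (simp add: ennreal_mult)
  qed
  then show ?thesis using chargeD[OF F] c by (simp add: charge_def)
qed

lemma coulomb_charge_le:
  assumes F: "charge K F" and H: "charge L H"
  shows "coulomb (\<lambda>x. ennreal (F x)) (\<lambda>x. ennreal (H x)) \<le> ennreal (L * (LBINT x. F x))"
proof -
  note [measurable] = chargeD(2)[OF F] chargeD(2)[OF H]
  have "coulomb (\<lambda>x. ennreal (F x)) (\<lambda>x. ennreal (H x)) \<le> (\<integral>\<^sup>+x. ennreal (F x) * ennreal L \<partial>lborel)"
    unfolding coulomb_def by (intro nn_integral_mono mult_left_mono chargeD(5) H) simp
  also have "\<dots> = ennreal (LBINT x. F x) * ennreal L"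
    using chargeD[OF F] by (simp add: nn_integral_multc nn_integral_eq_integral)
  also have "\<dots> = ennreal (L * (LBINT x. F x))"
    using chargeD(3)[OF F] chargeD(4)[OF H] by (simp add: ennreal_mult mult.commute)
  finally show ?thesis .
qed

lemma coulomb_interaction:
  assumes F: "charge K F" and H: "charge L H"
  shows "coulomb (\<lambda>x. ennreal (F x)) (\<lambda>x. ennreal (H x)) = ennreal (interaction F H)"
  using coulomb_charge_le[OF F H] unfolding interaction_def
  by (metis ennreal_enn2real ennreal_less_top le_less_trans)

text \<open>Overlaps and small increments have a small total charge and a bounded potential, and are negligible
  for this reason.\<close>

lemma interaction_le:
  assumes F: "charge K F" and H: "charge L H"
  shows "interaction F H \<le> L * (LBINT x. F x)"
proof -
  have "0 \<le> (LBINT x. F x)" using chargeD(3)[OF F] by (intro Bochner_Integration.integral_nonneg) auto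
  then show ?thesis
    using coulomb_charge_le[OF F H] chargeD(4)[OF H] unfolding coulomb_interaction[OF F H] by (simp add: ennreal_le_iff)
qed

lemma interaction_nonneg: "0 \<le> interaction F H" by (simp add: interaction_def)

lemma interaction_commute:
  assumes F: "charge K F" and H: "charge L H" shows "interaction F H = interaction H F"
proof -
  note [measurable] = chargeD(2)[OF F] chargeD(2)[OF H]
  show ?thesis unfolding interaction_def by (subst coulomb_commute) auto
qed

lemma interaction_add_left:
  assumes F: "charge K F" and G: "charge K' G" and H: "charge L H"
  shows "interaction (\<lambda>x. F x + G x) H = interaction F H + interaction G H"
proof -
  note [measurable] = chargeD(2)[OF F] chargeD(2)[OF G] chargeD(2)[OF H]
  have "coulomb (\<lambda>x. ennreal (F x + G x)) (\<lambda>x. ennreal (H x)) = coulomb (\<lambda>x. ennreal (F x)) (\<lambda>x. ennreal (H x)) + coulomb (\<lambda>x. ennreal (G x)) (\<lambda>x. ennreal (H x))"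
    unfolding coulomb_def using chargeD(3)[OF F] chargeD(3)[OF G] by (subst nn_integral_add[symmetric]) (auto simp: distrib_right)
  then have "ennreal (interaction (\<lambda>x. F x + G x) H) = ennreal (interaction F H + interaction G H)"
    unfolding coulomb_interaction[OF charge_add[OF F G] H] coulomb_interaction[OF F H] coulomb_interaction[OF G H]
    by (simp add: interaction_nonneg)
  then show ?thesis by (subst (asm) ennreal_inj) (auto intro: add_nonneg_nonneg interaction_nonneg)
qed

lemma interaction_add_right:
  assumes F: "charge K F" and G: "charge K' G" and H: "charge L H"
  shows "interaction H (\<lambda>x. F x + G x) = interaction H F + interaction H G"
  using interaction_add_left[OF F G H] interaction_commute[OF charge_add[OF F G] H] interaction_commute[OF F H] interaction_commute[OF G H]
  by simp

lemma interaction_cmult: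
  assumes F: "charge K F" and H: "charge L H" and c: "0 \<le> c"
  shows "interaction (\<lambda>x. c * F x) H = c * interaction F H" "interaction H (\<lambda>x. c * F x) = c * interaction H F"
proof -
  note [measurable] = chargeD(2)[OF F] chargeD(2)[OF H]
  have "coulomb (\<lambda>x. ennreal (c * F x)) (\<lambda>x. ennreal (H x)) = ennreal c * coulomb (\<lambda>x. ennreal (F x)) (\<lambda>x. ennreal (H x))"
    unfolding coulomb_def using chargeD(3)[OF F] c by (subst nn_integral_cmult[symmetric]) (auto simp: ennreal_mult mult.assoc)
  then have "ennreal (interaction (\<lambda>x. c * F x) H) = ennreal (c * interaction F H)"
    unfolding coulomb_interaction[OF charge_cmult[OF F c] H] coulomb_interaction[OF F H] using c
    by (simp add: ennreal_mult interaction_nonneg)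
  then show e: "interaction (\<lambda>x. c * F x) H = c * interaction F H" using c by (simp add: interaction_nonneg)
  show "interaction H (\<lambda>x. c * F x) = c * interaction H F"
    using e interaction_commute[OF charge_cmult[OF F c] H] interaction_commute[OF F H] by simp
qed

lemma interaction_mono:
  assumes F: "charge K F" and H: "charge L H" and F': "charge K' F'" and H': "charge L' H'"
    and b: "\<And>x. F x \<le> F' x" "\<And>x. H x \<le> H' x"
  shows "interaction F H \<le> interaction F' H'"
proof -
  have "coulomb (\<lambda>x. ennreal (F x)) (\<lambda>x. ennreal (H x)) \<le> coulomb (\<lambda>x. ennreal (F' x)) (\<lambda>x. ennreal (H' x))"
    unfolding coulomb_def by (intro nn_integral_mono mult_mono newton_mono ennreal_leI b) auto
  then show ?thesis unfolding coulomb_interaction[OF F H] coulomb_interaction[OF F' H']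
    by (simp add: ennreal_le_iff interaction_nonneg)
qed

section \<open>The power nonlinearity\<close>

definition coupling :: "real \<Rightarrow> real \<Rightarrow> real \<Rightarrow> real \<Rightarrow> real" where
  "coupling p \<beta> s t = \<bar>s\<bar> powr p + \<bar>t\<bar> powr p + 2 * \<beta> * \<bar>s\<bar> powr (p/2) * \<bar>t\<bar> powr (p/2)"

lemma coupling_zero: "coupling p \<beta> s 0 = \<bar>s\<bar> powr p" "coupling p \<beta> 0 t = \<bar>t\<bar> powr p"
  by (simp_all add: coupling_def)

lemma coupling_measurable [measurable]:
  assumes [measurable]: "u \<in> borel_measurable M" "v \<in> borel_measurable M"
  shows "(\<lambda>x. coupling p \<beta> (u x) (v x)) \<in> borel_measurable M"
  unfolding coupling_def by measurable

lemma continuous_coupling: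
  assumes p: "0 < p" and "(f \<longlongrightarrow> a) F" "(h \<longlongrightarrow> b) F"
  shows "((\<lambda>n. coupling p \<beta> (f n) (h n)) \<longlongrightarrow> coupling p \<beta> a b) F"
  unfolding coupling_def using assms by (intro tendsto_intros) auto

lemma powr_half_mult: "\<bar>s\<bar> powr (p/2) * \<bar>t\<bar> powr (p/2) \<le> (\<bar>s\<bar> powr p + \<bar>t\<bar> powr p) / 2" for s t p :: real
proof -
  have "(\<bar>r\<bar> powr (p/2))^2 = \<bar>r\<bar> powr p" for r :: real by (simp add: power2_eq_square flip: powr_add)
  then show ?thesis using sum_squares_bound[of "\<bar>s\<bar> powr (p/2)" "\<bar>t\<bar> powr (p/2)"] by simp
qed

lemma coupling_le: "\<beta> \<ge> 0 \<Longrightarrow> coupling p \<beta> s t \<le> (1 + \<beta>) * (\<bar>s\<bar> powr p + \<bar>t\<bar> powr p)"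
  using mult_left_mono[OF powr_half_mult[of s p t], of "2 * \<beta>"] by (simp add: coupling_def algebra_simps)

lemma powr_between: "\<bar>s\<bar> powr p \<le> s^2 + \<bar>s\<bar>^3" if "2 < p" "p < 3" for s p :: real
proof (cases "\<bar>s\<bar> \<le> 1")
  case True
  have "\<bar>s\<bar> powr p \<le> \<bar>s\<bar> powr 2"
  proof (cases "s = 0")
    case False
    then show ?thesis by (intro powr_mono') (use that True in auto)
  qed simp
  also have "\<dots> = s^2" by (cases "s = 0") (simp_all add: powr_numeral)
  also have "\<dots> \<le> s^2 + \<bar>s\<bar>^3" by simp
  finally show ?thesis .
next
  case False
  have "\<bar>s\<bar> powr p \<le> \<bar>s\<bar> powr 3" using that False by (intro powr_mono) auto
  also have "\<dots> = \<bar>s\<bar>^3" using False by (simp add: powr_numeral)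
  also have "\<dots> \<le> s^2 + \<bar>s\<bar>^3" by simp
  finally show ?thesis .
qed

text \<open>The weighted inequality between the arithmetic and the geometric mean, for the exponent \<open>p\<close>
  as an average of \<open>2\<close> and \<open>3\<close>. It is the source of the constant in the upper bound for \<open>\<beta>\<close>.\<close>

lemma powr_interpolation:
  fixes A B s p :: real
  assumes p: "2 < p" "p < 3" and A: "0 < A" and B: "0 < B"
  shows "(A / (3 - p)) powr (3 - p) * (B / (p - 2)) powr (p - 2) * \<bar>s\<bar> powr p \<le> A * s^2 + B * \<bar>s\<bar>^3"
proof (cases "s = 0")
  case False
  let ?a = "A * s^2 / (3 - p)" and ?b = "B * \<bar>s\<bar>^3 / (p - 2)"
  have "?a powr (3 - p) * ?b powr (p - 2) \<le> (3 - p) * ?a + (p - 2) * ?b"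
    by (rule Youngs_inequality_0) (use assms False in auto)
  also have "\<dots> = A * s^2 + B * \<bar>s\<bar>^3" using p by simp
  also have "?a powr (3 - p) = (A / (3 - p)) powr (3 - p) * \<bar>s\<bar> powr (2 * (3 - p))"
  proof -
    have "?a = (A / (3 - p)) * \<bar>s\<bar> powr 2" using False by (simp add: powr_numeral)
    then show ?thesis using p A by (simp only: powr_mult powr_powr)
  qed
  also have "?b powr (p - 2) = (B / (p - 2)) powr (p - 2) * \<bar>s\<bar> powr (3 * (p - 2))"
  proof -
    have "?b = (B / (p - 2)) * \<bar>s\<bar> powr 3" using False by (simp add: powr_numeral)
    then show ?thesis using p B by (simp only: powr_mult powr_powr)
  qed
  also have "(A / (3 - p)) powr (3 - p) * \<bar>s\<bar> powr (2 * (3 - p)) * ((B / (p - 2)) powr (p - 2) * \<bar>s\<bar> powr (3 * (p - 2)))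
    = (A / (3 - p)) powr (3 - p) * (B / (p - 2)) powr (p - 2) * (\<bar>s\<bar> powr (2 * (3 - p)) * \<bar>s\<bar> powr (3 * (p - 2)))"
    by (simp only: mult_ac)
  also have "\<bar>s\<bar> powr (2 * (3 - p)) * \<bar>s\<bar> powr (3 * (p - 2)) = \<bar>s\<bar> powr p"
    unfolding powr_add[symmetric] by (simp add: algebra_simps)
  finally show ?thesis .
qed simp

text \<open>The threshold \<open>S\<close> is where the two terms without the constant coincide.\<close>

lemma powr_absorbed:
  fixes c d p :: real assumes p: "2 < p" "p < 3" and c: "0 < c" and d: "0 < d"
  obtains C where "C \<ge> 0" "\<And>s. c * \<bar>s\<bar> powr p \<le> d * \<bar>s\<bar>^3 + C"
proof
  define S where "S = (c / d) powr (1 / (3 - p))"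
  have S: "S > 0" using c d by (simp add: S_def)
  have Sp: "S powr (3 - p) = c / d" using p c d by (simp add: S_def powr_powr)
  show "c * S powr p \<ge> 0" using c by simp
  fix s :: real
  show "c * \<bar>s\<bar> powr p \<le> d * \<bar>s\<bar>^3 + c * S powr p"
  proof (cases "\<bar>s\<bar> \<le> S")
    case True
    then have "c * \<bar>s\<bar> powr p \<le> c * S powr p" using p c by (intro mult_left_mono powr_mono2) auto
    then show ?thesis using d by (simp add: add_increasing)
  next
    case False
    then have s: "\<bar>s\<bar> > 0" using S by linarith
    have "c = d * S powr (3 - p)" using Sp d by simp
    also have "\<dots> \<le> d * \<bar>s\<bar> powr (3 - p)" using False p d S by (intro mult_left_mono powr_mono2) auto
    finally have "c * \<bar>s\<bar> powr p \<le> d * \<bar>s\<bar> powr (3 - p) * \<bar>s\<bar> powr p" by (rule mult_right_mono) simp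
    also have "\<dots> = d * (\<bar>s\<bar> powr (3 - p + p))" by (simp only: powr_add mult.assoc)
    also have "\<bar>s\<bar> powr (3 - p + p) = \<bar>s\<bar>^3" using s by (simp add: powr_numeral)
    finally show ?thesis using c by (simp add: add_increasing2)
  qed
qed

lemma powr_mean_convex:
  fixes a b p :: real assumes p: "1 < p"
  shows "2 * \<bar>a\<bar> powr p \<le> \<bar>a + b\<bar> powr p + \<bar>a - b\<bar> powr p"
proof -
  have conv: "((x + y) / 2) powr p \<le> (x powr p + y powr p) / 2" if xy: "0 < x" "0 < y" for x y :: real
    using convex_onD[OF powr_convex[of p], of "1/2" x y] p xy by (simp add: field_simps)
  have mono: "\<bar>a\<bar> powr p \<le> ((\<bar>a + b\<bar> + \<bar>a - b\<bar>) / 2) powr p" using p by (intro powr_mono2) auto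
  have half: "(x / 2) powr p \<le> x powr p / 2" if "0 \<le> x" for x :: real
  proof -
    have "2 powr 1 \<le> (2::real) powr p" using p by (intro powr_mono) auto
    then have "x powr p / 2 powr p \<le> x powr p / 2" by (intro divide_left_mono) auto
    then show ?thesis using that by (simp add: powr_divide)
  qed
  show ?thesis
  proof (cases "a + b = 0 \<or> a - b = 0")
    case True
    then show ?thesis using mono half[of "\<bar>a + b\<bar>"] half[of "\<bar>a - b\<bar>"] p by auto
  next
    case False
    then show ?thesis using mono conv[of "\<bar>a + b\<bar>" "\<bar>a - b\<bar>"] by auto
  qed
qed

text \<open>For \<open>\<bar>y\<bar> \<le> \<bar>x\<bar>\<close> and \<open>q < 2\<close> one has \<open>\<bar>y\<bar> powr q \<ge> \<bar>x\<bar> powr (q - 2) * y\<^sup>2\<close>, which reduces the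
  difference to a difference of squares.\<close>

lemma powr_difference:
  fixes a b q M :: real assumes q: "1 < q" "q < 2" and M: "\<bar>a\<bar> \<le> M" "\<bar>b\<bar> \<le> M"
  shows "\<bar>\<bar>a\<bar> powr q - \<bar>b\<bar> powr q\<bar> \<le> 2 * M powr (q - 1) * \<bar>a - b\<bar>"
proof -
  have main: "\<bar>\<bar>x\<bar> powr q - \<bar>y\<bar> powr q\<bar> \<le> 2 * M powr (q - 1) * \<bar>x - y\<bar>" if yx: "\<bar>y\<bar> \<le> \<bar>x\<bar>" and x: "\<bar>x\<bar> \<le> M" for x y :: real
  proof (cases "x = 0")
    case False
    then have x0: "\<bar>x\<bar> > 0" by simp
    have y: "\<bar>x\<bar> powr (q - 2) * y^2 \<le> \<bar>y\<bar> powr q"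
    proof (cases "y = 0")
      case False
      have "\<bar>x\<bar> powr (q - 2) * y^2 \<le> \<bar>y\<bar> powr (q - 2) * y^2"
        using q yx False by (intro mult_right_mono powr_mono2') auto
      also have "\<dots> = \<bar>y\<bar> powr (q - 2) * \<bar>y\<bar> powr 2" using False by (simp add: powr_numeral)
      also have "\<dots> = \<bar>y\<bar> powr q" unfolding powr_add[symmetric] by simp
      finally show ?thesis .
    qed simp
    have "\<bar>y\<bar> powr q \<le> \<bar>x\<bar> powr q" using q yx by (intro powr_mono2) auto
    then have "\<bar>\<bar>x\<bar> powr q - \<bar>y\<bar> powr q\<bar> = \<bar>x\<bar> powr q - \<bar>y\<bar> powr q" by simp
    also have "\<dots> \<le> \<bar>x\<bar> powr (q - 2) * \<bar>x\<bar> powr 2 - \<bar>x\<bar> powr (q - 2) * y^2"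
      unfolding powr_add[symmetric] using y by simp
    also have "\<dots> = \<bar>x\<bar> powr (q - 2) * ((\<bar>x\<bar> + \<bar>y\<bar>) * (\<bar>x\<bar> - \<bar>y\<bar>))"
      using x0 by (simp add: powr_numeral algebra_simps power2_eq_square)
    also have "\<dots> \<le> \<bar>x\<bar> powr (q - 2) * ((2 * \<bar>x\<bar>) * \<bar>x - y\<bar>)"
      using yx by (intro mult_left_mono mult_mono) auto
    also have "\<dots> = 2 * (\<bar>x\<bar> powr (q - 2) * \<bar>x\<bar> powr 1) * \<bar>x - y\<bar>" using x0 by simp
    also have "\<dots> = 2 * \<bar>x\<bar> powr (q - 1) * \<bar>x - y\<bar>" unfolding powr_add[symmetric] by simp
    also have "\<dots> \<le> 2 * M powr (q - 1) * \<bar>x - y\<bar>" using q x by (intro mult_right_mono mult_left_mono powr_mono2) auto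
    finally show ?thesis .
  qed (use yx in simp)
  show ?thesis
  proof (cases "\<bar>b\<bar> \<le> \<bar>a\<bar>")
    case True then show ?thesis using main[of b a] M by simp
  next
    case False then show ?thesis using main[of a b] M by (simp add: abs_minus_commute)
  qed
qed

text \<open>The function \<open>\<bar>s\<bar>\<^sup>q\<close> with \<open>q < 2\<close> is not twice differentiable, but it is convex. In the product of
  two such functions, convexity handles the product of the means, and the product of the
  differences is quadratic in the increments.\<close>

lemma coupling_second_difference:
  fixes p \<beta> s t a b :: real
  assumes p: "2 < p" "p < 3" and \<beta>: "0 \<le> \<beta>"
  shows "2 * coupling p \<beta> s t - (coupling p \<beta> (s + a) (t + b) + coupling p \<beta> (s - a) (t - b))
    \<le> 8 * \<beta> * ((1 + (\<bar>s\<bar> + \<bar>t\<bar> + \<bar>a\<bar> + \<bar>b\<bar>)) * (a^2 + b^2))"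
proof -
  define q where "q = p / 2"
  have q: "1 < q" "q < 2" using p by (auto simp: q_def)
  define S where "S = \<bar>s\<bar> + \<bar>t\<bar> + \<bar>a\<bar> + \<bar>b\<bar>"
  have S0: "S \<ge> 0" by (simp add: S_def)
  define A Ap Am where "A = \<bar>s\<bar> powr q" and "Ap = \<bar>s + a\<bar> powr q" and "Am = \<bar>s - a\<bar> powr q"
  define B Bp Bm where "B = \<bar>t\<bar> powr q" and "Bp = \<bar>t + b\<bar> powr q" and "Bm = \<bar>t - b\<bar> powr q"
  have A: "2 * A \<le> Ap + Am" "0 \<le> A" unfolding A_def Ap_def Am_def by (rule powr_mean_convex[OF q(1)]) simp
  have B: "2 * B \<le> Bp + Bm" "0 \<le> B" unfolding B_def Bp_def Bm_def by (rule powr_mean_convex[OF q(1)]) simp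
  have dA: "\<bar>Ap - Am\<bar> \<le> 4 * S powr (q - 1) * \<bar>a\<bar>"
  proof -
    have "\<bar>s + a\<bar> \<le> S" "\<bar>s - a\<bar> \<le> S" unfolding S_def by linarith+
    from powr_difference[OF q this] show ?thesis unfolding Ap_def Am_def by (simp add: abs_mult)
  qed
  have dB: "\<bar>Bp - Bm\<bar> \<le> 4 * S powr (q - 1) * \<bar>b\<bar>"
  proof -
    have "\<bar>t + b\<bar> \<le> S" "\<bar>t - b\<bar> \<le> S" unfolding S_def by linarith+
    from powr_difference[OF q this] show ?thesis unfolding Bp_def Bm_def by (simp add: abs_mult)
  qed
  have "\<bar>Ap - Am\<bar> * \<bar>Bp - Bm\<bar> \<le> (4 * S powr (q - 1) * \<bar>a\<bar>) * (4 * S powr (q - 1) * \<bar>b\<bar>)"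
    by (intro mult_mono dA dB) auto
  also have "\<dots> = 16 * (S powr (q - 1) * S powr (q - 1)) * (\<bar>a\<bar> * \<bar>b\<bar>)" by simp
  also have "S powr (q - 1) * S powr (q - 1) = S powr (p - 2)" unfolding powr_add[symmetric] by (simp add: q_def)
  also have "16 * S powr (p - 2) * (\<bar>a\<bar> * \<bar>b\<bar>) \<le> 16 * (1 + S) * ((a^2 + b^2) / 2)"
  proof (intro mult_mono)
    show "S powr (p - 2) \<le> 1 + S"
    proof (cases "S \<le> 1")
      case True
      have "S powr (p - 2) \<le> 1 powr (p - 2)" using True S0 p by (intro powr_mono2) auto
      then show ?thesis using S0 by simp
    next
      case False
      have "S powr (p - 2) \<le> S powr 1" using False p by (intro powr_mono) auto
      then show ?thesis using False by simp
    qed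
    show "\<bar>a\<bar> * \<bar>b\<bar> \<le> (a^2 + b^2) / 2" using sum_squares_bound[of "\<bar>a\<bar>" "\<bar>b\<bar>"] by simp
  qed (use S0 in auto)
  also have "16 * (1 + S) * ((a^2 + b^2) / 2) = 8 * ((1 + S) * (a^2 + b^2))" by (simp add: algebra_simps)
  finally have diff: "\<bar>Ap - Am\<bar> * \<bar>Bp - Bm\<bar> \<le> 8 * ((1 + S) * (a^2 + b^2))" .
  have prod: "4 * A * B \<le> (Ap + Am) * (Bp + Bm)" using mult_mono[OF A(1) B(1)] A B by simp
  have "2 * A * B - (Ap * Bp + Am * Bm) = (4 * A * B - (Ap + Am) * (Bp + Bm)) / 2 - (Ap - Am) * (Bp - Bm) / 2"
    by (simp add: field_simps)
  also have "\<dots> \<le> \<bar>Ap - Am\<bar> * \<bar>Bp - Bm\<bar> / 2"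
  proof -
    have "(P - X) / 2 - Y / 2 \<le> \<bar>Y\<bar> / 2" if "P \<le> X" for P X Y :: real
      using that abs_ge_minus_self[of Y] by argo
    from this[OF prod] show ?thesis unfolding abs_mult[symmetric] .
  qed
  also have "\<dots> \<le> 4 * ((1 + S) * (a^2 + b^2))" using diff by simp
  finally have *: "2 * A * B - (Ap * Bp + Am * Bm) \<le> 4 * ((1 + S) * (a^2 + b^2))" .
  have "2 * \<bar>s\<bar> powr p \<le> \<bar>s + a\<bar> powr p + \<bar>s - a\<bar> powr p" "2 * \<bar>t\<bar> powr p \<le> \<bar>t + b\<bar> powr p + \<bar>t - b\<bar> powr p"
    using p by (auto intro!: powr_mean_convex)
  moreover have "2 * \<beta> * (2 * A * B - (Ap * Bp + Am * Bm)) \<le> 2 * \<beta> * (4 * ((1 + S) * (a^2 + b^2)))"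
    using \<beta> by (intro mult_left_mono *) auto
  ultimately show ?thesis
    unfolding coupling_def q_def[symmetric] A_def[symmetric] Ap_def[symmetric] Am_def[symmetric]
      B_def[symmetric] Bp_def[symmetric] Bm_def[symmetric] S_def[symmetric] by (simp add: algebra_simps)
qed

section \<open>The energy functional\<close>

text \<open>The constants of \<open>newton_bound\<close> and \<open>L3_bound\<close> are named, because they enter bounds whose uniformity
  matters later.\<close>

definition hardy_const :: real where
  "hardy_const = (SOME K. K > 0 \<and> (\<forall>u g x. sobolev u g \<longrightarrow> newton (\<lambda>y. ennreal ((u y)^2)) x \<le> ennreal (K * nsq u g)))"

lemma hardy_const:
  "hardy_const > 0" "sobolev u g \<Longrightarrow> newton (\<lambda>y. ennreal ((u y)^2)) x \<le> ennreal (hardy_const * nsq u g)"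
proof -
  have "\<exists>K>0. \<forall>u g x. sobolev u g \<longrightarrow> newton (\<lambda>y. ennreal ((u y)^2)) x \<le> ennreal (K * nsq u g)"
    using newton_bound by metis
  then have "hardy_const > 0 \<and> (\<forall>u g x. sobolev u g \<longrightarrow> newton (\<lambda>y. ennreal ((u y)^2)) x \<le> ennreal (hardy_const * nsq u g))"
    unfolding hardy_const_def by (rule someI_ex)
  then show "hardy_const > 0" "sobolev u g \<Longrightarrow> newton (\<lambda>y. ennreal ((u y)^2)) x \<le> ennreal (hardy_const * nsq u g)" by auto
qed

definition cube_const :: real where
  "cube_const = (SOME K. K > 0 \<and> (\<forall>u g t. sobolev u g \<longrightarrow> t > 0 \<longrightarrow> nsq u g \<le> t^2 \<longrightarrow> (LBINT x. \<bar>u x\<bar>^3) \<le> K * t^3))"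

lemma cube_const:
  "cube_const > 0" "sobolev u g \<Longrightarrow> t > 0 \<Longrightarrow> nsq u g \<le> t^2 \<Longrightarrow> (LBINT x. \<bar>u x\<bar>^3) \<le> cube_const * t^3"
proof -
  have "\<exists>K>0. \<forall>u g t. sobolev u g \<longrightarrow> t > 0 \<longrightarrow> nsq u g \<le> t^2 \<longrightarrow> (LBINT x. \<bar>u x\<bar>^3) \<le> K * t^3"
    using L3_bound by metis
  then have "cube_const > 0 \<and> (\<forall>u g t. sobolev u g \<longrightarrow> t > 0 \<longrightarrow> nsq u g \<le> t^2 \<longrightarrow> (LBINT x. \<bar>u x\<bar>^3) \<le> cube_const * t^3)"
    unfolding cube_const_def by (rule someI_ex)
  then show "cube_const > 0" "sobolev u g \<Longrightarrow> t > 0 \<Longrightarrow> nsq u g \<le> t^2 \<Longrightarrow> (LBINT x. \<bar>u x\<bar>^3) \<le> cube_const * t^3" by auto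
qed

lemma cube_integrable: assumes "sobolev u g" shows "integrable lborel (\<lambda>x. \<bar>u x\<bar>^3)"
proof -
  have n: "nsq u g \<le> (sqrt (nsq u g) + 1)^2" using nsq_nonneg[of u g] by (simp add: power2_sum)
  show ?thesis
  proof (rule L3_bound)
    assume i: "\<And>u g t. sobolev u g \<Longrightarrow> t > 0 \<Longrightarrow> nsq u g \<le> t^2 \<Longrightarrow> integrable lborel (\<lambda>x. \<bar>u x\<bar>^3)"
    show ?thesis by (rule i[OF assms _ n]) (use nsq_nonneg[of u g] in \<open>simp add: add_nonneg_pos\<close>)
  qed
qed

lemma powr_integrable:
  assumes u: "sobolev u g" and p: "2 < p" "p < 3" shows "integrable lborel (\<lambda>x. \<bar>u x\<bar> powr p)"
proof (rule Bochner_Integration.integrable_bound[OF Bochner_Integration.integrable_add[OF sobolevD(6)[OF u] cube_integrable[OF u]]])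
  note [measurable] = sobolevD(4)[OF u]
  show "(\<lambda>x. \<bar>u x\<bar> powr p) \<in> borel_measurable lborel" by measurable
  show "AE x in lborel. norm (\<bar>u x\<bar> powr p) \<le> norm ((u x)^2 + \<bar>u x\<bar>^3)"
    using powr_between[OF p, of "u x" for x] by (intro AE_I2) simp
qed

lemma powr_half_integrable:
  assumes u: "sobolev u g" and v: "sobolev v h" and p: "2 < p" "p < 3"
  shows "integrable lborel (\<lambda>x. \<bar>u x\<bar> powr (p/2) * \<bar>v x\<bar> powr (p/2))"
proof (rule Bochner_Integration.integrable_bound[OF Bochner_Integration.integrable_add[OF powr_integrable[OF u p] powr_integrable[OF v p]]])
  note [measurable] = sobolevD(4)[OF u] sobolevD(4)[OF v]
  show "(\<lambda>x. \<bar>u x\<bar> powr (p/2) * \<bar>v x\<bar> powr (p/2)) \<in> borel_measurable lborel" by measurable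
  have "\<bar>u x\<bar> powr (p/2) * \<bar>v x\<bar> powr (p/2) \<le> \<bar>u x\<bar> powr p + \<bar>v x\<bar> powr p" for x
    using powr_half_mult[of "u x" p "v x"] powr_ge_zero[of "\<bar>u x\<bar>" p] powr_ge_zero[of "\<bar>v x\<bar>" p] by argo
  then show "AE x in lborel. norm (\<bar>u x\<bar> powr (p/2) * \<bar>v x\<bar> powr (p/2)) \<le> norm (\<bar>u x\<bar> powr p + \<bar>v x\<bar> powr p)"
    by (intro AE_I2) simp
qed

lemma coupling_integrable:
  assumes u: "sobolev u g" and v: "sobolev v h" and p: "2 < p" "p < 3"
  shows "integrable lborel (\<lambda>x. coupling p \<beta> (u x) (v x))"
  unfolding coupling_def mult.assoc
  by (intro Bochner_Integration.integrable_add integrable_mult_right powr_integrable[OF u p] powr_integrable[OF v p]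
      powr_half_integrable[OF u v p])

text \<open>The scalar field of a charge, as it enters the definition of the functional.\<close>

lemma field_newton:
  assumes F: "charge K F"
  shows "(LBINT y. F y / norm (x - y)) = enn2real (newton (\<lambda>y. ennreal (F y)) x)"
proof -
  note [measurable] = chargeD(2)[OF F]
  have e: "ennreal (F y / norm (x - y)) = ennreal (norm (y - x) powr (-1)) * ennreal (F y)" for y
    using chargeD(3)[OF F, of y] by (simp add: ennreal_mult' [symmetric] powr_minus_divide norm_minus_commute mult.commute)
  have "(LBINT y. F y / norm (x - y)) = enn2real (\<integral>\<^sup>+y. ennreal (F y / norm (x - y)) \<partial>lborel)"
    by (rule integral_eq_nn_integral) (use chargeD(3)[OF F] in auto)
  then show ?thesis unfolding newton_def e .
qed

lemma field_energy:
  assumes F: "charge K F"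
  shows "(\<integral>x. F x * enn2real (newton (\<lambda>y. ennreal (F y)) x) \<partial>lborel) = interaction F F"
proof -
  note [measurable] = chargeD(2)[OF F]
  have e: "ennreal (F x * enn2real (newton (\<lambda>y. ennreal (F y)) x)) = ennreal (F x) * newton (\<lambda>y. ennreal (F y)) x" for x
    using chargeD(3)[OF F, of x] chargeD(5)[OF F, of x] by (simp add: ennreal_mult le_less_trans[OF _ ennreal_less_top])
  have "(\<integral>x. F x * enn2real (newton (\<lambda>y. ennreal (F y)) x) \<partial>lborel)
    = enn2real (\<integral>\<^sup>+x. ennreal (F x * enn2real (newton (\<lambda>y. ennreal (F y)) x)) \<partial>lborel)"
    by (rule integral_eq_nn_integral) (use chargeD(3)[OF F] in auto)
  then show ?thesis unfolding e interaction_def coulomb_def .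
qed

text \<open>The coefficients \<open>V\<close> and \<open>\<rho>\<close> enter through two sided bounds only, except for the behaviour at
  infinity that makes the functional coercive.\<close>

locale coefficients =
  fixes V \<rho> :: "real^3 \<Rightarrow> real" and Vm VM rm rM p :: real
  assumes V_measurable [measurable]: "V \<in> borel_measurable borel"
    and \<rho>_measurable [measurable]: "\<rho> \<in> borel_measurable borel"
    and V_pos: "0 < Vm" and V_bounds: "Vm \<le> V x" "V x \<le> VM"
    and \<rho>_pos: "0 < rm" and \<rho>_bounds: "rm \<le> \<rho> x" "\<rho> x \<le> rM"
    and p: "2 < p" "p < 3"
begin

definition density :: "(real^3 \<Rightarrow> real) \<Rightarrow> (real^3 \<Rightarrow> real) \<Rightarrow> real^3 \<Rightarrow> real" where
  "density u v x = \<rho> x * ((u x)^2 + (v x)^2)"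

definition gsq :: "(real^3 \<Rightarrow> real^3) \<Rightarrow> (real^3 \<Rightarrow> real^3) \<Rightarrow> real" where
  "gsq g h = (LBINT x. (norm (g x))^2) + (LBINT x. (norm (h x))^2)"

definition potential :: "(real^3 \<Rightarrow> real) \<Rightarrow> (real^3 \<Rightarrow> real) \<Rightarrow> real" where
  "potential u v = (LBINT x. V x * ((u x)^2 + (v x)^2))"

lemma V_nonneg: "0 \<le> V x" "0 \<le> VM" and \<rho>_nonneg: "0 \<le> \<rho> x" "0 \<le> rM"
  using V_pos \<rho>_pos V_bounds[of x] \<rho>_bounds[of x] by linarith+

lemma bounded_integrable:
  assumes "integrable lborel f" shows "integrable lborel (\<lambda>x. V x * f x :: real)" "integrable lborel (\<lambda>x. \<rho> x * f x :: real)"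
proof -
  have [measurable]: "f \<in> borel_measurable borel" using borel_measurable_integrable[OF assms] by simp
  show "integrable lborel (\<lambda>x. V x * f x)"
    by (rule Bochner_Integration.integrable_bound[OF integrable_mult_right[OF assms, of VM]])
      (use V_nonneg V_bounds in \<open>auto simp: abs_mult intro!: AE_I2 mult_right_mono\<close>)
  show "integrable lborel (\<lambda>x. \<rho> x * f x)"
    by (rule Bochner_Integration.integrable_bound[OF integrable_mult_right[OF assms, of rM]])
      (use \<rho>_nonneg \<rho>_bounds in \<open>auto simp: abs_mult intro!: AE_I2 mult_right_mono\<close>)
qed

lemma squares_charge:
  assumes u: "sobolev u g" and v: "sobolev v h"
  shows "charge (hardy_const * (nsq u g + nsq v h)) (\<lambda>x. (u x)^2 + (v x)^2)"
proof -
  have c: "charge (hardy_const * nsq u g) (\<lambda>x. (u x)^2)" if "sobolev u g" for u g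
    using that sobolevD(6)[OF that] sobolevD(4)[OF that] hardy_const(1) hardy_const(2)[OF that]
    by (auto simp: charge_def nsq_nonneg)
  show ?thesis using charge_add[OF c[OF u] c[OF v]] by (simp add: distrib_left)
qed

lemma density_charge:
  assumes u: "sobolev u g" and v: "sobolev v h"
  shows "charge (rM * (hardy_const * (nsq u g + nsq v h))) (density u v)"
proof (rule charge_mono[OF charge_cmult[OF squares_charge[OF u v] \<rho>_nonneg(2)]])
  note [measurable] = sobolevD(4)[OF u] sobolevD(4)[OF v]
  show "density u v \<in> borel_measurable borel" unfolding density_def[abs_def] by measurable
  show "0 \<le> density u v x" "density u v x \<le> rM * ((u x)^2 + (v x)^2)" for x
    using \<rho>_nonneg(1)[of x] \<rho>_bounds[of x] by (auto simp: density_def intro: mult_right_mono)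
qed

lemma pair_norm_eq:
  assumes u: "sobolev u g" and v: "sobolev v h"
  shows "pair_norm_sq V u v = gsq g h + potential u v"
proof -
  have [measurable]: "weak_grad u \<in> borel_measurable borel" "weak_grad v \<in> borel_measurable borel"
    using sobolevD(5)[OF sobolev_weak_grad[OF sobolev_H1[OF u]]] sobolevD(5)[OF sobolev_weak_grad[OF sobolev_H1[OF v]]] by auto
  note [measurable] = sobolevD(4,5)[OF u] sobolevD(4,5)[OF v]
  have "pair_norm_sq V u v = (LBINT x. (norm (g x))^2 + (norm (h x))^2 + V x * ((u x)^2 + (v x)^2))"
    unfolding pair_norm_sq_def
  proof (rule integral_cong_AE)
    show "AE x in lborel. (norm (weak_grad u x))^2 + (norm (weak_grad v x))^2 + V x * (u x)^2 + V x * (v x)^2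
      = (norm (g x))^2 + (norm (h x))^2 + V x * ((u x)^2 + (v x)^2)"
      using weak_grad_eq_AE[OF u] weak_grad_eq_AE[OF v] by eventually_elim (simp add: distrib_left)
  qed measurable
  also have "\<dots> = gsq g h + potential u v"
    using sobolevD(6,7)[OF u] sobolevD(6,7)[OF v] bounded_integrable(1)[of "\<lambda>x. (u x)^2 + (v x)^2"]
    by (simp add: gsq_def potential_def)
  finally show ?thesis .
qed

lemma J_eq:
  assumes u: "sobolev u g" and v: "sobolev v h"
  shows "J V \<rho> p \<beta> u v = 1/2 * (gsq g h + potential u v) + 1/4 * interaction (density u v) (density u v)
    - 1/p * (LBINT x. coupling p \<beta> (u x) (v x))"
proof -
  have "(LBINT x. \<rho> x * phi \<rho> u v x * ((u x)^2 + (v x)^2))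
    = (\<integral>x. density u v x * enn2real (newton (\<lambda>y. ennreal (density u v y)) x) \<partial>lborel)"
    unfolding phi_def field_newton[OF density_charge[OF u v], symmetric] by (simp add: density_def mult_ac)
  then show ?thesis
    unfolding J_def pair_norm_eq[OF u v] field_energy[OF density_charge[OF u v]] coupling_def by simp
qed

lemma J_commute: "J V \<rho> p \<beta> u v = J V \<rho> p \<beta> v u"
  unfolding J_def pair_norm_sq_def phi_def by (simp add: add_ac mult_ac)

end

lemma H_norm_eq:
  assumes u: "sobolev u g" and v: "sobolev v h" shows "H_norm u v = sqrt (nsq u g + nsq v h)"
proof -
  interpret coefficients "\<lambda>_. 1" "\<lambda>_. 1" 1 1 1 1 "5/2" by unfold_locales auto
  show ?thesis unfolding H_norm_def pair_norm_eq[OF u v] gsq_def potential_def nsq_def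
    using sobolevD(6)[OF u] sobolevD(6)[OF v] by (simp add: add_ac)
qed

section \<open>Coercivity and lower semicontinuity\<close>

text \<open>The constant of Lions' inequality.\<close>

definition lions_const :: real where "lions_const = 1 / (2 * sqrt 2)"

lemma lions_const: "0 < lions_const" "lions_const \<le> 1"
proof -
  have "1 \<le> sqrt (2::real)" by simp
  then have "1 \<le> 2 * sqrt (2::real)" by argo
  then show "0 < lions_const" "lions_const \<le> 1" unfolding lions_const_def by (auto simp: divide_le_eq)
qed

context coefficients begin

definition cubic :: "(real^3 \<Rightarrow> real) \<Rightarrow> (real^3 \<Rightarrow> real) \<Rightarrow> real" where
  "cubic u v = (LBINT x. \<rho> x * (\<bar>u x\<bar>^3 + \<bar>v x\<bar>^3))"

text \<open>The part of \<open>J\<close> to which Lions' inequality applies; \<open>remainder\<close> is the integrand of the rest. The cubic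
  term is subtracted here and added there.\<close>

definition kinetic :: "(real^3 \<Rightarrow> real) \<Rightarrow> (real^3 \<Rightarrow> real^3) \<Rightarrow> (real^3 \<Rightarrow> real) \<Rightarrow> (real^3 \<Rightarrow> real^3) \<Rightarrow> real" where
  "kinetic u g v h = 1/2 * gsq g h + 1/4 * interaction (density u v) (density u v) - lions_const * cubic u v"

definition remainder :: "real \<Rightarrow> real^3 \<Rightarrow> real \<Rightarrow> real \<Rightarrow> real" where
  "remainder \<beta> x s t = 1/2 * V x * (s^2 + t^2) + lions_const * \<rho> x * (\<bar>s\<bar>^3 + \<bar>t\<bar>^3) - 1/p * coupling p \<beta> s t"

lemma gsq_nonneg: "0 \<le> gsq g h" by (simp add: gsq_def)

lemma cubic_integrable:
  assumes u: "sobolev u g" and v: "sobolev v h"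
  shows "integrable lborel (\<lambda>x. \<rho> x * (\<bar>u x\<bar>^3 + \<bar>v x\<bar>^3))"
  by (intro bounded_integrable Bochner_Integration.integrable_add cube_integrable[OF u] cube_integrable[OF v])

text \<open>Lions' inequality with \<open>F = \<rho> (u\<^sup>2 + v\<^sup>2)\<close>.\<close>

lemma cubic_le:
  assumes u: "sobolev u g" and v: "sobolev v h"
  shows "lions_const * cubic u v \<le> 1/4 * gsq g h + 1/4 * interaction (density u v) (density u v)"
proof -
  note d = density_charge[OF u v]
  note [measurable] = sobolevD(4)[OF u] sobolevD(4)[OF v] chargeD(2)[OF d]
  have pw: "\<rho> x * (\<bar>u x\<bar>^3 + \<bar>v x\<bar>^3) \<le> density u v x * (\<bar>u x\<bar> + \<bar>v x\<bar>)" for x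
  proof -
    have "a^3 + b^3 \<le> (a^2 + b^2) * (a + b)" if "0 \<le> a" "0 \<le> b" for a b :: real
      using that by (simp add: algebra_simps power2_eq_square power3_eq_cube)
    from this[of "\<bar>u x\<bar>" "\<bar>v x\<bar>"] show ?thesis unfolding density_def mult.assoc by (intro mult_left_mono \<rho>_nonneg) simp
  qed
  have "ennreal (cubic u v) = (\<integral>\<^sup>+x. ennreal (\<rho> x * (\<bar>u x\<bar>^3 + \<bar>v x\<bar>^3)) \<partial>lborel)"
    unfolding cubic_def by (rule nn_integral_eq_integral[OF cubic_integrable[OF u v], symmetric]) (simp add: \<rho>_nonneg)
  also have "\<dots> \<le> (\<integral>\<^sup>+x. ennreal (density u v x) * ennreal (\<bar>u x\<bar> + \<bar>v x\<bar>) \<partial>lborel)"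
  proof (intro nn_integral_mono)
    fix x
    have "ennreal (\<rho> x * (\<bar>u x\<bar>^3 + \<bar>v x\<bar>^3)) \<le> ennreal (density u v x * (\<bar>u x\<bar> + \<bar>v x\<bar>))" by (rule ennreal_leI[OF pw])
    also have "\<dots> = ennreal (density u v x) * ennreal (\<bar>u x\<bar> + \<bar>v x\<bar>)" using chargeD(3)[OF d] by (rule ennreal_mult')
    finally show "ennreal (\<rho> x * (\<bar>u x\<bar>^3 + \<bar>v x\<bar>^3)) \<le> ennreal (density u v x) * ennreal (\<bar>u x\<bar> + \<bar>v x\<bar>)" .
  qed
  finally have "ennreal lions_const * ennreal (cubic u v) \<le> ennreal lions_const * (\<integral>\<^sup>+x. ennreal (density u v x) * ennreal (\<bar>u x\<bar> + \<bar>v x\<bar>) \<partial>lborel)"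
    by (rule mult_left_mono) simp
  also have "\<dots> \<le> ennreal (1/4 * gsq g h) + ennreal (1/4) * coulomb (\<lambda>x. ennreal (density u v x)) (\<lambda>x. ennreal (density u v x))"
    unfolding lions_const_def gsq_def by (rule lions_inequality[OF u v]) measurable
  also have "\<dots> = ennreal (1/4 * gsq g h + 1/4 * interaction (density u v) (density u v))"
    unfolding coulomb_interaction[OF d d] using gsq_nonneg interaction_nonneg[of "density u v" "density u v"]
    by (simp add: ennreal_plus ennreal_mult' [symmetric] del: ennreal_plus[symmetric])
  finally have "ennreal (lions_const * cubic u v) \<le> ennreal (1/4 * gsq g h + 1/4 * interaction (density u v) (density u v))"
    using lions_const by (simp add: ennreal_mult')
  then show ?thesis using gsq_nonneg interaction_nonneg[of "density u v" "density u v"]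
    by (subst (asm) ennreal_le_iff) (auto intro: add_nonneg_nonneg)
qed

lemma kinetic_ge:
  assumes u: "sobolev u g" and v: "sobolev v h"
  shows "1/4 * gsq g h \<le> kinetic u g v h"
  using cubic_le[OF u v] by (simp add: kinetic_def)

lemma squares_integrable:
  assumes u: "sobolev u g" and v: "sobolev v h" shows "integrable lborel (\<lambda>x. (u x)^2 + (v x)^2)"
  using sobolevD(6)[OF u] sobolevD(6)[OF v] by simp

lemma remainder_integrable:
  assumes u: "sobolev u g" and v: "sobolev v h" shows "integrable lborel (\<lambda>x. remainder \<beta> x (u x) (v x))"
  unfolding remainder_def mult.assoc
  by (intro Bochner_Integration.integrable_diff Bochner_Integration.integrable_add integrable_mult_right
      bounded_integrable squares_integrable[OF u v] cubic_integrable[OF u v] coupling_integrable[OF u v p])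

lemma J_split:
  assumes u: "sobolev u g" and v: "sobolev v h"
  shows "J V \<rho> p \<beta> u v = kinetic u g v h + (LBINT x. remainder \<beta> x (u x) (v x))"
proof -
  have "(LBINT x. remainder \<beta> x (u x) (v x)) = 1/2 * potential u v + lions_const * cubic u v
    - 1/p * (LBINT x. coupling p \<beta> (u x) (v x))"
    unfolding remainder_def mult.assoc potential_def cubic_def
    using bounded_integrable(1)[OF squares_integrable[OF u v]] cubic_integrable[OF u v] coupling_integrable[OF u v p, of \<beta>]
    by simp
  then show ?thesis unfolding J_eq[OF u v] kinetic_def by (simp add: algebra_simps)
qed

lemma charge_weaken: "charge K F \<Longrightarrow> K \<le> L \<Longrightarrow> charge L F"
  unfolding charge_def by (meson ennreal_leI order_trans)

text \<open>The charge of a sum differs from the sum of the charges by an overlap that may be negative. It is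
  added on the other side of the inequality, so that all functions involved remain charges.\<close>

lemma coulomb_split:
  assumes u: "sobolev u g" and v: "sobolev v h" and w: "sobolev w d" and z: "sobolev z e"
    and K: "nsq u g + nsq v h \<le> K" "nsq w d + nsq z e \<le> K"
      "nsq (\<lambda>x. u x + w x) (\<lambda>x. g x + d x) + nsq (\<lambda>x. v x + z x) (\<lambda>x. h x + e x) \<le> K"
  shows "interaction (density u v) (density u v) + interaction (density w z) (density w z)
    \<le> interaction (density (\<lambda>x. u x + w x) (\<lambda>x. v x + z x)) (density (\<lambda>x. u x + w x) (\<lambda>x. v x + z x))
      + 12 * (rM * (hardy_const * K)) * (rM * ((LBINT x. \<bar>u x * w x\<bar>) + (LBINT x. \<bar>v x * z x\<bar>)))"
proof -
  define L where "L = rM * (hardy_const * K)"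
  note [measurable] = sobolevD(4)[OF u] sobolevD(4)[OF v] sobolevD(4)[OF w] sobolevD(4)[OF z]
  have le: "rM * (hardy_const * N) \<le> L" if "N \<le> K" for N
    unfolding L_def using that \<rho>_nonneg(2) hardy_const(1) by (intro mult_left_mono) auto
  define f where "f = density u v"
  define fw where "fw = density w z"
  define fn where "fn = density (\<lambda>x. u x + w x) (\<lambda>x. v x + z x)"
  define l where "l x = \<rho> x * (\<bar>u x * w x\<bar> + \<bar>v x * z x\<bar>)" for x
  have f: "charge L f" unfolding f_def by (rule charge_weaken[OF density_charge[OF u v] le[OF K(1)]])
  have fw: "charge L fw" unfolding fw_def by (rule charge_weaken[OF density_charge[OF w z] le[OF K(2)]])
  have fn: "charge L fn" unfolding fn_def
    by (rule charge_weaken[OF density_charge[OF sobolev_add[OF u w] sobolev_add[OF v z]] le[OF K(3)]])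
  have am: "\<bar>a * b\<bar> \<le> a^2 + b^2" for a b :: real using abs_mult_le_weighted[of 1 a b] by simp
  have l: "charge (L + L) l"
  proof (rule charge_mono[OF charge_add[OF f fw]])
    show "l \<in> borel_measurable borel" unfolding l_def[abs_def] by measurable
    show "0 \<le> l x" for x by (simp add: l_def \<rho>_nonneg)
    show "l x \<le> f x + fw x" for x
      unfolding l_def f_def fw_def density_def distrib_left[symmetric]
      by (intro mult_left_mono \<rho>_nonneg) (use am[of "u x" "w x"] am[of "v x" "z x"] in linarith)
  qed
  have l2: "charge (2 * (L + L)) (\<lambda>x. 2 * l x)" by (rule charge_cmult[OF l]) simp
  have pw: "f x + fw x \<le> fn x + 2 * l x" for x
  proof -
    have "f x + fw x = fn x - 2 * (\<rho> x * (u x * w x + v x * z x))"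
      by (simp add: f_def fw_def fn_def density_def power2_eq_square algebra_simps)
    also have "\<dots> \<le> fn x + 2 * l x"
    proof -
      have "- (u x * w x + v x * z x) \<le> \<bar>u x * w x\<bar> + \<bar>v x * z x\<bar>" by linarith
      from mult_left_mono[OF this \<rho>_nonneg(1)[of x]] have "- (\<rho> x * (u x * w x + v x * z x)) \<le> l x"
        unfolding l_def mult_minus_right .
      then show ?thesis by linarith
    qed
    finally show ?thesis .
  qed
  have "interaction f f + interaction fw fw \<le> interaction (\<lambda>x. f x + fw x) (\<lambda>x. f x + fw x)"
    unfolding interaction_add_left[OF f fw charge_add[OF f fw]] interaction_add_right[OF f fw f] interaction_add_right[OF f fw fw]
    using interaction_nonneg[of f fw] interaction_nonneg[of fw f] by linarith
  also have "\<dots> \<le> interaction (\<lambda>x. fn x + 2 * l x) (\<lambda>x. fn x + 2 * l x)"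
    by (rule interaction_mono[OF charge_add[OF f fw] charge_add[OF f fw] charge_add[OF fn l2] charge_add[OF fn l2] pw pw])
  also have "\<dots> = interaction fn fn + 4 * interaction l fn + 4 * interaction l l"
    unfolding interaction_add_left[OF fn l2 charge_add[OF fn l2]] interaction_add_right[OF fn l2 fn] interaction_add_right[OF fn l2 l2]
      interaction_cmult(1)[OF l fn zero_le_numeral] interaction_cmult(2)[OF l fn zero_le_numeral]
      interaction_cmult(1)[OF l l2 zero_le_numeral] interaction_cmult(2)[OF l l zero_le_numeral] interaction_commute[OF fn l]
    by simp
  also have "\<dots> \<le> interaction fn fn + 12 * L * (LBINT x. l x)"
    using interaction_le[OF l fn] interaction_le[OF l l] by (simp add: algebra_simps)
  also have "(LBINT x. l x) \<le> (LBINT x. rM * (\<bar>u x * w x\<bar> + \<bar>v x * z x\<bar>))"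
  proof (rule integral_mono[OF chargeD(1)[OF l]])
    show "integrable lborel (\<lambda>x. rM * (\<bar>u x * w x\<bar> + \<bar>v x * z x\<bar>))"
      by (intro integrable_mult_right Bochner_Integration.integrable_add integrable_abs square_integrable_mult sobolevD(1)[OF u]
          sobolevD(1)[OF v] sobolevD(1)[OF w] sobolevD(1)[OF z])
    show "l x \<le> rM * (\<bar>u x * w x\<bar> + \<bar>v x * z x\<bar>)" for x
      unfolding l_def by (intro mult_right_mono \<rho>_bounds) simp
  qed
  also have "\<dots> = rM * ((LBINT x. \<bar>u x * w x\<bar>) + (LBINT x. \<bar>v x * z x\<bar>))"
    using square_integrable_mult[OF sobolevD(1)[OF u] sobolevD(1)[OF w]] square_integrable_mult[OF sobolevD(1)[OF v] sobolevD(1)[OF z]]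
    by simp
  finally show ?thesis using chargeD(4)[OF f] unfolding f_def fw_def fn_def L_def by (simp add: mult_left_mono)
qed

lemma cubic_split:
  assumes u: "sobolev u g" and v: "sobolev v h" and w: "sobolev w d" and z: "sobolev z e"
  shows "cubic (\<lambda>x. u x + w x) (\<lambda>x. v x + z x) \<le> cubic u v + cubic w z
    + 3 * rM * (((LBINT x. (u x)^2 * \<bar>w x\<bar>) + (LBINT x. \<bar>u x\<bar> * (w x)^2))
      + ((LBINT x. (v x)^2 * \<bar>z x\<bar>) + (LBINT x. \<bar>v x\<bar> * (z x)^2)))"
proof -
  have i: "integrable lborel (\<lambda>x. \<bar>a x\<bar> * (b x)^2)" "integrable lborel (\<lambda>x. (a x)^2 * \<bar>b x\<bar>)"
    if "sobolev a ga" "sobolev b gb" for a ga b gb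
    using cubic_product_integrable[of a b] cubic_product_integrable[of b a] that sobolevD(4) cube_integrable
    by (auto simp: mult.commute)
  have c: "\<bar>a + b\<bar>^3 \<le> \<bar>a\<bar>^3 + \<bar>b\<bar>^3 + 3 * (a^2 * \<bar>b\<bar> + \<bar>a\<bar> * b^2)" for a b :: real
  proof -
    have e: "(x + y)^3 = x^3 + y^3 + 3 * (x^2 * y + x * y^2)" for x y :: real
      by (simp add: power2_eq_square power3_eq_cube algebra_simps)
    have "\<bar>a + b\<bar>^3 \<le> (\<bar>a\<bar> + \<bar>b\<bar>)^3" by (intro power_mono) auto
    also have "\<dots> = \<bar>a\<bar>^3 + \<bar>b\<bar>^3 + 3 * (\<bar>a\<bar>^2 * \<bar>b\<bar> + \<bar>a\<bar> * \<bar>b\<bar>^2)" by (rule e)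
    finally show ?thesis by simp
  qed
  let ?m = "\<lambda>x. ((u x)^2 * \<bar>w x\<bar> + \<bar>u x\<bar> * (w x)^2) + ((v x)^2 * \<bar>z x\<bar> + \<bar>v x\<bar> * (z x)^2)"
  have im: "integrable lborel ?m" by (intro Bochner_Integration.integrable_add i[OF u w] i[OF v z])
  have "cubic (\<lambda>x. u x + w x) (\<lambda>x. v x + z x)
    \<le> (LBINT x. \<rho> x * (\<bar>u x\<bar>^3 + \<bar>v x\<bar>^3) + \<rho> x * (\<bar>w x\<bar>^3 + \<bar>z x\<bar>^3) + 3 * rM * ?m x)"
    unfolding cubic_def
  proof (intro integral_mono cubic_integrable[OF sobolev_add[OF u w] sobolev_add[OF v z]] Bochner_Integration.integrable_add
      cubic_integrable[OF u v] cubic_integrable[OF w z] integrable_mult_right i[OF u w] i[OF v z])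
    fix x
    have "\<rho> x * (\<bar>u x + w x\<bar>^3 + \<bar>v x + z x\<bar>^3) \<le> \<rho> x * ((\<bar>u x\<bar>^3 + \<bar>v x\<bar>^3) + (\<bar>w x\<bar>^3 + \<bar>z x\<bar>^3) + 3 * ?m x)"
      by (intro mult_left_mono \<rho>_nonneg) (use c[of "u x" "w x"] c[of "v x" "z x"] in \<open>simp add: algebra_simps\<close>)
    also have "\<dots> = \<rho> x * (\<bar>u x\<bar>^3 + \<bar>v x\<bar>^3) + \<rho> x * (\<bar>w x\<bar>^3 + \<bar>z x\<bar>^3) + \<rho> x * (3 * ?m x)"
      by (simp only: distrib_left)
    also have "\<rho> x * (3 * ?m x) \<le> rM * (3 * ?m x)" by (intro mult_right_mono \<rho>_bounds) simp
    finally show "\<rho> x * (\<bar>u x + w x\<bar>^3 + \<bar>v x + z x\<bar>^3) \<le> \<rho> x * (\<bar>u x\<bar>^3 + \<bar>v x\<bar>^3) + \<rho> x * (\<bar>w x\<bar>^3 + \<bar>z x\<bar>^3) + 3 * rM * ?m x"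
      by (simp only: mult_ac add_left_mono)
  qed
  also have "\<dots> = cubic u v + cubic w z + 3 * rM * (LBINT x. ?m x)"
    unfolding cubic_def using cubic_integrable[OF u v] cubic_integrable[OF w z] im by simp
  also have "(LBINT x. ?m x) = ((LBINT x. (u x)^2 * \<bar>w x\<bar>) + (LBINT x. \<bar>u x\<bar> * (w x)^2))
      + ((LBINT x. (v x)^2 * \<bar>z x\<bar>) + (LBINT x. \<bar>v x\<bar> * (z x)^2))"
    using i[OF u w] i[OF v z] by simp
  finally show ?thesis .
qed

lemma gsq_split:
  assumes "square_integrable g" "square_integrable h" "square_integrable d" "square_integrable e"
  shows "gsq (\<lambda>x. g x + d x) (\<lambda>x. h x + e x)
    = gsq g h + 2 * ((LBINT x. inner (g x) (d x)) + (LBINT x. inner (h x) (e x))) + gsq d e"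
  unfolding gsq_def using integral_norm_diff[OF assms(1,3), of 1] integral_norm_diff[OF assms(2,4), of 1] by simp

lemma kinetic_split:
  assumes u: "sobolev u g" and v: "sobolev v h" and w: "sobolev w d" and z: "sobolev z e"
    and K: "nsq u g + nsq v h \<le> K" "nsq w d + nsq z e \<le> K"
      "nsq (\<lambda>x. u x + w x) (\<lambda>x. g x + d x) + nsq (\<lambda>x. v x + z x) (\<lambda>x. h x + e x) \<le> K"
  shows "kinetic u g v h + ((LBINT x. inner (g x) (d x)) + (LBINT x. inner (h x) (e x)))
    \<le> kinetic (\<lambda>x. u x + w x) (\<lambda>x. g x + d x) (\<lambda>x. v x + z x) (\<lambda>x. h x + e x)
      + 3 * (rM * (hardy_const * K)) * (rM * ((LBINT x. \<bar>u x * w x\<bar>) + (LBINT x. \<bar>v x * z x\<bar>)))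
      + 3 * rM * (((LBINT x. (u x)^2 * \<bar>w x\<bar>) + (LBINT x. \<bar>u x\<bar> * (w x)^2))
        + ((LBINT x. (v x)^2 * \<bar>z x\<bar>) + (LBINT x. \<bar>v x\<bar> * (z x)^2)))" (is "_ \<le> _ + ?C + ?Q")
proof -
  have "?Q \<ge> 0" using \<rho>_nonneg(2) by (intro mult_nonneg_nonneg add_nonneg_nonneg Bochner_Integration.integral_nonneg) auto
  then have "lions_const * ?Q \<le> ?Q" using lions_const by (intro mult_left_le_one_le) auto
  moreover have "lions_const * cubic (\<lambda>x. u x + w x) (\<lambda>x. v x + z x) \<le> lions_const * (cubic u v + cubic w z + ?Q)"
    using lions_const by (intro mult_left_mono cubic_split[OF u v w z]) auto
  moreover have "0 \<le> kinetic w d z e" using kinetic_ge[OF w z] gsq_nonneg[of d e] by linarith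
  ultimately show ?thesis
    using coulomb_split[OF u v w z K] gsq_split[OF sobolevD(2)[OF u] sobolevD(2)[OF v] sobolevD(2)[OF w] sobolevD(2)[OF z]]
    unfolding kinetic_def distrib_left by argo
qed

lemma nsq_diff_le:
  assumes u: "sobolev u g" and v: "sobolev v h"
  shows "nsq (\<lambda>x. u x - v x) (\<lambda>x. g x - h x) \<le> 2 * nsq u g + 2 * nsq v h"
proof -
  have a: "(LBINT x. (u x - v x)^2) \<le> (LBINT x. 2 * (u x)^2 + 2 * (v x)^2)"
  proof (rule integral_mono)
    show "integrable lborel (\<lambda>x. (u x - v x)^2)" by (rule sobolevD(6)[OF sobolev_diff[OF u v]])
    show "(u x - v x)^2 \<le> 2 * (u x)^2 + 2 * (v x)^2" for x
      using zero_le_power2[of "u x + v x"] by (simp add: power2_eq_square algebra_simps)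
  qed (use sobolevD(6)[OF u] sobolevD(6)[OF v] in simp)
  have b: "(LBINT x. (norm (g x - h x))^2) \<le> (LBINT x. 2 * (norm (g x))^2 + 2 * (norm (h x))^2)"
  proof (rule integral_mono)
    show "integrable lborel (\<lambda>x. (norm (g x - h x))^2)" by (rule sobolevD(7)[OF sobolev_diff[OF u v]])
    show "(norm (g x - h x))^2 \<le> 2 * (norm (g x))^2 + 2 * (norm (h x))^2" for x
      using zero_le_power2[of "norm (g x + h x)"] unfolding power2_norm_eq_inner
      by (simp add: inner_add_left inner_add_right inner_diff_left inner_diff_right inner_commute)
  qed (use sobolevD(7)[OF u] sobolevD(7)[OF v] in simp)
  show ?thesis using a b sobolevD(6,7)[OF u] sobolevD(6,7)[OF v] by (simp add: nsq_def)
qed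

text \<open>Of the terms of the functional only the gradient, the Coulomb energy and the cubic term need
  more than convergence almost everywhere; in their difference, the part of the sequence that is lost
  in the limit has nonnegative energy, by Lions' inequality.\<close>

lemma kinetic_lower_semicontinuous:
  fixes un vn :: "nat \<Rightarrow> real^3 \<Rightarrow> real" and gn hn :: "nat \<Rightarrow> real^3 \<Rightarrow> real^3"
  assumes un: "\<And>n. sobolev (un n) (gn n)" and vn: "\<And>n. sobolev (vn n) (hn n)" and u: "sobolev u g" and v: "sobolev v h"
    and M: "\<And>n. nsq (un n) (gn n) \<le> M" "\<And>n. nsq (vn n) (hn n) \<le> M"
    and lu: "(\<lambda>n. \<integral>x. (weight x)^2 * (un n x - u x)^2 \<partial>lborel) \<longlonglongrightarrow> 0"
    and lv: "(\<lambda>n. \<integral>x. (weight x)^2 * (vn n x - v x)^2 \<partial>lborel) \<longlonglongrightarrow> 0"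
    and gu: "\<And>e. e > 0 \<Longrightarrow> \<exists>N. \<forall>n\<ge>N. (LBINT x. inner (g x) (gn n x - g x)) \<ge> - e"
    and hv: "\<And>e. e > 0 \<Longrightarrow> \<exists>N. \<forall>n\<ge>N. (LBINT x. inner (h x) (hn n x - h x)) \<ge> - e"
    and e: "e > 0"
  shows "\<exists>N. \<forall>n\<ge>N. kinetic u g v h \<le> kinetic (un n) (gn n) (vn n) (hn n) + e"
proof -
  define w where "w n x = un n x - u x" for n x
  define z where "z n x = vn n x - v x" for n x
  define d where "d n x = gn n x - g x" for n x
  define d' where "d' n x = hn n x - h x" for n x
  define K where "K = 4 * M + 2 * (nsq u g + nsq v h)"
  have nn: "0 \<le> nsq u g" "0 \<le> nsq v h" "0 \<le> M" using nsq_nonneg M(1)[of 0] order_trans by blast+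
  have sw: "sobolev (w n) (d n)" for n using sobolev_diff[OF un u] by (simp add: w_def[abs_def] d_def[abs_def])
  have sz: "sobolev (z n) (d' n)" for n using sobolev_diff[OF vn v] by (simp add: z_def[abs_def] d'_def[abs_def])
  have nw: "nsq (w n) (d n) \<le> 2 * M + 2 * nsq u g" for n
    using nsq_diff_le[OF un u, of n] M(1)[of n] by (simp add: w_def[abs_def] d_def[abs_def])
  have nz: "nsq (z n) (d' n) \<le> 2 * M + 2 * nsq v h" for n
    using nsq_diff_le[OF vn v, of n] M(2)[of n] by (simp add: z_def[abs_def] d'_def[abs_def])
  have split: "kinetic u g v h + ((LBINT x. inner (g x) (d n x)) + (LBINT x. inner (h x) (d' n x)))
    \<le> kinetic (un n) (gn n) (vn n) (hn n)
      + 3 * (rM * (hardy_const * K)) * (rM * ((LBINT x. \<bar>u x * w n x\<bar>) + (LBINT x. \<bar>v x * z n x\<bar>)))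
      + 3 * rM * (((LBINT x. (u x)^2 * \<bar>w n x\<bar>) + (LBINT x. \<bar>u x\<bar> * (w n x)^2))
        + ((LBINT x. (v x)^2 * \<bar>z n x\<bar>) + (LBINT x. \<bar>v x\<bar> * (z n x)^2)))" for n
  proof -
    have eq: "(\<lambda>x. u x + w n x) = un n" "(\<lambda>x. g x + d n x) = gn n" "(\<lambda>x. v x + z n x) = vn n" "(\<lambda>x. h x + d' n x) = hn n"
      by (auto simp: w_def z_def d_def d'_def)
    show ?thesis
      using kinetic_split[OF u v sw[of n] sz[of n], of K] nw[of n] nz[of n] M(1)[of n] M(2)[of n] nn unfolding eq K_def by auto
  qed
  (* A parameter for cube_const that is positive even if all norms vanish. *)
  define T where "T = sqrt (2 * M + 2 * (nsq u g + nsq v h)) + 1"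
  have T: "T > 0" unfolding T_def using nn by (intro add_nonneg_pos) auto
  have TK: "2 * M + 2 * nsq u g \<le> T^2" "2 * M + 2 * nsq v h \<le> T^2" unfolding T_def using nn by (auto simp: power2_sum)
  have sq: "(LBINT x. (a x)^2) \<le> nsq a b" for a b by (simp add: nsq_def)
  have lw: "(\<lambda>n. \<integral>x. (weight x)^2 * (w n x)^2 \<partial>lborel) \<longlonglongrightarrow> 0" and lz: "(\<lambda>n. \<integral>x. (weight x)^2 * (z n x)^2 \<partial>lborel) \<longlonglongrightarrow> 0"
    using lu lv by (simp_all add: w_def z_def)
  have cw: "(LBINT x. \<bar>w n x\<bar>^3) \<le> cube_const * T^3" and cz: "(LBINT x. \<bar>z n x\<bar>^3) \<le> cube_const * T^3" for n
    using cube_const(2)[OF sw T order_trans[OF nw TK(1)]] cube_const(2)[OF sz T order_trans[OF nz TK(2)]] by auto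
  note pu = product_tendsto_0[OF sobolevD(1)[OF u] sobolevD(1)[OF sw] order_trans[OF sq nw] lw]
  note pv = product_tendsto_0[OF sobolevD(1)[OF v] sobolevD(1)[OF sz] order_trans[OF sq nz] lz]
  note qu = cubic_product_tendsto_0(1,2)[OF sobolevD(4)[OF u] cube_integrable[OF u] sobolevD(1)[OF sw] cube_integrable[OF sw] cw lw]
  note qv = cubic_product_tendsto_0(1,2)[OF sobolevD(4)[OF v] cube_integrable[OF v] sobolevD(1)[OF sz] cube_integrable[OF sz] cz lz]
  have "(\<lambda>n. 3 * (rM * (hardy_const * K)) * (rM * ((LBINT x. \<bar>u x * w n x\<bar>) + (LBINT x. \<bar>v x * z n x\<bar>)))
      + 3 * rM * (((LBINT x. (u x)^2 * \<bar>w n x\<bar>) + (LBINT x. \<bar>u x\<bar> * (w n x)^2))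
        + ((LBINT x. (v x)^2 * \<bar>z n x\<bar>) + (LBINT x. \<bar>v x\<bar> * (z n x)^2))))
    \<longlonglongrightarrow> 3 * (rM * (hardy_const * K)) * (rM * (0 + 0)) + 3 * rM * ((0 + 0) + (0 + 0))" (is "?E \<longlonglongrightarrow> _")
    by (intro tendsto_add tendsto_mult tendsto_const pu pv qu qv)
  then have "?E \<longlonglongrightarrow> 0" by simp
  then have "\<forall>\<^sub>F n in sequentially. ?E n < e / 2" by (rule order_tendstoD(2)) (use e in simp)
  then obtain N1 where N1: "\<And>n. n \<ge> N1 \<Longrightarrow> ?E n < e / 2" by (auto simp: eventually_sequentially)
  obtain N2 where N2: "\<And>n. n \<ge> N2 \<Longrightarrow> (LBINT x. inner (g x) (d n x)) \<ge> - (e/4)" using gu[of "e/4"] e by (auto simp: d_def)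
  obtain N3 where N3: "\<And>n. n \<ge> N3 \<Longrightarrow> (LBINT x. inner (h x) (d' n x)) \<ge> - (e/4)" using hv[of "e/4"] e by (auto simp: d'_def)
  show ?thesis
  proof (intro exI[of _ "max N1 (max N2 N3)"] allI impI)
    fix n assume "n \<ge> max N1 (max N2 N3)"
    then have "?E n < e / 2" "(LBINT x. inner (g x) (d n x)) \<ge> - (e/4)" "(LBINT x. inner (h x) (d' n x)) \<ge> - (e/4)"
      using N1 N2 N3 by auto
    with split[of n] show "kinetic u g v h \<le> kinetic (un n) (gn n) (vn n) (hn n) + e" by argo
  qed
qed

end

section \<open>Existence of a minimizer\<close>

text \<open>The nonlinearity is dominated pointwise by the potential and by the cubic term that Lions'
  inequality extracts from the gradient and the Coulomb energy, except on a ball.\<close>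

locale dominated = coefficients +
  fixes \<beta> R C :: real
  assumes \<beta>_nonneg: "0 \<le> \<beta>" and C_nonneg: "0 \<le> C"
    and remainder_ge: "Vm / 4 * (s^2 + t^2) - C * indicator (cball 0 R) x \<le> remainder \<beta> x s t"
begin

text \<open>The integral of the constant by which domination fails inside the ball.\<close>

definition defect :: real where "defect = C * measure lborel (cball (0::real^3) R)"

lemma defect_integral:
  "integrable lborel (\<lambda>x. C * indicator (cball (0::real^3) R) x)" "(LBINT x. C * indicator (cball (0::real^3) R) x) = defect"
proof -
  have "emeasure lborel (cball (0::real^3) R) < \<infinity>" by (rule emeasure_lborel_cball_finite)
  then show "integrable lborel (\<lambda>x. C * indicator (cball (0::real^3) R) x)" by (intro integrable_mult_right integrable_real_indicator) auto
  show "(LBINT x. C * indicator (cball (0::real^3) R) x) = defect" by (simp add: defect_def)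
qed

lemma J_coercive:
  assumes u: "sobolev u g" and v: "sobolev v h"
  shows "min (1/4) (Vm/4) * (nsq u g + nsq v h) - defect \<le> J V \<rho> p \<beta> u v"
proof -
  let ?S = "(LBINT x. (u x)^2) + (LBINT x. (v x)^2)"
  have "(LBINT x. Vm / 4 * ((u x)^2 + (v x)^2) - C * indicator (cball 0 R) x) \<le> (LBINT x. remainder \<beta> x (u x) (v x))"
    by (intro integral_mono Bochner_Integration.integrable_diff integrable_mult_right squares_integrable[OF u v] defect_integral
        remainder_integrable[OF u v] remainder_ge)
  moreover have "(LBINT x. Vm / 4 * ((u x)^2 + (v x)^2) - C * indicator (cball 0 R) x) = Vm / 4 * ?S - defect"
    using sobolevD(6)[OF u] sobolevD(6)[OF v] defect_integral squares_integrable[OF u v] by simp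
  moreover have "min (1/4) (Vm/4) * (nsq u g + nsq v h) \<le> 1/4 * gsq g h + Vm/4 * ?S"
  proof -
    have "nsq u g + nsq v h = gsq g h + ?S" by (simp add: nsq_def gsq_def)
    then have "min (1/4) (Vm/4) * (nsq u g + nsq v h) = min (1/4) (Vm/4) * gsq g h + min (1/4) (Vm/4) * ?S" by (simp only: distrib_left)
    also have "\<dots> \<le> 1/4 * gsq g h + Vm/4 * ?S" by (intro add_mono mult_right_mono gsq_nonneg add_nonneg_nonneg) auto
    finally show ?thesis .
  qed
  ultimately show ?thesis using kinetic_ge[OF u v] unfolding J_split[OF u v] by linarith
qed

text \<open>Fatou's lemma for the nonnegative function \<open>\<psi>\<close>, the remainder plus the constant that dominates its
  negative part. Along the sequence the integral of \<open>\<psi>\<close> is the energy minus the kinetic part.\<close>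

lemma J_lower_semicontinuous:
  fixes un vn :: "nat \<Rightarrow> real^3 \<Rightarrow> real" and gn hn :: "nat \<Rightarrow> real^3 \<Rightarrow> real^3"
  assumes un: "\<And>n. sobolev (un n) (gn n)" and vn: "\<And>n. sobolev (vn n) (hn n)" and u: "sobolev u g" and v: "sobolev v h"
    and ae: "AE x in lborel. (\<lambda>n. un n x) \<longlonglongrightarrow> u x" "AE x in lborel. (\<lambda>n. vn n x) \<longlonglongrightarrow> v x"
    and k: "\<And>e. e > 0 \<Longrightarrow> \<exists>N. \<forall>n\<ge>N. kinetic u g v h \<le> kinetic (un n) (gn n) (vn n) (hn n) + e"
    and J: "(\<lambda>n. J V \<rho> p \<beta> (un n) (vn n)) \<longlonglongrightarrow> m"
  shows "J V \<rho> p \<beta> u v \<le> m"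
proof (rule field_le_epsilon)
  fix e :: real assume e: "e > 0"
  note [measurable] = sobolevD(4)[OF un] sobolevD(4)[OF vn] sobolevD(4)[OF u] sobolevD(4)[OF v]
  define \<psi> where "\<psi> x s t = remainder \<beta> x s t + C * indicator (cball 0 R) x" for x s t
  have \<psi>0: "0 \<le> \<psi> x s t" for x s t
  proof -
    have "0 \<le> Vm / 4 * (s^2 + t^2)" using V_pos by simp
    then show ?thesis using remainder_ge[of s t x] unfolding \<psi>_def by linarith
  qed
  have \<psi>i: "integrable lborel (\<lambda>x. \<psi> x (a x) (b x))"
    "(LBINT x. \<psi> x (a x) (b x)) = J V \<rho> p \<beta> a b - kinetic a c b d + defect" if s: "sobolev a c" "sobolev b d" for a b c d
    unfolding \<psi>_def J_split[OF s] using remainder_integrable[OF s] defect_integral by simp_all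
  obtain N1 where N1: "\<And>n. n \<ge> N1 \<Longrightarrow> kinetic u g v h \<le> kinetic (un n) (gn n) (vn n) (hn n) + e/2" using k[of "e/2"] e by auto
  have "\<forall>\<^sub>F n in sequentially. J V \<rho> p \<beta> (un n) (vn n) < m + e/2" by (rule order_tendstoD(2)[OF J]) (use e in simp)
  then obtain N2 where N2: "\<And>n. n \<ge> N2 \<Longrightarrow> J V \<rho> p \<beta> (un n) (vn n) < m + e/2" by (auto simp: eventually_sequentially)
  define N where "N = max N1 N2"
  define Q where "Q = m + e - kinetic u g v h + defect"
  have Q: "(LBINT x. \<psi> x (un (n + N) x) (vn (n + N) x)) \<le> Q" for n
  proof -
    have "N1 \<le> n + N" "N2 \<le> n + N" by (auto simp: N_def)
    from N1[OF this(1)] N2[OF this(2)] show ?thesis unfolding \<psi>i(2)[OF un vn] Q_def by linarith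
  qed
  have Q0: "0 \<le> Q" by (rule order_trans[OF _ Q[of 0]]) (simp add: \<psi>0 Bochner_Integration.integral_nonneg)
  have "ennreal (LBINT x. \<psi> x (u x) (v x)) = (\<integral>\<^sup>+x. ennreal (\<psi> x (u x) (v x)) \<partial>lborel)"
    by (rule nn_integral_eq_integral[OF \<psi>i(1)[OF u v], symmetric]) (simp add: \<psi>0)
  also have "\<dots> \<le> (\<integral>\<^sup>+x. liminf (\<lambda>n. ennreal (\<psi> x (un (n + N) x) (vn (n + N) x))) \<partial>lborel)"
  proof (rule nn_integral_mono_AE)
    show "AE x in lborel. ennreal (\<psi> x (u x) (v x)) \<le> liminf (\<lambda>n. ennreal (\<psi> x (un (n + N) x) (vn (n + N) x)))"
      using ae
    proof eventually_elim
      case (elim x)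
      have "(\<lambda>n. \<psi> x (un (n + N) x) (vn (n + N) x)) \<longlonglongrightarrow> \<psi> x (u x) (v x)"
        unfolding \<psi>_def remainder_def using p
        by (intro tendsto_intros continuous_coupling LIMSEQ_ignore_initial_segment elim) auto
      then have "(\<lambda>n. ennreal (\<psi> x (un (n + N) x) (vn (n + N) x))) \<longlonglongrightarrow> ennreal (\<psi> x (u x) (v x))" by (rule tendsto_ennrealI)
      then show ?case by (rule tendsto_le_liminf)
    qed
  qed
  also have "\<dots> \<le> liminf (\<lambda>n. \<integral>\<^sup>+x. ennreal (\<psi> x (un (n + N) x) (vn (n + N) x)) \<partial>lborel)"
    by (rule nn_integral_liminf) (use borel_measurable_integrable[OF \<psi>i(1)[OF un vn]] in simp)
  also have "\<dots> \<le> liminf (\<lambda>n. ennreal Q)"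
  proof (rule Liminf_mono, rule always_eventually, rule allI)
    fix n
    have "(\<integral>\<^sup>+x. ennreal (\<psi> x (un (n + N) x) (vn (n + N) x)) \<partial>lborel) = ennreal (LBINT x. \<psi> x (un (n + N) x) (vn (n + N) x))"
      by (rule nn_integral_eq_integral[OF \<psi>i(1)[OF un vn]]) (simp add: \<psi>0)
    then show "(\<integral>\<^sup>+x. ennreal (\<psi> x (un (n + N) x) (vn (n + N) x)) \<partial>lborel) \<le> ennreal Q" using Q[of n] by (simp add: ennreal_leI)
  qed
  also have "\<dots> = ennreal Q" by (simp add: Liminf_const)
  finally have "(LBINT x. \<psi> x (u x) (v x)) \<le> Q" using Q0 by (simp add: ennreal_le_iff)
  then show "J V \<rho> p \<beta> u v \<le> m + e" unfolding \<psi>i(2)[OF u v] Q_def by simp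
qed

text \<open>Only one subsequence for each component has to be extracted; the gradients need none, since
  \<open>weak_gradient_limit\<close> is a statement about the whole sequence.\<close>

theorem minimizer_exists:
  obtains u g v h where "sobolev u g" "sobolev v h" "\<And>a b. a \<in> H1 \<Longrightarrow> b \<in> H1 \<Longrightarrow> J V \<rho> p \<beta> u v \<le> J V \<rho> p \<beta> a b"
proof -
  let ?J = "J V \<rho> p \<beta>"
  let ?S = "(\<lambda>(a, b). ?J a b) ` (H1 \<times> H1)"
  define m where "m = Inf ?S"
  define k where "k = min (1/4) (Vm/4)"
  have kp: "k > 0" using V_pos by (simp add: k_def)
  have ge: "k * (nsq a (weak_grad a) + nsq b (weak_grad b)) - defect \<le> ?J a b" if "a \<in> H1" "b \<in> H1" for a b
    unfolding k_def by (intro J_coercive sobolev_weak_grad that)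
  have bb: "bdd_below ?S"
  proof (rule bdd_belowI[of _ "- defect"])
    fix x assume "x \<in> ?S"
    then obtain a b where ab: "a \<in> H1" "b \<in> H1" "x = ?J a b" by auto
    have "0 \<le> k * (nsq a (weak_grad a) + nsq b (weak_grad b))" using kp by (intro mult_nonneg_nonneg add_nonneg_nonneg nsq_nonneg) auto
    then show "- defect \<le> x" using ge[OF ab(1,2)] ab(3) by linarith
  qed
  have ne: "?S \<noteq> {}" using sobolev_H1[OF sobolev_zero] by auto
  have "\<forall>n. \<exists>c. c \<in> H1 \<times> H1 \<and> ?J (fst c) (snd c) < m + inverse (real (Suc n))"
  proof
    fix n
    have "Inf ?S < m + inverse (real (Suc n))" by (simp add: m_def[symmetric])
    then have "\<exists>y\<in>?S. y < m + inverse (real (Suc n))" by (intro cInf_lessD ne)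
    then show "\<exists>c. c \<in> H1 \<times> H1 \<and> ?J (fst c) (snd c) < m + inverse (real (Suc n))" by fastforce
  qed
  then obtain c where c: "\<And>n. c n \<in> H1 \<times> H1" "\<And>n. ?J (fst (c n)) (snd (c n)) < m + inverse (real (Suc n))" by metis
  define a where "a n = fst (c n)" for n
  define b where "b n = snd (c n)" for n
  have H: "a n \<in> H1" "b n \<in> H1" for n using c(1)[of n] by (auto simp: a_def b_def)
  have Jlt: "?J (a n) (b n) < m + inverse (real (Suc n))" for n using c(2)[of n] by (simp add: a_def b_def)
  have Jge: "m \<le> ?J x y" if "x \<in> H1" "y \<in> H1" for x y
    unfolding m_def by (rule cInf_lower[OF _ bb]) (use that in auto)
  have Jlim: "(\<lambda>n. ?J (a n) (b n)) \<longlonglongrightarrow> m"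
  proof (rule tendsto_sandwich[OF _ _ tendsto_const])
    show "(\<lambda>n. m + inverse (real (Suc n))) \<longlonglongrightarrow> m" using tendsto_add[OF tendsto_const LIMSEQ_inverse_real_of_nat, of m] by simp
  qed (use Jge[OF H] Jlt in \<open>auto intro!: always_eventually less_imp_le\<close>)
  let ?g = "\<lambda>n. weak_grad (a n)" and ?h = "\<lambda>n. weak_grad (b n)"
  have sa: "sobolev (a n) (?g n)" and sb: "sobolev (b n) (?h n)" for n by (intro sobolev_weak_grad H)+
  define M where "M = (m + 1 + defect) / k"
  have M: "nsq (a n) (?g n) \<le> M" "nsq (b n) (?h n) \<le> M" for n
  proof -
    have "inverse (real (Suc n)) \<le> 1" by (simp add: inverse_le_1_iff)
    then have "k * (nsq (a n) (?g n) + nsq (b n) (?h n)) \<le> m + 1 + defect" using ge[OF H(1)[of n] H(2)[of n]] Jlt[of n] by linarith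
    then have "nsq (a n) (?g n) + nsq (b n) (?h n) \<le> M" unfolding M_def using kp by (simp add: pos_le_divide_eq mult.commute)
    then show "nsq (a n) (?g n) \<le> M" "nsq (b n) (?h n) \<le> M" using nsq_nonneg[of "a n" "?g n"] nsq_nonneg[of "b n" "?h n"] by linarith+
  qed
  obtain r u where r: "strict_mono (r :: nat \<Rightarrow> nat)" and u: "square_integrable u" "AE x in lborel. (\<lambda>n. a (r n) x) \<longlonglongrightarrow> u x"
      "(\<lambda>n. \<integral>x. (weight x)^2 * (a (r n) x - u x)^2 \<partial>lborel) \<longlonglongrightarrow> 0"
    by (rule rellich[OF sa M(1)])
  obtain s v where s: "strict_mono (s :: nat \<Rightarrow> nat)" and v: "square_integrable v" "AE x in lborel. (\<lambda>n. b (r (s n)) x) \<longlonglongrightarrow> v x"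
      "(\<lambda>n. \<integral>x. (weight x)^2 * (b (r (s n)) x - v x)^2 \<partial>lborel) \<longlonglongrightarrow> 0"
    by (rule rellich[of "\<lambda>n. b (r n)" "\<lambda>n. ?h (r n)", OF sb M(2)])
  define q where "q n = r (s n)" for n
  have u2: "AE x in lborel. (\<lambda>n. a (q n) x) \<longlonglongrightarrow> u x"
    using u(2) unfolding q_def by eventually_elim (use LIMSEQ_subseq_LIMSEQ[OF _ s] in \<open>auto simp: o_def\<close>)
  have u3: "(\<lambda>n. \<integral>x. (weight x)^2 * (a (q n) x - u x)^2 \<partial>lborel) \<longlonglongrightarrow> 0"
    using LIMSEQ_subseq_LIMSEQ[OF u(3) s] by (simp add: o_def q_def)
  have v2: "AE x in lborel. (\<lambda>n. b (q n) x) \<longlonglongrightarrow> v x" and v3: "(\<lambda>n. \<integral>x. (weight x)^2 * (b (q n) x - v x)^2 \<partial>lborel) \<longlonglongrightarrow> 0"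
    using v(2,3) by (simp_all add: q_def)
  have q: "strict_mono q" using strict_mono_o[OF r s] by (simp add: o_def q_def[abs_def])
  have gM: "(LBINT x. (norm (g x))^2) \<le> nsq f g" for f g by (simp add: nsq_def)
  obtain g where g: "sobolev u g" "\<And>e. e > 0 \<Longrightarrow> \<exists>N. \<forall>n\<ge>N. (LBINT x. inner (g x) (?g (q n) x - g x)) \<ge> - e"
  proof (rule weak_gradient_limit[of "\<lambda>n. a (q n)" "\<lambda>n. ?g (q n)", OF sa order_trans[OF gM M(1)] u(1) u3])
    fix G assume "sobolev u G" "\<And>e. e > 0 \<Longrightarrow> \<exists>N. \<forall>n\<ge>N. (LBINT x. inner (G x) (?g (q n) x - G x)) \<ge> - e"
    then show thesis by (rule that)
  qed
  obtain h where h: "sobolev v h" "\<And>e. e > 0 \<Longrightarrow> \<exists>N. \<forall>n\<ge>N. (LBINT x. inner (h x) (?h (q n) x - h x)) \<ge> - e"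
  proof (rule weak_gradient_limit[of "\<lambda>n. b (q n)" "\<lambda>n. ?h (q n)", OF sb order_trans[OF gM M(2)] v(1) v3])
    fix G assume "sobolev v G" "\<And>e. e > 0 \<Longrightarrow> \<exists>N. \<forall>n\<ge>N. (LBINT x. inner (G x) (?h (q n) x - G x)) \<ge> - e"
    then show thesis by (rule that)
  qed
  have "?J u v \<le> m"
  proof (rule J_lower_semicontinuous[OF sa sb g(1) h(1) u2 v2])
    show "(\<lambda>n. ?J (a (q n)) (b (q n))) \<longlonglongrightarrow> m" using LIMSEQ_subseq_LIMSEQ[OF Jlim q] by (simp add: o_def)
    show "\<exists>N. \<forall>n\<ge>N. kinetic u g v h \<le> kinetic (a (q n)) (?g (q n)) (b (q n)) (?h (q n)) + e" if "e > 0" for e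
      by (rule kinetic_lower_semicontinuous[OF sa sb g(1) h(1) M(1) M(2) u3 v3 g(2) h(2) that])
  qed
  then show thesis using that[OF g(1) h(1)] Jge order_trans by blast
qed

end

section \<open>Minimizers are critical points\<close>

lemma coulomb_double:
  assumes [measurable]: "F \<in> borel_measurable borel" "H \<in> borel_measurable borel"
  shows "coulomb F H = (\<integral>\<^sup>+x. \<integral>\<^sup>+y. ennreal (norm (y - x) powr (-1)) * (F x * H y) \<partial>lborel \<partial>lborel)"
  unfolding coulomb_def newton_def by (simp add: nn_integral_cmult[symmetric] mult.left_commute)

text \<open>The second difference of a quadratic form, for charges \<open>f + q \<plusminus> 2 l\<close> whose mixed part \<open>l\<close> may
  change sign.\<close>

lemma interaction_second_difference:
  assumes f: "charge K f" and q: "charge L q" and fp: "charge P fp" and fm: "charge M fm"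
    and e: "\<And>x. fp x = f x + q x + 2 * l x" "\<And>x. fm x = f x + q x - 2 * l x" and l: "\<And>x. (l x)^2 \<le> f x * q x"
  shows "interaction fp fp + interaction fm fm \<le> 2 * interaction f f + 12 * interaction q f + 18 * interaction q q"
proof -
  define c where "c x = f x + 3 * q x" for x
  have q3: "charge (3 * L) (\<lambda>x. 3 * q x)" by (rule charge_cmult[OF q]) simp
  have c: "charge (K + 3 * L) c" using charge_add[OF f q3] by (simp add: c_def[abs_def])
  note [measurable] = chargeD(2)[OF f] chargeD(2)[OF q] chargeD(2)[OF fp] chargeD(2)[OF fm] chargeD(2)[OF c]
  have nn: "0 \<le> f x" "0 \<le> q x" "0 \<le> fp x" "0 \<le> fm x" "0 \<le> c x" for x
    using chargeD(3)[OF f] chargeD(3)[OF q] chargeD(3)[OF fp] chargeD(3)[OF fm] chargeD(3)[OF c] by auto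
  have pw: "fp x * fp y + fm x * fm y \<le> 2 * (c x * c y)" for x y
  proof -
    let ?X = "f x * q y" and ?Y = "q x * f y"
    have "(l x * l y)^2 \<le> (f x * q x) * (f y * q y)"
      unfolding power_mult_distrib by (intro mult_mono l mult_nonneg_nonneg nn) simp
    also have "\<dots> = ?X * ?Y" by simp
    also have "\<dots> \<le> ((?X + ?Y) / 2)^2"
      using zero_le_power2[of "?X - ?Y"] by (simp add: power2_eq_square field_simps)
    finally have "l x * l y \<le> (?X + ?Y) / 2" by (rule power2_le_imp_le) (use nn in simp)
    moreover have "fp x * fp y + fm x * fm y = 2 * ((f x + q x) * (f y + q y)) + 8 * (l x * l y)"
      unfolding e by (simp add: algebra_simps)
    moreover have "2 * (c x * c y) = 2 * ((f x + q x) * (f y + q y)) + 4 * (?X + ?Y) + 16 * (q x * q y)"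
      unfolding c_def by (simp add: algebra_simps)
    moreover have "0 \<le> q x * q y" using nn by simp
    ultimately show ?thesis by linarith
  qed
  let ?k = "\<lambda>x y :: real^3. ennreal (norm (y - x) powr (-1))"
  have "coulomb (\<lambda>x. ennreal (fp x)) (\<lambda>x. ennreal (fp x)) + coulomb (\<lambda>x. ennreal (fm x)) (\<lambda>x. ennreal (fm x))
    = (\<integral>\<^sup>+x. \<integral>\<^sup>+y. ?k x y * (ennreal (fp x) * ennreal (fp y)) + ?k x y * (ennreal (fm x) * ennreal (fm y)) \<partial>lborel \<partial>lborel)"
    by (simp add: coulomb_double nn_integral_add)
  also have "\<dots> \<le> (\<integral>\<^sup>+x. \<integral>\<^sup>+y. 2 * (?k x y * (ennreal (c x) * ennreal (c y))) \<partial>lborel \<partial>lborel)"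
  proof (intro nn_integral_mono)
    fix x y :: "real^3"
    have "ennreal (fp x) * ennreal (fp y) + ennreal (fm x) * ennreal (fm y) = ennreal (fp x * fp y + fm x * fm y)"
      using nn by (simp add: ennreal_mult)
    also have "\<dots> \<le> ennreal (2 * (c x * c y))" by (rule ennreal_leI[OF pw])
    also have "\<dots> = 2 * (ennreal (c x) * ennreal (c y))" using nn by (simp add: ennreal_mult)
    finally have "?k x y * (ennreal (fp x) * ennreal (fp y) + ennreal (fm x) * ennreal (fm y)) \<le> ?k x y * (2 * (ennreal (c x) * ennreal (c y)))"
      by (rule mult_left_mono) simp
    then show "?k x y * (ennreal (fp x) * ennreal (fp y)) + ?k x y * (ennreal (fm x) * ennreal (fm y))
      \<le> 2 * (?k x y * (ennreal (c x) * ennreal (c y)))" by (simp only: distrib_left mult.left_commute)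
  qed
  also have "\<dots> = 2 * coulomb (\<lambda>x. ennreal (c x)) (\<lambda>x. ennreal (c x))"
    by (simp add: coulomb_double nn_integral_cmult)
  finally have "ennreal (interaction fp fp + interaction fm fm) \<le> ennreal (2 * interaction c c)"
    unfolding coulomb_interaction[OF fp fp] coulomb_interaction[OF fm fm] coulomb_interaction[OF c c]
    by (simp add: interaction_nonneg ennreal_mult)
  then have "interaction fp fp + interaction fm fm \<le> 2 * interaction c c"
    by (subst (asm) ennreal_le_iff) (auto simp: interaction_nonneg)
  also have "interaction c c = interaction f f + 6 * interaction q f + 9 * interaction q q"
    unfolding c_def[abs_def] interaction_add_left[OF f q3 charge_add[OF f q3]] interaction_add_right[OF f q3 f] interaction_add_right[OF f q3 q3]
      interaction_cmult(1)[OF q f zero_le_numeral] interaction_cmult(2)[OF q f zero_le_numeral]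
      interaction_cmult(1)[OF q q3 zero_le_numeral] interaction_cmult(2)[OF q q zero_le_numeral] interaction_commute[OF f q]
    by simp
  finally show ?thesis by simp
qed

text \<open>The parameter \<open>1 / t\<close> in \<open>cubic_young\<close> makes both terms quadratic in \<open>t\<close>, because the integral of
  \<open>\<bar>y\<bar>\<^sup>3\<close> is of order \<open>t\<^sup>3\<close>.\<close>

lemma cubic_product_bound:
  assumes x: "sobolev x gx" and y: "sobolev y gy" and t: "0 < t" and n: "nsq y gy \<le> t^2"
  shows "integrable lborel (\<lambda>z. \<bar>x z\<bar> * (y z)^2)"
    "(LBINT z. \<bar>x z\<bar> * (y z)^2) \<le> t^2 * ((LBINT z. \<bar>x z\<bar>^3) + cube_const)"
proof -
  show i: "integrable lborel (\<lambda>z. \<bar>x z\<bar> * (y z)^2)"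
    by (rule cubic_product_integrable[OF sobolevD(4)[OF x] sobolevD(4)[OF y] cube_integrable[OF x] cube_integrable[OF y]])
  have "(LBINT z. \<bar>x z\<bar> * (y z)^2) \<le> (LBINT z. t^2 * \<bar>x z\<bar>^3 + inverse t * \<bar>y z\<bar>^3)"
  proof (intro integral_mono i Bochner_Integration.integrable_add integrable_mult_right cube_integrable[OF x] cube_integrable[OF y])
    show "\<bar>x z\<bar> * (y z)^2 \<le> t^2 * \<bar>x z\<bar>^3 + inverse t * \<bar>y z\<bar>^3" for z
      using cubic_young(1)[of "\<bar>x z\<bar>" "\<bar>y z\<bar>" "inverse t"] t by simp
  qed
  also have "\<dots> = t^2 * (LBINT z. \<bar>x z\<bar>^3) + inverse t * (LBINT z. \<bar>y z\<bar>^3)"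
    using cube_integrable[OF x] cube_integrable[OF y] by simp
  also have "inverse t * (LBINT z. \<bar>y z\<bar>^3) \<le> inverse t * (cube_const * t^3)"
    using t by (intro mult_left_mono cube_const(2)[OF y t n]) simp
  also have "inverse t * (cube_const * t^3) = t^2 * cube_const" using t by (simp add: power2_eq_square power3_eq_cube)
  finally show "(LBINT z. \<bar>x z\<bar> * (y z)^2) \<le> t^2 * ((LBINT z. \<bar>x z\<bar>^3) + cube_const)"
    by (simp add: distrib_left)
qed

context coefficients begin

lemma gsq_second_difference:
  assumes "square_integrable g" "square_integrable h" "square_integrable c" "square_integrable d"
  shows "gsq (\<lambda>x. g x + c x) (\<lambda>x. h x + d x) + gsq (\<lambda>x. g x - c x) (\<lambda>x. h x - d x) = 2 * gsq g h + 2 * gsq c d"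
  unfolding gsq_def using integral_norm_diff[OF assms(1,3), of 1] integral_norm_diff[OF assms(2,4), of 1]
    integral_norm_diff[OF assms(1,3), of "-1"] integral_norm_diff[OF assms(2,4), of "-1"] by simp

lemma potential_second_difference:
  assumes u: "sobolev u g" and v: "sobolev v h" and a: "sobolev a c" and b: "sobolev b d"
  shows "potential (\<lambda>x. u x + a x) (\<lambda>x. v x + b x) + potential (\<lambda>x. u x - a x) (\<lambda>x. v x - b x)
    = 2 * potential u v + 2 * potential a b"
proof -
  note i = bounded_integrable(1)[OF squares_integrable]
  have "potential (\<lambda>x. u x + a x) (\<lambda>x. v x + b x) + potential (\<lambda>x. u x - a x) (\<lambda>x. v x - b x)
    = (LBINT x. V x * ((u x + a x)^2 + (v x + b x)^2) + V x * ((u x - a x)^2 + (v x - b x)^2))"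
    unfolding potential_def
    by (rule Bochner_Integration.integral_add[symmetric, OF i[OF sobolev_add[OF u a] sobolev_add[OF v b]] i[OF sobolev_diff[OF u a] sobolev_diff[OF v b]]])
  also have "\<dots> = (LBINT x. 2 * (V x * ((u x)^2 + (v x)^2)) + 2 * (V x * ((a x)^2 + (b x)^2)))"
    by (simp add: power2_eq_square algebra_simps)
  also have "\<dots> = 2 * potential u v + 2 * potential a b"
    unfolding potential_def using i[OF u v] i[OF a b] by simp
  finally show ?thesis .
qed

lemma charge_bounds:
  assumes a: "sobolev a c" and b: "sobolev b d" and n: "nsq a c + nsq b d \<le> N"
  shows "(LBINT x. density a b x) \<le> rM * N" "potential a b \<le> VM * N" "gsq c d \<le> N"
proof -
  have e: "(LBINT x. (a x)^2 + (b x)^2) \<le> N" "gsq c d \<le> N"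
  proof -
    have "nsq a c + nsq b d = (LBINT x. (a x)^2 + (b x)^2) + gsq c d"
      using sobolevD(6)[OF a] sobolevD(6)[OF b] by (simp add: nsq_def gsq_def)
    moreover have "0 \<le> (LBINT x. (a x)^2 + (b x)^2)" by (intro Bochner_Integration.integral_nonneg) simp
    ultimately show "(LBINT x. (a x)^2 + (b x)^2) \<le> N" "gsq c d \<le> N" using n gsq_nonneg[of c d] by linarith+
  qed
  show "gsq c d \<le> N" by (rule e)
  have "(LBINT x. density a b x) \<le> (LBINT x. rM * ((a x)^2 + (b x)^2))"
    by (intro integral_mono chargeD(1)[OF density_charge[OF a b]] integrable_mult_right squares_integrable[OF a b])
      (auto simp: density_def intro!: mult_right_mono \<rho>_bounds)
  also have "\<dots> \<le> rM * N" using e(1) \<rho>_nonneg(2) by (simp add: mult_left_mono)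
  finally show "(LBINT x. density a b x) \<le> rM * N" .
  have "potential a b \<le> (LBINT x. VM * ((a x)^2 + (b x)^2))" unfolding potential_def
    by (intro integral_mono bounded_integrable(1)[OF squares_integrable[OF a b]] integrable_mult_right squares_integrable[OF a b])
      (auto intro!: mult_right_mono V_bounds)
  also have "\<dots> \<le> VM * N" using e(1) V_nonneg(2) by (simp add: mult_left_mono)
  finally show "potential a b \<le> VM * N" .
qed

lemma coulomb_second_difference:
  assumes u: "sobolev u g" and v: "sobolev v h" and a: "sobolev a c" and b: "sobolev b d"
    and n: "nsq a c + nsq b d \<le> N" "N \<le> 1"
  shows "interaction (density (\<lambda>x. u x + a x) (\<lambda>x. v x + b x)) (density (\<lambda>x. u x + a x) (\<lambda>x. v x + b x))
    + interaction (density (\<lambda>x. u x - a x) (\<lambda>x. v x - b x)) (density (\<lambda>x. u x - a x) (\<lambda>x. v x - b x))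
    \<le> 2 * interaction (density u v) (density u v)
      + (12 * (rM * (hardy_const * (nsq u g + nsq v h))) + 18 * (rM * hardy_const)) * (rM * N)"
proof -
  note f = density_charge[OF u v] and q = density_charge[OF a b]
  have "interaction (density (\<lambda>x. u x + a x) (\<lambda>x. v x + b x)) (density (\<lambda>x. u x + a x) (\<lambda>x. v x + b x))
    + interaction (density (\<lambda>x. u x - a x) (\<lambda>x. v x - b x)) (density (\<lambda>x. u x - a x) (\<lambda>x. v x - b x))
    \<le> 2 * interaction (density u v) (density u v) + 12 * interaction (density a b) (density u v) + 18 * interaction (density a b) (density a b)"
  proof (rule interaction_second_difference[OF f q density_charge[OF sobolev_add[OF u a] sobolev_add[OF v b]]
        density_charge[OF sobolev_diff[OF u a] sobolev_diff[OF v b]], where l = "\<lambda>x. \<rho> x * (u x * a x + v x * b x)"])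
    fix x
    have "(u x * a x + v x * b x)^2 \<le> ((u x)^2 + (v x)^2) * ((a x)^2 + (b x)^2)"
      using zero_le_power2[of "u x * b x - v x * a x"] by (simp add: power2_eq_square algebra_simps)
    then have "(\<rho> x)^2 * (u x * a x + v x * b x)^2 \<le> (\<rho> x)^2 * (((u x)^2 + (v x)^2) * ((a x)^2 + (b x)^2))"
      by (rule mult_left_mono) simp
    then show "(\<rho> x * (u x * a x + v x * b x))^2 \<le> density u v x * density a b x"
      unfolding density_def power_mult_distrib by (simp only: power2_eq_square mult_ac)
  qed (simp_all add: density_def power2_eq_square algebra_simps)
  also have "interaction (density a b) (density u v) \<le> (rM * (hardy_const * (nsq u g + nsq v h))) * (rM * N)"
    by (rule order_trans[OF interaction_le[OF q f] mult_left_mono[OF charge_bounds(1)[OF a b n(1)] chargeD(4)[OF f]]])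
  also have "interaction (density a b) (density a b) \<le> (rM * hardy_const) * (rM * N)"
  proof -
    have nn: "0 \<le> nsq a c + nsq b d" by (intro add_nonneg_nonneg nsq_nonneg)
    have "interaction (density a b) (density a b) \<le> (rM * (hardy_const * (nsq a c + nsq b d))) * (rM * N)"
      by (rule order_trans[OF interaction_le[OF q q] mult_left_mono[OF charge_bounds(1)[OF a b n(1)] chargeD(4)[OF q]]])
    also have "\<dots> \<le> (rM * (hardy_const * 1)) * (rM * N)"
      using n nn hardy_const(1) \<rho>_nonneg(2) by (intro mult_right_mono mult_left_mono) auto
    finally show ?thesis by simp
  qed
  finally show ?thesis by (simp add: algebra_simps)
qed

lemma coupling_integral_second_difference:
  assumes u: "sobolev u g" and v: "sobolev v h" and a: "sobolev a c" and b: "sobolev b d" and \<beta>: "0 \<le> \<beta>"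
    and t: "0 < t" "t \<le> 1" and n: "nsq a c + nsq b d \<le> t^2"
  shows "2 * (LBINT x. coupling p \<beta> (u x) (v x)) - ((LBINT x. coupling p \<beta> (u x + a x) (v x + b x))
      + (LBINT x. coupling p \<beta> (u x - a x) (v x - b x)))
    \<le> 8 * \<beta> * (t^2 * (1 + 2 * (LBINT x. \<bar>u x\<bar>^3) + 2 * (LBINT x. \<bar>v x\<bar>^3) + 12 * cube_const))"
proof -
  have na: "nsq a c \<le> t^2" "nsq b d \<le> t^2" using n nsq_nonneg[of a c] nsq_nonneg[of b d] by linarith+
  have t3: "t^3 \<le> 1" using t by (simp add: power_le_one)
  have ca: "(LBINT x. \<bar>a x\<bar>^3) \<le> cube_const" "(LBINT x. \<bar>b x\<bar>^3) \<le> cube_const"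
    using cube_const(2)[OF a t(1) na(1)] cube_const(2)[OF b t(1) na(2)] mult_left_mono[OF t3, of cube_const] cube_const(1) by linarith+
  note iu = cubic_product_bound[OF u a t(1) na(1)] cubic_product_bound[OF u b t(1) na(2)]
  note iv = cubic_product_bound[OF v a t(1) na(1)] cubic_product_bound[OF v b t(1) na(2)]
  note ia = cubic_product_bound[OF a a t(1) na(1)] cubic_product_bound[OF a b t(1) na(2)]
  note ib = cubic_product_bound[OF b a t(1) na(1)] cubic_product_bound[OF b b t(1) na(2)]
  let ?m = "\<lambda>x. ((a x)^2 + (b x)^2) + ((\<bar>u x\<bar> * (a x)^2 + \<bar>u x\<bar> * (b x)^2) + (\<bar>v x\<bar> * (a x)^2 + \<bar>v x\<bar> * (b x)^2)
    + (\<bar>a x\<bar> * (a x)^2 + \<bar>a x\<bar> * (b x)^2) + (\<bar>b x\<bar> * (a x)^2 + \<bar>b x\<bar> * (b x)^2))"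
  note cp = coupling_integrable[OF sobolev_add[OF u a] sobolev_add[OF v b] p, of \<beta>]
    and cm = coupling_integrable[OF sobolev_diff[OF u a] sobolev_diff[OF v b] p, of \<beta>] and c0 = coupling_integrable[OF u v p, of \<beta>]
  have "2 * (LBINT x. coupling p \<beta> (u x) (v x)) - ((LBINT x. coupling p \<beta> (u x + a x) (v x + b x))
      + (LBINT x. coupling p \<beta> (u x - a x) (v x - b x)))
    = (LBINT x. 2 * coupling p \<beta> (u x) (v x) - (coupling p \<beta> (u x + a x) (v x + b x) + coupling p \<beta> (u x - a x) (v x - b x)))"
    using cp cm c0 by simp
  also have "\<dots> \<le> (LBINT x. 8 * \<beta> * ?m x)"
  proof (intro integral_mono Bochner_Integration.integrable_diff Bochner_Integration.integrable_add integrable_mult_right cp cm c0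
      iu iv ia ib sobolevD(6)[OF a] sobolevD(6)[OF b])
    fix x
    show "2 * coupling p \<beta> (u x) (v x) - (coupling p \<beta> (u x + a x) (v x + b x) + coupling p \<beta> (u x - a x) (v x - b x)) \<le> 8 * \<beta> * ?m x"
      using coupling_second_difference[OF p \<beta>, of "u x" "v x" "a x" "b x"] by (simp add: algebra_simps)
  qed
  also have "\<dots> = 8 * \<beta> * (LBINT x. ?m x)" by simp
  also have "\<dots> \<le> 8 * \<beta> * (t^2 * (1 + 2 * (LBINT x. \<bar>u x\<bar>^3) + 2 * (LBINT x. \<bar>v x\<bar>^3) + 12 * cube_const))"
  proof (rule mult_left_mono)
    have "(LBINT x. ?m x) = ((LBINT x. (a x)^2) + (LBINT x. (b x)^2))
      + (((LBINT x. \<bar>u x\<bar> * (a x)^2) + (LBINT x. \<bar>u x\<bar> * (b x)^2)) + ((LBINT x. \<bar>v x\<bar> * (a x)^2) + (LBINT x. \<bar>v x\<bar> * (b x)^2))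
      + ((LBINT x. \<bar>a x\<bar> * (a x)^2) + (LBINT x. \<bar>a x\<bar> * (b x)^2)) + ((LBINT x. \<bar>b x\<bar> * (a x)^2) + (LBINT x. \<bar>b x\<bar> * (b x)^2)))"
      using iu(1,3) iv(1,3) ia(1,3) ib(1,3) sobolevD(6)[OF a] sobolevD(6)[OF b] by simp
    also have "(LBINT x. (a x)^2) + (LBINT x. (b x)^2) \<le> t^2"
      using n sobolevD(7)[OF a] sobolevD(7)[OF b] unfolding nsq_def
      by (smt (verit) Bochner_Integration.integral_nonneg zero_le_power2)
    also have "(LBINT x. \<bar>a x\<bar> * (a x)^2) \<le> t^2 * (2 * cube_const)"
      by (rule order_trans[OF ia(2)]) (use ca in \<open>auto intro: mult_left_mono\<close>)
    also have "(LBINT x. \<bar>a x\<bar> * (b x)^2) \<le> t^2 * (2 * cube_const)"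
      by (rule order_trans[OF ia(4)]) (use ca in \<open>auto intro: mult_left_mono\<close>)
    also have "(LBINT x. \<bar>b x\<bar> * (a x)^2) \<le> t^2 * (2 * cube_const)"
      by (rule order_trans[OF ib(2)]) (use ca in \<open>auto intro: mult_left_mono\<close>)
    also have "(LBINT x. \<bar>b x\<bar> * (b x)^2) \<le> t^2 * (2 * cube_const)"
      by (rule order_trans[OF ib(4)]) (use ca in \<open>auto intro: mult_left_mono\<close>)
    also note iu(2) also note iu(4) also note iv(2) also note iv(4)
    finally show "(LBINT x. ?m x) \<le> t^2 * (1 + 2 * (LBINT x. \<bar>u x\<bar>^3) + 2 * (LBINT x. \<bar>v x\<bar>^3) + 12 * cube_const)"
      by (simp add: algebra_simps)
  qed (use \<beta> in simp)
  finally show ?thesis .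
qed

lemma J_second_difference:
  assumes u: "sobolev u g" and v: "sobolev v h" and \<beta>: "0 \<le> \<beta>"
  obtains C where "0 \<le> C" "\<And>a c b d t. sobolev a c \<Longrightarrow> sobolev b d \<Longrightarrow> 0 < t \<Longrightarrow> t \<le> 1 \<Longrightarrow> nsq a c + nsq b d \<le> t^2 \<Longrightarrow>
    J V \<rho> p \<beta> (\<lambda>x. u x + a x) (\<lambda>x. v x + b x) + J V \<rho> p \<beta> (\<lambda>x. u x - a x) (\<lambda>x. v x - b x) - 2 * J V \<rho> p \<beta> u v \<le> C * t^2"
proof -
  define A where "A = (12 * (rM * (hardy_const * (nsq u g + nsq v h))) + 18 * (rM * hardy_const)) * rM"
  define B where "B = 8 * \<beta> * (1 + 2 * (LBINT x. \<bar>u x\<bar>^3) + 2 * (LBINT x. \<bar>v x\<bar>^3) + 12 * cube_const)"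
  have A0: "0 \<le> A" unfolding A_def using \<rho>_nonneg(2) hardy_const(1) nsq_nonneg[of u g] nsq_nonneg[of v h] by (auto intro!: mult_nonneg_nonneg add_nonneg_nonneg)
  have B0: "0 \<le> B" unfolding B_def using \<beta> cube_const(1) by (auto intro!: mult_nonneg_nonneg add_nonneg_nonneg)
  show ?thesis
  proof
    show "0 \<le> (1 + VM) + A / 4 + B" using A0 B0 V_nonneg(2) by simp
    fix a c b d t assume a: "sobolev a c" and b: "sobolev b d" and t: "0 < t" "t \<le> 1" and n: "nsq a c + nsq b d \<le> t^2"
    have t1: "t^2 \<le> 1" using t by (simp add: power_le_one)
    note ap = sobolev_add[OF u a] sobolev_add[OF v b] and am = sobolev_diff[OF u a] sobolev_diff[OF v b]
    let ?c = "2 * (LBINT x. coupling p \<beta> (u x) (v x)) - ((LBINT x. coupling p \<beta> (u x + a x) (v x + b x))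
      + (LBINT x. coupling p \<beta> (u x - a x) (v x - b x)))"
    have "1/p * ?c \<le> B * t^2"
    proof -
      have "1/p * ?c \<le> 1/p * (B * t^2)"
        using coupling_integral_second_difference[OF u v a b \<beta> t n] p by (intro mult_left_mono) (auto simp: B_def algebra_simps)
      also have "\<dots> \<le> B * t^2" using p B0 by (intro mult_left_le_one_le) auto
      finally show ?thesis .
    qed
    moreover have combine: "1/2 * (g1 + p1) + 1/4 * d1 - r * i1 + (1/2 * (g2 + p2) + 1/4 * d2 - r * i2) - 2 * (1/2 * (g0 + p0) + 1/4 * d0 - r * i0)
        \<le> ((1 + VM) + A / 4 + B) * T"
      if "r * (2 * i0 - (i1 + i2)) \<le> B * T" "g1 + g2 = 2 * g0 + 2 * gc" "p1 + p2 = 2 * p0 + 2 * pc" "d1 + d2 \<le> 2 * d0 + A * T" "pc \<le> VM * T" "gc \<le> T"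
      for g1 g2 g0 gc p1 p2 p0 pc d1 d2 d0 i1 i2 i0 r T
    proof -
      have "2 * (r * i0) - (r * i1 + r * i2) \<le> B * T" using that(1) by (simp add: algebra_simps)
      moreover have "((1 + VM) + A / 4 + B) * T = T + VM * T + A * T / 4 + B * T" by (simp add: algebra_simps)
      ultimately show ?thesis using that(2-6) by argo
    qed
    moreover have "interaction (density (\<lambda>x. u x + a x) (\<lambda>x. v x + b x)) (density (\<lambda>x. u x + a x) (\<lambda>x. v x + b x))
      + interaction (density (\<lambda>x. u x - a x) (\<lambda>x. v x - b x)) (density (\<lambda>x. u x - a x) (\<lambda>x. v x - b x))
      \<le> 2 * interaction (density u v) (density u v) + A * t^2"
      using coulomb_second_difference[OF u v a b n t1] unfolding A_def mult.assoc .
    ultimately show "J V \<rho> p \<beta> (\<lambda>x. u x + a x) (\<lambda>x. v x + b x) + J V \<rho> p \<beta> (\<lambda>x. u x - a x) (\<lambda>x. v x - b x) - 2 * J V \<rho> p \<beta> u v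
      \<le> ((1 + VM) + A / 4 + B) * t^2"
      unfolding J_eq[OF ap] J_eq[OF am] J_eq[OF u v]
      using potential_second_difference[OF u v a b]
        gsq_second_difference[OF sobolevD(2)[OF u] sobolevD(2)[OF v] sobolevD(2)[OF a] sobolevD(2)[OF b]] charge_bounds(2,3)[OF a b n]
      by (intro combine)
  qed
qed

text \<open>A bound on the second difference makes the functional differentiable at a minimizer: both first
  differences are nonnegative, and their sum is of second order.\<close>

lemma minimizer_critical:
  assumes u: "sobolev u g" and v: "sobolev v h" and \<beta>: "0 \<le> \<beta>"
    and min: "\<And>a b. a \<in> H1 \<Longrightarrow> b \<in> H1 \<Longrightarrow> J V \<rho> p \<beta> u v \<le> J V \<rho> p \<beta> a b"
  shows "critical_point (J V \<rho> p \<beta>) u v"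
proof -
  let ?J = "J V \<rho> p \<beta>"
  obtain C where C: "0 \<le> C" "\<And>a c b d t. sobolev a c \<Longrightarrow> sobolev b d \<Longrightarrow> 0 < t \<Longrightarrow> t \<le> 1 \<Longrightarrow> nsq a c + nsq b d \<le> t^2 \<Longrightarrow>
    ?J (\<lambda>x. u x + a x) (\<lambda>x. v x + b x) + ?J (\<lambda>x. u x - a x) (\<lambda>x. v x - b x) - 2 * ?J u v \<le> C * t^2"
    using J_second_difference[OF u v \<beta>] by blast
  show ?thesis
    unfolding critical_point_def
  proof (intro conjI allI impI)
    show "(u, v) \<in> H1_pairs" using sobolev_H1[OF u] sobolev_H1[OF v] by (simp add: H1_pairs_def)
    fix \<epsilon> :: real assume \<epsilon>: "\<epsilon> > 0"
    define \<delta> where "\<delta> = min 1 (\<epsilon> / (C + 1))"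
    have \<delta>: "0 < \<delta>" "\<delta> \<le> 1" "C * \<delta> \<le> \<epsilon>"
    proof -
      show "0 < \<delta>" "\<delta> \<le> 1" using \<epsilon> C(1) by (auto simp: \<delta>_def)
      have "C * \<delta> \<le> (C + 1) * (\<epsilon> / (C + 1))" using \<epsilon> C(1) by (intro mult_mono) (auto simp: \<delta>_def)
      then show "C * \<delta> \<le> \<epsilon>" using C(1) by simp
    qed
    show "\<exists>\<delta>>0. \<forall>(a, b)\<in>H1_pairs. H_norm a b < \<delta> \<longrightarrow> \<bar>?J (\<lambda>x. u x + a x) (\<lambda>x. v x + b x) - ?J u v\<bar> \<le> \<epsilon> * H_norm a b"
    proof (intro exI[of _ \<delta>] conjI \<delta>(1), clarify)
      fix a b assume ab: "(a, b) \<in> H1_pairs" and lt: "H_norm a b < \<delta>"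
      have a: "sobolev a (weak_grad a)" and b: "sobolev b (weak_grad b)"
        using ab by (auto simp: H1_pairs_def intro: sobolev_weak_grad)
      let ?n = "H_norm a b" and ?d = "?J (\<lambda>x. u x + a x) (\<lambda>x. v x + b x) - ?J u v"
      have n: "?n^2 = nsq a (weak_grad a) + nsq b (weak_grad b)" "0 \<le> ?n"
        unfolding H_norm_eq[OF a b] using nsq_nonneg by (simp_all add: add_nonneg_nonneg)
      have d0: "0 \<le> ?d" "?J u v \<le> ?J (\<lambda>x. u x - a x) (\<lambda>x. v x - b x)"
        using min sobolev_H1[OF sobolev_add[OF u a]] sobolev_H1[OF sobolev_add[OF v b]]
          sobolev_H1[OF sobolev_diff[OF u a]] sobolev_H1[OF sobolev_diff[OF v b]] by auto
      have le: "?d \<le> C * t^2" if "0 < t" "t \<le> 1" "?n \<le> t" for t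
      proof -
        have "nsq a (weak_grad a) + nsq b (weak_grad b) \<le> t^2" unfolding n(1)[symmetric] using that n(2) by (intro power_mono) auto
        from C(2)[OF a b that(1,2) this] d0 show ?thesis by linarith
      qed
      show "\<bar>?d\<bar> \<le> \<epsilon> * ?n"
      proof (cases "?n = 0")
        case True
        have "?d \<le> 0 + e" if "e > 0" for e
        proof -
          define t where "t = min 1 (e / (C + 1))"
          have t: "0 < t" "t \<le> 1" using that C(1) by (auto simp: t_def)
          have "?d \<le> C * t^2" using le[of t] t True by simp
          also have "\<dots> \<le> C * t" using t C(1) by (intro mult_left_mono) (auto simp: power2_eq_square mult_left_le_one_le)
          also have "\<dots> \<le> (C + 1) * (e / (C + 1))" using that C(1) t by (intro mult_mono) (auto simp: t_def)
          also have "\<dots> = e" using C(1) by simp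
          finally show ?thesis by simp
        qed
        then have "?d \<le> 0" by (rule field_le_epsilon)
        then show ?thesis using d0 True by simp
      next
        case False
        then have "?d \<le> C * ?n^2" using le[of ?n] n lt \<delta> by simp
        also have "\<dots> = (C * ?n) * ?n" by (simp add: power2_eq_square)
        also have "\<dots> \<le> \<epsilon> * ?n"
        proof (rule mult_right_mono[OF _ n(2)])
          show "C * ?n \<le> \<epsilon>" using mult_left_mono[OF less_imp_le[OF lt] C(1)] \<delta>(3) by linarith
        qed
        finally show ?thesis using d0 by simp
      qed
    qed
  qed
qed

end

section \<open>The sign of the threshold\<close>

lemma Lambda_quotient_eq:
  "Lambda_quotient p \<theta> k (u, v) = J (\<lambda>_. \<theta>) (\<lambda>_. k) p 0 u v / (2/p * (LBINT x. \<bar>u x\<bar> powr (p/2) * \<bar>v x\<bar> powr (p/2)))"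
proof -
  have "(\<integral>x. k * phi (\<lambda>_. k) u v x * ((u x)^2 + (v x)^2) \<partial>lborel) = k * (\<integral>x. phi (\<lambda>_. k) u v x * ((u x)^2 + (v x)^2) \<partial>lborel)"
    by (simp add: mult.assoc)
  then show ?thesis by (simp add: Lambda_quotient_def J_def)
qed

lemma powr_integral_pos:
  assumes u: "sobolev u g" and p: "2 < p" "p < 3" and nz: "\<not> ae_zero u"
  shows "0 < (LBINT x. \<bar>u x\<bar> powr p)"
proof (rule ccontr)
  assume "\<not> ?thesis"
  moreover have "0 \<le> (LBINT x. \<bar>u x\<bar> powr p)" by simp
  ultimately have "(LBINT x. \<bar>u x\<bar> powr p) = 0" by linarith
  then have "AE x in lborel. \<bar>u x\<bar> powr p = 0"
    using integral_nonneg_eq_0_iff_AE[OF powr_integrable[OF u p]] by simp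
  then have "ae_zero u" unfolding ae_zero_def by eventually_elim simp
  then show False using nz by simp
qed

context coefficients begin

lemma density_split: "density u v = (\<lambda>x. density u (\<lambda>_. 0) x + density (\<lambda>_. 0) v x)"
  by (simp add: density_def fun_eq_iff distrib_left)

lemma J_coupling:
  assumes u: "sobolev u g" and v: "sobolev v h"
  shows "J V \<rho> p \<beta> u v = J V \<rho> p 0 u v - \<beta> * (2/p * (LBINT x. \<bar>u x\<bar> powr (p/2) * \<bar>v x\<bar> powr (p/2)))"
  unfolding J_def using powr_integrable[OF u p] powr_integrable[OF v p] powr_half_integrable[OF u v p]
  by (simp add: mult.assoc distrib_left right_diff_distrib)

text \<open>Without coupling, the two components interact only through the Coulomb repulsion.\<close>

lemma J_superadditive:
  assumes u: "sobolev u g" and v: "sobolev v h"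
  shows "J V \<rho> p 0 u (\<lambda>_. 0) + J V \<rho> p 0 (\<lambda>_. 0) v \<le> J V \<rho> p 0 u v"
proof -
  let ?a = "density u (\<lambda>_. 0)" and ?b = "density (\<lambda>_. 0) v"
  note a = density_charge[OF u sobolev_zero] and b = density_charge[OF sobolev_zero v]
  have "interaction ?a ?a + interaction ?b ?b \<le> interaction (density u v) (density u v)"
    unfolding density_split[of u v] interaction_add_left[OF a b charge_add[OF a b]] interaction_add_right[OF a b a] interaction_add_right[OF a b b]
    using interaction_nonneg[of ?a ?b] interaction_nonneg[of ?b ?a] by linarith
  moreover have "gsq g h = gsq g (\<lambda>_. 0) + gsq (\<lambda>_. 0) h" by (simp add: gsq_def)
  moreover have "potential u v = potential u (\<lambda>_. 0) + potential (\<lambda>_. 0) v"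
    unfolding potential_def distrib_left using bounded_integrable(1)[OF sobolevD(6)[OF u]] bounded_integrable(1)[OF sobolevD(6)[OF v]] by simp
  moreover have "(LBINT x. coupling p 0 (u x) (v x)) = (LBINT x. coupling p 0 (u x) 0) + (LBINT x. coupling p 0 0 (v x))"
    using powr_integrable[OF u p] powr_integrable[OF v p] by (simp add: coupling_def)
  ultimately show ?thesis unfolding J_eq[OF u v] J_eq[OF u sobolev_zero] J_eq[OF sobolev_zero v] by (simp add: algebra_simps)
qed

text \<open>For \<open>c\<^sup>2 + s\<^sup>2 = 1\<close> only the last term depends on \<open>c\<close> and \<open>s\<close>.\<close>

lemma J_rotated:
  assumes u: "sobolev u g" and cs: "0 \<le> c" "0 \<le> s"
  shows "J V \<rho> p \<beta> (\<lambda>x. c * u x) (\<lambda>x. s * u x)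
    = 1/2 * ((c^2 + s^2) * (gsq g (\<lambda>_. 0) + potential u (\<lambda>_. 0)))
      + 1/4 * ((c^2 + s^2)^2 * interaction (density u (\<lambda>_. 0)) (density u (\<lambda>_. 0)))
      - 1/p * ((c powr p + s powr p + 2 * \<beta> * (c powr (p/2) * s powr (p/2))) * (LBINT x. \<bar>u x\<bar> powr p))"
proof -
  note a = density_charge[OF u sobolev_zero]
  have r: "0 \<le> c^2 + s^2" by simp
  have "gsq (\<lambda>x. c *\<^sub>R g x) (\<lambda>x. s *\<^sub>R g x) = (c^2 + s^2) * gsq g (\<lambda>_. 0)"
    by (simp add: gsq_def power_mult_distrib distrib_right)
  moreover have "potential (\<lambda>x. c * u x) (\<lambda>x. s * u x) = (c^2 + s^2) * potential u (\<lambda>_. 0)"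
    unfolding potential_def by (subst integral_mult_right_zero[symmetric]) (simp add: power_mult_distrib algebra_simps)
  moreover have "density (\<lambda>x. c * u x) (\<lambda>x. s * u x) = (\<lambda>x. (c^2 + s^2) * density u (\<lambda>_. 0) x)"
    by (simp add: density_def fun_eq_iff power_mult_distrib algebra_simps)
  moreover have "interaction (\<lambda>x. (c^2 + s^2) * density u (\<lambda>_. 0) x) (\<lambda>x. (c^2 + s^2) * density u (\<lambda>_. 0) x)
    = (c^2 + s^2)^2 * interaction (density u (\<lambda>_. 0)) (density u (\<lambda>_. 0))"
    unfolding interaction_cmult(1)[OF a charge_cmult[OF a r] r] interaction_cmult(2)[OF a a r] by (simp add: power2_eq_square)
  moreover have "coupling p \<beta> (c * u x) (s * u x) = (c powr p + s powr p + 2 * \<beta> * (c powr (p/2) * s powr (p/2))) * \<bar>u x\<bar> powr p" for x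
  proof -
    have "\<bar>u x\<bar> powr (p/2) * \<bar>u x\<bar> powr (p/2) = \<bar>u x\<bar> powr p" by (simp flip: powr_add)
    then show ?thesis using cs unfolding coupling_def abs_mult by (simp add: powr_mult algebra_simps)
  qed
  ultimately show ?thesis unfolding J_eq[OF sobolev_scale[OF u] sobolev_scale[OF u]] by (simp add: distrib_left)
qed

lemma J_single:
  assumes u: "sobolev u g"
  shows "J V \<rho> p \<beta> u (\<lambda>_. 0) = 1/2 * (gsq g (\<lambda>_. 0) + potential u (\<lambda>_. 0))
    + 1/4 * interaction (density u (\<lambda>_. 0)) (density u (\<lambda>_. 0)) - 1/p * (LBINT x. \<bar>u x\<bar> powr p)"
  unfolding J_eq[OF u sobolev_zero] coupling_zero ..

text \<open>Switching on a small second component changes the energy to second order, but the coupling by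
  the lower order \<open>\<epsilon> powr (p/2)\<close>. A lower bound for their quotient thus forces the sign of the energy.\<close>

lemma J_single_nonneg:
  assumes u: "sobolev u g"
    and q: "\<And>\<epsilon>. 0 < \<epsilon> \<Longrightarrow> \<epsilon> \<le> 1 \<Longrightarrow> q * (2/p * (LBINT x. \<bar>u x\<bar> powr (p/2) * \<bar>\<epsilon> * u x\<bar> powr (p/2))) \<le> J V \<rho> p 0 u (\<lambda>x. \<epsilon> * u x)"
  shows "0 \<le> J V \<rho> p 0 u (\<lambda>_. 0)"
proof -
  define P where "P = (LBINT x. \<bar>u x\<bar> powr p)"
  define D where "D = interaction (density u (\<lambda>_. 0)) (density u (\<lambda>_. 0))"
  define G where "G = gsq g (\<lambda>_. 0) + potential u (\<lambda>_. 0)"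
  define X where "X = 1/2 * G + 3/4 * D"
  have P0: "0 \<le> P" by (simp add: P_def)
  have D0: "0 \<le> D" by (simp add: D_def interaction_nonneg)
  have le: "q * (2/p * (\<epsilon> powr (p/2) * P)) - \<epsilon>^2 * X \<le> J V \<rho> p 0 u (\<lambda>_. 0)" if \<epsilon>: "0 < \<epsilon>" "\<epsilon> \<le> 1" for \<epsilon>
  proof -
    have "\<bar>u x\<bar> powr (p/2) * \<bar>\<epsilon> * u x\<bar> powr (p/2) = \<epsilon> powr (p/2) * \<bar>u x\<bar> powr p" for x
    proof -
      have "\<bar>u x\<bar> powr (p/2) * \<bar>u x\<bar> powr (p/2) = \<bar>u x\<bar> powr p" by (simp flip: powr_add)
      then show ?thesis using \<epsilon> by (simp add: abs_mult powr_mult)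
    qed
    then have "q * (2/p * (\<epsilon> powr (p/2) * P)) \<le> J V \<rho> p 0 u (\<lambda>x. \<epsilon> * u x)" using q[OF \<epsilon>] by (simp add: P_def)
    also have "\<dots> = 1/2 * ((1 + \<epsilon>^2) * G) + 1/4 * ((1 + \<epsilon>^2)^2 * D) - 1/p * ((1 + \<epsilon> powr p) * P)"
      using J_rotated[OF u, of 1 \<epsilon> 0] \<epsilon> unfolding G_def D_def P_def by simp
    also have "\<dots> \<le> J V \<rho> p 0 u (\<lambda>_. 0) + \<epsilon>^2 * X"
    proof -
      have "\<epsilon>^2 \<le> 1" using \<epsilon> by (simp add: power_le_one)
      then have "(\<epsilon>^2)^2 \<le> \<epsilon>^2" by (simp add: power2_eq_square mult_left_le_one_le)
      then have "(1 + \<epsilon>^2)^2 \<le> 1 + 3 * \<epsilon>^2" by (simp add: power2_sum)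
      then have "(1 + \<epsilon>^2)^2 * D \<le> (1 + 3 * \<epsilon>^2) * D" using D0 by (rule mult_right_mono)
      moreover have "1/p * (1 * P) \<le> 1/p * ((1 + \<epsilon> powr p) * P)" using p P0 by (intro mult_left_mono mult_right_mono) auto
      moreover have "(1 + \<epsilon>^2) * G = G + \<epsilon>^2 * G" "(1 + 3 * \<epsilon>^2) * D = D + 3 * (\<epsilon>^2 * D)"
        "\<epsilon>^2 * X = 1/2 * (\<epsilon>^2 * G) + 3/4 * (\<epsilon>^2 * D)" "1/p * (1 * P) = 1/p * P" by (simp_all add: X_def algebra_simps)
      ultimately show ?thesis unfolding J_single[OF u] G_def[symmetric] D_def[symmetric] P_def[symmetric] by argo
    qed
    finally show ?thesis by linarith
  qed
  have z: "(\<lambda>n. inverse (real (Suc n))) \<longlonglongrightarrow> 0" by (rule LIMSEQ_inverse_real_of_nat)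
  have "(\<lambda>n. q * (2/p * (inverse (real (Suc n)) powr (p/2) * P)) - (inverse (real (Suc n)))^2 * X)
    \<longlonglongrightarrow> q * (2/p * (0 * P)) - 0^2 * X"
    using p by (intro tendsto_diff tendsto_mult tendsto_const tendsto_power z tendsto_zero_powrI[OF z tendsto_const]) auto
  then have "q * (2/p * (0 * P)) - 0^2 * X \<le> J V \<rho> p 0 u (\<lambda>_. 0)"
    by (rule LIMSEQ_le_const2) (intro exI[of _ 0] allI impI le; simp add: inverse_le_1_iff del: of_nat_Suc)
  then show ?thesis by simp
qed

end

text \<open>The pairs \<open>(w, \<epsilon> w)\<close> are admissible for the quotient, so \<open>J_single_nonneg\<close> applies to both components
  of the minimizer. By superadditivity the numerator of the quotient at the minimizer is nonnegative.\<close>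

lemma Lambda_minimizer_props:
  assumes p: "2 < p" "p < 3" and pos: "0 < \<theta>" "0 < k" and min: "Lambda_minimizer p \<theta> k u v"
  defines "D \<equiv> 2/p * (LBINT x. \<bar>u x\<bar> powr (p/2) * \<bar>v x\<bar> powr (p/2))"
  obtains q where "Lambda p \<theta> k = ereal q" "0 \<le> q" "0 < D" "J (\<lambda>_. \<theta>) (\<lambda>_. k) p 0 u v = q * D" "u \<in> H1" "v \<in> H1"
proof -
  interpret coefficients "\<lambda>_. \<theta>" "\<lambda>_. k" \<theta> \<theta> k k p by unfold_locales (use p pos in auto)
  define q where "q = Lambda_quotient p \<theta> k (u, v)"
  have dom: "(u, v) \<in> Lambda_dom p" and le: "\<And>w. w \<in> Lambda_dom p \<Longrightarrow> q \<le> Lambda_quotient p \<theta> k w"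
    using min by (auto simp: Lambda_minimizer_def is_arg_min_linorder q_def)
  have H: "u \<in> H1" "v \<in> H1" and rad: "radial u" "radial v" and D0: "D \<noteq> 0"
    using dom by (auto simp: Lambda_dom_def H1_rad_pairs_def D_def)
  have su: "sobolev u (weak_grad u)" and sv: "sobolev v (weak_grad v)" by (intro sobolev_weak_grad H)+
  have "0 \<le> D" unfolding D_def using p by (intro mult_nonneg_nonneg Bochner_Integration.integral_nonneg) auto
  with D0 have Dp: "0 < D" by simp
  have L: "Lambda p \<theta> k = ereal q"
    unfolding Lambda_def q_def
    by (rule antisym) (use dom le in \<open>auto simp: q_def intro!: INF_lower INF_greatest\<close>)
  have J: "J (\<lambda>_. \<theta>) (\<lambda>_. k) p 0 u v = q * D"
    unfolding q_def Lambda_quotient_eq D_def[symmetric] using Dp by simp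
  have nz: "\<not> ae_zero u" "\<not> ae_zero v"
  proof -
    have "D = 0" if "ae_zero u \<or> ae_zero v"
    proof -
      have "AE x in lborel. \<bar>u x\<bar> powr (p/2) * \<bar>v x\<bar> powr (p/2) = 0" using that by (auto simp: ae_zero_def)
      then have "(LBINT x. \<bar>u x\<bar> powr (p/2) * \<bar>v x\<bar> powr (p/2)) = 0" by (rule integral_eq_zero_AE)
      then show ?thesis by (simp add: D_def)
    qed
    then show "\<not> ae_zero u" "\<not> ae_zero v" using D0 by auto
  qed
  have single: "0 \<le> J (\<lambda>_. \<theta>) (\<lambda>_. k) p 0 w (\<lambda>_. 0)" if w: "w \<in> H1" "radial w" "\<not> ae_zero w" for w
  proof -
    have sw: "sobolev w (weak_grad w)" by (rule sobolev_weak_grad[OF w(1)])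
    show ?thesis
    proof (rule J_single_nonneg[OF sw])
      fix \<epsilon> :: real assume \<epsilon>: "0 < \<epsilon>" "\<epsilon> \<le> 1"
      let ?D = "2/p * (LBINT x. \<bar>w x\<bar> powr (p/2) * \<bar>\<epsilon> * w x\<bar> powr (p/2))"
      have "\<bar>w x\<bar> powr (p/2) * \<bar>\<epsilon> * w x\<bar> powr (p/2) = \<epsilon> powr (p/2) * \<bar>w x\<bar> powr p" for x
      proof -
        have "\<bar>w x\<bar> powr (p/2) * \<bar>w x\<bar> powr (p/2) = \<bar>w x\<bar> powr p" by (simp flip: powr_add)
        then show ?thesis using \<epsilon> by (simp add: abs_mult powr_mult)
      qed
      then have Dp: "0 < ?D" using powr_integral_pos[OF sw p w(3)] \<epsilon> p by simp
      obtain f where "AE x in lborel. w x = f (norm x)" using w(2) by (auto simp: radial_def)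
      then have "AE x in lborel. \<epsilon> * w x = \<epsilon> * f (norm x)" by eventually_elim simp
      then have "radial (\<lambda>x. \<epsilon> * w x)" unfolding radial_def by (rule exI[of _ "\<lambda>r. \<epsilon> * f r"])
      then have "(w, \<lambda>x. \<epsilon> * w x) \<in> Lambda_dom p"
        using w sobolev_H1[OF sobolev_scale[OF sw]] Dp by (auto simp: Lambda_dom_def H1_rad_pairs_def nontrivial_def)
      from le[OF this] show "q * ?D \<le> J (\<lambda>_. \<theta>) (\<lambda>_. k) p 0 w (\<lambda>x. \<epsilon> * w x)"
        unfolding Lambda_quotient_eq using Dp by (simp only: pos_le_divide_eq)
    qed
  qed
  have "0 \<le> q * D"
    using J_superadditive[OF su sv] single[OF H(1) rad(1) nz(1)] single[OF H(2) rad(2) nz(2)]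
      J_commute[of 0 "\<lambda>_. 0" v] unfolding J by linarith
  then have "0 \<le> q" using Dp by (simp add: zero_le_mult_iff)
  then show thesis using that L Dp J H by blast
qed

section \<open>Both components of a minimizer are nonzero\<close>

text \<open>With \<open>s\<^sup>2 = \<sigma> = 2 y\<^sup>4\<close> the loss in \<open>c powr p\<close> is at most \<open>4 y\<^sup>4\<close>, while the product of the half powers is
  at least \<open>y\<^sup>3\<close>; twice \<open>\<beta>\<close> times the latter wins for \<open>y \<le> \<beta> / 4\<close>.\<close>

lemma rotation_gain:
  fixes p \<beta> :: real assumes p: "2 < p" "p < 3" and \<beta>: "0 < \<beta>"
  obtains c s where "0 \<le> c" "0 \<le> s" "c^2 + s^2 = 1" "1 < c powr p + s powr p + 2 * \<beta> * (c powr (p/2) * s powr (p/2))"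
proof
  define y where "y = min (1/2) (\<beta> / 4)"
  have y: "0 < y" "y \<le> 1/2" "4 * y \<le> \<beta>" using \<beta> by (auto simp: y_def)
  define \<sigma> where "\<sigma> = 2 * y^4"
  have y4: "y^4 \<le> (1/2)^4" using y by (intro power_mono) auto
  have \<sigma>: "0 < \<sigma>" "\<sigma> \<le> 1/2" using y y4 by (auto simp: \<sigma>_def power4_eq_xxxx)
  show "0 \<le> sqrt (1 - \<sigma>)" "0 \<le> sqrt \<sigma>" "(sqrt (1 - \<sigma>))^2 + (sqrt \<sigma>)^2 = 1" using \<sigma> by auto
  have sq: "sqrt x powr r = x powr (r/2)" if "0 < x" for x r :: real using that by (simp add: powr_half_sqrt[symmetric] powr_powr)
  have "1 - 2 * \<sigma> \<le> (1 - \<sigma>)^2" by (simp add: power2_diff)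
  also have "\<dots> = (1 - \<sigma>) powr 2" using \<sigma> by (simp add: powr_numeral)
  also have "\<dots> \<le> (1 - \<sigma>) powr (p/2)" using \<sigma> p by (intro powr_mono') auto
  finally have c: "1 - 4 * y^4 \<le> sqrt (1 - \<sigma>) powr p" using \<sigma> by (simp add: sq \<sigma>_def)
  have "y^3 = y powr 3" using y by (simp add: powr_numeral)
  also have "\<dots> \<le> y powr p" using y p by (intro powr_mono') auto
  also have "\<dots> = (y^4) powr (p/4)"
  proof -
    have "y^4 = y powr 4" using y by (simp add: powr_numeral)
    then show ?thesis by (simp add: powr_powr)
  qed
  also have "\<dots> \<le> ((1 - \<sigma>) * \<sigma>) powr (p/4)"
  proof (intro powr_mono2)
    have "1/2 * \<sigma> \<le> (1 - \<sigma>) * \<sigma>" using \<sigma> by (intro mult_right_mono) auto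
    then show "y^4 \<le> (1 - \<sigma>) * \<sigma>" by (simp add: \<sigma>_def)
  qed (use p y in auto)
  also have "\<dots> = sqrt (1 - \<sigma>) powr (p/2) * sqrt \<sigma> powr (p/2)" using \<sigma> by (simp add: sq powr_mult)
  finally have "2 * \<beta> * y^3 \<le> 2 * \<beta> * (sqrt (1 - \<sigma>) powr (p/2) * sqrt \<sigma> powr (p/2))" using \<beta> by (intro mult_left_mono) auto
  moreover have "8 * y^4 \<le> 2 * \<beta> * y^3"
  proof -
    have "2 * (4 * y) * y^3 \<le> 2 * \<beta> * y^3" using y by (intro mult_right_mono) auto
    then show ?thesis by (simp add: power4_eq_xxxx power3_eq_cube mult.assoc)
  qed
  moreover have "0 < y^4" "0 \<le> sqrt \<sigma> powr p" using y by auto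
  ultimately show "1 < sqrt (1 - \<sigma>) powr p + sqrt \<sigma> powr p + 2 * \<beta> * (sqrt (1 - \<sigma>) powr (p/2) * sqrt \<sigma> powr (p/2))"
    using c by linarith
qed

context coefficients begin

lemma J_drop_zero:
  assumes u: "sobolev u g" and v: "v \<in> H1" and z: "ae_zero v"
  shows "J V \<rho> p \<beta> u (\<lambda>_. 0) \<le> J V \<rho> p \<beta> u v"
proof -
  have [measurable]: "v \<in> borel_measurable borel" by (rule sobolevD(4)[OF sobolev_weak_grad[OF v]])
  note [measurable] = sobolevD(4)[OF u]
  have az: "AE x in lborel. 0 = v x" using z unfolding ae_zero_def by eventually_elim simp
  have sv: "sobolev v (\<lambda>_. 0)" by (rule sobolev_cong_AE[OF sobolev_zero _ az]) simp
  have e: "(LBINT x. coupling p \<beta> (u x) (v x)) = (LBINT x. coupling p \<beta> (u x) 0)"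
    using az by (intro integral_cong_AE) (auto elim: eventually_mono)
  have "potential u (\<lambda>_. 0) \<le> potential u v" unfolding potential_def
    by (intro integral_mono bounded_integrable(1)[OF squares_integrable[OF u sobolev_zero]] bounded_integrable(1)[OF squares_integrable[OF u sv]]
        mult_left_mono V_nonneg) simp
  moreover have "interaction (density u (\<lambda>_. 0)) (density u (\<lambda>_. 0)) \<le> interaction (density u v) (density u v)"
    by (intro interaction_mono[OF density_charge[OF u sobolev_zero] density_charge[OF u sobolev_zero] density_charge[OF u sv] density_charge[OF u sv]])
      (auto simp: density_def intro!: mult_left_mono \<rho>_nonneg)
  ultimately show ?thesis unfolding J_eq[OF u sv] J_eq[OF u sobolev_zero] e
    by (intro diff_right_mono add_mono mult_left_mono order_refl) auto
qed

lemma J_zero: "J V \<rho> p \<beta> (\<lambda>_. 0) (\<lambda>_. 0) = 0"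
  unfolding J_eq[OF sobolev_zero sobolev_zero]
  by (simp add: gsq_def potential_def density_def[abs_def] interaction_def coulomb_def coupling_def)

text \<open>If \<open>v\<close> vanished, the energy would be that of \<open>(u, 0)\<close>, and rotating this pair would lower it.\<close>

lemma second_component_nonzero:
  assumes u: "u \<in> H1" and v: "v \<in> H1" and \<beta>: "0 < \<beta>" and neg: "J V \<rho> p \<beta> u v < 0"
    and min: "\<And>a b. a \<in> H1 \<Longrightarrow> b \<in> H1 \<Longrightarrow> J V \<rho> p \<beta> u v \<le> J V \<rho> p \<beta> a b"
  shows "\<not> ae_zero v"
proof
  assume vz: "ae_zero v"
  have su: "sobolev u (weak_grad u)" by (rule sobolev_weak_grad[OF u])
  have le: "J V \<rho> p \<beta> u (\<lambda>_. 0) \<le> J V \<rho> p \<beta> u v" by (rule J_drop_zero[OF su v vz])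
  have "\<not> ae_zero u"
  proof
    assume "ae_zero u"
    from J_drop_zero[OF sobolev_zero u this, of \<beta>] have "0 \<le> J V \<rho> p \<beta> u (\<lambda>_. 0)"
      unfolding J_zero J_commute[of \<beta> "\<lambda>_. 0" u] .
    then show False using le neg by linarith
  qed
  from powr_integral_pos[OF su p this] have P: "0 < (LBINT x. \<bar>u x\<bar> powr p)" .
  obtain c s where cs: "0 \<le> c" "0 \<le> s" "c^2 + s^2 = 1" "1 < c powr p + s powr p + 2 * \<beta> * (c powr (p/2) * s powr (p/2))"
    using rotation_gain[OF p \<beta>] by blast
  have "1/p * (1 * (LBINT x. \<bar>u x\<bar> powr p)) < 1/p * ((c powr p + s powr p + 2 * \<beta> * (c powr (p/2) * s powr (p/2))) * (LBINT x. \<bar>u x\<bar> powr p))"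
    using p P cs(4) by (intro mult_strict_left_mono mult_strict_right_mono) auto
  then have "J V \<rho> p \<beta> (\<lambda>x. c * u x) (\<lambda>x. s * u x) < J V \<rho> p \<beta> u (\<lambda>_. 0)"
    unfolding J_rotated[OF su cs(1,2)] J_single[OF su] cs(3) by simp
  moreover have "J V \<rho> p \<beta> u v \<le> J V \<rho> p \<beta> (\<lambda>x. c * u x) (\<lambda>x. s * u x)"
    by (intro min sobolev_H1[OF sobolev_scale[OF su]])
  ultimately show False using le by linarith
qed

end

section \<open>Domination of the nonlinearity\<close>

lemma bounded_of_limit_at_infinity:
  fixes f :: "real^3 \<Rightarrow> real"
  assumes c: "continuous_on UNIV f" and l: "(f \<longlongrightarrow> a) at_infinity"
  obtains B where "\<And>x. \<bar>f x\<bar> \<le> B"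
proof -
  have "\<forall>\<^sub>F x in at_infinity. dist (f x) a < 1" using l by (rule tendstoD) simp
  then obtain R where R: "\<And>x. R \<le> norm x \<Longrightarrow> dist (f x) a < 1" by (auto simp: eventually_at_infinity)
  have "bounded (f ` cball 0 R)"
    by (intro compact_imp_bounded compact_continuous_image continuous_on_subset[OF c]) auto
  then obtain B where B: "\<forall>y\<in>f ` cball 0 R. norm y \<le> B" unfolding bounded_iff by blast
  have "\<bar>f x\<bar> \<le> max B (\<bar>a\<bar> + 1)" for x
  proof (cases "norm x \<le> R")
    case True then have "norm (f x) \<le> B" using B by auto
    then show ?thesis by simp
  next
    case False then show ?thesis using R[of x] by (simp add: dist_real_def)
  qed
  then show thesis by (rule that)
qed

context coefficients begin

text \<open>A quarter of \<open>V\<close> is kept for coercivity, another quarter and the cubic term with Lions' constant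
  \<open>2 powr (-3/2)\<close> absorb the nonlinearity. Since \<open>(1/4) powr (3 - p) * 2 powr (-3/2 * (p - 2))\<close> equals
  \<open>2 powr (- ((6 - p) / 2))\<close>, absorption at a point \<open>x\<close> is the upper bound for \<open>\<beta>\<close> with \<open>V x\<close>, \<open>\<rho> x\<close> in place of
  the limits at infinity.\<close>

lemma domination:
  assumes V: "(V \<longlongrightarrow> Vinf) at_infinity" "0 < Vinf" and \<rho>: "(\<rho> \<longlongrightarrow> \<rho>inf) at_infinity" "0 < \<rho>inf"
    and \<beta>: "0 \<le> \<beta>" "\<beta> < p / 2 powr ((6 - p) / 2) * (Vinf / (3 - p)) powr (3 - p) * (\<rho>inf / (p - 2)) powr (p - 2) - 1"
  obtains R C where "0 \<le> C" "\<And>x s t. Vm / 4 * (s^2 + t^2) - C * indicator (cball 0 R) x \<le> remainder \<beta> x s t"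
proof -
  define c where "c = (1 + \<beta>) / p"
  have c: "0 < c" using p \<beta> by (simp add: c_def)
  define T where "T x = (V x / (3 - p)) powr (3 - p) * (\<rho> x / (p - 2)) powr (p - 2)" for x
  define K where "K = 2 powr ((6 - p) / 2) * c"
  have K: "K < (Vinf / (3 - p)) powr (3 - p) * (\<rho>inf / (p - 2)) powr (p - 2)"
  proof -
    have "1 + \<beta> < p / 2 powr ((6 - p) / 2) * ((Vinf / (3 - p)) powr (3 - p) * (\<rho>inf / (p - 2)) powr (p - 2))" using \<beta>(2) by (simp add: mult.assoc)
    then show ?thesis using p unfolding K_def c_def by (simp add: field_simps)
  qed
  have "(T \<longlongrightarrow> (Vinf / (3 - p)) powr (3 - p) * (\<rho>inf / (p - 2)) powr (p - 2)) at_infinity"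
    unfolding T_def[abs_def] using p V(2) \<rho>(2) by (intro tendsto_intros V(1) \<rho>(1)) auto
  then have "\<forall>\<^sub>F x in at_infinity. K < T x" by (rule order_tendstoD(1)[OF _ K])
  then obtain R where R: "\<And>x. R \<le> norm x \<Longrightarrow> K < T x" by (auto simp: eventually_at_infinity)
  have d: "0 < lions_const * rm" using lions_const(1) \<rho>_pos by simp
  obtain C where C: "0 \<le> C" "\<And>s. c * \<bar>s\<bar> powr p \<le> lions_const * rm * \<bar>s\<bar>^3 + C" using powr_absorbed[OF p c d] by blast
  have key: "c * \<bar>s\<bar> powr p \<le> V x / 4 * s^2 + lions_const * \<rho> x * \<bar>s\<bar>^3 + C * indicator (cball 0 R) x" for x s
  proof (cases "norm x \<le> R")
    case True
    have "lions_const * rm * \<bar>s\<bar>^3 \<le> lions_const * \<rho> x * \<bar>s\<bar>^3"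
      using lions_const(1) \<rho>_bounds by (intro mult_right_mono mult_left_mono) auto
    moreover have "0 \<le> V x / 4 * s^2" using V_nonneg by simp
    ultimately show ?thesis using C(2)[of s] True by simp
  next
    case False
    have Vx: "0 < V x" and \<rho>x: "0 < \<rho> x" using V_pos V_bounds(1)[of x] \<rho>_pos \<rho>_bounds(1)[of x] by linarith+
    have b: "lions_const = 2 powr (-3/2)"
    proof -
      have "2 powr (3/2) = (2::real) powr 1 * 2 powr (1/2)" unfolding powr_add[symmetric] by simp
      also have "\<dots> = 2 * sqrt 2" by (simp add: powr_half_sqrt)
      finally show ?thesis by (simp add: lions_const_def powr_minus_divide)
    qed
    have q: "1/4 = (2::real) powr (-2)" by (simp add: powr_minus_divide powr_numeral)
    have "c = 2 powr (- ((6 - p) / 2)) * K" unfolding K_def by (simp flip: powr_add mult.assoc)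
    also have "\<dots> \<le> 2 powr (- ((6 - p) / 2)) * T x" using R[of x] False by (intro mult_left_mono) auto
    also have "2 powr (- ((6 - p) / 2)) = (2::real) powr (-2 * (3 - p)) * 2 powr (-3/2 * (p - 2))"
    proof -
      have e: "- ((6 - p) / 2) = -2 * (3 - p) + -3/2 * (p - 2)" by (simp add: field_simps)
      show ?thesis unfolding e powr_add ..
    qed
    also have "2 powr (-2 * (3 - p)) * 2 powr (-3/2 * (p - 2)) * T x
      = (1/4) powr (3 - p) * lions_const powr (p - 2) * T x" unfolding q b powr_powr ..
    also have "\<dots> = ((1/4) * (V x / (3 - p))) powr (3 - p) * (lions_const * (\<rho> x / (p - 2))) powr (p - 2)"
      unfolding T_def by (simp only: powr_mult mult_ac)
    also have "\<dots> = (V x / 4 / (3 - p)) powr (3 - p) * (lions_const * \<rho> x / (p - 2)) powr (p - 2)" by simp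
    finally have "c * \<bar>s\<bar> powr p \<le> (V x / 4 / (3 - p)) powr (3 - p) * (lions_const * \<rho> x / (p - 2)) powr (p - 2) * \<bar>s\<bar> powr p"
      by (rule mult_right_mono) simp
    also have "\<dots> \<le> V x / 4 * s^2 + lions_const * \<rho> x * \<bar>s\<bar>^3"
      using Vx \<rho>x lions_const(1) by (intro powr_interpolation p) auto
    finally show ?thesis using False by simp
  qed
  show thesis
  proof (rule that)
    show "0 \<le> 2 * C" using C by simp
    fix x s t
    have "1/p * coupling p \<beta> s t \<le> 1/p * ((1 + \<beta>) * (\<bar>s\<bar> powr p + \<bar>t\<bar> powr p))"
      using p by (intro mult_left_mono coupling_le \<beta>(1)) auto
    also have "\<dots> = c * \<bar>s\<bar> powr p + c * \<bar>t\<bar> powr p" by (simp add: c_def algebra_simps add_divide_distrib)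
    finally have F: "1/p * coupling p \<beta> s t \<le> c * \<bar>s\<bar> powr p + c * \<bar>t\<bar> powr p" .
    have "Vm / 4 * (s^2 + t^2) \<le> V x / 4 * (s^2 + t^2)" using V_bounds by (intro mult_right_mono) auto
    then show "Vm / 4 * (s^2 + t^2) - 2 * C * indicator (cball 0 R) x \<le> remainder \<beta> x s t"
      using F key[of s x] key[of t x] unfolding remainder_def by (simp add: algebra_simps)
  qed
qed

end

theorem theorem1p4:
  fixes V \<rho> :: "real^3 \<Rightarrow> real" and p Vinf \<rho>inf lam0 k0 :: real
    and u0 v0 :: "real^3 \<Rightarrow> real"
  assumes p: "2 < p" "p < 3"
    and V_cont: "continuous_on UNIV V" and V_inf: "(INF x. V x) > 0"
    and V_lim: "(V \<longlongrightarrow> Vinf) at_infinity" "Vinf > 0"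
    and \<rho>_cont: "continuous_on UNIV \<rho>" and \<rho>_inf: "(INF x. \<rho> x) > 0"
    and \<rho>_lim: "(\<rho> \<longlongrightarrow> \<rho>inf) at_infinity" "\<rho>inf > 0"
    and pos: "lam0 > 0" "k0 > 0"
    and threshold:
      "ereal (Vinf powr (3 - p) * \<rho>inf powr (p - 2))
         > ereal (2 powr ((6 - p) / 2) / p * (p - 2) powr (p - 2) * (3 - p) powr (3 - p))
           * (1 + Lambda p lam0 k0)"
    and minimizer: "Lambda_minimizer p lam0 k0 u0 v0"
    and comparison:
      "1/2 * (\<integral>x. V x * ((u0 x)\<^sup>2 + (v0 x)\<^sup>2) \<partial>lborel)
       + 1/4 * (\<integral>x. \<rho> x * phi \<rho> u0 v0 x * ((u0 x)\<^sup>2 + (v0 x)\<^sup>2) \<partial>lborel)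
       < 1/2 * (\<integral>x. lam0 * ((u0 x)\<^sup>2 + (v0 x)\<^sup>2) \<partial>lborel)
         + k0/4 * (\<integral>x. phi (\<lambda>_. k0) u0 v0 x * ((u0 x)\<^sup>2 + (v0 x)\<^sup>2) \<partial>lborel)"
  shows "\<forall>\<beta>::real.
     Lambda p lam0 k0 < ereal \<beta> \<and>
     \<beta> < p / 2 powr ((6 - p) / 2) * (Vinf / (3 - p)) powr (3 - p)
            * (\<rho>inf / (p - 2)) powr (p - 2) - 1 \<longrightarrow>
     (\<exists>u v. (u, v) \<in> H1_pairs \<and> vectorial u v \<and> ground_state V \<rho> p \<beta> u v \<and>
        ereal (J V \<rho> p \<beta> u v) = (INF (w, z)\<in>H1_pairs. ereal (J V \<rho> p \<beta> w z)) \<and>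
        J V \<rho> p \<beta> u v < 0)"
proof (intro allI impI, elim conjE)
  fix \<beta> :: real
  assume L: "Lambda p lam0 k0 < ereal \<beta>"
    and \<beta>: "\<beta> < p / 2 powr ((6 - p) / 2) * (Vinf / (3 - p)) powr (3 - p) * (\<rho>inf / (p - 2)) powr (p - 2) - 1"
  let ?J = "J V \<rho> p \<beta>"
  obtain VM where VM: "\<And>x. \<bar>V x\<bar> \<le> VM" using bounded_of_limit_at_infinity[OF V_cont V_lim(1)] by blast
  obtain rM where rM: "\<And>x. \<bar>\<rho> x\<bar> \<le> rM" using bounded_of_limit_at_infinity[OF \<rho>_cont \<rho>_lim(1)] by blast
  have "- VM \<le> V x" "- rM \<le> \<rho> x" for x using VM[of x] rM[of x] by linarith+
  then have "bdd_below (range V)" "bdd_below (range \<rho>)" using bdd_belowI2[of UNIV "- VM" V] bdd_belowI2[of UNIV "- rM" \<rho>] by auto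
  then have inf: "(INF x. V x) \<le> V x" "(INF x. \<rho> x) \<le> \<rho> x" for x by (auto intro: cINF_lower)
  interpret coefficients V \<rho> "INF x. V x" VM "INF x. \<rho> x" rM p
    using V_inf \<rho>_inf p inf VM rM V_cont \<rho>_cont
    by unfold_locales (auto intro: borel_measurable_continuous_onI order_trans[OF abs_ge_self])
  interpret const: coefficients "\<lambda>_. lam0" "\<lambda>_. k0" lam0 lam0 k0 k0 p by unfold_locales (use p pos in auto)
  obtain q where q: "Lambda p lam0 k0 = ereal q" "0 \<le> q"
    "0 < 2/p * (\<integral>x. \<bar>u0 x\<bar> powr (p/2) * \<bar>v0 x\<bar> powr (p/2) \<partial>lborel)"
    "J (\<lambda>_. lam0) (\<lambda>_. k0) p 0 u0 v0 = q * (2/p * (\<integral>x. \<bar>u0 x\<bar> powr (p/2) * \<bar>v0 x\<bar> powr (p/2) \<partial>lborel))"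
    and H0: "u0 \<in> H1" "v0 \<in> H1"
    by (rule Lambda_minimizer_props[OF p pos minimizer])
  have q\<beta>: "q < \<beta>" using L q(1) by simp
  then have \<beta>0: "0 < \<beta>" using q(2) by simp
  have s0: "sobolev u0 (weak_grad u0)" "sobolev v0 (weak_grad v0)" by (intro sobolev_weak_grad H0)+
  have neg: "?J u0 v0 < 0"
  proof -
    let ?D = "2/p * (\<integral>x. \<bar>u0 x\<bar> powr (p/2) * \<bar>v0 x\<bar> powr (p/2) \<partial>lborel)"
    have k: "(\<integral>x. k0 * phi (\<lambda>_. k0) u0 v0 x * ((u0 x)\<^sup>2 + (v0 x)\<^sup>2) \<partial>lborel) = k0 * (\<integral>x. phi (\<lambda>_. k0) u0 v0 x * ((u0 x)\<^sup>2 + (v0 x)\<^sup>2) \<partial>lborel)"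
      by (simp add: mult.assoc)
    have "J V \<rho> p 0 u0 v0 < J (\<lambda>_. lam0) (\<lambda>_. k0) p 0 u0 v0"
    proof -
      have gen: "1/2 * (G + A) + 1/4 * B - r < 1/2 * (G + A') + 1/4 * (k0 * B') - r" if "1/2 * A + 1/4 * B < 1/2 * A' + k0/4 * B'"
        for G A B A' B' r :: real
      proof -
        have "k0/4 * B' = 1/4 * (k0 * B')" by simp
        with that show ?thesis by argo
      qed
      show ?thesis
        unfolding J_def pair_norm_eq[OF s0] const.pair_norm_eq[OF s0] potential_def const.potential_def k gsq_def const.gsq_def
        by (rule gen[OF comparison])
    qed
    then have "?J u0 v0 < (q - \<beta>) * ?D" unfolding J_coupling[OF s0, of \<beta>] q(4) by (simp only: left_diff_distrib)
    also have "\<dots> \<le> 0" using q\<beta> q(3) by (intro mult_nonpos_nonneg) auto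
    finally show ?thesis .
  qed
  obtain R C where RC: "0 \<le> C" "\<And>x s t. (INF x. V x) / 4 * (s^2 + t^2) - C * indicator (cball 0 R) x \<le> remainder \<beta> x s t"
  proof (rule domination[OF V_lim \<rho>_lim less_imp_le[OF \<beta>0] \<beta>])
    fix R C assume "0 \<le> C" "\<And>x s t. (INF x. V x) / 4 * (s^2 + t^2) - C * indicator (cball 0 R) x \<le> remainder \<beta> x s t"
    then show thesis by (rule that)
  qed
  interpret dominated V \<rho> "INF x. V x" VM "INF x. \<rho> x" rM p \<beta> R C
    by unfold_locales (use RC \<beta>0 in auto)
  obtain u g v h where u: "sobolev u g" and v: "sobolev v h"
    and min: "\<And>a b. a \<in> H1 \<Longrightarrow> b \<in> H1 \<Longrightarrow> ?J u v \<le> ?J a b"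
  proof (rule minimizer_exists)
    fix u g v h assume "sobolev u g" "sobolev v h" "\<And>a b. a \<in> H1 \<Longrightarrow> b \<in> H1 \<Longrightarrow> ?J u v \<le> ?J a b"
    then show thesis by (rule that)
  qed
  note H = sobolev_H1[OF u] sobolev_H1[OF v]
  have Jneg: "?J u v < 0" using min[OF H0] neg by linarith
  have vz: "\<not> ae_zero v" by (rule second_component_nonzero[OF H \<beta>0 Jneg min])
  have uz: "\<not> ae_zero u"
    by (rule second_component_nonzero[OF H(2,1) \<beta>0]) (use Jneg min in \<open>auto simp: J_commute[of \<beta> v u]\<close>)
  have crit: "critical_point ?J u v" by (rule minimizer_critical[OF u v less_imp_le[OF \<beta>0] min])
  have "ground_state V \<rho> p \<beta> u v"
    unfolding ground_state_def HF_solution_def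
    using crit min uz by (auto simp: nontrivial_def critical_point_def H1_pairs_def)
  moreover have "ereal (?J u v) = (INF (w, z)\<in>H1_pairs. ereal (?J w z))"
  proof (rule antisym)
    show "ereal (?J u v) \<le> (INF (w, z)\<in>H1_pairs. ereal (?J w z))"
      by (rule INF_greatest) (use min in \<open>auto simp: H1_pairs_def\<close>)
    show "(INF (w, z)\<in>H1_pairs. ereal (?J w z)) \<le> ereal (?J u v)"
      by (rule INF_lower2[of "(u, v)"]) (use H in \<open>auto simp: H1_pairs_def\<close>)
  qed
  ultimately show "\<exists>u v. (u, v) \<in> H1_pairs \<and> vectorial u v \<and> ground_state V \<rho> p \<beta> u v \<and>
      ereal (?J u v) = (INF (w, z)\<in>H1_pairs. ereal (?J w z)) \<and> ?J u v < 0"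
    using H uz vz Jneg by (intro exI[of _ u] exI[of _ v]) (auto simp: H1_pairs_def vectorial_def)
qed

end
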